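(* Suppose that $\gamma\in C^1([0,L])$ and that there exist $m\ge2$ (distinct) strict central configurations, not antipodal if $m=2$. Then the domain $D$ is admissible and the refraction billiard admits a symbolic dynamics: for every sufficiently large $h$, the itinerary map $\pi:X\to\mathcal L$ is continuous and surjective and satisfies $\pi\circ\mathcal F=\sigma_r\circ\pi$.
   Context: Fix constants $\omega,\mu,\mathcal E>0$. $D\subset\mathbb R^2$ is a bounded open domain containing the origin, with $\overline D\subset\{z:\|z\|<\sqrt{2\mathcal E}/\omega\}$, whose boundary is a simple closed curve $\partial D=\gamma([0,L])$, with $\gamma:[0,L]\to\mathbb R^2$ an arc-length parametrization of class (at least) $C^1$. For $h>0$ put $V_E(z)=\mathcal E-\frac{\omega^2}{2}\|z\|^2$ (outer potential) and $V_I(z)=\mathcal E+h+\frac{\mu}{\|z\|}$ (inner potential). Let $t(\xi)=\dot\gamma(\xi)$ and let $n(\xi)$ be the outward unit normal to $\partial D$ at $\gamma(\xi)$. Central configurations. $\bar\xi\in[0,L]$ (or the point $\gamma(\bar\xi)$) is a central configuration if it is a critical point of $\xi\mapsto\|\gamma(\xi)\|$ and the half-line from the origin through $\gamma(\bar\xi)$ intersects $\partial D$ only at $\gamma(\bar\xi)$; it is strict if it is a strict local maximum or minimum of $\|\gamma(\cdot)\|$. Outer-arc property. An open interval $(a,b)\subset[0,L]$ satisfies the outer-arc property if for all $\xi_1,\xi_2\in(a,b)$ there is a unique solution $z_E(\cdot;\gamma(\xi_1),\gamma(\xi_2))$ (the outer arc), for some $T=T_E(\xi_1,\xi_2)>0$,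 of $z''=-\omega^2z$ and $\frac12\|z'\|^2=V_E(z)$ on $[0,T]$, $z(s)\notin D$ for $s\in(0,T)$, $z(0)=\gamma(\xi_1)$, $z(T)=\gamma(\xi_2)$. Inner-arc property. Parameters $\xi_1,\xi_2\in[0,L]$ are antipodal if the origin belongs to the segment joining $\gamma(\xi_1)$ and $\gamma(\xi_2)$; two (possibly equal) intervals are not antipodal if no point of the first is antipodal to a point of the second. If $\xi_1,\xi_2$ are not antipodal, a continuous curve in $\mathbb R^2\setminus\{0\}$ from $\gamma(\xi_1)$ to $\gamma(\xi_2)$ is topologically non-trivial (TnT) if it is not homotopic in $\mathbb R^2\setminus\{0\}$ (with fixed endpoints) to the segment joining them. A set $\mathcal A$ satisfies the inner-arc property if: (IP0) $\mathcal A$ is a disjoint union of open intervals $(a_i,b_i)\subset[0,L]$, $i\in\mathcal I=\{1,\dots,m\}$, $m\ge2$; (IP1) for every $i$ there is $j\ne i$ such that both $(a_i,b_i)$ and $(a_j,b_j)$ are not antipodal to $(a_i,b_i)$; (IP2) there is $h_0>0$ such that for all $\xi_1,\xi_2$ belonging to two non-antipodal (possibly equal) intervals and all $h>h_0$ there is a unique TnT solution $z_I(\cdot;\gamma(\xi_1),\gamma(\xi_2);h)$ (the inner arc), for some $T=T_I(\xi_1,\xi_2;h)>0$, of $z''=-\mu z/\|z\|^3$ and $\frac12\|z'\|^2=V_I(z)$ on $[0,T]$, $z(s)\in D$ for $s\in(0,T)$, $z(0)=\gamma(\xi_1)$, $z(T)=\gamma(\xi_2)$; if $\xi_1=\xi_2$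 the solution is meant in the Levi-Civita regularized sense (collision-ejection along the radial segment). Let $NA(i)=\{j\in\mathcal I:(a_i,b_i)\text{ and }(a_j,b_j)\text{ are not antipodal}\}$. Jacobi lengths. $S_E(\xi_1,\xi_2)=\int_0^{T_E}\|z_E'\|\sqrt{V_E(z_E)}\,ds$ and $S_I(\xi_1,\xi_2;h)=\int_0^{T_I}\|z_I'\|\sqrt{V_I(z_I)}\,ds$ along these arcs; $\partial_a,\partial_b$ are the partial derivatives in the first and second variable. Change-sign property. If $\mathcal A$ satisfies the inner-arc property and every $(a_i,b_i)$ the outer-arc property, $\mathcal A$ satisfies the change-sign property if there are $h_1\ge h_0$ and compact intervals $[\alpha_i,\beta_i]\subset(a_i,b_i)$, $i\in\mathcal I$, such that for all $h>h_1$, $i\in\mathcal I$, $\xi_E\in[\alpha_i,\beta_i]$, $\xi_I\in\bigcup_{j\in NA(i)}[\alpha_j,\beta_j]$, $$(\partial_bS_E(\xi_E,\alpha_i)+\partial_aS_I(\alpha_i,\xi_I;h))\,(\partial_bS_E(\xi_E,\beta_i)+\partial_aS_I(\beta_i,\xi_I;h))<0.$$ $D$ is admissible if $\gamma\in C^1$ and there is $\mathcal A=\bigcup_{i=1}^m(a_i,b_i)\subset[0,L]$, $m\ge2$, satisfying the inner-arc and change-sign properties and such that every $(a_i,b_i)$ satisfies the outer-arc property. Put $I^{(i)}=[\alpha_i,\beta_i]$. Return map. For $r\in\mathcal I$ let $\Xi_r^{\pm}=\{(\xi,v):\xi\in I^{(r)},\ v\in\mathbb R^2,\ \frac12\|v\|^2=V_E(\gamma(\xi)),\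 \pm\langle n(\xi),v\rangle>0\}$. The refraction map (Snell's law $\sqrt{V_E}\sin\alpha_E=\sqrt{V_I}\sin\alpha_I$, angles from the normal) sends $v=a\,t(\xi)+b\,n(\xi)$ with $\|v\|^2=2V_E(\gamma(\xi))$ to $R_\xi(v)=a\,t(\xi)+\mathrm{sgn}(b)\sqrt{2V_I(\gamma(\xi))-a^2}\,n(\xi)$. The map $F$ is defined at $(\xi,v)\in\Xi_r^+$, $r\in\mathcal I$, if: (i) the solution of $z''=-\omega^2z$ with initial data $(\gamma(\xi),v)$ is outside $\overline D$ for $s\in(0,s_1)$ and at time $s_1>0$ has position and velocity $(\gamma(\xi_1),v_1)$ with $(\xi_1,v_1)\in\Xi_r^-$; (ii) the (regularized) solution of $z''=-\mu z/\|z\|^3$ with initial data $(\gamma(\xi_1),R_{\xi_1}(v_1))$ stays in $D$ for $s\in(0,s_2)$ and at time $s_2>0$ has position and velocity $(\gamma(\xi_2),R_{\xi_2}(v_2))$ with $(\xi_2,v_2)\in\Xi_{r'}^+$ for some $r'\in NA(r)$. Then $F(\xi,v)=(\xi_2,v_2)$. $X$ is the set of $(\xi,v)$ at which all iterates $F^k$, $k\in\mathbb Z$, are defined, with the Euclidean metric of $\mathbb R^3$, and $\mathcal F=F|_X$. Words. $\mathcal L=\{\underline\ell=(\ell_j)_{j\in\mathbb Z}\in\mathcal I^{\mathbb Z}:\ell_{j+1}\in NA(\ell_j)\ \forall j\}$ with metric $d(\underline\ell,\underline m)=\sum_k\rho(\ell_k,m_k)4^{-|k|}$, $\rho(i,j)=0$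 if $i=j$ and $1$ otherwise. Put $\chi(\xi,v)=r$ iff $\xi\in I^{(r)}$ and $\pi(\xi,v)=(\chi(\mathcal F^j(\xi,v)))_{j\in\mathbb Z}$. The shift is $(\sigma_r\underline\ell)_j=\ell_{j+1}$.
   Formalization: In the outer-arc property T_E is continuous and uniqueness holds only among solutions with travel time near T_E (uniqueness over all T can fail); if γ(0) is one of the configurations, the conclusion is for the same curve with another base point. *)

theory Defs
  imports "HOL-Analysis.Analysis" "HOL-Library.Real_Mod"
begin

text \<open>
  The plane is modelled by \<^typ>\<open>complex\<close>, with its Euclidean norm, metric and inner product; the
  complex square is used for the Levi-Civita regularization. A pair (parameter, velocity) has type
  \<^typ>\<open>real \<times> complex\<close>, whose product metric is the Euclidean metric of three-dimensional space.
\<close>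

section \<open>Domain and potentials\<close>

definition V_outer :: "real \<Rightarrow> real \<Rightarrow> complex \<Rightarrow> real" where
  "V_outer \<omega> E z = E - \<omega>\<^sup>2 / 2 * (norm z)\<^sup>2"

definition V_inner :: "real \<Rightarrow> real \<Rightarrow> real \<Rightarrow> complex \<Rightarrow> real" where
  "V_inner \<mu> E h z = E + h + \<mu> / norm z"

definition C1_arclength_boundary :: "complex set \<Rightarrow> real \<Rightarrow> (real \<Rightarrow> complex) \<Rightarrow> bool" where
  "C1_arclength_boundary D L \<gamma> \<longleftrightarrow>
     0 < L \<and> \<gamma> 0 = \<gamma> L \<and> inj_on \<gamma> {0..<L} \<and> \<gamma> ` {0..L} = frontier D \<and>
     (\<exists>\<gamma>'. continuous_on {0..L} \<gamma>' \<and>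
        (\<forall>\<xi>\<in>{0..L}. (\<gamma> has_vector_derivative \<gamma>' \<xi>) (at \<xi> within {0..L}) \<and> norm (\<gamma>' \<xi>) = 1))"

definition refraction_domain :: "real \<Rightarrow> real \<Rightarrow> complex set \<Rightarrow> bool" where
  "refraction_domain \<omega> E D \<longleftrightarrow>
     open D \<and> connected D \<and> bounded D \<and> 0 \<in> D \<and> closure D \<subseteq> {z. norm z < sqrt (2 * E) / \<omega>}"

definition unit_tangent :: "real \<Rightarrow> (real \<Rightarrow> complex) \<Rightarrow> real \<Rightarrow> complex" where
  "unit_tangent L \<gamma> \<xi> = vector_derivative \<gamma> (at \<xi> within {0..L})"

definition outward_normal :: "complex set \<Rightarrow> real \<Rightarrow> (real \<Rightarrow> complex) \<Rightarrow> real \<Rightarrow> complex" where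
  "outward_normal D L \<gamma> \<xi> =
     (THE n. norm n = 1 \<and> n \<bullet> unit_tangent L \<gamma> \<xi> = 0 \<and>
        (\<forall>\<^sub>F s in at_right 0. \<gamma> \<xi> + s *\<^sub>R n \<notin> closure D \<and> \<gamma> \<xi> - s *\<^sub>R n \<in> D))"

text \<open>
  The \<open>L\<close>-periodic extension of \<open>\<gamma>\<close> from \<open>[0,L]\<close>. It makes "critical point" and "local extremum"
  two-sided notions at the base point \<open>\<gamma> 0 = \<gamma> L\<close> as well, and \<open>\<lambda>\<xi>. periodic_ext L \<gamma> (c + \<xi>)\<close> is the
  same closed curve with base point \<open>\<gamma> c\<close>.
\<close>

definition periodic_ext :: "real \<Rightarrow> (real \<Rightarrow> complex) \<Rightarrow> real \<Rightarrow> complex" where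
  "periodic_ext L \<gamma> \<xi> = \<gamma> (\<xi> rmod L)"

section \<open>Central configurations and antipodality\<close>

definition central_configuration ::
    "complex set \<Rightarrow> real \<Rightarrow> (real \<Rightarrow> complex) \<Rightarrow> real \<Rightarrow> bool" where
  "central_configuration D L \<gamma> \<xi> \<longleftrightarrow>
     \<xi> \<in> {0..L} \<and>
     ((\<lambda>x. norm (periodic_ext L \<gamma> x)) has_real_derivative 0) (at \<xi>) \<and>
     {s *\<^sub>R \<gamma> \<xi> | s. 0 \<le> s} \<inter> frontier D = {\<gamma> \<xi>}"

definition strict_central_configuration ::
    "complex set \<Rightarrow> real \<Rightarrow> (real \<Rightarrow> complex) \<Rightarrow> real \<Rightarrow> bool" where
  "strict_central_configuration D L \<gamma> \<xi> \<longleftrightarrow>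
     central_configuration D L \<gamma> \<xi> \<and>
     ((\<forall>\<^sub>F x in at \<xi>. norm (periodic_ext L \<gamma> x) < norm (\<gamma> \<xi>)) \<or>
      (\<forall>\<^sub>F x in at \<xi>. norm (periodic_ext L \<gamma> x) > norm (\<gamma> \<xi>)))"

definition antipodal :: "(real \<Rightarrow> complex) \<Rightarrow> real \<Rightarrow> real \<Rightarrow> bool" where
  "antipodal \<gamma> \<xi>1 \<xi>2 \<longleftrightarrow> 0 \<in> closed_segment (\<gamma> \<xi>1) (\<gamma> \<xi>2)"

definition not_antipodal_sets :: "(real \<Rightarrow> complex) \<Rightarrow> real set \<Rightarrow> real set \<Rightarrow> bool" where
  "not_antipodal_sets \<gamma> A B \<longleftrightarrow> (\<forall>\<xi>1\<in>A. \<forall>\<xi>2\<in>B. \<not> antipodal \<gamma> \<xi>1 \<xi>2)"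

definition NA :: "(real \<Rightarrow> complex) \<Rightarrow> nat \<Rightarrow> (nat \<Rightarrow> real) \<Rightarrow> (nat \<Rightarrow> real) \<Rightarrow> nat \<Rightarrow> nat set" where
  "NA \<gamma> m a b i = {j \<in> {1..m}. not_antipodal_sets \<gamma> {a i<..<b i} {a j<..<b j}}"

section \<open>Solutions of the two differential equations\<close>

definition newton_sol ::
    "(complex \<Rightarrow> complex) \<Rightarrow> real \<Rightarrow> (real \<Rightarrow> complex) \<Rightarrow> (real \<Rightarrow> complex) \<Rightarrow> bool" where
  "newton_sol f T z v \<longleftrightarrow>
     (\<forall>s\<in>{0..T}. (z has_vector_derivative v s) (at s within {0..T}) \<and>
                 (v has_vector_derivative f (z s)) (at s within {0..T}))"

definition harmonic_force :: "real \<Rightarrow> complex \<Rightarrow> complex" where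
  "harmonic_force \<omega> z = - (\<omega>\<^sup>2 *\<^sub>R z)"

definition kepler_force :: "real \<Rightarrow> complex \<Rightarrow> complex" where
  "kepler_force \<mu> z = - ((\<mu> / norm z ^ 3) *\<^sub>R z)"

text \<open>
  Levi-Civita regularized Kepler motion of energy \<open>H\<close>, i.e. \<open>1/2 |z'|\<^sup>2 - \<mu> / |z| = H\<close>, on \<open>[0,T]\<close>:
  with \<open>z = w\<^sup>2\<close> and \<open>dt = |w|\<^sup>2 d\<tau>\<close> the equations become \<open>w'' = (H/2) w\<close> and
  \<open>2 |w'|\<^sup>2 = \<mu> + H |w|\<^sup>2\<close>. Away from collisions these are exactly the classical solutions.
\<close>

definition lc_kepler_sol :: "real \<Rightarrow> real \<Rightarrow> real \<Rightarrow> (real \<Rightarrow> complex) \<Rightarrow> bool" where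
  "lc_kepler_sol \<mu> H T z \<longleftrightarrow>
     (\<exists>\<sigma>>0. \<exists>w w' t.
        newton_sol (\<lambda>u. (H / 2) *\<^sub>R u) \<sigma> w w' \<and>
        (\<forall>\<tau>\<in>{0..\<sigma>}. 2 * (norm (w' \<tau>))\<^sup>2 = \<mu> + H * (norm (w \<tau>))\<^sup>2) \<and>
        t 0 = 0 \<and> t \<sigma> = T \<and>
        (\<forall>\<tau>\<in>{0..\<sigma>}. (t has_real_derivative (norm (w \<tau>))\<^sup>2) (at \<tau> within {0..\<sigma>}) \<and>
                    z (t \<tau>) = (w \<tau>)\<^sup>2))"

section \<open>Outer and inner arcs\<close>

definition outer_arc ::
    "real \<Rightarrow> real \<Rightarrow> complex set \<Rightarrow> complex \<Rightarrow> complex \<Rightarrow> real \<Rightarrow> (real \<Rightarrow> complex) \<Rightarrow> bool" where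
  "outer_arc \<omega> E D p q T z \<longleftrightarrow>
     0 < T \<and> z 0 = p \<and> z T = q \<and> (\<forall>s\<in>{0<..<T}. z s \<notin> D) \<and>
     (\<exists>v. newton_sol (harmonic_force \<omega>) T z v \<and>
          (\<forall>s\<in>{0..T}. 1 / 2 * (norm (v s))\<^sup>2 = V_outer \<omega> E (z s)))"

text \<open>
  The outer arcs form a branch, with continuous travel time \<open>TE\<close>, and each is the only solution with
  travel time near \<open>TE\<close>. Uniqueness among all travel times would be too much to ask: for
  \<open>|p| = max {|z|. z \<in> closure D}\<close> and \<open>E \<ge> \<omega>\<^sup>2 |p|\<^sup>2\<close>, both the radial arc from \<open>p\<close> to \<open>p\<close> and the full
  ellipse through \<open>p\<close> orthogonal to \<open>p\<close> avoid \<open>D\<close>; where \<open>\<partial>D\<close> is strongly dented, so does a short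
  direct arc between the two sides of the dent.
\<close>

definition outer_arc_property ::
    "real \<Rightarrow> real \<Rightarrow> complex set \<Rightarrow> (real \<Rightarrow> complex) \<Rightarrow> (real \<Rightarrow> real \<Rightarrow> real) \<Rightarrow> real \<Rightarrow> real \<Rightarrow> bool" where
  "outer_arc_property \<omega> E D \<gamma> TE a b \<longleftrightarrow>
     continuous_on ({a<..<b} \<times> {a<..<b}) (\<lambda>(\<xi>1, \<xi>2). TE \<xi>1 \<xi>2) \<and>
     (\<exists>\<delta>>0. \<forall>\<xi>1\<in>{a<..<b}. \<forall>\<xi>2\<in>{a<..<b}.
        \<exists>z. outer_arc \<omega> E D (\<gamma> \<xi>1) (\<gamma> \<xi>2) (TE \<xi>1 \<xi>2) z \<and>
            (\<forall>T' z'. outer_arc \<omega> E D (\<gamma> \<xi>1) (\<gamma> \<xi>2) T' z' \<and> \<bar>T' - TE \<xi>1 \<xi>2\<bar> < \<delta> \<longrightarrow>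
               T' = TE \<xi>1 \<xi>2 \<and> (\<forall>s\<in>{0..T'}. z' s = z s)))"

definition TnT :: "complex \<Rightarrow> complex \<Rightarrow> real \<Rightarrow> (real \<Rightarrow> complex) \<Rightarrow> bool" where
  "TnT p q T z \<longleftrightarrow> \<not> homotopic_paths (- {0}) (\<lambda>t. z (T * t)) (linepath p q)"

definition inner_arc ::
    "real \<Rightarrow> real \<Rightarrow> real \<Rightarrow> complex set \<Rightarrow> complex \<Rightarrow> complex \<Rightarrow> real \<Rightarrow> (real \<Rightarrow> complex) \<Rightarrow> bool" where
  "inner_arc \<mu> E h D p q T z \<longleftrightarrow>
     0 < T \<and> z 0 = p \<and> z T = q \<and> (\<forall>s\<in>{0<..<T}. z s \<in> D) \<and>
     (if p = q then lc_kepler_sol \<mu> (E + h) T z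
      else (\<exists>v. newton_sol (kepler_force \<mu>) T z v \<and>
                (\<forall>s\<in>{0..T}. z s \<noteq> 0 \<and> 1 / 2 * (norm (v s))\<^sup>2 = V_inner \<mu> E h (z s))) \<and>
           TnT p q T z)"

definition inner_arc_property ::
    "real \<Rightarrow> real \<Rightarrow> complex set \<Rightarrow> real \<Rightarrow> (real \<Rightarrow> complex) \<Rightarrow> nat \<Rightarrow> (nat \<Rightarrow> real) \<Rightarrow> (nat \<Rightarrow> real) \<Rightarrow>
     real \<Rightarrow> bool" where
  "inner_arc_property \<mu> E D L \<gamma> m a b h0 \<longleftrightarrow>
     2 \<le> m \<and>
     (\<forall>i\<in>{1..m}. 0 \<le> a i \<and> a i < b i \<and> b i \<le> L) \<and>
     disjoint_family_on (\<lambda>i. {a i<..<b i}) {1..m} \<and>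
     (\<forall>i\<in>{1..m}. i \<in> NA \<gamma> m a b i \<and> (\<exists>j\<in>NA \<gamma> m a b i. j \<noteq> i)) \<and>
     0 < h0 \<and>
     (\<forall>i\<in>{1..m}. \<forall>j\<in>NA \<gamma> m a b i. \<forall>\<xi>1\<in>{a i<..<b i}. \<forall>\<xi>2\<in>{a j<..<b j}. \<forall>h>h0.
        \<exists>T z. inner_arc \<mu> E h D (\<gamma> \<xi>1) (\<gamma> \<xi>2) T z \<and>
              (\<forall>T' z'. inner_arc \<mu> E h D (\<gamma> \<xi>1) (\<gamma> \<xi>2) T' z' \<longrightarrow>
                 T' = T \<and> (\<forall>s\<in>{0..T}. z' s = z s)))"

section \<open>Jacobi lengths and the change-sign property\<close>

definition jacobi_length :: "(complex \<Rightarrow> real) \<Rightarrow> real \<Rightarrow> (real \<Rightarrow> complex) \<Rightarrow> real" where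
  "jacobi_length V T z =
     integral {0..T} (\<lambda>s. norm (vector_derivative z (at s within {0..T})) * sqrt (V (z s)))"

definition S_outer ::
    "real \<Rightarrow> real \<Rightarrow> complex set \<Rightarrow> (real \<Rightarrow> complex) \<Rightarrow> (real \<Rightarrow> real \<Rightarrow> real) \<Rightarrow> real \<Rightarrow> real \<Rightarrow> real" where
  "S_outer \<omega> E D \<gamma> TE \<xi>1 \<xi>2 =
     jacobi_length (V_outer \<omega> E) (TE \<xi>1 \<xi>2)
       (SOME z. outer_arc \<omega> E D (\<gamma> \<xi>1) (\<gamma> \<xi>2) (TE \<xi>1 \<xi>2) z)"

definition S_inner ::
    "real \<Rightarrow> real \<Rightarrow> complex set \<Rightarrow> (real \<Rightarrow> complex) \<Rightarrow> real \<Rightarrow> real \<Rightarrow> real \<Rightarrow> real" where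
  "S_inner \<mu> E D \<gamma> \<xi>1 \<xi>2 h =
     (let (T, z) = (SOME (T, z). inner_arc \<mu> E h D (\<gamma> \<xi>1) (\<gamma> \<xi>2) T z)
      in jacobi_length (V_inner \<mu> E h) T z)"

definition change_sign_property ::
    "real \<Rightarrow> real \<Rightarrow> real \<Rightarrow> complex set \<Rightarrow> (real \<Rightarrow> complex) \<Rightarrow> (real \<Rightarrow> real \<Rightarrow> real) \<Rightarrow>
     nat \<Rightarrow> (nat \<Rightarrow> real) \<Rightarrow> (nat \<Rightarrow> real) \<Rightarrow> real \<Rightarrow> (nat \<Rightarrow> real) \<Rightarrow> (nat \<Rightarrow> real) \<Rightarrow> real \<Rightarrow> bool" where
  "change_sign_property \<omega> \<mu> E D \<gamma> TE m a b h0 \<alpha> \<beta> h1 \<longleftrightarrow>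
     h0 \<le> h1 \<and>
     (\<forall>i\<in>{1..m}. a i < \<alpha> i \<and> \<alpha> i < \<beta> i \<and> \<beta> i < b i) \<and>
     (\<forall>h>h1. \<forall>i\<in>{1..m}. \<forall>\<xi>E\<in>{\<alpha> i..\<beta> i}. \<forall>\<xi>I\<in>(\<Union>j\<in>NA \<gamma> m a b i. {\<alpha> j..\<beta> j}).
        \<exists>dE\<alpha> dI\<alpha> dE\<beta> dI\<beta>.
          ((\<lambda>x. S_outer \<omega> E D \<gamma> TE \<xi>E x) has_real_derivative dE\<alpha>) (at (\<alpha> i)) \<and>
          ((\<lambda>x. S_inner \<mu> E D \<gamma> x \<xi>I h) has_real_derivative dI\<alpha>) (at (\<alpha> i)) \<and>
          ((\<lambda>x. S_outer \<omega> E D \<gamma> TE \<xi>E x) has_real_derivative dE\<beta>) (at (\<beta> i)) \<and>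
          ((\<lambda>x. S_inner \<mu> E D \<gamma> x \<xi>I h) has_real_derivative dI\<beta>) (at (\<beta> i)) \<and>
          (dE\<alpha> + dI\<alpha>) * (dE\<beta> + dI\<beta>) < 0)"

text \<open>
  \<open>D\<close> is admissible iff \<open>admissible_with \<dots>\<close> holds for some choice of \<open>m\<close>, \<open>a\<close>, \<open>b\<close>, \<open>TE\<close>, \<open>h0\<close>, \<open>\<alpha>\<close>,
  \<open>\<beta>\<close>, \<open>h1\<close>. The choice is kept explicit because the return map and the words depend on it.
\<close>

definition admissible_with ::
    "real \<Rightarrow> real \<Rightarrow> real \<Rightarrow> complex set \<Rightarrow> real \<Rightarrow> (real \<Rightarrow> complex) \<Rightarrow> (real \<Rightarrow> real \<Rightarrow> real) \<Rightarrow>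
     nat \<Rightarrow> (nat \<Rightarrow> real) \<Rightarrow> (nat \<Rightarrow> real) \<Rightarrow> real \<Rightarrow> (nat \<Rightarrow> real) \<Rightarrow> (nat \<Rightarrow> real) \<Rightarrow> real \<Rightarrow> bool" where
  "admissible_with \<omega> \<mu> E D L \<gamma> TE m a b h0 \<alpha> \<beta> h1 \<longleftrightarrow>
     C1_arclength_boundary D L \<gamma> \<and>
     inner_arc_property \<mu> E D L \<gamma> m a b h0 \<and>
     (\<forall>i\<in>{1..m}. outer_arc_property \<omega> E D \<gamma> TE (a i) (b i)) \<and>
     change_sign_property \<omega> \<mu> E D \<gamma> TE m a b h0 \<alpha> \<beta> h1"

section \<open>The return map\<close>

definition Xi_plus ::
    "real \<Rightarrow> real \<Rightarrow> complex set \<Rightarrow> real \<Rightarrow> (real \<Rightarrow> complex) \<Rightarrow> (nat \<Rightarrow> real) \<Rightarrow> (nat \<Rightarrow> real) \<Rightarrow> nat \<Rightarrow>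
     (real \<times> complex) set" where
  "Xi_plus \<omega> E D L \<gamma> \<alpha> \<beta> r =
     {(\<xi>, v). \<xi> \<in> {\<alpha> r..\<beta> r} \<and> 1 / 2 * (norm v)\<^sup>2 = V_outer \<omega> E (\<gamma> \<xi>) \<and>
              outward_normal D L \<gamma> \<xi> \<bullet> v > 0}"

definition Xi_minus ::
    "real \<Rightarrow> real \<Rightarrow> complex set \<Rightarrow> real \<Rightarrow> (real \<Rightarrow> complex) \<Rightarrow> (nat \<Rightarrow> real) \<Rightarrow> (nat \<Rightarrow> real) \<Rightarrow> nat \<Rightarrow>
     (real \<times> complex) set" where
  "Xi_minus \<omega> E D L \<gamma> \<alpha> \<beta> r =
     {(\<xi>, v). \<xi> \<in> {\<alpha> r..\<beta> r} \<and> 1 / 2 * (norm v)\<^sup>2 = V_outer \<omega> E (\<gamma> \<xi>) \<and>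
              outward_normal D L \<gamma> \<xi> \<bullet> v < 0}"

definition refraction ::
    "real \<Rightarrow> real \<Rightarrow> real \<Rightarrow> complex set \<Rightarrow> real \<Rightarrow> (real \<Rightarrow> complex) \<Rightarrow> real \<Rightarrow> complex \<Rightarrow> complex" where
  "refraction \<mu> E h D L \<gamma> \<xi> v =
     (let t = unit_tangent L \<gamma> \<xi>; n = outward_normal D L \<gamma> \<xi>; A = v \<bullet> t; B = v \<bullet> n
      in A *\<^sub>R t + (sgn B * sqrt (2 * V_inner \<mu> E h (\<gamma> \<xi>) - A\<^sup>2)) *\<^sub>R n)"

definition return_map ::
    "real \<Rightarrow> real \<Rightarrow> real \<Rightarrow> complex set \<Rightarrow> real \<Rightarrow> (real \<Rightarrow> complex) \<Rightarrow>
     nat \<Rightarrow> (nat \<Rightarrow> real) \<Rightarrow> (nat \<Rightarrow> real) \<Rightarrow> (nat \<Rightarrow> real) \<Rightarrow> (nat \<Rightarrow> real) \<Rightarrow> real \<Rightarrow>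
     ((real \<times> complex) \<times> (real \<times> complex)) set" where
  "return_map \<omega> \<mu> E D L \<gamma> m a b \<alpha> \<beta> h =
     {((\<xi>, v), (\<xi>2, v2)).
        \<exists>r\<in>{1..m}. (\<xi>, v) \<in> Xi_plus \<omega> E D L \<gamma> \<alpha> \<beta> r \<and>
        (\<exists>s1>0. \<exists>z u \<xi>1 v1.
           newton_sol (harmonic_force \<omega>) s1 z u \<and> z 0 = \<gamma> \<xi> \<and> u 0 = v \<and>
           (\<forall>s\<in>{0<..<s1}. z s \<notin> closure D) \<and>
           z s1 = \<gamma> \<xi>1 \<and> u s1 = v1 \<and> (\<xi>1, v1) \<in> Xi_minus \<omega> E D L \<gamma> \<alpha> \<beta> r \<and>
           (\<exists>s2>0. \<exists>y.
              lc_kepler_sol \<mu> (E + h) s2 y \<and> y 0 = \<gamma> \<xi>1 \<and>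
              (y has_vector_derivative refraction \<mu> E h D L \<gamma> \<xi>1 v1) (at 0 within {0..s2}) \<and>
              (\<forall>s\<in>{0<..<s2}. y s \<in> D) \<and>
              y s2 = \<gamma> \<xi>2 \<and>
              (y has_vector_derivative refraction \<mu> E h D L \<gamma> \<xi>2 v2) (at s2 within {0..s2}) \<and>
              (\<exists>r'\<in>NA \<gamma> m a b r. (\<xi>2, v2) \<in> Xi_plus \<omega> E D L \<gamma> \<alpha> \<beta> r')))}"

text \<open>
  For a map given by its graph \<open>F\<close>, single-valued and injective: the points at which all iterates of
  integer order are defined, and these iterates.
\<close>

definition invariant_set :: "('a \<times> 'a) set \<Rightarrow> 'a set" where
  "invariant_set F = {x. \<forall>n. x \<in> Domain (F ^^ n) \<and> x \<in> Range (F ^^ n)}"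

definition iterate :: "('a \<times> 'a) set \<Rightarrow> int \<Rightarrow> 'a \<Rightarrow> 'a" where
  "iterate F k x =
     (if 0 \<le> k then (THE y. (x, y) \<in> F ^^ nat k) else (THE y. (y, x) \<in> F ^^ nat (- k)))"

section \<open>Words and itineraries\<close>

definition words ::
    "(real \<Rightarrow> complex) \<Rightarrow> nat \<Rightarrow> (nat \<Rightarrow> real) \<Rightarrow> (nat \<Rightarrow> real) \<Rightarrow> (int \<Rightarrow> nat) set" where
  "words \<gamma> m a b = {l. \<forall>j. l j \<in> {1..m} \<and> l (j + 1) \<in> NA \<gamma> m a b (l j)}"

definition word_dist :: "(int \<Rightarrow> nat) \<Rightarrow> (int \<Rightarrow> nat) \<Rightarrow> real" where
  "word_dist l l' = (\<Sum>\<^sub>\<infinity>k. (if l k = l' k then 0 else 1) / 4 ^ nat \<bar>k\<bar>)"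

definition right_shift :: "(int \<Rightarrow> nat) \<Rightarrow> int \<Rightarrow> nat" where
  "right_shift l = (\<lambda>j. l (j + 1))"

definition itinerary ::
    "((real \<times> complex) \<times> (real \<times> complex)) set \<Rightarrow> nat \<Rightarrow> (nat \<Rightarrow> real) \<Rightarrow> (nat \<Rightarrow> real) \<Rightarrow>
     real \<times> complex \<Rightarrow> int \<Rightarrow> nat" where
  "itinerary F m \<alpha> \<beta> x = (\<lambda>j. THE r. r \<in> {1..m} \<and> fst (iterate F j x) \<in> {\<alpha> r..\<beta> r})"

definition symbolic_dynamics ::
    "real \<Rightarrow> real \<Rightarrow> real \<Rightarrow> complex set \<Rightarrow> real \<Rightarrow> (real \<Rightarrow> complex) \<Rightarrow>
     nat \<Rightarrow> (nat \<Rightarrow> real) \<Rightarrow> (nat \<Rightarrow> real) \<Rightarrow> (nat \<Rightarrow> real) \<Rightarrow> (nat \<Rightarrow> real) \<Rightarrow> real \<Rightarrow> bool" where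
  "symbolic_dynamics \<omega> \<mu> E D L \<gamma> m a b \<alpha> \<beta> h \<longleftrightarrow>
     (let F = return_map \<omega> \<mu> E D L \<gamma> m a b \<alpha> \<beta> h; X = invariant_set F; \<pi> = itinerary F m \<alpha> \<beta>
      in continuous_map (top_of_set X) (Metric_space.mtopology (words \<gamma> m a b) word_dist) \<pi> \<and>
         \<pi> ` X = words \<gamma> m a b \<and>
         (\<forall>x\<in>X. iterate F 1 x \<in> X \<and> \<pi> (iterate F 1 x) = right_shift (\<pi> x)))"

end

(*
A central configuration is a boundary point at which the boundary is orthogonal to the radius and which
the ray from the origin meets transversally. Near it the outer arc (a harmonic ellipse) and, for large
h, the inner arc (a nearly collisional Kepler arc) are close to the radial solutions, and both are explicit:
the cosine of the harmonic angle and the hyperbolic cosine of the Levi-Civita time solve quadratic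
equations in |p|, |q| and p . q. Hence the arcs exist, are unique, depend smoothly on their end points,
and the derivative of their Jacobi lengths is the tangential component of the velocity at the end point.
As h grows the inner length dominates and its derivative has the sign of the derivative of the distance
to the origin, up to a global factor; at a strict extremum this derivative changes sign.

A concatenation of arcs satisfies Snell's law exactly where the derivatives of the two adjacent Jacobi
lengths cancel. By the change of sign this is a countable system on a product of compact
intervals to which the Poincare-Miranda theorem applies, so every word is realized by an orbit. The
itinerary is continuous because the orbits cross the boundary transversally, which makes the two half
steps of the return map continuous, and because the reversal of velocities inverts them.

The base point of the parametrization is moved if it is itself a central configuration; the curve is
smooth there, since at a cusp the ray could not separate the two sides of the boundary.
*)

theory Submission
  imports Defs "HOL-Complex_Analysis.Great_Picard"
begin

section \<open>Explicit solutions of the equations of motion\<close>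

text \<open>Closeness to the radial motion is expressed by one geometric condition,
  \<open>radial_point\<close>: arc points are written as p + t (p + u) or p - t (p + u) with p an
  end point, and a bound on u decides whether the arc is outside or inside D. For inner arcs one
  quantity controls everything: C = cosh (k \<sigma>) is at least 4 k^2 d / \<mu>, where 2 k^2 = E +
  h and d stays away from 0 for non-antipodal intervals. Containment, transversality and dominance
  over the outer arc all follow once C and k are large. At an end of [\<alpha> i, \<beta> i] the
  sign of the sum of the two derivatives does not depend on the neighbouring points of the orbit.
  This is what makes the infinite system of a word a Poincare-Miranda problem. In regularized time
  the Kepler problem is linear, and arcs between equal and between distinct points have the same
  formulas. The return map is kept as a relation: velocity reversal conjugates each half step to its
  inverse, so injectivity and continuity of the inverse come for free.\<close>

definition osc :: "real \<Rightarrow> complex \<Rightarrow> complex \<Rightarrow> real \<Rightarrow> complex" where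
  "osc \<omega> p v s = cos (\<omega> * s) *\<^sub>R p + (sin (\<omega> * s) / \<omega>) *\<^sub>R v"

definition osc_vel :: "real \<Rightarrow> complex \<Rightarrow> complex \<Rightarrow> real \<Rightarrow> complex" where
  "osc_vel \<omega> p v s = cos (\<omega> * s) *\<^sub>R v - (\<omega> * sin (\<omega> * s)) *\<^sub>R p"

text \<open>Flow of w'' = k^2 w. The regularized Kepler equation w'' = (H/2) w has this form for H =
  2 k^2, and the energy is written in this way below.\<close>

definition hyp :: "real \<Rightarrow> complex \<Rightarrow> complex \<Rightarrow> real \<Rightarrow> complex" where
  "hyp k a b \<tau> = cosh (k * \<tau>) *\<^sub>R a + (sinh (k * \<tau>) / k) *\<^sub>R b"

definition hyp_vel :: "real \<Rightarrow> complex \<Rightarrow> complex \<Rightarrow> real \<Rightarrow> complex" where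
  "hyp_vel k a b \<tau> = cosh (k * \<tau>) *\<^sub>R b + (k * sinh (k * \<tau>)) *\<^sub>R a"

lemma osc_0 [simp]: "osc \<omega> p v 0 = p" "osc_vel \<omega> p v 0 = v"
  by (simp_all add: osc_def osc_vel_def)

lemma hyp_0 [simp]: "hyp k a b 0 = a" "hyp_vel k a b 0 = b"
  by (simp_all add: hyp_def hyp_vel_def)

lemma osc_deriv:
  assumes "\<omega> \<noteq> 0"
  shows "(osc \<omega> p v has_vector_derivative osc_vel \<omega> p v s) (at s within A)"
    and "(osc_vel \<omega> p v has_vector_derivative harmonic_force \<omega> (osc \<omega> p v s)) (at s within A)"
  using assms unfolding osc_def osc_vel_def harmonic_force_def
  by (auto intro!: derivative_eq_intros simp: scaleR_add_right power2_eq_square algebra_simps)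

lemma hyp_deriv:
  assumes "k \<noteq> 0"
  shows "(hyp k a b has_vector_derivative hyp_vel k a b \<tau>) (at \<tau> within A)"
    and "(hyp_vel k a b has_vector_derivative k\<^sup>2 *\<^sub>R hyp k a b \<tau>) (at \<tau> within A)"
  using assms unfolding hyp_def hyp_vel_def
  by (auto intro!: derivative_eq_intros simp: scaleR_add_right power2_eq_square algebra_simps)

lemma zero_deriv_const_Icc:
  fixes f :: "real \<Rightarrow> 'a::real_normed_vector"
  assumes "\<And>x. x \<in> {0..T} \<Longrightarrow> (f has_vector_derivative 0) (at x within {0..T})" "s \<in> {0..T}"
  shows "f s = f 0"
proof -
  obtain c where "\<And>x. x \<in> {0..T} \<Longrightarrow> f x = c"
    using has_vector_derivative_zero_constant[of "{0..T}" f] assms(1) by auto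
  with assms(2) show ?thesis by auto
qed

text \<open>Uniqueness for the linear equation: \<open>A\<close> and \<open>B\<close> apply the
  inverse of the flow to (z, v), so their derivatives vanish and they keep their initial values.
  Applying the flow again gives the formulas.\<close>

lemma newton_sol_harmonic:
  assumes "newton_sol (harmonic_force \<omega>) T z v" "\<omega> \<noteq> 0" "s \<in> {0..T}"
  shows "z s = osc \<omega> (z 0) (v 0) s" "v s = osc_vel \<omega> (z 0) (v 0) s"
proof -
  define A where "A = (\<lambda>s. cos (\<omega> * s) *\<^sub>R z s - (sin (\<omega> * s) / \<omega>) *\<^sub>R v s)"
  define B where "B = (\<lambda>s. (\<omega> * sin (\<omega> * s)) *\<^sub>R z s + cos (\<omega> * s) *\<^sub>R v s)"
  have der: "(z has_vector_derivative v x) (at x within {0..T})"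
    "(v has_vector_derivative - (\<omega>\<^sup>2 *\<^sub>R z x)) (at x within {0..T})" if "x \<in> {0..T}" for x
    using assms(1) that by (auto simp: newton_sol_def harmonic_force_def)
  have "A s = A 0"
    by (rule zero_deriv_const_Icc[where T = T])
      (use assms der in \<open>auto simp: A_def power2_eq_square algebra_simps intro!: derivative_eq_intros\<close>)
  moreover have "B s = B 0"
    by (rule zero_deriv_const_Icc[where T = T])
      (use assms der in \<open>auto simp: B_def power2_eq_square algebra_simps intro!: derivative_eq_intros\<close>)
  ultimately have AB: "A s = z 0" "B s = v 0" by (auto simp: A_def B_def)
  have 1: "cos (\<omega> * s) * cos (\<omega> * s) = 1 - sin (\<omega> * s) * sin (\<omega> * s)"
    using sin_cos_squared_add[of "\<omega> * s"] by (simp add: power2_eq_square)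
  have "osc \<omega> (A s) (B s) s = (cos (\<omega> * s) * cos (\<omega> * s)) *\<^sub>R z s + (sin (\<omega> * s) * sin (\<omega> * s)) *\<^sub>R z s"
    using assms(2) unfolding osc_def A_def B_def by (simp add: algebra_simps)
  hence "osc \<omega> (A s) (B s) s = (cos (\<omega> * s) * cos (\<omega> * s) + sin (\<omega> * s) * sin (\<omega> * s)) *\<^sub>R z s"
    by (simp only: scaleR_left_distrib)
  thus "z s = osc \<omega> (z 0) (v 0) s" using AB 1 by simp
  have "osc_vel \<omega> (A s) (B s) s = (cos (\<omega> * s) * cos (\<omega> * s)) *\<^sub>R v s + (sin (\<omega> * s) * sin (\<omega> * s)) *\<^sub>R v s"
    using assms(2) unfolding osc_vel_def A_def B_def by (simp add: algebra_simps)
  hence "osc_vel \<omega> (A s) (B s) s = (cos (\<omega> * s) * cos (\<omega> * s) + sin (\<omega> * s) * sin (\<omega> * s)) *\<^sub>R v s"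
    by (simp only: scaleR_left_distrib)
  thus "v s = osc_vel \<omega> (z 0) (v 0) s" using AB 1 by simp
qed

lemma newton_sol_hyperbolic:
  assumes "newton_sol (\<lambda>u. k\<^sup>2 *\<^sub>R u) T z v" "k \<noteq> 0" "s \<in> {0..T}"
  shows "z s = hyp k (z 0) (v 0) s" "v s = hyp_vel k (z 0) (v 0) s"
proof -
  define A where "A = (\<lambda>s. cosh (k * s) *\<^sub>R z s - (sinh (k * s) / k) *\<^sub>R v s)"
  define B where "B = (\<lambda>s. cosh (k * s) *\<^sub>R v s - (k * sinh (k * s)) *\<^sub>R z s)"
  have der: "(z has_vector_derivative v x) (at x within {0..T})"
    "(v has_vector_derivative k\<^sup>2 *\<^sub>R z x) (at x within {0..T})" if "x \<in> {0..T}" for x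
    using assms(1) that by (auto simp: newton_sol_def)
  have "A s = A 0"
    by (rule zero_deriv_const_Icc[where T = T])
      (use assms der in \<open>auto simp: A_def power2_eq_square algebra_simps intro!: derivative_eq_intros\<close>)
  moreover have "B s = B 0"
    by (rule zero_deriv_const_Icc[where T = T])
      (use assms der in \<open>auto simp: B_def power2_eq_square algebra_simps intro!: derivative_eq_intros\<close>)
  ultimately have AB: "A s = z 0" "B s = v 0" by (auto simp: A_def B_def)
  have 1: "cosh (k * s) * cosh (k * s) - sinh (k * s) * sinh (k * s) = 1"
    using cosh_square_eq[of "k * s"] by (simp add: power2_eq_square)
  have "hyp k (A s) (B s) s = (cosh (k * s) * cosh (k * s) - sinh (k * s) * sinh (k * s)) *\<^sub>R z s"
    using assms(2) unfolding hyp_def A_def B_def by (simp add: algebra_simps)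
  thus "z s = hyp k (z 0) (v 0) s" using AB 1 by simp
  have "hyp_vel k (A s) (B s) s = (cosh (k * s) * cosh (k * s) - sinh (k * s) * sinh (k * s)) *\<^sub>R v s"
    using assms(2) unfolding hyp_vel_def A_def B_def by (simp add: algebra_simps)
  thus "v s = hyp_vel k (z 0) (v 0) s" using AB 1 by simp
qed

lemma newton_sol_osc:
  "\<omega> \<noteq> 0 \<Longrightarrow> newton_sol (harmonic_force \<omega>) T (osc \<omega> p v) (osc_vel \<omega> p v)"
  by (simp add: newton_sol_def osc_deriv)

lemma newton_sol_hyp:
  "k \<noteq> 0 \<Longrightarrow> newton_sol (\<lambda>u. k\<^sup>2 *\<^sub>R u) T (hyp k a b) (hyp_vel k a b)"
  by (simp add: newton_sol_def hyp_deriv)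

lemma osc_energy:
  assumes "\<omega> \<noteq> 0"
  shows "(norm (osc_vel \<omega> p v s))\<^sup>2 + \<omega>\<^sup>2 * (norm (osc \<omega> p v s))\<^sup>2 = (norm v)\<^sup>2 + \<omega>\<^sup>2 * (norm p)\<^sup>2"
proof -
  have "(norm (osc_vel \<omega> p v s))\<^sup>2 + \<omega>\<^sup>2 * (norm (osc \<omega> p v s))\<^sup>2
     = cos (\<omega> * s) ^ 2 * ((norm v)\<^sup>2 + \<omega>\<^sup>2 * (norm p)\<^sup>2) + sin (\<omega> * s) ^ 2 * ((norm v)\<^sup>2 + \<omega>\<^sup>2 * (norm p)\<^sup>2)"
    using assms unfolding osc_def osc_vel_def power2_norm_eq_inner
    by (simp add: inner_simps inner_commute power2_eq_square field_simps)
  thus ?thesis by (simp flip: distrib_right)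
qed

lemma hyp_energy:
  assumes "k \<noteq> 0"
  shows "(norm (hyp_vel k a b s))\<^sup>2 - k\<^sup>2 * (norm (hyp k a b s))\<^sup>2 = (norm b)\<^sup>2 - k\<^sup>2 * (norm a)\<^sup>2"
proof -
  have "(norm (hyp_vel k a b s))\<^sup>2 - k\<^sup>2 * (norm (hyp k a b s))\<^sup>2
     = (cosh (k * s) ^ 2 - sinh (k * s) ^ 2) * ((norm b)\<^sup>2 - k\<^sup>2 * (norm a)\<^sup>2)"
    using assms unfolding hyp_def hyp_vel_def power2_norm_eq_inner
    by (simp add: inner_simps inner_commute power2_eq_square field_simps)
  thus ?thesis by (simp add: cosh_square_eq)
qed

section \<open>Levi-Civita time\<close>

text \<open>The integral of |\<open>hyp k a b\<close>|^2 from 0 to \<tau> in closed form, that is,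
  physical time as a function of regularized time.\<close>

definition lc_time :: "real \<Rightarrow> complex \<Rightarrow> complex \<Rightarrow> real \<Rightarrow> real" where
  "lc_time k a b \<tau> = (norm a)\<^sup>2 * (\<tau> / 2 + sinh (2 * k * \<tau>) / (4 * k)) + (a \<bullet> b) * (sinh (k * \<tau>))\<^sup>2 / k\<^sup>2
     + (norm b)\<^sup>2 / k\<^sup>2 * (sinh (2 * k * \<tau>) / (4 * k) - \<tau> / 2)"

lemma lc_time_0 [simp]: "lc_time k a b 0 = 0"
  by (simp add: lc_time_def)

lemma lc_time_deriv:
  assumes "k \<noteq> 0"
  shows "(lc_time k a b has_real_derivative (norm (hyp k a b \<tau>))\<^sup>2) (at \<tau> within A)"
proof -
  have 1: "cosh (2 * k * \<tau>) = cosh (k * \<tau>) ^ 2 + sinh (k * \<tau>) ^ 2"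
    using cosh_double[of "k * \<tau>"] by (simp add: mult.assoc)
  have c: "cosh (k * \<tau>) ^ 2 = sinh (k * \<tau>) ^ 2 + 1" by (rule cosh_square_eq)
  have n: "(norm (hyp k a b \<tau>))\<^sup>2 = cosh (k * \<tau>) ^ 2 * (norm a)\<^sup>2 + 2 * cosh (k * \<tau>) * sinh (k * \<tau>) / k * (a \<bullet> b)
     + sinh (k * \<tau>) ^ 2 / k\<^sup>2 * (norm b)\<^sup>2"
    unfolding hyp_def power2_norm_eq_inner using assms
    by (simp add: inner_simps inner_commute power2_eq_square field_simps)
  show ?thesis
    unfolding lc_time_def
    apply (rule derivative_eq_intros refl | simp add: assms)+
    unfolding n 1 c using assms by (simp add: power2_eq_square power4_eq_xxxx field_simps)
qed

text \<open>The derivative vanishes only at collisions. If time stood still on an interval, position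
  and hence velocity of the lift would vanish there, which the energy relation excludes. The second
  assumption is \<mu> > 0, read through 2 |b|^2 = \<mu> + 2 k^2 |a|^2.\<close>

lemma lc_time_strict_mono:
  assumes k: "k \<noteq> 0" and mu: "(norm b)\<^sup>2 > k\<^sup>2 * (norm a)\<^sup>2"
  shows "strict_mono (lc_time k a b)"
proof -
  have mono: "lc_time k a b x \<le> lc_time k a b y" if "x \<le> y" for x y
    by (rule DERIV_nonneg_imp_nondecreasing[OF that]) (use lc_time_deriv[OF k] in \<open>force\<close>)
  show ?thesis
  proof (rule strict_monoI, rule ccontr)
    fix x y :: real assume xy: "x < y" "\<not> lc_time k a b x < lc_time k a b y"
    hence eq: "lc_time k a b x = lc_time k a b y" using mono[of x y] by simp
    have const: "lc_time k a b u = lc_time k a b x" if "u \<in> {x<..<y}" for u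
      using mono[of x u] mono[of u y] that eq by auto
    have z: "hyp k a b u = 0" if "u \<in> {x<..<y}" for u
    proof -
      have "(lc_time k a b has_real_derivative 0) (at u)"
        by (rule has_field_derivative_transform_within_open[where f = "\<lambda>_. lc_time k a b x" and S = "{x<..<y}"])
          (use that const in auto)
      from DERIV_unique[OF this lc_time_deriv[OF k]] show ?thesis by simp
    qed
    define u where "u = (x + y) / 2"
    have u: "u \<in> {x<..<y}" using xy by (auto simp: u_def)
    have "(hyp k a b has_vector_derivative 0) (at u)"
      by (rule has_vector_derivative_transform_within_open[where f = "\<lambda>_. 0" and S = "{x<..<y}"])
        (use u z in auto)
    hence "hyp_vel k a b u = 0"
      using hyp_deriv(1)[OF k] vector_derivative_at by metis
    with hyp_energy[OF k, of a b u] z[OF u] mu show False by simp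
  qed
qed

definition lc_traj :: "real \<Rightarrow> complex \<Rightarrow> complex \<Rightarrow> real \<Rightarrow> complex" where
  "lc_traj k a b s = (hyp k a b (inv (lc_time k a b) s))\<^sup>2"

text \<open>The chain rule for z = w^2 with dt = |w|^2 d\<tau>: the velocity is 2 w w' / (w cnj
  w).\<close>

definition lc_vel :: "real \<Rightarrow> complex \<Rightarrow> complex \<Rightarrow> real \<Rightarrow> complex" where
  "lc_vel k a b s = 2 * hyp_vel k a b (inv (lc_time k a b) s) / cnj (hyp k a b (inv (lc_time k a b) s))"

lemma lc_traj_time:
  assumes k: "k \<noteq> 0" and mu: "(norm b)\<^sup>2 > k\<^sup>2 * (norm a)\<^sup>2"
  shows "lc_traj k a b (lc_time k a b \<tau>) = (hyp k a b \<tau>)\<^sup>2"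
    "lc_vel k a b (lc_time k a b \<tau>) = 2 * hyp_vel k a b \<tau> / cnj (hyp k a b \<tau>)"
  using strict_mono_imp_inj_on[OF lc_time_strict_mono[OF assms]]
  by (auto simp: lc_traj_def lc_vel_def)

lemma lc_time_cont: "k \<noteq> 0 \<Longrightarrow> continuous_on A (lc_time k a b)"
  by (meson DERIV_isCont continuous_at_imp_continuous_on lc_time_deriv)

text \<open>The inverse is continuous even at a collision, where time has derivative 0; only its
  differentiability requires \<open>hyp k a b \<tau> \<noteq> 0\<close>.\<close>

lemma lc_time_inv:
  assumes k: "k \<noteq> 0" and mu: "(norm b)\<^sup>2 > k\<^sup>2 * (norm a)\<^sup>2"
  shows "isCont (inv (lc_time k a b)) (lc_time k a b \<tau>)"
    and "hyp k a b \<tau> \<noteq> 0 \<Longrightarrow>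
      (inv (lc_time k a b) has_real_derivative inverse ((norm (hyp k a b \<tau>))\<^sup>2)) (at (lc_time k a b \<tau>))"
proof -
  let ?f = "lc_time k a b"
  have sm: "strict_mono ?f" using lc_time_strict_mono[OF assms] .
  have inv: "inv ?f (?f x) = x" for x using strict_mono_imp_inj_on[OF sm] by simp
  show c: "isCont (inv ?f) (?f \<tau>)"
    by (rule isCont_inverse_function[where d = 1])
      (use inv k lc_time_deriv DERIV_isCont in \<open>auto\<close>, blast)
  assume nz: "hyp k a b \<tau> \<noteq> 0"
  show "(inv ?f has_real_derivative inverse ((norm (hyp k a b \<tau>))\<^sup>2)) (at (?f \<tau>))"
  proof (rule DERIV_inverse_function[where f = ?f and a = "?f (\<tau> - 1)" and b = "?f (\<tau> + 1)"])
    show "(?f has_real_derivative (norm (hyp k a b \<tau>))\<^sup>2) (at (inv ?f (?f \<tau>)))"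
      using lc_time_deriv[OF k] inv by simp
    show "?f (inv ?f y) = y" if "?f (\<tau> - 1) < y" "y < ?f (\<tau> + 1)" for y
    proof -
      have "\<exists>x\<ge>\<tau> - 1. x \<le> \<tau> + 1 \<and> ?f x = y"
        using that by (intro IVT' lc_time_cont[OF k]) auto
      then obtain x where "?f x = y" by blast
      thus ?thesis using inv by auto
    qed
  qed (use nz c sm in \<open>auto simp: strict_mono_def\<close>)
qed


lemma norm_square_cnj: "(complex_of_real (norm z))\<^sup>2 = z * cnj z"
  using complex_norm_square[of z] by simp

lemma has_vector_derivative_divide_complex:
  fixes f g :: "real \<Rightarrow> complex"
  assumes "(f has_vector_derivative f') (at x within A)" "(g has_vector_derivative g') (at x within A)" "g x \<noteq> 0"
  shows "((\<lambda>x. f x / g x) has_vector_derivative (f' * g x - f x * g') / (g x)\<^sup>2) (at x within A)"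
  using has_derivative_divide'[OF assms(1,2)[unfolded has_vector_derivative_def] assms(3)]
  unfolding has_vector_derivative_def
  by (rule has_derivative_eq_rhs) (auto simp: power2_eq_square scaleR_conv_of_real algebra_simps diff_divide_distrib)

lemma lc_traj_deriv:
  assumes k: "k \<noteq> 0" and mu: "(norm b)\<^sup>2 > k\<^sup>2 * (norm a)\<^sup>2" and nz: "hyp k a b \<tau> \<noteq> 0"
  shows "(lc_traj k a b has_vector_derivative lc_vel k a b (lc_time k a b \<tau>)) (at (lc_time k a b \<tau>))"
proof -
  let ?f = "lc_time k a b"
  have inv: "inv ?f (?f \<tau>) = \<tau>" using strict_mono_imp_inj_on[OF lc_time_strict_mono[OF k mu]] by simp
  have d: "(inv ?f has_vector_derivative inverse ((norm (hyp k a b \<tau>))\<^sup>2)) (at (?f \<tau>))"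
    using lc_time_inv(2)[OF k mu nz] by (simp add: has_real_derivative_iff_has_vector_derivative)
  have "(hyp k a b \<circ> inv ?f has_vector_derivative inverse ((norm (hyp k a b \<tau>))\<^sup>2) *\<^sub>R hyp_vel k a b \<tau>) (at (?f \<tau>))"
    using vector_diff_chain_at[OF d, of "hyp k a b" "hyp_vel k a b \<tau>"] hyp_deriv(1)[OF k] inv by simp
  from has_vector_derivative_mult[OF this this]
  have "(lc_traj k a b has_vector_derivative 2 * hyp k a b \<tau> * (inverse ((norm (hyp k a b \<tau>))\<^sup>2) *\<^sub>R hyp_vel k a b \<tau>)) (at (?f \<tau>))"
    by (simp add: lc_traj_def[abs_def] o_def inv power2_eq_square algebra_simps)
  moreover have "2 * hyp k a b \<tau> * (inverse ((norm (hyp k a b \<tau>))\<^sup>2) *\<^sub>R hyp_vel k a b \<tau>) = lc_vel k a b (?f \<tau>)"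
    using nz unfolding lc_vel_def inv
    by (simp add: scaleR_conv_of_real norm_square_cnj field_simps)
  ultimately show ?thesis by simp
qed

text \<open>The quotient rule leaves the numerator 2 k^2 |w|^2 - 2 |w'|^2, which the energy relation
  turns into the constant -\<mu>; this is how a linear equation produces the Kepler force.\<close>

lemma lc_vel_deriv:
  assumes k: "k \<noteq> 0" and mu: "0 < \<mu>" and en: "2 * (norm b)\<^sup>2 = \<mu> + 2 * k\<^sup>2 * (norm a)\<^sup>2"
    and nz: "hyp k a b \<tau> \<noteq> 0"
  shows "(lc_vel k a b has_vector_derivative kepler_force \<mu> (lc_traj k a b (lc_time k a b \<tau>))) (at (lc_time k a b \<tau>))"
proof -
  let ?f = "lc_time k a b" and ?w = "hyp k a b \<tau>" and ?v = "hyp_vel k a b \<tau>"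
  have mu': "(norm b)\<^sup>2 > k\<^sup>2 * (norm a)\<^sup>2" using mu en by simp
  have inv: "inv ?f (?f \<tau>) = \<tau>" using strict_mono_imp_inj_on[OF lc_time_strict_mono[OF k mu']] by simp
  have d: "(inv ?f has_vector_derivative inverse ((norm (hyp k a b \<tau>))\<^sup>2)) (at (?f \<tau>))"
    using lc_time_inv(2)[OF k mu' nz] by (simp add: has_real_derivative_iff_has_vector_derivative)
  have c: "((\<lambda>\<tau>. cnj (hyp k a b \<tau>)) has_vector_derivative cnj ?v) (at \<tau>)"
    using bounded_linear.has_vector_derivative[OF bounded_linear_cnj hyp_deriv(1)[OF k]] by simp
  have en\<tau>: "2 * (norm ?v)\<^sup>2 = \<mu> + 2 * k\<^sup>2 * (norm ?w)\<^sup>2"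
    using hyp_energy[OF k, of a b \<tau>] en by simp
  have "((\<lambda>\<tau>. 2 * hyp_vel k a b \<tau> / cnj (hyp k a b \<tau>)) has_vector_derivative
      ((2 * (k\<^sup>2 *\<^sub>R ?w)) * cnj ?w - 2 * ?v * cnj ?v) / (cnj ?w)\<^sup>2) (at \<tau>)"
    by (rule has_vector_derivative_divide_complex[OF has_vector_derivative_mult_right[OF hyp_deriv(2)[OF k]] c])
      (use nz in simp)
  also have "((2 * (k\<^sup>2 *\<^sub>R ?w)) * cnj ?w - 2 * ?v * cnj ?v) = of_real (2 * k\<^sup>2 * (norm ?w)\<^sup>2 - 2 * (norm ?v)\<^sup>2)"
    by (simp add: scaleR_conv_of_real norm_square_cnj)
  also have "\<dots> = - of_real \<mu>" unfolding en\<tau> by simp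
  finally have q: "((\<lambda>\<tau>. 2 * hyp_vel k a b \<tau> / cnj (hyp k a b \<tau>)) has_vector_derivative - of_real \<mu> / (cnj ?w)\<^sup>2) (at \<tau>)" .
  have "((\<lambda>\<tau>. 2 * hyp_vel k a b \<tau> / cnj (hyp k a b \<tau>)) \<circ> inv ?f has_vector_derivative
      inverse ((norm ?w)\<^sup>2) *\<^sub>R (- of_real \<mu> / (cnj ?w)\<^sup>2)) (at (?f \<tau>))"
    by (rule vector_diff_chain_at[OF d]) (use q inv in simp)
  also have "(\<lambda>\<tau>. 2 * hyp_vel k a b \<tau> / cnj (hyp k a b \<tau>)) \<circ> inv ?f = lc_vel k a b"
    by (simp add: fun_eq_iff lc_vel_def)
  also have "inverse ((norm ?w)\<^sup>2) *\<^sub>R (- of_real \<mu> / (cnj ?w)\<^sup>2) = kepler_force \<mu> (lc_traj k a b (?f \<tau>))"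
  proof -
    have n: "complex_of_real (norm (?w\<^sup>2)) = ?w * cnj ?w"
      unfolding norm_power by (simp flip: norm_square_cnj)
    have "inverse ((norm ?w)\<^sup>2) *\<^sub>R (- of_real \<mu> / (cnj ?w)\<^sup>2) = inverse (?w * cnj ?w) * (- of_real \<mu> / (cnj ?w)\<^sup>2)"
      by (simp add: scaleR_conv_of_real norm_square_cnj)
    also have "\<dots> = - (of_real \<mu> / (?w * cnj ?w) ^ 3 * ?w\<^sup>2)"
      using nz by (simp add: field_simps power2_eq_square power3_eq_cube)
    also have "\<dots> = kepler_force \<mu> (?w\<^sup>2)"
      unfolding kepler_force_def by (simp add: scaleR_conv_of_real n del: complex_cnj_power)
    finally show ?thesis unfolding lc_traj_time(1)[OF k mu'] .
  qed
  finally show ?thesis .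
qed

lemma lc_energy:
  assumes k: "k \<noteq> 0" and mu: "0 < \<mu>" and en: "2 * (norm b)\<^sup>2 = \<mu> + 2 * k\<^sup>2 * (norm a)\<^sup>2"
    and nz: "hyp k a b \<tau> \<noteq> 0"
  shows "1 / 2 * (norm (lc_vel k a b (lc_time k a b \<tau>)))\<^sup>2 = 2 * k\<^sup>2 + \<mu> / norm (lc_traj k a b (lc_time k a b \<tau>))"
proof -
  have mu': "(norm b)\<^sup>2 > k\<^sup>2 * (norm a)\<^sup>2" using mu en by simp
  have "2 * (norm (hyp_vel k a b \<tau>))\<^sup>2 = \<mu> + 2 * k\<^sup>2 * (norm (hyp k a b \<tau>))\<^sup>2"
    using hyp_energy[OF k, of a b \<tau>] en by simp
  hence "1 / 2 * (2 * norm (hyp_vel k a b \<tau>) / norm (hyp k a b \<tau>))\<^sup>2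
      = (\<mu> + 2 * k\<^sup>2 * (norm (hyp k a b \<tau>))\<^sup>2) / (norm (hyp k a b \<tau>))\<^sup>2"
    by (simp add: power_divide power_mult_distrib)
  thus ?thesis unfolding lc_traj_time[OF k mu'] using nz
    by (simp add: norm_divide norm_mult norm_power add_divide_distrib)
qed

lemma lc_traj_sol:
  assumes k: "k \<noteq> 0" and mu: "0 < \<mu>" and en: "2 * (norm b)\<^sup>2 = \<mu> + 2 * k\<^sup>2 * (norm a)\<^sup>2"
    and "0 < \<sigma>"
  shows "lc_kepler_sol \<mu> (2 * k\<^sup>2) (lc_time k a b \<sigma>) (lc_traj k a b)"
proof -
  have mu': "(norm b)\<^sup>2 > k\<^sup>2 * (norm a)\<^sup>2" using mu en by simp
  have e: "2 * (norm (hyp_vel k a b x))\<^sup>2 = \<mu> + 2 * k\<^sup>2 * (norm (hyp k a b x))\<^sup>2" for x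
    using hyp_energy[OF k, of a b x] en by simp
  show ?thesis unfolding lc_kepler_sol_def
    apply (rule exI[of _ \<sigma>], intro conjI assms, rule exI[of _ "hyp k a b"], rule exI[of _ "hyp_vel k a b"],
      rule exI[of _ "lc_time k a b"])
    using newton_sol_hyp[OF k, of \<sigma> a b] e lc_time_deriv[OF k] lc_traj_time[OF k mu'] by simp
qed

text \<open>The lift is determined by its initial data, and the time change by its derivative and
  its value at 0, so only \<sigma>, a and b remain free.\<close>

lemma lc_kepler_sol_explicit:
  assumes "lc_kepler_sol \<mu> (2 * k\<^sup>2) T z" "k \<noteq> 0"
  shows "\<exists>\<sigma> a b. 0 < \<sigma> \<and> 2 * (norm b)\<^sup>2 = \<mu> + 2 * k\<^sup>2 * (norm a)\<^sup>2 \<and> T = lc_time k a b \<sigma> \<and>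
    (\<forall>\<tau>\<in>{0..\<sigma>}. z (lc_time k a b \<tau>) = (hyp k a b \<tau>)\<^sup>2)"
proof -
  obtain \<sigma> w w' t where *: "0 < \<sigma>" "newton_sol (\<lambda>u. k\<^sup>2 *\<^sub>R u) \<sigma> w w'"
    "\<And>\<tau>. \<tau> \<in> {0..\<sigma>} \<Longrightarrow> 2 * (norm (w' \<tau>))\<^sup>2 = \<mu> + 2 * k\<^sup>2 * (norm (w \<tau>))\<^sup>2"
    "t 0 = 0" "t \<sigma> = T"
    "\<And>\<tau>. \<tau> \<in> {0..\<sigma>} \<Longrightarrow> (t has_real_derivative (norm (w \<tau>))\<^sup>2) (at \<tau> within {0..\<sigma>})"
    "\<And>\<tau>. \<tau> \<in> {0..\<sigma>} \<Longrightarrow> z (t \<tau>) = (w \<tau>)\<^sup>2"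
    using assms(1) unfolding lc_kepler_sol_def by auto
  define a b where "a = w 0" and "b = w' 0"
  have w: "w \<tau> = hyp k a b \<tau>" if "\<tau> \<in> {0..\<sigma>}" for \<tau>
    using newton_sol_hyperbolic[OF *(2) assms(2) that] by (simp add: a_def b_def)
  have t: "t \<tau> = lc_time k a b \<tau>" if "\<tau> \<in> {0..\<sigma>}" for \<tau>
  proof -
    have "t \<tau> - lc_time k a b \<tau> = t 0 - lc_time k a b 0"
      by (rule zero_deriv_const_Icc[OF _ that])
       (use *(6) lc_time_deriv[OF assms(2)] w in
         \<open>auto intro!: derivative_eq_intros simp flip: has_real_derivative_iff_has_vector_derivative\<close>)
    thus ?thesis by (simp add: *)
  qed
  show ?thesis
  proof (intro exI conjI ballI)
    show "2 * (norm b)\<^sup>2 = \<mu> + 2 * k\<^sup>2 * (norm a)\<^sup>2" using *(1) *(3)[of 0] by (simp add: a_def b_def)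
  qed (use * t w in auto)
qed

text \<open>The arc is known only at the times \<open>lc_time k a b \<tau>\<close>, and V may be a
  one-sided derivative. In regularized time both |w|^2 V and 2 w w' are derivatives of w^2 on a
  closed interval, where derivatives are unique.\<close>

lemma lc_velocity:
  assumes k: "k \<noteq> 0" and en: "(norm b)\<^sup>2 > k\<^sup>2 * (norm a)\<^sup>2" and "0 < \<sigma>"
    and z: "\<And>\<tau>. \<tau> \<in> {0..\<sigma>} \<Longrightarrow> z (lc_time k a b \<tau>) = (hyp k a b \<tau>)\<^sup>2"
    and \<tau>: "\<tau> \<in> {0..\<sigma>}"
    and V: "(z has_vector_derivative V) (at (lc_time k a b \<tau>) within {0..lc_time k a b \<sigma>})"
    and nz: "hyp k a b \<tau> \<noteq> 0"
  shows "V = 2 * hyp_vel k a b \<tau> / cnj (hyp k a b \<tau>)"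
proof -
  let ?f = "lc_time k a b" and ?w = "hyp k a b \<tau>"
  have sm: "strict_mono ?f" by (rule lc_time_strict_mono[OF k en])
  have d: "(?f has_vector_derivative (norm ?w)\<^sup>2) (at \<tau> within {0..\<sigma>})"
    using lc_time_deriv[OF k] by (simp add: has_real_derivative_iff_has_vector_derivative)
  have im: "?f ` {0..\<sigma>} \<subseteq> {0..?f \<sigma>}"
    using strict_mono_less_eq[OF sm] lc_time_0 by (metis (no_types, lifting) atLeastAtMost_iff image_subsetI)
  have 1: "(z \<circ> ?f has_vector_derivative (norm ?w)\<^sup>2 *\<^sub>R V) (at \<tau> within {0..\<sigma>})"
    by (rule vector_diff_chain_within[OF d has_vector_derivative_within_subset[OF V im]])
  have 2: "((\<lambda>\<tau>. (hyp k a b \<tau>)\<^sup>2) has_vector_derivative 2 * ?w * hyp_vel k a b \<tau>) (at \<tau> within {0..\<sigma>})"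
    using has_vector_derivative_mult[OF hyp_deriv(1)[OF k, of a b \<tau> "{0..\<sigma>}"] hyp_deriv(1)[OF k, of a b \<tau> "{0..\<sigma>}"]]
    by (simp add: power2_eq_square algebra_simps)
  have 3: "(z \<circ> ?f has_vector_derivative 2 * ?w * hyp_vel k a b \<tau>) (at \<tau> within {0..\<sigma>})"
    by (rule has_vector_derivative_transform[OF \<tau> _ 2]) (simp add: z)
  have "(norm ?w)\<^sup>2 *\<^sub>R V = 2 * ?w * hyp_vel k a b \<tau>"
    by (rule vector_derivative_unique_within_closed_interval[OF \<open>0 < \<sigma>\<close>, of \<tau>]) (use \<tau> 1 3 in simp_all)
  hence "?w * (cnj ?w * V) = ?w * (2 * hyp_vel k a b \<tau>)"
    by (simp add: scaleR_conv_of_real norm_square_cnj mult_ac)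
  thus ?thesis using nz by (simp add: field_simps)
qed

text \<open>A square root of z along the path without a choice of branch: w = sqrt (z 0) exp
  (integral of v / (2 z)). With \<tau> the integral of 1/|z|, the pair of w and its
  \<tau>-derivative solves the linear system, where the factor k^2 comes from the energy
  relation.\<close>

lemma kepler_imp_lc:
  assumes sol: "newton_sol (kepler_force \<mu>) T z v" and "0 < T" and k: "k \<noteq> 0"
    and en: "\<And>s. s \<in> {0..T} \<Longrightarrow> z s \<noteq> 0 \<and> 1 / 2 * (norm (v s))\<^sup>2 = 2 * k\<^sup>2 + \<mu> / norm (z s)"
  shows "lc_kepler_sol \<mu> (2 * k\<^sup>2) T z"
proof -
  have dz: "(z has_vector_derivative v s) (at s within {0..T})"
    and dv: "(v has_vector_derivative kepler_force \<mu> (z s)) (at s within {0..T})" if "s \<in> {0..T}" for s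
    using sol that by (auto simp: newton_sol_def)
  have cz: "continuous_on {0..T} z" and cv: "continuous_on {0..T} v"
    using dz dv has_vector_derivative_continuous continuous_on_eq_continuous_within by blast+
  define \<tau> where "\<tau> = (\<lambda>s. integral {0..s} (\<lambda>s. 1 / norm (z s)))"
  define e where "e = (\<lambda>s. integral {0..s} (\<lambda>s. v s / (2 * z s)))"
  define w where "w = (\<lambda>s. csqrt (z 0) * exp (e s))"
  \<comment> \<open>The derivative of w with respect to \<tau>: |z| w v / (2 z) = (cnj w) v / 2,
    because z = w^2.\<close>
  define W where "W = (\<lambda>s. cnj (w s) * v s / 2)"
  have d\<tau>: "(\<tau> has_vector_derivative 1 / norm (z s)) (at s within {0..T})" if "s \<in> {0..T}" for s
    unfolding \<tau>_def by (rule integral_has_vector_derivative) (use that cz en in \<open>auto intro!: continuous_intros\<close>)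
  have de: "(e has_vector_derivative v s / (2 * z s)) (at s within {0..T})" if "s \<in> {0..T}" for s
    unfolding e_def by (rule integral_has_vector_derivative) (use that cz cv en in \<open>auto intro!: continuous_intros\<close>)
  have dw: "(w has_vector_derivative w s * (v s / (2 * z s))) (at s within {0..T})" if "s \<in> {0..T}" for s
  proof -
    have "(exp \<circ> e has_vector_derivative v s / (2 * z s) * exp (e s)) (at s within {0..T})"
      by (rule field_vector_diff_chain_within[OF de[OF that]]) (auto intro!: derivative_eq_intros)
    from has_vector_derivative_mult_right[OF this, of "csqrt (z 0)"]
    show ?thesis by (simp add: w_def o_def mult_ac)
  qed
  have w0: "w s \<noteq> 0" for s using en[of 0] \<open>0 < T\<close> by (simp add: w_def)
  have ww: "(w s)\<^sup>2 = z s" if s: "s \<in> {0..T}" for s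
  proof -
    \<comment> \<open>w^2 and z have the same logarithmic derivative, so their quotient is
      constant.\<close>
    have "z s / (w s)\<^sup>2 = z 0 / (w 0)\<^sup>2"
    proof (rule zero_deriv_const_Icc[OF _ s])
      fix x assume x: "x \<in> {0..T}"
      have zx: "z x \<noteq> 0" using en x by simp
      have "((\<lambda>s. (w s)\<^sup>2) has_vector_derivative (w x)\<^sup>2 * (v x / z x)) (at x within {0..T})"
        using has_vector_derivative_mult[OF dw[OF x] dw[OF x]] zx by (simp add: power2_eq_square field_simps)
      from has_vector_derivative_divide_complex[OF dz[OF x] this]
      show "((\<lambda>s. z s / (w s)\<^sup>2) has_vector_derivative 0) (at x within {0..T})"
        using w0 zx by (simp add: field_simps)
    qed
    moreover have "z 0 / (w 0)\<^sup>2 = 1" using en[of 0] \<open>0 < T\<close> by (simp add: w_def e_def)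
    ultimately show ?thesis using w0 by (simp add: field_simps)
  qed
  have nw: "norm (z s) = (norm (w s))\<^sup>2" if "s \<in> {0..T}" for s
    using ww[OF that] by (metis norm_power)
  have dw': "(w has_vector_derivative (1 / norm (z s)) *\<^sub>R W s) (at s within {0..T})" if s: "s \<in> {0..T}" for s
  proof -
    have "w s * (v s / (2 * z s)) = (1 / norm (z s)) *\<^sub>R W s"
    proof -
      have "w s * (v s / (2 * z s)) = v s / (2 * w s)"
        unfolding ww[OF s, symmetric] using w0[of s] by (simp add: power2_eq_square)
      also have "\<dots> = (1 / (w s * cnj (w s))) * W s" using w0[of s] by (simp add: W_def)
      also have "\<dots> = (1 / norm (z s)) *\<^sub>R W s"
        unfolding nw[OF s] by (simp add: scaleR_conv_of_real norm_square_cnj)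
      finally show ?thesis .
    qed
    thus ?thesis using dw[OF s] by simp
  qed
  have dW: "(W has_vector_derivative (1 / norm (z s)) *\<^sub>R (k\<^sup>2 *\<^sub>R w s)) (at s within {0..T})" if s: "s \<in> {0..T}" for s
  proof -
    have zs: "norm (z s) \<noteq> 0" "(norm (w s))\<^sup>2 \<noteq> 0" using en s w0 by auto
    have "(W has_vector_derivative (cnj (w s) * kepler_force \<mu> (z s) + cnj (w s * (v s / (2 * z s))) * v s) / 2) (at s within {0..T})"
      unfolding W_def
      by (intro has_vector_derivative_divide has_vector_derivative_mult dv[OF s]
          bounded_linear.has_vector_derivative[OF bounded_linear_cnj dw[OF s]])
    also have "(cnj (w s) * kepler_force \<mu> (z s) + cnj (w s * (v s / (2 * z s))) * v s) / 2
      = of_real ((1 / 2 * (norm (v s))\<^sup>2 - \<mu> / norm (z s)) / norm (z s) / 2) * w s"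
    proof -
      have 1: "cnj (w s) * kepler_force \<mu> (z s) = - of_real (\<mu> / norm (z s) / norm (z s)) * w s"
      proof -
        have "cnj (w s) * z s = of_real (norm (z s)) * w s"
        proof -
          have "cnj (w s) * z s = (w s * cnj (w s)) * w s" by (simp add: ww[OF s, symmetric] power2_eq_square)
          thus ?thesis unfolding nw[OF s] by (simp add: norm_square_cnj)
        qed
        thus ?thesis unfolding kepler_force_def using zs
          by (simp add: scaleR_conv_of_real field_simps power3_eq_cube)
      qed
      have 2: "cnj (w s * (v s / (2 * z s))) * v s = of_real ((norm (v s))\<^sup>2 / (2 * norm (z s))) * w s"
      proof -
        have "cnj (w s * (v s / (2 * z s))) * v s = (v s * cnj (v s)) / (2 * cnj (w s))"
          using w0[of s] by (simp add: ww[OF s, symmetric] power2_eq_square)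
        also have "\<dots> = (v s * cnj (v s)) * w s / (2 * (w s * cnj (w s)))"
          using w0[of s] by simp
        also have "\<dots> = of_real ((norm (v s))\<^sup>2 / (2 * norm (z s))) * w s"
          unfolding nw[OF s] by (simp add: norm_square_cnj)
        finally show ?thesis .
      qed
      show ?thesis unfolding 1 2 using zs(1) by (simp add: field_simps power2_eq_square)
    qed
    also have "1 / 2 * (norm (v s))\<^sup>2 - \<mu> / norm (z s) = 2 * k\<^sup>2" using conjunct2[OF en[OF s]] by linarith
    finally show ?thesis by (simp add: scaleR_conv_of_real)
  qed
  define a b where "a = w 0" and "b = W 0"
  \<comment> \<open>As in \<open>newton_sol_hyperbolic\<close>, but along \<tau> s: the chain rule
    contributes a common factor 1/|z|, and the derivatives still vanish.\<close>
  define A where "A = (\<lambda>s. cosh (k * \<tau> s) *\<^sub>R w s - (sinh (k * \<tau> s) / k) *\<^sub>R W s)"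
  define B where "B = (\<lambda>s. cosh (k * \<tau> s) *\<^sub>R W s - (k * sinh (k * \<tau> s)) *\<^sub>R w s)"
  have \<tau>0: "\<tau> 0 = 0" by (simp add: \<tau>_def)
  have d\<tau>': "(\<tau> has_real_derivative 1 / norm (z s)) (at s within {0..T})" if "s \<in> {0..T}" for s
    using d\<tau>[OF that] by (simp add: has_real_derivative_iff_has_vector_derivative)
  have ki: "k * (inverse k * x) = x" for x using k by simp
  have A: "A s = a" if "s \<in> {0..T}" for s
  proof -
    have "A s = A 0"
      by (rule zero_deriv_const_Icc[where T = T])
       (use that k dw' dW d\<tau>' in \<open>auto simp: A_def power2_eq_square algebra_simps divide_inverse ki intro!: derivative_eq_intros\<close>)
    thus ?thesis by (simp add: A_def a_def \<tau>0)
  qed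
  have B: "B s = b" if "s \<in> {0..T}" for s
  proof -
    have "B s = B 0"
      by (rule zero_deriv_const_Icc[where T = T])
       (use that k dw' dW d\<tau>' in \<open>auto simp: B_def power2_eq_square algebra_simps divide_inverse ki intro!: derivative_eq_intros\<close>)
    thus ?thesis by (simp add: B_def b_def \<tau>0)
  qed
  have w_hyp: "w s = hyp k a b (\<tau> s)" if "s \<in> {0..T}" for s
  proof -
    have 1: "cosh (k * \<tau> s) * cosh (k * \<tau> s) - sinh (k * \<tau> s) * sinh (k * \<tau> s) = 1"
      using cosh_square_eq[of "k * \<tau> s"] by (simp add: power2_eq_square)
    have "hyp k (A s) (B s) (\<tau> s) = (cosh (k * \<tau> s) * cosh (k * \<tau> s) - sinh (k * \<tau> s) * sinh (k * \<tau> s)) *\<^sub>R w s"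
      using k unfolding hyp_def A_def B_def by (simp add: algebra_simps)
    thus ?thesis using 1 A[OF that] B[OF that] by simp
  qed
  have ltau: "lc_time k a b (\<tau> s) = s" if s: "s \<in> {0..T}" for s
  proof -
    have "lc_time k a b (\<tau> s) - s = lc_time k a b (\<tau> 0) - 0"
    proof (rule zero_deriv_const_Icc[OF _ s])
      fix x assume x: "x \<in> {0..T}"
      have "((lc_time k a b \<circ> \<tau>) has_real_derivative (norm (hyp k a b (\<tau> x)))\<^sup>2 * (1 / norm (z x))) (at x within {0..T})"
        by (rule DERIV_chain) (use d\<tau>'[OF x] lc_time_deriv[OF k] in auto)
      also have "(norm (hyp k a b (\<tau> x)))\<^sup>2 * (1 / norm (z x)) = 1"
        using w_hyp[OF x] nw[OF x] w0[of x] by simp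
      finally have "((\<lambda>s. lc_time k a b (\<tau> s) - s) has_real_derivative 1 - 1) (at x within {0..T})"
        by (intro derivative_intros) (simp add: o_def)
      thus "((\<lambda>s. lc_time k a b (\<tau> s) - s) has_vector_derivative 0) (at x within {0..T})"
        by (simp add: has_real_derivative_iff_has_vector_derivative)
    qed
    thus ?thesis by (simp add: \<tau>0)
  qed
  have c\<tau>: "continuous_on {0..T} \<tau>"
    using d\<tau> has_vector_derivative_continuous continuous_on_eq_continuous_within by blast
  have pos: "0 < \<tau> T"
  proof -
    have "\<tau> T \<noteq> 0" using ltau[of T] \<open>0 < T\<close> by auto
    moreover have "0 \<le> \<tau> T" unfolding \<tau>_def by (rule integral_nonneg)
      (auto intro!: integrable_continuous_interval continuous_intros cz simp: en)
    ultimately show ?thesis by simp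
  qed
  have enab: "2 * (norm b)\<^sup>2 = \<mu> + 2 * k\<^sup>2 * (norm a)\<^sup>2"
  proof -
    have 0: "0 \<in> {0..T}" using \<open>0 < T\<close> by simp
    have "2 * (norm b)\<^sup>2 = (norm a)\<^sup>2 * (1 / 2 * (norm (v 0))\<^sup>2)"
      by (simp add: b_def a_def W_def norm_mult power_mult_distrib norm_divide power_divide)
    also have "\<dots> = (norm a)\<^sup>2 * (2 * k\<^sup>2 + \<mu> / (norm a)\<^sup>2)"
      using en[OF 0] nw[OF 0] by (simp add: a_def)
    also have "\<dots> = \<mu> + 2 * k\<^sup>2 * (norm a)\<^sup>2" using w0[of 0] by (simp add: a_def field_simps)
    finally show ?thesis .
  qed
  show ?thesis unfolding lc_kepler_sol_def
  proof (rule exI[of _ "\<tau> T"], intro conjI pos, rule exI[of _ "hyp k a b"], rule exI[of _ "hyp_vel k a b"],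
      rule exI[of _ "lc_time k a b"], intro conjI ballI)
    show "newton_sol (\<lambda>u. (2 * k\<^sup>2 / 2) *\<^sub>R u) (\<tau> T) (hyp k a b) (hyp_vel k a b)"
      using newton_sol_hyp[OF k] by simp
    fix x assume x: "x \<in> {0..\<tau> T}"
    show "2 * (norm (hyp_vel k a b x))\<^sup>2 = \<mu> + 2 * k\<^sup>2 * (norm (hyp k a b x))\<^sup>2"
      using hyp_energy[OF k, of a b x] enab by simp
    show "(lc_time k a b has_real_derivative (norm (hyp k a b x))\<^sup>2) (at x within {0..\<tau> T})"
      by (rule lc_time_deriv[OF k])
    have "\<exists>s\<ge>0. s \<le> T \<and> \<tau> s = x"
      using x \<open>0 < T\<close> c\<tau> \<tau>0 by (intro IVT') auto
    then obtain s where s: "s \<in> {0..T}" "\<tau> s = x" by auto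
    show "z (lc_time k a b x) = (hyp k a b x)\<^sup>2"
      using ltau[OF s(1)] w_hyp[OF s(1)] ww[OF s(1)] s(2) by simp
  qed (use ltau \<open>0 < T\<close> in auto)
qed

section \<open>Local geometry of the boundary\<close>

text \<open>This lemma and the next turn avoidance of the boundary into staying on one side of it,
  which is how the inclusions below are obtained.\<close>

lemma connected_inside:
  assumes "connected S" "S \<inter> frontier D = {}" "x \<in> S" "x \<in> D"
  shows "S \<subseteq> D"
  using connected_Int_frontier[of S D] assms by blast

lemma connected_outside:
  assumes "connected S" "S \<inter> frontier D = {}" "x \<in> S" "x \<notin> closure D"
  shows "S \<inter> closure D = {}"
proof -
  have "x \<notin> D" using assms(4) closure_subset by blast
  hence "S \<inter> D = {}" using connected_Int_frontier[of S D] assms by blast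
  thus ?thesis using assms(2) closure_Un_frontier[of D] by blast
qed

text \<open>The tangent is a parameter of the locale. Differentiability holds on the closed interval
  [0, L] and the two end tangents may differ, so the curve may have a corner at
  \<open>\<gamma> 0\<close>; local statements are therefore made at interior parameters.\<close>

locale arclength_domain =
  fixes D :: "complex set" and L :: real and \<gamma> \<gamma>' :: "real \<Rightarrow> complex"
  assumes D: "open D" "bounded D" "0 \<in> D"
    and L: "0 < L" and closed_curve: "\<gamma> 0 = \<gamma> L" and inj: "inj_on \<gamma> {0..<L}"
    and image: "\<gamma> ` {0..L} = frontier D"
    and cont': "continuous_on {0..L} \<gamma>'"
    and deriv: "\<And>\<xi>. \<xi> \<in> {0..L} \<Longrightarrow> (\<gamma> has_vector_derivative \<gamma>' \<xi>) (at \<xi> within {0..L})"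
    and unit: "\<And>\<xi>. \<xi> \<in> {0..L} \<Longrightarrow> norm (\<gamma>' \<xi>) = 1"
begin

lemma C1: "C1_arclength_boundary D L \<gamma>"
  unfolding C1_arclength_boundary_def using L closed_curve inj image cont' deriv unit by blast

lemma cont: "continuous_on {0..L} \<gamma>"
  using deriv has_vector_derivative_continuous continuous_on_eq_continuous_within by blast

lemma on_frontier: "\<xi> \<in> {0..L} \<Longrightarrow> \<gamma> \<xi> \<in> frontier D"
  using image by blast

lemma frontier_disjoint: "x \<in> frontier D \<Longrightarrow> x \<notin> D"
  using D(1) by (simp add: frontier_def interior_open)

lemma nonzero: "\<xi> \<in> {0..L} \<Longrightarrow> \<gamma> \<xi> \<noteq> 0"
  using on_frontier frontier_disjoint D(3) by metis

lemma inj_interior: "\<xi> \<in> {0<..<L} \<Longrightarrow> \<xi>' \<in> {0..L} \<Longrightarrow> \<gamma> \<xi> = \<gamma> \<xi>' \<Longrightarrow> \<xi> = \<xi>'"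
  using inj closed_curve inj_onD[OF inj, of \<xi> \<xi>'] inj_onD[OF inj, of \<xi> 0]
  by (cases "\<xi>' = L") auto

lemma unit_tangent_eq: "\<xi> \<in> {0..L} \<Longrightarrow> unit_tangent L \<gamma> \<xi> = \<gamma>' \<xi>"
  unfolding unit_tangent_def using vector_derivative_within_cbox[of 0 L \<xi> \<gamma> "\<gamma>' \<xi>"] L deriv[of \<xi>] by simp

lemma deriv_at: "\<xi> \<in> {0<..<L} \<Longrightarrow> (\<gamma> has_vector_derivative \<gamma>' \<xi>) (at \<xi>)"
  using deriv[of \<xi>] at_within_interior[of \<xi> "{0..L}"] by (simp add: interior_atLeastAtMost_real)

lemma isCont_interior: "\<xi> \<in> {0<..<L} \<Longrightarrow> isCont \<gamma> \<xi>" "\<xi> \<in> {0<..<L} \<Longrightarrow> isCont \<gamma>' \<xi>"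
  using continuous_on_interior[OF cont, of \<xi>] continuous_on_interior[OF cont', of \<xi>]
  by (auto simp: interior_atLeastAtMost_real)

text \<open>Continuity of the inverse parametrization: the part of the curve with parameters away
  from \<xi> is compact and misses \<open>\<gamma> \<xi>\<close> by injectivity.\<close>

lemma param_close:
  assumes "\<xi> \<in> {0<..<L}" "0 < e"
  obtains d where "0 < d" "\<And>\<xi>'. \<xi>' \<in> {0..L} \<Longrightarrow> dist (\<gamma> \<xi>') (\<gamma> \<xi>) < d \<Longrightarrow> \<bar>\<xi>' - \<xi>\<bar> < e"
proof -
  define K where "K = \<gamma> ` ({0..L} - ball \<xi> e)"
  have K: "compact K" unfolding K_def
    by (intro compact_continuous_image continuous_on_subset[OF cont] compact_diff) auto
  have "\<gamma> \<xi> \<notin> K" unfolding K_def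
    using assms inj_interior[OF assms(1)] by (auto simp: dist_real_def)
  then obtain d where d: "d > 0" "\<And>y. y \<in> K \<Longrightarrow> d \<le> dist (\<gamma> \<xi>) y"
    using separate_point_closed[OF compact_imp_closed[OF K], of "\<gamma> \<xi>"] by blast
  show ?thesis
  proof (rule that[OF d(1)])
    fix \<xi>' assume "\<xi>' \<in> {0..L}" "dist (\<gamma> \<xi>') (\<gamma> \<xi>) < d"
    moreover have "\<gamma> \<xi>' \<notin> K" using d(2)[of "\<gamma> \<xi>'"] calculation by (auto simp: dist_commute)
    ultimately show "\<bar>\<xi>' - \<xi>\<bar> < e" unfolding K_def by (auto simp: dist_real_def)
  qed
qed

text \<open>Strict differentiability from C^1:
  \<open>\<gamma> x - x *\<^sub>R \<gamma>' \<xi>\<close> has small derivative near \<xi>. Both x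
  and y vary, which makes the later estimates uniform in the base point.\<close>

lemma chord:
  assumes "\<xi> \<in> {0<..<L}" "0 < e"
  obtains d where "0 < d" "{\<xi> - d<..<\<xi> + d} \<subseteq> {0<..<L}"
    "\<And>x y. \<bar>x - \<xi>\<bar> < d \<Longrightarrow> \<bar>y - \<xi>\<bar> < d \<Longrightarrow> norm (\<gamma> x - \<gamma> y - (x - y) *\<^sub>R \<gamma>' \<xi>) \<le> e * \<bar>x - y\<bar>"
proof -
  obtain d0 where d0: "d0 > 0" "\<And>x. \<bar>x - \<xi>\<bar> < d0 \<Longrightarrow> norm (\<gamma>' x - \<gamma>' \<xi>) < e"
    using isCont_interior(2)[OF assms(1)] assms(2) unfolding continuous_at_eps_delta
    by (metis dist_norm real_norm_def)
  define d where "d = min d0 (min \<xi> (L - \<xi>))"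
  have d: "0 < d" "d \<le> d0" "{\<xi> - d<..<\<xi> + d} \<subseteq> {0<..<L}" using d0 assms by (auto simp: d_def)
  show ?thesis
  proof (rule that[OF d(1,3)])
    fix x y assume xy: "\<bar>x - \<xi>\<bar> < d" "\<bar>y - \<xi>\<bar> < d"
    let ?S = "{\<xi> - d<..<\<xi> + d}"
    have "norm ((\<gamma> x - x *\<^sub>R \<gamma>' \<xi>) - (\<gamma> y - y *\<^sub>R \<gamma>' \<xi>)) \<le> e * norm (x - y)"
    proof (rule differentiable_bound[where S = ?S and f' = "\<lambda>x h. h *\<^sub>R (\<gamma>' x - \<gamma>' \<xi>)"])
      fix u assume u: "u \<in> ?S"
      hence "u \<in> {0<..<L}" using d by blast
      from deriv_at[OF this] have "(\<gamma> has_derivative (\<lambda>h. h *\<^sub>R \<gamma>' u)) (at u within ?S)"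
        unfolding has_vector_derivative_def by (rule has_derivative_at_withinI)
      thus "((\<lambda>x. \<gamma> x - x *\<^sub>R \<gamma>' \<xi>) has_derivative (\<lambda>h. h *\<^sub>R (\<gamma>' u - \<gamma>' \<xi>))) (at u within ?S)"
        by (auto intro!: derivative_eq_intros simp: algebra_simps)
      have "\<bar>u - \<xi>\<bar> < d0" using u d(2) by auto
      hence "norm (\<gamma>' u - \<gamma>' \<xi>) \<le> e" using d0(2) by (meson less_imp_le)
      hence "norm (h *\<^sub>R (\<gamma>' u - \<gamma>' \<xi>)) \<le> e * norm h" for h :: real
        using mult_left_mono[of "norm (\<gamma>' u - \<gamma>' \<xi>)" e "\<bar>h\<bar>"] by (simp add: mult.commute)
      thus "onorm (\<lambda>h. h *\<^sub>R (\<gamma>' u - \<gamma>' \<xi>)) \<le> e" by (rule onorm_le)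
    qed (use xy in auto)
    thus "norm (\<gamma> x - \<gamma> y - (x - y) *\<^sub>R \<gamma>' \<xi>) \<le> e * \<bar>x - y\<bar>" by (simp add: algebra_simps)
  qed
qed

text \<open>A boundary point close to \<open>\<gamma> \<xi>\<close> is joined to
  \<open>\<gamma> \<xi>'\<close> by an almost tangential chord, whereas \<open>s *\<^sub>R d\<close>
  has a component of size at least s c along n. The bounds are uniform in the base point, in s and
  in d.\<close>

lemma transversal:
  assumes \<xi>: "\<xi> \<in> {0<..<L}" and n: "n \<bullet> \<gamma>' \<xi> = 0" and c: "0 < c"
  shows "\<exists>e>0. {\<xi> - e<..<\<xi> + e} \<subseteq> {0<..<L} \<and>
    (\<forall>\<xi>' s d. \<bar>\<xi>' - \<xi>\<bar> < e \<longrightarrow> 0 < s \<longrightarrow> s < e \<longrightarrow> norm d \<le> M \<longrightarrow> c \<le> \<bar>n \<bullet> d\<bar> \<longrightarrow> \<gamma> \<xi>' + s *\<^sub>R d \<notin> frontier D)"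
proof -
  define M' where "M' = \<bar>M\<bar> + 1"
  \<comment> \<open>A chord of parameter length at most 2 s \<open>M'\<close> with error rate r has
    a component along n of size below s c.\<close>
  define r where "r = min (1/2) (c / (4 * M' * (norm n + 1)))"
  have M': "M' > 0" "M < M'" by (auto simp: M'_def)
  have r: "r > 0" "r \<le> 1/2" "r * (4 * M' * (norm n + 1)) \<le> c" using c M' 
    by (auto simp: r_def min_def field_simps add_pos_nonneg)
  obtain d0 where d0: "0 < d0" "{\<xi> - d0<..<\<xi> + d0} \<subseteq> {0<..<L}"
    "\<And>x y. \<bar>x - \<xi>\<bar> < d0 \<Longrightarrow> \<bar>y - \<xi>\<bar> < d0 \<Longrightarrow> norm (\<gamma> x - \<gamma> y - (x - y) *\<^sub>R \<gamma>' \<xi>) \<le> r * \<bar>x - y\<bar>"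
    using chord[OF \<xi> r(1)] by blast
  obtain d1 where d1: "0 < d1" "\<And>\<xi>'. \<xi>' \<in> {0..L} \<Longrightarrow> dist (\<gamma> \<xi>') (\<gamma> \<xi>) < d1 \<Longrightarrow> \<bar>\<xi>' - \<xi>\<bar> < d0"
    using param_close[OF \<xi> d0(1)] by blast
  \<comment> \<open>Keeps the end of the displacement within \<open>d1\<close> of
    \<open>\<gamma> \<xi>\<close>, so that its parameter is in the range of the chord estimate: the
    base point is at distance below 2 e and the displacement has length at most e
    \<open>M'\<close>.\<close>
  define e where "e = min d0 (d1 / (M' + 2))"
  have e: "0 < e" "e \<le> d0" "e * (M' + 2) \<le> d1" 
  proof -
    have "e \<le> d1 / (M' + 2)" by (simp add: e_def)
    thus "e * (M' + 2) \<le> d1" using M' by (simp add: pos_le_divide_eq)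
  qed (use d0 d1 M' in \<open>auto simp: e_def\<close>)
  have u: "norm (\<gamma>' \<xi>) = 1" using unit \<xi> by auto
  show ?thesis
  proof (intro exI[of _ e] conjI allI impI e(1))
    show "{\<xi> - e<..<\<xi> + e} \<subseteq> {0<..<L}" using d0(2) e(2) by auto
    fix \<xi>' s d assume *: "\<bar>\<xi>' - \<xi>\<bar> < e" "0 < s" "s < e" "norm d \<le> M" "c \<le> \<bar>n \<bullet> d\<bar>"
    show "\<gamma> \<xi>' + s *\<^sub>R d \<notin> frontier D"
    proof
      assume "\<gamma> \<xi>' + s *\<^sub>R d \<in> frontier D"
      then obtain x where x: "x \<in> {0..L}" "\<gamma> x = \<gamma> \<xi>' + s *\<^sub>R d" using image by (metis imageE)
      have "norm (\<gamma> \<xi>' - \<gamma> \<xi>) \<le> r * \<bar>\<xi>' - \<xi>\<bar> + \<bar>\<xi>' - \<xi>\<bar>"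
      proof -
        have "norm (\<gamma> \<xi>' - \<gamma> \<xi> - (\<xi>' - \<xi>) *\<^sub>R \<gamma>' \<xi>) \<le> r * \<bar>\<xi>' - \<xi>\<bar>" using d0(3)[of \<xi>' \<xi>] * e d0(1) by simp
        thus ?thesis using norm_triangle_sub[of "\<gamma> \<xi>' - \<gamma> \<xi>" "(\<xi>' - \<xi>) *\<^sub>R \<gamma>' \<xi>"] u by simp
      qed
      also have "\<dots> \<le> 1/2 * \<bar>\<xi>' - \<xi>\<bar> + \<bar>\<xi>' - \<xi>\<bar>" using r by (intro add_mono mult_right_mono) auto
      also have "\<dots> < 2 * e" using mult_strict_left_mono[OF *(1), of "3/2"] e(1) by (simp add: field_simps)
      finally have 1: "norm (\<gamma> \<xi>' - \<gamma> \<xi>) < 2 * e" .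
      have "norm (\<gamma> x - \<gamma> \<xi>) \<le> norm (\<gamma> \<xi>' - \<gamma> \<xi>) + norm (s *\<^sub>R d)"
        unfolding x(2) using norm_triangle_ineq[of "\<gamma> \<xi>' - \<gamma> \<xi>" "s *\<^sub>R d"] by (simp add: algebra_simps)
      also have "norm (s *\<^sub>R d) \<le> e * M'" using * M' by (simp, intro mult_mono) auto
      also have "norm (\<gamma> \<xi>' - \<gamma> \<xi>) + e * M' < e * (M' + 2)" using 1 by (simp add: algebra_simps)
      also have "\<dots> \<le> d1" by (rule e)
      finally have "\<bar>x - \<xi>\<bar> < d0" using d1(2)[OF x(1)] by (simp add: dist_norm)
      hence 2: "norm (s *\<^sub>R d - (x - \<xi>') *\<^sub>R \<gamma>' \<xi>) \<le> r * \<bar>x - \<xi>'\<bar>"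
        using d0(3)[of x \<xi>'] * e x(2) by simp
      have "\<bar>x - \<xi>'\<bar> = norm ((x - \<xi>') *\<^sub>R \<gamma>' \<xi>)" using u by simp
      also have "\<dots> \<le> norm (s *\<^sub>R d) + norm (s *\<^sub>R d - (x - \<xi>') *\<^sub>R \<gamma>' \<xi>)"
        by (rule norm_triangle_sub[of "(x - \<xi>') *\<^sub>R \<gamma>' \<xi>" "s *\<^sub>R d", unfolded norm_minus_commute[of "(x - \<xi>') *\<^sub>R \<gamma>' \<xi>"]])
      also have "\<dots> \<le> s * M' + 1/2 * \<bar>x - \<xi>'\<bar>"
      proof (rule add_mono)
        show "norm (s *\<^sub>R d) \<le> s * M'" using *(2,4) M'(2) by simp
        show "norm (s *\<^sub>R d - (x - \<xi>') *\<^sub>R \<gamma>' \<xi>) \<le> 1/2 * \<bar>x - \<xi>'\<bar>"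
          using 2 mult_right_mono[OF r(2), of "\<bar>x - \<xi>'\<bar>"] by simp
      qed
      finally have 3: "\<bar>x - \<xi>'\<bar> \<le> 2 * s * M'" by simp
      have "s * \<bar>n \<bullet> d\<bar> = \<bar>n \<bullet> (s *\<^sub>R d - (x - \<xi>') *\<^sub>R \<gamma>' \<xi>)\<bar>"
        using n * by (simp add: inner_diff_right abs_mult)
      also have "\<dots> \<le> norm n * norm (s *\<^sub>R d - (x - \<xi>') *\<^sub>R \<gamma>' \<xi>)" by (rule Cauchy_Schwarz_ineq2)
      also have "\<dots> \<le> norm n * (r * (2 * s * M'))"
        using 2 3 r(1) by (intro mult_left_mono) (auto intro: order_trans[OF _ mult_left_mono])
      also have "\<dots> < (norm n + 1) * (r * (4 * s * M'))"
      proof -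
        have "0 < r * s * M'" using r(1) M'(1) *(2) by simp
        moreover from this have "0 \<le> norm n * (r * s * M')" by simp
        ultimately show ?thesis by (simp add: algebra_simps)
      qed
      also have "\<dots> = s * (r * (4 * M' * (norm n + 1)))" by simp
      also have "\<dots> \<le> s * c" using r(3) *(2) by (intro mult_left_mono) auto
      finally show False using * by simp
    qed
  qed
qed

text \<open>A boundary point at which the segment to the origin and the opposite half-line are separated
  from the boundary, uniformly under perturbations of size \<open>\<eta>\<close> of the radial direction.\<close>

definition radial_point :: "real \<Rightarrow> real \<Rightarrow> bool" where
  "radial_point \<eta> \<xi> \<longleftrightarrow> \<xi> \<in> {0<..<L} \<and> 0 < \<eta> \<and> \<bar>\<gamma> \<xi> \<bullet> \<gamma>' \<xi>\<bar> \<le> \<eta> \<and>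
     (\<exists>n. norm n = 1 \<and> n \<bullet> \<gamma>' \<xi> = 0 \<and> \<eta> < n \<bullet> \<gamma> \<xi>) \<and>
     (\<forall>u. norm u \<le> \<eta> \<longrightarrow> (\<forall>t. 0 < t \<longrightarrow> t \<le> 1 \<longrightarrow> \<gamma> \<xi> - t *\<^sub>R (\<gamma> \<xi> + u) \<in> D) \<and>
        (\<forall>t>0. \<gamma> \<xi> + t *\<^sub>R (\<gamma> \<xi> + u) \<notin> closure D))"

lemma complex_orth_unique:
  fixes n n' t :: complex
  assumes "norm n = 1" "norm n' = 1" "norm t = 1" "n \<bullet> t = 0" "n' \<bullet> t = 0"
  shows "n' = n \<or> n' = - n"
proof -
  have *: "Re n * Re t + Im n * Im t = 0" "Re n' * Re t + Im n' * Im t = 0"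
    "(Re n)\<^sup>2 + (Im n)\<^sup>2 = 1" "(Re n')\<^sup>2 + (Im n')\<^sup>2 = 1" "(Re t)\<^sup>2 + (Im t)\<^sup>2 = 1"
    using assms by (auto simp: inner_complex_def cmod_def)
  have "Re n * Im n' = Im n * Re n'"
    using * by algebra
  hence "(n' - n) * (n' + n) = 0" using * unfolding complex_eq_iff
    apply simp by algebra
  thus ?thesis by (auto simp: eq_neg_iff_add_eq_0)
qed

text \<open>The description of the normal has exactly one solution here. Removing from
  \<open>\<gamma> \<xi>\<close> its tangential part, of size at most \<eta>, leaves a positive
  multiple of the unit vector N, so the two sides along N are covered by the cones of
  \<open>radial_point\<close>; -N fails because no point is both in D and outside its
  closure.\<close>

lemma radial_normal:
  assumes "radial_point \<eta> \<xi>"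
  defines "n \<equiv> outward_normal D L \<gamma> \<xi>"
  shows "norm n = 1" "n \<bullet> \<gamma>' \<xi> = 0" "\<eta> < n \<bullet> \<gamma> \<xi>"
    "\<forall>\<^sub>F s in at_right 0. \<gamma> \<xi> + s *\<^sub>R n \<notin> closure D \<and> \<gamma> \<xi> - s *\<^sub>R n \<in> D"
proof -
  have \<xi>: "\<xi> \<in> {0<..<L}" "0 < \<eta>" "\<bar>\<gamma> \<xi> \<bullet> \<gamma>' \<xi>\<bar> \<le> \<eta>"
    and cone: "\<And>u t. norm u \<le> \<eta> \<Longrightarrow> 0 < t \<Longrightarrow> t \<le> 1 \<Longrightarrow> \<gamma> \<xi> - t *\<^sub>R (\<gamma> \<xi> + u) \<in> D"
      "\<And>u t. norm u \<le> \<eta> \<Longrightarrow> 0 < t \<Longrightarrow> \<gamma> \<xi> + t *\<^sub>R (\<gamma> \<xi> + u) \<notin> closure D"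
    using assms(1) unfolding radial_point_def by auto
  obtain N where N: "norm N = 1" "N \<bullet> \<gamma>' \<xi> = 0" "\<eta> < N \<bullet> \<gamma> \<xi>"
    using assms(1) unfolding radial_point_def by auto
  have t: "norm (\<gamma>' \<xi>) = 1" using unit \<xi> by auto
  define u where "u = - (\<gamma> \<xi> \<bullet> \<gamma>' \<xi>) *\<^sub>R \<gamma>' \<xi>"
  have u: "norm u \<le> \<eta>" using t \<xi>(3) by (simp add: u_def)
  have dec: "\<gamma> \<xi> + u = (N \<bullet> \<gamma> \<xi>) *\<^sub>R N"
  proof -
    have *: "Re N * Re (\<gamma>' \<xi>) + Im N * Im (\<gamma>' \<xi>) = 0" "(Re N)\<^sup>2 + (Im N)\<^sup>2 = 1" "(Re (\<gamma>' \<xi>))\<^sup>2 + (Im (\<gamma>' \<xi>))\<^sup>2 = 1"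
      using N t by (auto simp: inner_complex_def cmod_def)
    have "Re (\<gamma>' \<xi>) * Re (\<gamma>' \<xi>) = Im N * Im N" "Im (\<gamma>' \<xi>) * Im (\<gamma>' \<xi>) = Re N * Re N" "Re (\<gamma>' \<xi>) * Im (\<gamma>' \<xi>) = - Re N * Im N"
      using * by algebra+
    thus ?thesis using *(2) unfolding complex_eq_iff u_def inner_complex_def
      apply simp by algebra
  qed
  have ev: "\<forall>\<^sub>F s in at_right 0. \<gamma> \<xi> + s *\<^sub>R N \<notin> closure D \<and> \<gamma> \<xi> - s *\<^sub>R N \<in> D"
    unfolding eventually_at_right_field
  proof (rule exI[of _ "N \<bullet> \<gamma> \<xi>"], intro conjI allI impI)
    show pos: "0 < N \<bullet> \<gamma> \<xi>" using N(3) \<xi>(2) by linarith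
    fix s assume s: "0 < s" "s < N \<bullet> \<gamma> \<xi>"
    have sN: "s *\<^sub>R N = (s / (N \<bullet> \<gamma> \<xi>)) *\<^sub>R (\<gamma> \<xi> + u)" unfolding dec using pos by simp
    show "\<gamma> \<xi> + s *\<^sub>R N \<notin> closure D" unfolding sN using cone(2)[OF u] s pos by simp
    show "\<gamma> \<xi> - s *\<^sub>R N \<in> D" unfolding sN using cone(1)[OF u] s pos by simp
  qed
  have "n = N" unfolding n_def outward_normal_def
  proof (rule the_equality)
    show "norm N = 1 \<and> N \<bullet> unit_tangent L \<gamma> \<xi> = 0 \<and> (\<forall>\<^sub>F s in at_right 0. \<gamma> \<xi> + s *\<^sub>R N \<notin> closure D \<and> \<gamma> \<xi> - s *\<^sub>R N \<in> D)"
      using N ev \<xi> by (simp add: unit_tangent_eq)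
    fix N' assume N': "norm N' = 1 \<and> N' \<bullet> unit_tangent L \<gamma> \<xi> = 0 \<and> (\<forall>\<^sub>F s in at_right 0. \<gamma> \<xi> + s *\<^sub>R N' \<notin> closure D \<and> \<gamma> \<xi> - s *\<^sub>R N' \<in> D)"
    have "N' \<noteq> - N"
    proof
      assume eq: "N' = - N"
      have "\<forall>\<^sub>F s in at_right (0::real). False"
        using eventually_conj[OF ev conjunct2[OF conjunct2[OF N']]]
        by (rule eventually_mono) (use closure_subset[of D] eq in auto)
      thus False by simp
    qed
    thus "N' = N" using complex_orth_unique[OF N(1) _ t N(2)] N' \<xi> by (auto simp: unit_tangent_eq)
  qed
  thus "norm n = 1" "n \<bullet> \<gamma>' \<xi> = 0" "\<eta> < n \<bullet> \<gamma> \<xi>"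
    "\<forall>\<^sub>F s in at_right 0. \<gamma> \<xi> + s *\<^sub>R n \<notin> closure D \<and> \<gamma> \<xi> - s *\<^sub>R n \<in> D"
    using N ev by auto
qed

text \<open>The displacements with normal part of one sign form a convex family of pairs (s, d)
  whose image avoids the boundary by \<open>transversal\<close>; a small multiple of the normal
  decides on which side the image lies.\<close>

lemma radial_sides:
  assumes "radial_point \<eta> \<xi>" "0 < c"
  obtains e where "0 < e"
    "\<And>s d. 0 < s \<Longrightarrow> s < e \<Longrightarrow> norm d \<le> M \<Longrightarrow> outward_normal D L \<gamma> \<xi> \<bullet> d \<le> - c \<Longrightarrow> \<gamma> \<xi> + s *\<^sub>R d \<in> D"
    "\<And>s d. 0 < s \<Longrightarrow> s < e \<Longrightarrow> norm d \<le> M \<Longrightarrow> c \<le> outward_normal D L \<gamma> \<xi> \<bullet> d \<Longrightarrow> \<gamma> \<xi> + s *\<^sub>R d \<notin> closure D"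
proof -
  let ?n = "outward_normal D L \<gamma> \<xi>"
  note n = radial_normal[OF assms(1)]
  have \<xi>: "\<xi> \<in> {0<..<L}" using assms(1) by (auto simp: radial_point_def)
  have cpos: "0 < min 1 c" using assms(2) by simp
  \<comment> \<open>The bounds 1 make the unit normal itself an admissible direction.\<close>
  from transversal[OF \<xi> n(2) cpos, of "max 1 M"]
  obtain e where e0: "0 < e" "\<forall>\<xi>' s d. \<bar>\<xi>' - \<xi>\<bar> < e \<longrightarrow> 0 < s \<longrightarrow> s < e \<longrightarrow> norm d \<le> max 1 M \<longrightarrow> min 1 c \<le> \<bar>?n \<bullet> d\<bar> \<longrightarrow> \<gamma> \<xi>' + s *\<^sub>R d \<notin> frontier D"
    by blast
  note e = e0(1) e0(2)[rule_format]
  obtain b where b: "b > 0" "\<And>s. 0 < s \<Longrightarrow> s < b \<Longrightarrow> \<gamma> \<xi> + s *\<^sub>R ?n \<notin> closure D \<and> \<gamma> \<xi> - s *\<^sub>R ?n \<in> D"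
    using n(4)[unfolded eventually_at_right_field] by meson
  define s0 where "s0 = min b e / 2"
  have s0: "0 < s0" "s0 < b" "s0 < e" using b e by (auto simp: s0_def)
  have nn: "?n \<bullet> ?n = 1" using n(1) by (simp add: dot_square_norm)
  let ?f = "\<lambda>(s, d). \<gamma> \<xi> + s *\<^sub>R d"
  let ?A = "{0<..<e} \<times> (cball 0 (max 1 M) \<inter> {d. ?n \<bullet> d \<le> - min 1 c})"
  let ?B = "{0<..<e} \<times> (cball 0 (max 1 M) \<inter> {d. min 1 c \<le> ?n \<bullet> d})"
  have A: "?f ` ?A \<subseteq> D"
  proof (rule connected_inside)
    show "connected (?f ` ?A)"
      by (intro connected_continuous_image convex_connected convex_Times convex_Int convex_halfspace_le)
        (auto intro!: continuous_intros simp: case_prod_unfold)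
    show "?f ` ?A \<inter> frontier D = {}" using e(2)[of \<xi>] e(1) by auto
    have "(s0, - ?n) \<in> ?A" using s0 n(1) nn by auto
    thus "\<gamma> \<xi> - s0 *\<^sub>R ?n \<in> ?f ` ?A" by (rule rev_image_eqI) simp
    show "\<gamma> \<xi> - s0 *\<^sub>R ?n \<in> D" using b(2) s0 by simp
  qed
  have B: "?f ` ?B \<inter> closure D = {}"
  proof (rule connected_outside)
    show "connected (?f ` ?B)"
      by (intro connected_continuous_image convex_connected convex_Times convex_Int)
        (auto intro!: continuous_intros simp: case_prod_unfold convex_halfspace_ge[of "min 1 c" ?n, simplified])
    show "?f ` ?B \<inter> frontier D = {}" using e(2)[of \<xi>] e(1) by auto
    have "(s0, ?n) \<in> ?B" using s0 n(1) nn by auto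
    thus "\<gamma> \<xi> + s0 *\<^sub>R ?n \<in> ?f ` ?B" by (rule rev_image_eqI) simp
    show "\<gamma> \<xi> + s0 *\<^sub>R ?n \<notin> closure D" using b(2) s0 by simp
  qed
  show ?thesis
  proof (rule that[OF e(1)])
    fix s d assume sd: "0 < s" "s < e" "norm d \<le> M" "?n \<bullet> d \<le> - c"
    have "\<gamma> \<xi> + s *\<^sub>R d \<in> ?f ` ?A" by (rule image_eqI[of _ _ "(s, d)"]) (use sd in auto)
    thus "\<gamma> \<xi> + s *\<^sub>R d \<in> D" by (rule subsetD[OF A])
  next
    fix s d assume sd: "0 < s" "s < e" "norm d \<le> M" "c \<le> ?n \<bullet> d"
    have "\<gamma> \<xi> + s *\<^sub>R d \<in> ?f ` ?B" by (rule image_eqI[of _ _ "(s, d)"]) (use sd in auto)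
    thus "\<gamma> \<xi> + s *\<^sub>R d \<notin> closure D" using B by (simp add: disjoint_iff)
  qed
qed

text \<open>The perturbed ray is split into three ranges: near the boundary point transversality
  applies, at intermediate distance the unperturbed ray has positive distance from the boundary by
  compactness, and far out everything lies beyond the bounded domain. Connectedness then fixes the
  side.\<close>

lemma central_radial:
  assumes \<xi>: "\<xi> \<in> {0<..<L}" and crit: "\<gamma> \<xi> \<bullet> \<gamma>' \<xi> = 0"
    and ray: "{s *\<^sub>R \<gamma> \<xi> | s. 0 \<le> s} \<inter> frontier D = {\<gamma> \<xi>}"
  obtains \<eta> e where "0 < \<eta>" "0 < e" "\<And>x. \<bar>x - \<xi>\<bar> < e \<Longrightarrow> radial_point \<eta> x"
proof -
  define p where "p = \<gamma> \<xi>"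
  have p: "p \<noteq> 0" using nonzero \<xi> by (auto simp: p_def)
  hence np: "0 < norm p" by simp
  have pt: "p \<bullet> \<gamma>' \<xi> = 0" using crit by (simp add: p_def)
  have "0 < (norm p)\<^sup>2 / 2" using np by simp
  from transversal[OF \<xi> pt this, of "2 * norm p"]
  obtain e1 where e10: "0 < e1" "{\<xi> - e1<..<\<xi> + e1} \<subseteq> {0<..<L}"
    "\<forall>\<xi>' s d. \<bar>\<xi>' - \<xi>\<bar> < e1 \<longrightarrow> 0 < s \<longrightarrow> s < e1 \<longrightarrow> norm d \<le> 2 * norm p \<longrightarrow> (norm p)\<^sup>2 / 2 \<le> \<bar>p \<bullet> d\<bar> \<longrightarrow> \<gamma> \<xi>' + s *\<^sub>R d \<notin> frontier D"
    by blast
  note e1 = e10(1,2) e10(3)[rule_format]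
  obtain B where B: "B > 0" "\<And>x. x \<in> closure D \<Longrightarrow> norm x \<le> B"
    using bounded_closure[OF D(2)] bounded_pos by metis
  \<comment> \<open>From t = K on, a perturbed outward ray has left the ball of radius B that
    contains \<open>closure D\<close>.\<close>
  define K where "K = 1 + 3 * (B + 1) / norm p"
  have K: "K > 1" "3 * (B + 1) < K * norm p" using B np by (auto simp: K_def field_simps)
  define R where "R = (\<lambda>s. s *\<^sub>R p) ` ({0..1 - e1} \<union> {1 + e1..1 + K})"
  have "compact R" unfolding R_def
    by (intro compact_continuous_image compact_Un continuous_intros) auto
  moreover have "R \<inter> frontier D = {}"
  proof -
    have "s *\<^sub>R p \<notin> frontier D" if "0 \<le> s" "s \<noteq> 1" for s
    proof
      assume "s *\<^sub>R p \<in> frontier D"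
      hence "s *\<^sub>R p = p" using ray that unfolding p_def by blast
      thus False using p that scaleR_cancel_right[of s p 1] by simp
    qed
    thus ?thesis using e1(1) unfolding R_def by auto
  qed
  ultimately obtain r where r: "r > 0" "\<And>x y. x \<in> R \<Longrightarrow> y \<in> frontier D \<Longrightarrow> r \<le> dist x y"
    using separate_compact_closed[of R "frontier D"] frontier_closed by blast
  obtain r0 where r0: "r0 > 0" "ball 0 r0 \<subseteq> D" using D openE by metis
  \<comment> \<open>The three entries: displacements up to 2 q (1 + K) stay within the distance r;
    the perturbed direction keeps at least half of its radial part; the point -u reached at t = 1
    lies in a ball inside D.\<close>
  define q where "q = Min {r / (2 * (1 + K)), norm p / 8, r0 / 2}"
  have q: "q > 0" "2 * q * (1 + K) \<le> r" "q \<le> norm p / 8" "q < r0"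
  proof -
    show "q > 0" using r r0 np K by (auto simp: q_def)
    have "q \<le> r / (2 * (1 + K))" unfolding q_def by (rule Min_le) auto
    thus "2 * q * (1 + K) \<le> r" using K by (simp add: field_simps)
    show "q \<le> norm p / 8" unfolding q_def by (rule Min_le) auto
    have "q \<le> r0 / 2" unfolding q_def by (rule Min_le) auto
    thus "q < r0" using r0 by simp
  qed
  obtain e2 where e2: "e2 > 0" "\<And>x. \<bar>x - \<xi>\<bar> < e2 \<Longrightarrow> norm (\<gamma> x - p) < q"
    using isCont_interior(1)[OF \<xi>] q(1) unfolding continuous_at_eps_delta p_def
    by (metis dist_norm real_norm_def)
  have "isCont (\<lambda>x. \<gamma> x \<bullet> \<gamma>' x) \<xi>" using isCont_interior[OF \<xi>] by (intro continuous_intros)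
  then obtain e3 where e3: "e3 > 0" "\<And>x. \<bar>x - \<xi>\<bar> < e3 \<Longrightarrow> \<bar>\<gamma> x \<bullet> \<gamma>' x\<bar> < q"
    using q(1) crit unfolding continuous_at_eps_delta by (metis diff_zero dist_real_def real_norm_def)
  define e where "e = min e1 (min e2 e3)"
  have e: "e > 0" "e \<le> e1" "e \<le> e2" "e \<le> e3" using e1 e2 e3 by (auto simp: e_def)
  show ?thesis
  proof (rule that[OF q(1) e(1)])
    fix x assume x: "\<bar>x - \<xi>\<bar> < e"
    have "x \<in> {\<xi> - e1<..<\<xi> + e1}" using x e(2) by auto
    hence xL: "x \<in> {0<..<L}" using e1(2) by blast
    have gx: "norm (\<gamma> x - p) < q" "\<bar>\<gamma> x \<bullet> \<gamma>' x\<bar> < q" using e2 e3 x e by auto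
    have ngx: "norm p - q \<le> norm (\<gamma> x)" using norm_triangle_ineq3[of "\<gamma> x" p] gx(1) by linarith
    have t: "norm (\<gamma>' x) = 1" using unit xL by auto
    have nz: "\<exists>n. norm n = 1 \<and> n \<bullet> \<gamma>' x = 0 \<and> q < n \<bullet> \<gamma> x"
    proof -
      define n0 where "n0 = \<i> * \<gamma>' x"
      have n0: "norm n0 = 1" "n0 \<bullet> \<gamma>' x = 0" using t by (auto simp: n0_def norm_mult inner_complex_def)
      have "(n0 \<bullet> \<gamma> x)\<^sup>2 + (\<gamma> x \<bullet> \<gamma>' x)\<^sup>2 = (norm (\<gamma>' x))\<^sup>2 * (norm (\<gamma> x))\<^sup>2"
        unfolding n0_def inner_complex_def cmod_power2 by (simp add: algebra_simps power2_eq_square)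
      hence "(n0 \<bullet> \<gamma> x)\<^sup>2 = (norm (\<gamma> x))\<^sup>2 - (\<gamma> x \<bullet> \<gamma>' x)\<^sup>2" using t by simp
      moreover have "(\<gamma> x \<bullet> \<gamma>' x)\<^sup>2 \<le> q\<^sup>2" using gx(2) by (simp add: abs_le_square_iff[symmetric])
      moreover have "(7 * q)\<^sup>2 \<le> (norm (\<gamma> x))\<^sup>2" using ngx q(1,3) by (intro power_mono) auto
      moreover have "0 < q\<^sup>2" "(7 * q)\<^sup>2 = 49 * q\<^sup>2" using q(1) by (auto simp: power_mult_distrib)
      ultimately have "q\<^sup>2 < (n0 \<bullet> \<gamma> x)\<^sup>2" by linarith
      hence "q < \<bar>n0 \<bullet> \<gamma> x\<bar>" using q(1) by (metis abs_le_square_iff abs_of_pos not_le)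
      thus ?thesis using n0 by (cases "0 \<le> n0 \<bullet> \<gamma> x") (auto intro: exI[of _ n0] exI[of _ "- n0"])
    qed
    have near: "\<gamma> x + s *\<^sub>R d \<notin> frontier D" if "0 < s" "s < e1" "norm u \<le> q" "d = \<gamma> x + u \<or> d = - (\<gamma> x + u)" for s d u
    proof (rule e1(3))
      have a: "norm (\<gamma> x + u - p) \<le> 2 * q"
        using norm_triangle_ineq[of "\<gamma> x - p" u] gx(1) that(3) by (simp add: algebra_simps)
      have "norm (\<gamma> x + u) \<le> norm p + 2 * q" using a norm_triangle_sub[of "\<gamma> x + u" p] by linarith
      moreover have "norm d = norm (\<gamma> x + u)" using that(4) norm_minus_cancel by metis
      ultimately show "norm d \<le> 2 * norm p" using q(3) np by linarith
      have "\<bar>p \<bullet> (\<gamma> x + u - p)\<bar> \<le> norm p * (2 * q)"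
        using Cauchy_Schwarz_ineq2[of p "\<gamma> x + u - p"] mult_left_mono[OF a, of "norm p"] by simp
      also have "\<dots> \<le> norm p * (norm p / 4)" using q(3) np by (intro mult_left_mono) auto
      also have "\<dots> = (norm p)\<^sup>2 / 4" by (simp add: power2_eq_square)
      finally have "\<bar>p \<bullet> (\<gamma> x + u) - (norm p)\<^sup>2\<bar> \<le> (norm p)\<^sup>2 / 4"
        by (simp add: inner_diff_right dot_square_norm)
      hence "(norm p)\<^sup>2 / 2 \<le> \<bar>p \<bullet> (\<gamma> x + u)\<bar>" using zero_le_power2[of "norm p"] by linarith
      thus "(norm p)\<^sup>2 / 2 \<le> \<bar>p \<bullet> d\<bar>" using that(4) by (metis abs_minus_cancel inner_minus_right)
    qed (use x e that in auto)
    show "radial_point q x" unfolding radial_point_def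
    proof (intro conjI allI impI xL q(1) nz)
      show "\<bar>\<gamma> x \<bullet> \<gamma>' x\<bar> \<le> q" using gx by simp
      fix u :: complex assume u: "norm u \<le> q"
      have "(\<lambda>t. \<gamma> x - t *\<^sub>R (\<gamma> x + u)) ` {0<..1} \<subseteq> D"
      proof (rule connected_inside)
        show "connected ((\<lambda>t. \<gamma> x - t *\<^sub>R (\<gamma> x + u)) ` {0<..1})"
          by (intro connected_continuous_image continuous_intros) auto
        have "- u \<in> D" using u q(4) r0(2) by (auto simp: subset_iff)
        thus "\<gamma> x - 1 *\<^sub>R (\<gamma> x + u) \<in> D" by simp
        show "\<gamma> x - 1 *\<^sub>R (\<gamma> x + u) \<in> (\<lambda>t. \<gamma> x - t *\<^sub>R (\<gamma> x + u)) ` {0<..1}" by (rule image_eqI[of _ _ 1]) simp_all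
        have "\<gamma> x - t *\<^sub>R (\<gamma> x + u) \<notin> frontier D" if t: "0 < t" "t \<le> 1" for t
        proof (cases "t < e1")
          case True
          thus ?thesis using near[OF t(1) True u, of "- (\<gamma> x + u)"] by (simp add: algebra_simps)
        next
          case False
          hence "(1 - t) *\<^sub>R p \<in> R" using t unfolding R_def by auto
          moreover have "dist ((1 - t) *\<^sub>R p) (\<gamma> x - t *\<^sub>R (\<gamma> x + u)) < r"
          proof -
            have "dist ((1 - t) *\<^sub>R p) (\<gamma> x - t *\<^sub>R (\<gamma> x + u)) = norm ((1 - t) *\<^sub>R (p - \<gamma> x) + t *\<^sub>R u)"
              by (simp add: dist_norm algebra_simps)
            also have "\<dots> \<le> (1 - t) * norm (\<gamma> x - p) + t * norm u"
              using norm_triangle_ineq[of "(1 - t) *\<^sub>R (p - \<gamma> x)" "t *\<^sub>R u"] t by (simp add: norm_minus_commute)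
            also have "\<dots> \<le> 1 * q + 1 * q" using t gx(1) u q(1) by (intro add_mono mult_mono) auto
            also have "\<dots> < 2 * q * (1 + K)" using K q(1) by (simp add: algebra_simps)
            finally show ?thesis using q(2) by linarith
          qed
          ultimately show ?thesis using r(2) by (meson not_le)
        qed
        thus "(\<lambda>t. \<gamma> x - t *\<^sub>R (\<gamma> x + u)) ` {0<..1} \<inter> frontier D = {}" by auto
      qed
      thus "\<gamma> x - t *\<^sub>R (\<gamma> x + u) \<in> D" if "0 < t" "t \<le> 1" for t
        using that by (simp add: image_subset_iff)
      have far: "\<gamma> x + t *\<^sub>R (\<gamma> x + u) \<notin> closure D" if "K \<le> t" for t
      proof
        assume "\<gamma> x + t *\<^sub>R (\<gamma> x + u) \<in> closure D"
        hence le: "norm (\<gamma> x + t *\<^sub>R (\<gamma> x + u)) \<le> B" by (rule B)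
        have t0: "0 < t" using that K by simp
        have "t * norm (\<gamma> x) - t * norm u \<le> norm (\<gamma> x + t *\<^sub>R (\<gamma> x + u))"
        proof -
          have "norm ((1 + t) *\<^sub>R \<gamma> x) \<le> norm ((1 + t) *\<^sub>R \<gamma> x + t *\<^sub>R u) + norm (t *\<^sub>R u)"
            by (metis add_diff_cancel_right' norm_triangle_ineq4)
          moreover have "(1 + t) *\<^sub>R \<gamma> x + t *\<^sub>R u = \<gamma> x + t *\<^sub>R (\<gamma> x + u)" by (simp add: algebra_simps)
          moreover have "norm ((1 + t) *\<^sub>R \<gamma> x) = norm (\<gamma> x) + t * norm (\<gamma> x)"
            using t0 by (simp add: distrib_right del: scaleR_left_distrib)
          ultimately show ?thesis using t0 norm_ge_zero[of "\<gamma> x"] by (simp del: norm_ge_zero)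
        qed
        moreover have "t * norm u \<le> t * q" using u t0 by simp
        moreover have "t * (7 * q) \<le> t * norm (\<gamma> x)" using ngx q t0 by (intro mult_left_mono) auto
        moreover have "t * (norm p - q) \<le> t * norm (\<gamma> x)" using ngx t0 by simp
        moreover have "K * norm p \<le> t * norm p" using that np by simp
        moreover have "t * q \<le> t * (norm p / 8)" using q t0 by (intro mult_left_mono) auto
        ultimately show False using le K(2) B(1) by (simp add: algebra_simps)
      qed
      have "(\<lambda>t. \<gamma> x + t *\<^sub>R (\<gamma> x + u)) ` {0<..} \<inter> closure D = {}"
      proof (rule connected_outside)
        show "connected ((\<lambda>t. \<gamma> x + t *\<^sub>R (\<gamma> x + u)) ` {0<..})"
          by (intro connected_continuous_image continuous_intros) auto
        show "\<gamma> x + K *\<^sub>R (\<gamma> x + u) \<notin> closure D" by (rule far) simp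
        show "\<gamma> x + K *\<^sub>R (\<gamma> x + u) \<in> (\<lambda>t. \<gamma> x + t *\<^sub>R (\<gamma> x + u)) ` {0<..}" using K by auto
        have "\<gamma> x + t *\<^sub>R (\<gamma> x + u) \<notin> frontier D" if t: "0 < t" for t
        proof -
          consider "t < e1" | "e1 \<le> t" "t \<le> K" | "K \<le> t" by linarith
          thus ?thesis
          proof cases
            case 1 thus ?thesis using near[OF t 1 u, of "\<gamma> x + u"] by simp
          next
            case 2
            hence "(1 + t) *\<^sub>R p \<in> R" using t unfolding R_def by auto
            moreover have "dist ((1 + t) *\<^sub>R p) (\<gamma> x + t *\<^sub>R (\<gamma> x + u)) < r"
            proof -
              have "dist ((1 + t) *\<^sub>R p) (\<gamma> x + t *\<^sub>R (\<gamma> x + u)) = norm ((1 + t) *\<^sub>R (p - \<gamma> x) - t *\<^sub>R u)"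
                by (simp add: dist_norm algebra_simps)
              also have "\<dots> \<le> (1 + t) * norm (\<gamma> x - p) + t * norm u"
                using norm_triangle_ineq4[of "(1 + t) *\<^sub>R (p - \<gamma> x)" "t *\<^sub>R u"] t by (simp add: norm_minus_commute)
              also have "\<dots> < (1 + K) * q + K * q"
              proof (rule add_less_le_mono)
                show "t * norm u \<le> K * q" using 2 t u K by (intro mult_mono) auto
                have "(1 + t) * norm (\<gamma> x - p) < (1 + t) * q" using gx t by simp
                also have "\<dots> \<le> (1 + K) * q" using 2 q by simp
                finally show "(1 + t) * norm (\<gamma> x - p) < (1 + K) * q" .
              qed
              also have "\<dots> \<le> 2 * q * (1 + K)" using q(1) by (simp add: algebra_simps)
              finally show ?thesis using q(2) by linarith
            qed
            ultimately show ?thesis using r(2) by (meson not_le)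
          next
            case 3 thus ?thesis using far[of t] by (auto simp: frontier_def)
          qed
        qed
        thus "(\<lambda>t. \<gamma> x + t *\<^sub>R (\<gamma> x + u)) ` {0<..} \<inter> frontier D = {}" by auto
      qed
      thus "\<gamma> x + t *\<^sub>R (\<gamma> x + u) \<notin> closure D" if "0 < t" for t
        using that by (simp add: disjoint_iff image_iff Bex_def) blast
    qed
  qed
qed

end

section \<open>Outer arcs\<close>

text \<open>A harmonic arc from \<open>p\<close> to \<open>q\<close> in time \<open>T\<close> has energy \<open>E\<close> iff \<open>c = cos (\<omega> T)\<close> satisfies
  \<open>R\<^sup>2 (1 - c\<^sup>2) = |p|\<^sup>2 + |q|\<^sup>2 - 2 c (p \<bullet> q)\<close> with \<open>R\<^sup>2 = 2 E / \<omega>\<^sup>2\<close>. The smaller root is the arc that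
  reaches almost radially out to the boundary of the Hill region; for \<open>p = q\<close> the other root is \<open>1\<close>.\<close>

definition outer_disc :: "real \<Rightarrow> complex \<Rightarrow> complex \<Rightarrow> real" where
  "outer_disc R2 p q = (p \<bullet> q)\<^sup>2 - R2 * ((norm p)\<^sup>2 + (norm q)\<^sup>2 - R2)"

definition outer_cos :: "real \<Rightarrow> complex \<Rightarrow> complex \<Rightarrow> real" where
  "outer_cos R2 p q = (p \<bullet> q - sqrt (outer_disc R2 p q)) / R2"

definition outer_time :: "real \<Rightarrow> real \<Rightarrow> complex \<Rightarrow> complex \<Rightarrow> real" where
  "outer_time \<omega> R2 p q = arccos (outer_cos R2 p q) / \<omega>"

definition outer_vel :: "real \<Rightarrow> real \<Rightarrow> complex \<Rightarrow> complex \<Rightarrow> complex" where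
  "outer_vel \<omega> R2 p q = (\<omega> / sqrt (1 - (outer_cos R2 p q)\<^sup>2)) *\<^sub>R (q - outer_cos R2 p q *\<^sub>R p)"

definition outer_action :: "real \<Rightarrow> real \<Rightarrow> real \<Rightarrow> complex \<Rightarrow> complex \<Rightarrow> real" where
  "outer_action \<omega> E R2 p q = \<omega> * (((norm p)\<^sup>2 + (norm q)\<^sup>2) * outer_cos R2 p q - 2 * (p \<bullet> q))
     / (2 * sqrt (1 - (outer_cos R2 p q)\<^sup>2)) + E * outer_time \<omega> R2 p q"

text \<open>The constant \<rho> keeps away from two degeneracies at once: c near -1 or 1, where the
  time ceases to be smooth, and the coalescence of the two roots, whose distance is 2 sqrt (disc) /
  R2.\<close>

definition outer_pair :: "real \<Rightarrow> real \<Rightarrow> complex \<Rightarrow> complex \<Rightarrow> bool" where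
  "outer_pair R2 \<rho> p q \<longleftrightarrow> 0 < \<rho> \<and> 0 < outer_disc R2 p q \<and> \<bar>outer_cos R2 p q\<bar> \<le> 1 - \<rho> \<and>
     \<rho> \<le> 2 * sqrt (outer_disc R2 p q) / R2"

lemma outer_sym:
  "outer_disc R2 p q = outer_disc R2 q p" "outer_cos R2 p q = outer_cos R2 q p"
  "outer_time \<omega> R2 p q = outer_time \<omega> R2 q p" "outer_pair R2 \<rho> p q = outer_pair R2 \<rho> q p"
  by (simp_all add: outer_disc_def outer_cos_def outer_time_def outer_pair_def inner_commute add.commute)

text \<open>For p = q the discriminant is (R2 - |p|^2)^2 and c = 2 |p|^2 / R2 - 1, which is
  non-degenerate because 0 < |p|^2 < R2. Continuity does the rest.\<close>

lemma outer_pair_nearby: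
  assumes p: "p \<noteq> 0" "(norm p)\<^sup>2 < R2"
  obtains \<rho> e where "0 < \<rho>" "0 < e"
    "\<And>x y. norm (x - p) < e \<Longrightarrow> norm (y - p) < e \<Longrightarrow> outer_pair R2 \<rho> x y"
proof -
  define a where "a = min ((norm p)\<^sup>2 / R2) (1 - (norm p)\<^sup>2 / R2)"
  have R2: "0 < R2" using p(2) zero_le_power2[of "norm p"] by linarith
  have np: "0 < (norm p)\<^sup>2" using p(1) by simp
  have a: "0 < a" "a \<le> (norm p)\<^sup>2 / R2" "a \<le> 1 - (norm p)\<^sup>2 / R2"
  proof -
    have "(norm p)\<^sup>2 / R2 < 1" using p(2) R2 by (subst divide_less_eq_1_pos) auto
    thus "0 < a" "a \<le> (norm p)\<^sup>2 / R2" "a \<le> 1 - (norm p)\<^sup>2 / R2" using divide_pos_pos[OF np R2] by (auto simp: a_def)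
  qed
  have disc: "outer_disc R2 p p = (R2 - (norm p)\<^sup>2)\<^sup>2"
    unfolding outer_disc_def dot_square_norm by (simp add: power2_eq_square algebra_simps)
  have sq: "sqrt (outer_disc R2 p p) = R2 - (norm p)\<^sup>2" unfolding disc using p(2) by simp
  have c: "outer_cos R2 p p = 2 * ((norm p)\<^sup>2 / R2) - 1"
    unfolding outer_cos_def sq dot_square_norm using R2 by (simp add: field_simps)
  have tf: "((\<lambda>z. fst z) \<longlongrightarrow> p) (nhds (p, p))" and ts: "((\<lambda>z. snd z) \<longlongrightarrow> p) (nhds (p, p))"
    using tendsto_fst[OF filterlim_ident[of "nhds (p, p)"]] tendsto_snd[OF filterlim_ident[of "nhds (p, p)"]] by auto
  have cd: "((\<lambda>z. outer_disc R2 (fst z) (snd z)) \<longlongrightarrow> outer_disc R2 p p) (nhds (p, p))"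
    unfolding outer_disc_def by (rule tf ts tendsto_intros)+
  have cs: "((\<lambda>z. sqrt (outer_disc R2 (fst z) (snd z))) \<longlongrightarrow> sqrt (outer_disc R2 p p)) (nhds (p, p))"
    by (rule tendsto_real_sqrt[OF cd])
  have cg: "((\<lambda>z. 2 * sqrt (outer_disc R2 (fst z) (snd z)) / R2) \<longlongrightarrow> 2 * sqrt (outer_disc R2 p p) / R2) (nhds (p, p))"
    by (intro tendsto_intros cs) (use R2 in auto)
  have cc: "((\<lambda>z. outer_cos R2 (fst z) (snd z)) \<longlongrightarrow> outer_cos R2 p p) (nhds (p, p))"
    unfolding outer_cos_def by (rule tf ts cs tendsto_intros)+ (use R2 in auto)
  have g0: "a < 2 * sqrt (outer_disc R2 p p) / R2" 
  proof -
    have "2 * (R2 - (norm p)\<^sup>2) / R2 = 2 * (1 - (norm p)\<^sup>2 / R2)" using R2 by (simp add: field_simps)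
    moreover have "a < 2 * (1 - (norm p)\<^sup>2 / R2)" 
    proof -
      have "a < 2 * Y" if "a \<le> Y" for Y using that a(1) by simp
      thus ?thesis using a(3) by blast
    qed
    ultimately show ?thesis unfolding sq by simp
  qed
  have c1: "- (1 - a) < outer_cos R2 p p" and c2: "outer_cos R2 p p < 1 - a"
  proof -
    have "- (1 - a) < 2 * X - 1 \<and> 2 * X - 1 < 1 - a" if "a \<le> X" "a \<le> 1 - X" for X
      using that a(1) by argo
    thus "- (1 - a) < outer_cos R2 p p" "outer_cos R2 p p < 1 - a" unfolding c using a(2,3) by blast+
  qed
  have "0 < outer_disc R2 p p" using disc p(2) by simp
  note ev = order_tendstoD(1)[OF cd this] order_tendstoD(1)[OF cg g0]
    order_tendstoD(1)[OF cc c1] order_tendstoD(2)[OF cc c2]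
  have "\<forall>\<^sub>F z in nhds (p, p). outer_pair R2 a (fst z) (snd z)"
    using ev
    by eventually_elim (use a in \<open>auto simp: outer_pair_def abs_le_iff\<close>)
  then obtain d where d: "d > 0" "\<And>z. dist z (p, p) < d \<Longrightarrow> outer_pair R2 a (fst z) (snd z)"
    unfolding eventually_nhds_metric by blast
  show ?thesis
  proof (rule that[of a "d / 2"])
    fix x y assume xy: "norm (x - p) < d / 2" "norm (y - p) < d / 2"
    have "dist (x, y) (p, p) \<le> dist x p + dist y p"
      unfolding dist_Pair_Pair by (rule sqrt_sum_squares_le_sum) auto
    thus "outer_pair R2 a x y" using d(2)[of "(x, y)"] xy by (simp add: dist_norm)
  qed (use a d in auto)
qed

locale outer_arcs =
  fixes \<omega> E R2 \<rho> :: real and p q :: complex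
  assumes \<omega>: "0 < \<omega>" and E: "0 < E" and R2: "R2 = 2 * E / \<omega>\<^sup>2" and pair: "outer_pair R2 \<rho> p q"
begin

abbreviation "c \<equiv> outer_cos R2 p q"
abbreviation "s \<equiv> sqrt (1 - c\<^sup>2)"
abbreviation "T \<equiv> outer_time \<omega> R2 p q"
abbreviation "v \<equiv> outer_vel \<omega> R2 p q"

lemma R2_pos: "0 < R2" using \<omega> E R2 by simp

lemma \<rho>: "0 < \<rho>" using pair by (simp add: outer_pair_def)

lemma c: "\<bar>c\<bar> \<le> 1 - \<rho>" "-1 < c" "c < 1" "-1 \<le> c" "c \<le> 1" using pair by (auto simp: outer_pair_def)

lemma s: "0 < s" "s\<^sup>2 = 1 - c\<^sup>2"
proof -
  have "\<bar>c\<bar> < 1" using c by linarith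
  hence "c\<^sup>2 < 1" by (simp add: abs_square_less_1)
  thus "0 < s" "s\<^sup>2 = 1 - c\<^sup>2" by auto
qed

lemma quadratic: "R2 * (1 - c\<^sup>2) = (norm p)\<^sup>2 + (norm q)\<^sup>2 - 2 * (p \<bullet> q) * c"
proof -
  define r where "r = sqrt (outer_disc R2 p q)"
  have "r\<^sup>2 = outer_disc R2 p q" unfolding r_def using pair by (simp add: outer_pair_def)
  moreover have "r = p \<bullet> q - R2 * c" unfolding outer_cos_def r_def using R2_pos by simp
  ultimately have "(p \<bullet> q - R2 * c)\<^sup>2 = (p \<bullet> q)\<^sup>2 - R2 * ((norm p)\<^sup>2 + (norm q)\<^sup>2 - R2)"
    unfolding outer_disc_def by simp
  hence "R2 * (R2 * c\<^sup>2 - 2 * (p \<bullet> q) * c) = R2 * (R2 - (norm p)\<^sup>2 - (norm q)\<^sup>2)"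
    by (simp add: power2_eq_square algebra_simps)
  hence "R2 * c\<^sup>2 - 2 * (p \<bullet> q) * c = R2 - (norm p)\<^sup>2 - (norm q)\<^sup>2" using R2_pos by simp
  thus ?thesis by (simp add: algebra_simps)
qed

lemma \<omega>R2: "\<omega>\<^sup>2 * R2 = 2 * E" using \<omega> by (simp add: R2)

text \<open>The only other root of the quadratic is at distance at least \<open>\<rho>\<close>.\<close>

lemma root_unique:
  assumes "R2 * (1 - x\<^sup>2) = (norm p)\<^sup>2 + (norm q)\<^sup>2 - 2 * (p \<bullet> q) * x" "\<bar>x - c\<bar> < \<rho>"
  shows "x = c"
proof (rule ccontr)
  assume ne: "x \<noteq> c"
  have "(x - c) * (R2 * (x + c) - 2 * (p \<bullet> q)) = 0" using assms(1) quadratic by algebra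
  hence "R2 * (x + c) - 2 * (p \<bullet> q) = 0" using ne by simp
  hence "R2 * x = 2 * (p \<bullet> q) - R2 * c" by (simp add: algebra_simps)
  also have "\<dots> = R2 * c + 2 * sqrt (outer_disc R2 p q)"
    unfolding outer_cos_def using R2_pos by (simp add: field_simps)
  finally have "x - c = 2 * sqrt (outer_disc R2 p q) / R2" using R2_pos by (simp add: field_simps)
  thus False using assms(2) pair R2_pos by (auto simp: outer_pair_def abs_of_pos)
qed

lemma T_arccos: "\<omega> * T = arccos c"
  using \<omega> by (simp add: outer_time_def)

lemma T: "0 < T" "cos (\<omega> * T) = c" "sin (\<omega> * T) = s" "\<omega> * T < pi"
proof -
  have "0 < arccos c" "arccos c < pi" using arccos_lt_bounded[OF c(2,3)] by auto
  thus "0 < T" "\<omega> * T < pi" using \<omega> by (auto simp: T_arccos) (simp add: outer_time_def)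
  show "cos (\<omega> * T) = c" "sin (\<omega> * T) = s" unfolding T_arccos using c by (auto simp: sin_arccos)
qed

lemma v_scaled: "s *\<^sub>R v = \<omega> *\<^sub>R (q - c *\<^sub>R p)"
  unfolding outer_vel_def using s(1) by simp

lemma osc_end: "osc \<omega> p v T = q" "osc_vel \<omega> p v T = - outer_vel \<omega> R2 q p"
proof -
  have "(s / \<omega>) *\<^sub>R v = (1 / \<omega>) *\<^sub>R (s *\<^sub>R v)" by simp
  also have "\<dots> = q - c *\<^sub>R p" unfolding v_scaled using \<omega> by simp
  finally show "osc \<omega> p v T = q" by (simp add: osc_def T)
  have "s *\<^sub>R osc_vel \<omega> p v T = c *\<^sub>R (s *\<^sub>R v) - (\<omega> * s\<^sup>2) *\<^sub>R p"
    unfolding osc_vel_def T by (simp add: algebra_simps power2_eq_square)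
  also have "\<dots> = \<omega> *\<^sub>R (c *\<^sub>R q - p)" unfolding v_scaled s(2) by (simp add: algebra_simps power2_eq_square)
  also have "\<dots> = s *\<^sub>R (- outer_vel \<omega> R2 q p)"
    unfolding outer_vel_def outer_sym(2)[of R2 q p] using s(1) by (simp add: algebra_simps)
  finally show "osc_vel \<omega> p v T = - outer_vel \<omega> R2 q p" using s(1) by (metis less_irrefl scaleR_left_imp_eq)
qed

lemma v_energy: "1 / 2 * (norm v)\<^sup>2 = V_outer \<omega> E p"
proof -
  have "s\<^sup>2 * (norm v)\<^sup>2 = (norm (s *\<^sub>R v))\<^sup>2" by (simp add: power_mult_distrib)
  also have "\<dots> = \<omega>\<^sup>2 * ((norm q)\<^sup>2 - 2 * c * (p \<bullet> q) + c\<^sup>2 * (norm p)\<^sup>2)"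
    unfolding v_scaled power2_norm_eq_inner
    by (simp add: inner_simps inner_commute power2_eq_square algebra_simps)
  also have "(norm q)\<^sup>2 - 2 * c * (p \<bullet> q) + c\<^sup>2 * (norm p)\<^sup>2 = s\<^sup>2 * (R2 - (norm p)\<^sup>2)"
    unfolding s(2) using quadratic by (simp add: algebra_simps)
  finally have "s\<^sup>2 * (norm v)\<^sup>2 = s\<^sup>2 * (\<omega>\<^sup>2 * (R2 - (norm p)\<^sup>2))" by simp
  hence "(norm v)\<^sup>2 = \<omega>\<^sup>2 * (R2 - (norm p)\<^sup>2)" using s(1) by simp
  thus ?thesis unfolding V_outer_def using \<omega>R2 by (simp add: right_diff_distrib)
qed

lemma osc_V: "1 / 2 * (norm (osc_vel \<omega> p v t))\<^sup>2 = V_outer \<omega> E (osc \<omega> p v t)"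
  using osc_energy[of \<omega> p v t] v_energy \<omega> unfolding V_outer_def by (simp add: algebra_simps)

text \<open>The two-point form of the arc, which treats both ends alike; the excess over 1 of the
  sum of the weights measures how far the arc has moved outwards.\<close>

lemma osc_comb: "osc \<omega> p v t = (sin (\<omega> * (T - t)) / s) *\<^sub>R p + (sin (\<omega> * t) / s) *\<^sub>R q"
proof -
  have "sin (\<omega> * (T - t)) = s * cos (\<omega> * t) - c * sin (\<omega> * t)"
    using sin_diff[of "\<omega> * T" "\<omega> * t"] by (simp add: right_diff_distrib T)
  moreover have "(sin (\<omega> * t) / \<omega>) *\<^sub>R v = (sin (\<omega> * t) / (\<omega> * s)) *\<^sub>R (s *\<^sub>R v)" using s(1) by simp
  ultimately show ?thesis unfolding osc_def using s(1) \<omega>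
    by (simp only: v_scaled) (simp add: algebra_simps diff_divide_distrib)
qed

text \<open>Bounds in terms of \<rho> only, from c \<le> 1 - \<rho> and the half-angle
  formulas.\<close>

lemma half_sin: "\<rho> / 4 \<le> sin (\<omega> * T / 4) * sin (\<omega> * T / 2)" "0 < sin (\<omega> * T / 4)" "0 < sin (\<omega> * T / 2)"
proof -
  have b: "0 < \<omega> * T" "\<omega> * T < pi" using T \<omega> by auto
  show pos: "0 < sin (\<omega> * T / 4)" "0 < sin (\<omega> * T / 2)" using b by (auto intro!: sin_gt_zero)
  have "c = 1 - 2 * (sin (\<omega> * T / 2))\<^sup>2" using cos_double_sin[of "\<omega> * T / 2"] T by simp
  hence 1: "\<rho> / 2 \<le> (sin (\<omega> * T / 2))\<^sup>2" using c by simp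
  have "sin (\<omega> * T / 2) = 2 * sin (\<omega> * T / 4) * cos (\<omega> * T / 4)"
    using sin_double[of "\<omega> * T / 4"] by simp
  also have "\<dots> \<le> 2 * sin (\<omega> * T / 4) * 1" using pos by (intro mult_left_mono) auto
  finally have "sin (\<omega> * T / 2) / 2 \<le> sin (\<omega> * T / 4)" by simp
  hence "sin (\<omega> * T / 2) / 2 * sin (\<omega> * T / 2) \<le> sin (\<omega> * T / 4) * sin (\<omega> * T / 2)"
    using pos by (intro mult_right_mono) auto
  thus "\<rho> / 4 \<le> sin (\<omega> * T / 4) * sin (\<omega> * T / 2)" using 1 by (simp add: power2_eq_square)
qed

text \<open>With \<open>x = \<omega> (T - t)\<close>, \<open>y = \<omega> t\<close> one has
  \<open>sin x + sin y - sin (x + y) = 4 sin (x/2) sin (y/2) sin ((x+y)/2)\<close>, so the distance from the end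
  point dominates the deviation from the ray through it.\<close>

lemma osc_radial_aux:
  assumes xy: "0 < y" "y \<le> x" "x + y = \<omega> * T"
  defines "t \<equiv> (sin x + sin y - s) / s"
  shows "0 < t" "sin y / s \<le> 2 / \<rho> * t"
proof -
  have b: "x + y < pi" "0 < x + y" using xy T \<omega> by auto
  have id: "sin x + sin y - sin (x + y) = 4 * sin (x / 2) * sin (y / 2) * sin ((x + y) / 2)"
  proof -
    have "sin x + sin y = 2 * sin ((x + y) / 2) * cos ((x - y) / 2)" by (rule sin_plus_sin)
    moreover have "sin (x + y) = 2 * sin ((x + y) / 2) * cos ((x + y) / 2)"
    proof -
      have "2 * ((x + y) / 2) = x + y" by simp
      thus ?thesis using sin_double[of "(x + y) / 2"] by metis
    qed
    moreover have "cos ((x - y) / 2) - cos ((x + y) / 2) = 2 * sin (x / 2) * sin (y / 2)"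
      by (simp add: cos_add cos_diff add_divide_distrib diff_divide_distrib)
    ultimately show ?thesis by algebra
  qed
  have sp: "0 < sin (x / 2)" "0 < sin (y / 2)" "0 < sin ((x + y) / 2)"
    using xy b by (auto intro!: sin_gt_zero)
  have st: "s * t = 4 * sin (x / 2) * sin (y / 2) * sin ((x + y) / 2)"
  proof -
    have "s * t = sin x + sin y - s" unfolding t_def using s(1) by simp
    moreover have "sin (x + y) = s" unfolding xy by (rule T)
    ultimately show ?thesis using id by simp
  qed
  hence "0 < s * t" using sp by simp
  thus "0 < t" using s(1) zero_less_mult_pos by blast
  have "sin (\<omega> * T / 4) \<le> sin (x / 2)" using xy b by (intro sin_monotone_2pi_le) auto
  hence "sin (\<omega> * T / 4) * sin (\<omega> * T / 2) \<le> sin (x / 2) * sin ((x + y) / 2)"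
    using half_sin xy by (intro mult_mono) auto
  hence 1: "\<rho> / 4 \<le> sin (x / 2) * sin ((x + y) / 2)" using half_sin(1) by linarith
  have "sin y = 2 * sin (y / 2) * cos (y / 2)" using sin_double[of "y / 2"] by simp
  also have "\<dots> \<le> 2 * sin (y / 2) * 1" using sp by (intro mult_left_mono) auto
  also have "\<dots> = 2 * sin (y / 2) * (4 / \<rho> * (\<rho> / 4))" using \<rho> by simp
  also have "\<dots> \<le> 2 * sin (y / 2) * (4 / \<rho> * (sin (x / 2) * sin ((x + y) / 2)))"
    using 1 sp \<rho> by (intro mult_left_mono) auto
  also have "\<dots> = 2 / \<rho> * (s * t)" unfolding st by simp
  finally have "sin y / s \<le> 2 / \<rho> * (s * t) / s" using s(1) by (intro divide_right_mono) auto
  thus "sin y / s \<le> 2 / \<rho> * t" using s(1) by simp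
qed

text \<open>Relative to the end point that is nearer in time, the weights add up to 1 + r and the
  other end contributes its weight times the chord. Dividing by r gives u, which
  \<open>osc_radial_aux\<close> bounds by 2 / \<rho> times |q - p|.\<close>

lemma osc_radial:
  assumes t: "0 < t" "t < T" and close: "2 / \<rho> * norm (q - p) \<le> \<eta>"
  obtains r u where "0 < r" "norm u \<le> \<eta>" "osc \<omega> p v t = p + r *\<^sub>R (p + u) \<or> osc \<omega> p v t = q + r *\<^sub>R (q + u)"
proof -
  define x y where "x = \<omega> * (T - t)" and "y = \<omega> * t"
  have xy: "0 < x" "0 < y" "x + y = \<omega> * T" using t \<omega> by (auto simp: x_def y_def algebra_simps)
  have z: "osc \<omega> p v t = (sin x / s) *\<^sub>R p + (sin y / s) *\<^sub>R q" unfolding x_def y_def by (rule osc_comb)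
  define r where "r = (sin x + sin y - s) / s"
  have sn: "0 \<le> sin x" "0 \<le> sin y" using xy T by (auto intro!: sin_ge_zero)
  have lam: "sin x / s + sin y / s = 1 + r" unfolding r_def using s(1) by (simp add: field_simps)
  have key: "norm ((b / r) *\<^sub>R d) \<le> \<eta>" if "0 < r" "0 \<le> b" "b \<le> 2 / \<rho> * r" "norm d = norm (q - p)" for b and d :: complex
  proof -
    have "b / r \<le> 2 / \<rho>" using that by (simp add: field_simps)
    hence "(b / r) * norm d \<le> 2 / \<rho> * norm d" by (intro mult_right_mono) auto
    thus ?thesis using that close by simp
  qed
  show ?thesis
  proof (cases "y \<le> x")
    case True
    note * = osc_radial_aux[OF xy(2) True xy(3), folded r_def]
    define u where "u = (sin y / s / r) *\<^sub>R (q - p)"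
    have "norm u \<le> \<eta>" unfolding u_def using key[OF *(1) _ *(2)] sn s(1) by simp
    moreover have "osc \<omega> p v t = p + r *\<^sub>R (p + u)"
    proof -
      have "p + r *\<^sub>R (p + u) = (1 + r) *\<^sub>R p + (sin y / s) *\<^sub>R (q - p)"
        unfolding u_def using *(1) by (simp add: algebra_simps)
      thus ?thesis unfolding z lam[symmetric] by (simp add: algebra_simps)
    qed
    ultimately show ?thesis using that *(1) by blast
  next
    case False
    hence yx: "x \<le> y" "y + x = \<omega> * T" using xy by auto
    note * = osc_radial_aux[OF xy(1) yx]
    have r': "(sin y + sin x - s) / s = r" by (simp add: r_def add.commute)
    note * = *[unfolded r']
    define u where "u = (sin x / s / r) *\<^sub>R (p - q)"
    have "norm u \<le> \<eta>" unfolding u_def using key[OF *(1) _ *(2)] sn s(1) by (simp add: norm_minus_commute)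
    moreover have "osc \<omega> p v t = q + r *\<^sub>R (q + u)"
    proof -
      have "q + r *\<^sub>R (q + u) = (1 + r) *\<^sub>R q + (sin x / s) *\<^sub>R (p - q)"
        unfolding u_def using *(1) by (simp add: algebra_simps)
      thus ?thesis unfolding z lam[symmetric] by (simp add: algebra_simps)
    qed
    ultimately show ?thesis using that *(1) by blast
  qed
qed

lemma is_outer_arc:
  assumes "\<And>t. 0 < t \<Longrightarrow> t < T \<Longrightarrow> osc \<omega> p v t \<notin> D"
  shows "outer_arc \<omega> E D p q T (osc \<omega> p v)"
  unfolding outer_arc_def using assms T osc_end newton_sol_osc[of \<omega> T p v] osc_V \<omega>
  by (auto intro!: exI[of _ "osc_vel \<omega> p v"])

text \<open>Closeness of the times is used twice: within \<rho> the cosine is the same root of the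
  quadratic, and within arccos (1 - \<rho>) the angle \<omega> T' stays in [0, pi], where the cosine
  determines it.\<close>

lemma outer_arc_unique:
  assumes arc: "outer_arc \<omega> E D p q T' z" and close: "\<bar>T' - T\<bar> < min \<rho> (arccos (1 - \<rho>)) / \<omega>"
  shows "T' = T" "\<forall>t\<in>{0..T'}. z t = osc \<omega> p v t"
proof -
  obtain w where w: "newton_sol (harmonic_force \<omega>) T' z w" "\<forall>t\<in>{0..T'}. 1 / 2 * (norm (w t))\<^sup>2 = V_outer \<omega> E (z t)"
    and T': "0 < T'" "z 0 = p" "z T' = q"
    using arc unfolding outer_arc_def by auto
  have osc: "z t = osc \<omega> p (w 0) t" if "t \<in> {0..T'}" for t
    using newton_sol_harmonic(1)[OF w(1) _ that] \<omega> T' by simp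
  define x where "x = cos (\<omega> * T')"
  have q: "(sin (\<omega> * T') / \<omega>) *\<^sub>R w 0 = q - x *\<^sub>R p" using osc[of T'] T' by (simp add: osc_def x_def)
  have "(norm (w 0))\<^sup>2 = \<omega>\<^sup>2 * (R2 - (norm p)\<^sup>2)"
    using bspec[OF w(2), of 0] T' \<omega>R2 unfolding V_outer_def by (simp add: right_diff_distrib)
  hence "(norm ((sin (\<omega> * T') / \<omega>) *\<^sub>R w 0))\<^sup>2 = (sin (\<omega> * T'))\<^sup>2 * (R2 - (norm p)\<^sup>2)"
    using \<omega> by (simp add: power_mult_distrib power_divide)
  also have "(sin (\<omega> * T'))\<^sup>2 = 1 - x\<^sup>2" using sin_cos_squared_add[of "\<omega> * T'"] unfolding x_def by linarith
  also have "(norm ((sin (\<omega> * T') / \<omega>) *\<^sub>R w 0))\<^sup>2 = (norm q)\<^sup>2 - 2 * (p \<bullet> q) * x + x\<^sup>2 * (norm p)\<^sup>2"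
    unfolding q power2_norm_eq_inner by (simp add: inner_simps inner_commute power2_eq_square algebra_simps)
  finally have quad: "R2 * (1 - x\<^sup>2) = (norm p)\<^sup>2 + (norm q)\<^sup>2 - 2 * (p \<bullet> q) * x"
    by (simp add: algebra_simps)
  have cl: "\<bar>\<omega> * T' - \<omega> * T\<bar> < min \<rho> (arccos (1 - \<rho>))"
  proof -
    have "\<bar>\<omega> * T' - \<omega> * T\<bar> = \<omega> * \<bar>T' - T\<bar>" using \<omega> by (simp add: abs_mult flip: right_diff_distrib)
    thus ?thesis using close \<omega> by (simp add: pos_less_divide_eq mult.commute)
  qed
  have "\<bar>x - c\<bar> \<le> \<bar>\<omega> * T' - \<omega> * T\<bar>"
  proof -
    have "norm (cos (\<omega> * T') - cos (\<omega> * T)) \<le> 1 * norm (\<omega> * T' - \<omega> * T)"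
      by (rule field_differentiable_bound[where S = UNIV and f' = "\<lambda>x. - sin x"])
        (auto intro!: derivative_eq_intros)
    thus ?thesis by (simp add: x_def T)
  qed
  hence xc: "x = c" using root_unique[OF quad] cl by simp
  have "\<rho> \<le> 1" using c by linarith
  have "arccos (1 - \<rho>) \<le> arccos c" using c \<rho> \<open>\<rho> \<le> 1\<close> by (intro arccos_le_arccos) auto
  moreover have "arccos c \<le> pi - arccos (1 - \<rho>)"
  proof -
    have "arccos c \<le> arccos (- (1 - \<rho>))" using c \<rho> \<open>\<rho> \<le> 1\<close> by (intro arccos_le_arccos) auto
    thus ?thesis using arccos_minus[of "1 - \<rho>"] \<rho> \<open>\<rho> \<le> 1\<close> by simp
  qed
  ultimately have "0 \<le> \<omega> * T'" "\<omega> * T' \<le> pi" using cl T_arccos T'(1) \<omega> by linarith+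
  hence "\<omega> * T' = arccos x" unfolding x_def by (simp add: arccos_cos)
  thus TT: "T' = T" using xc T_arccos \<omega> by (metis less_irrefl mult_left_cancel)
  have "w 0 = v"
  proof -
    have "s *\<^sub>R w 0 = s *\<^sub>R v" using q unfolding TT T xc v_scaled
      using \<omega> by (metis (no_types, opaque_lifting) divide_self_if less_irrefl mult.commute pth_1 scaleR_scaleR times_divide_eq_right)
    thus ?thesis using s(1) by simp
  qed
  thus "\<forall>t\<in>{0..T'}. z t = osc \<omega> p v t" using osc by simp
qed

text \<open>Along the arc sqrt V = |z'| / sqrt 2, so the length is the integral of |z'|^2 / sqrt 2,
  and |z'|^2 has the primitive (z . z') / 2 + E t by the energy equation.\<close>

lemma outer_jacobi:
  assumes "outer_arc \<omega> E D p q T z"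
  shows "jacobi_length (V_outer \<omega> E) T z = outer_action \<omega> E R2 p q / sqrt 2"
proof -
  have "0 < min \<rho> (arccos (1 - \<rho>)) / \<omega>"
  proof -
    have "\<rho> \<le> 1" using c by linarith
    hence "0 < arccos (1 - \<rho>)" using arccos_lt_bounded[of "1 - \<rho>"] \<rho> by simp
    thus ?thesis using \<rho> \<omega> by simp
  qed
  hence z: "z t = osc \<omega> p v t" if "t \<in> {0..T}" for t using outer_arc_unique(2)[OF assms] that by simp
  let ?V = "osc_vel \<omega> p v"
  have 1: "norm (vector_derivative z (at t within {0..T})) * sqrt (V_outer \<omega> E (z t)) = (norm (?V t))\<^sup>2 / sqrt 2"
    if t: "t \<in> {0..T}" for t
  proof -
    have "(z has_vector_derivative ?V t) (at t within {0..T})"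
      by (rule has_vector_derivative_transform[OF t z osc_deriv(1)]) (use \<omega> in auto)
    hence "vector_derivative z (at t within {0..T}) = ?V t"
      using vector_derivative_within_cbox[of 0 T t z "?V t"] T t by simp
    moreover have "V_outer \<omega> E (z t) = (norm (?V t))\<^sup>2 / 2" using osc_V[of t] z[OF t] by simp
    hence "sqrt (V_outer \<omega> E (z t)) = sqrt ((norm (?V t))\<^sup>2 / 2)" by (rule arg_cong)
    hence "sqrt (V_outer \<omega> E (z t)) = norm (?V t) / sqrt 2" by (simp add: real_sqrt_divide)
    ultimately show ?thesis by (simp add: power2_eq_square)
  qed
  let ?F = "\<lambda>t. (1 / 2 * (osc \<omega> p v t \<bullet> ?V t) + E * t) / sqrt 2"
  have "((\<lambda>t. (norm (?V t))\<^sup>2 / sqrt 2) has_integral ?F T - ?F 0) {0..T}"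
  proof (rule fundamental_theorem_of_calculus)
    fix t assume t: "t \<in> {0..T}"
    have d: "((\<lambda>t. osc \<omega> p v t \<bullet> ?V t) has_vector_derivative (osc \<omega> p v t \<bullet> harmonic_force \<omega> (osc \<omega> p v t) + ?V t \<bullet> ?V t)) (at t within {0..T})"
      by (rule bounded_bilinear.has_vector_derivative[OF bounded_bilinear_inner osc_deriv]) (use \<omega> in auto)
    have eq: "osc \<omega> p v t \<bullet> harmonic_force \<omega> (osc \<omega> p v t) + ?V t \<bullet> ?V t = 2 * (norm (?V t))\<^sup>2 - 2 * E"
      using osc_V[of t] unfolding V_outer_def harmonic_force_def by (simp add: dot_square_norm)
    show "(?F has_vector_derivative (norm (?V t))\<^sup>2 / sqrt 2) (at t within {0..T})"
      using d unfolding eq has_real_derivative_iff_has_vector_derivative[symmetric]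
      by (auto intro!: derivative_eq_intros simp: field_simps)
  qed (use T in auto)
  hence "integral {0..T} (\<lambda>t. (norm (?V t))\<^sup>2 / sqrt 2) = ?F T - ?F 0" by (rule integral_unique)
  moreover have "jacobi_length (V_outer \<omega> E) T z = integral {0..T} (\<lambda>t. (norm (?V t))\<^sup>2 / sqrt 2)"
    unfolding jacobi_length_def by (rule integral_cong) (use 1 in simp)
  moreover have "1 / 2 * (q \<bullet> (- outer_vel \<omega> R2 q p)) - 1 / 2 * (p \<bullet> v) =
      \<omega> * (((norm p)\<^sup>2 + (norm q)\<^sup>2) * c - 2 * (p \<bullet> q)) / (2 * s)"
    unfolding outer_vel_def outer_sym(2)[of R2 q p] power2_norm_eq_inner using s(1)
    by (simp add: inner_simps inner_commute field_simps)
  moreover have "?F T - ?F 0 = (1 / 2 * (q \<bullet> (- outer_vel \<omega> R2 q p)) - 1 / 2 * (p \<bullet> v) + E * T) / sqrt 2"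
    by (simp add: osc_end diff_divide_distrib add_divide_distrib)
  ultimately show ?thesis unfolding outer_action_def by simp
qed

end

text \<open>First variation: moving the end point g x changes the action by the inner product with
  the arrival velocity, which is \<open>- outer_vel \<omega> R2 (g x) e\<close> by
  \<open>osc_end\<close>. The derivative \<open>c'\<close> of the cosine never has to be computed:
  by the quadratic for c its terms cancel against those of the travel time.\<close>

lemma outer_action_deriv:
  assumes "outer_arcs \<omega> E R2 \<rho> e (g x)" and g: "(g has_vector_derivative g') (at x)"
  shows "((\<lambda>x. outer_action \<omega> E R2 e (g x)) has_real_derivative (- outer_vel \<omega> R2 (g x) e) \<bullet> g') (at x)"
proof -
  interpret outer_arcs \<omega> E R2 \<rho> e "g x" by fact
  have disc: "0 < outer_disc R2 e (g x)" using pair by (simp add: outer_pair_def)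
  have dn: "((\<lambda>x. (norm (g x))\<^sup>2) has_real_derivative 2 * (g x \<bullet> g')) (at x)"
    unfolding has_real_derivative_iff_has_vector_derivative power2_norm_eq_inner
    using bounded_bilinear.has_vector_derivative[OF bounded_bilinear_inner g g] by (simp add: inner_commute)
  have di: "((\<lambda>x. e \<bullet> g x) has_real_derivative e \<bullet> g') (at x)"
    unfolding has_real_derivative_iff_has_vector_derivative
    using bounded_linear.has_vector_derivative[OF bounded_linear_inner_right g] .
  have "\<exists>c'. ((\<lambda>x. outer_cos R2 e (g x)) has_real_derivative c') (at x)"
  proof -
    have dd: "((\<lambda>x. outer_disc R2 e (g x)) has_real_derivative 2 * (e \<bullet> g x) * (e \<bullet> g') - R2 * (2 * (g x \<bullet> g'))) (at x)"
    proof -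
      have "((\<lambda>x. R2 * ((norm e)\<^sup>2 + (norm (g x))\<^sup>2 - R2)) has_real_derivative R2 * (2 * (g x \<bullet> g'))) (at x)"
        using DERIV_cmult[OF DERIV_diff[OF DERIV_add[OF DERIV_const dn] DERIV_const]] by simp
      from DERIV_diff[OF DERIV_power[OF di, of 2] this] show ?thesis unfolding outer_disc_def by (simp add: mult_ac)
    qed
    show ?thesis unfolding outer_cos_def
      by (rule exI, rule DERIV_cdivide, rule DERIV_diff[OF di DERIV_chain2[OF DERIV_real_sqrt[OF disc] dd]])
  qed
  then obtain c' where dc: "((\<lambda>x. outer_cos R2 e (g x)) has_real_derivative c') (at x)" by blast
  have ds: "((\<lambda>x. sqrt (1 - (outer_cos R2 e (g x))\<^sup>2)) has_real_derivative - c * c' / s) (at x)"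
  proof -
    have "((\<lambda>x. 1 - (outer_cos R2 e (g x))\<^sup>2) has_real_derivative - (2 * c * c')) (at x)"
      using DERIV_diff[OF DERIV_const[of 1] DERIV_power[OF dc, of 2]] by (simp add: mult_ac)
    note d = this
    have pos: "0 < 1 - c\<^sup>2" using s by (metis zero_less_power)
    have "inverse s / 2 * - (2 * c * c') = - c * c' / s" by (simp add: field_simps)
    with DERIV_chain2[OF DERIV_real_sqrt[OF pos] d] show ?thesis by simp
  qed
  have da: "((\<lambda>x. arccos (outer_cos R2 e (g x))) has_real_derivative - c' / s) (at x)"
    using DERIV_chain2[OF DERIV_arccos dc] c by (simp add: field_simps)
  let ?A = "(norm e)\<^sup>2 + (norm (g x))\<^sup>2"
  have "((\<lambda>x. outer_action \<omega> E R2 e (g x)) has_real_derivative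
     \<omega> * ((2 * (g x \<bullet> g') * c + ?A * c' - 2 * (e \<bullet> g')) * s + (?A * c - 2 * (e \<bullet> g x)) * (c * c' / s)) / (2 * s\<^sup>2)
      - E * c' / (s * \<omega>)) (at x)"
  proof -
    define N I C S A where "N = (\<lambda>x. (norm (g x))\<^sup>2)" and "I = (\<lambda>x. e \<bullet> g x)" and "C = (\<lambda>x. outer_cos R2 e (g x))"
      and "S = (\<lambda>x. sqrt (1 - (outer_cos R2 e (g x))\<^sup>2))" and "A = (\<lambda>x. arccos (outer_cos R2 e (g x)))"
    note defs = N_def I_def C_def S_def A_def
    have S: "S x \<noteq> 0" using s by (simp add: S_def)
    have dS: "(S has_real_derivative - C x * c' / S x) (at x)" using ds by (simp add: S_def C_def)
    have dA: "(A has_real_derivative - c' / S x) (at x)" using da by (simp add: S_def A_def)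
    have "((\<lambda>x. \<omega> * (((norm e)\<^sup>2 + N x) * C x - 2 * I x) / (2 * S x) + E * (A x / \<omega>)) has_real_derivative
        \<omega> * ((2 * (g x \<bullet> g') * C x + ((norm e)\<^sup>2 + N x) * c' - 2 * (e \<bullet> g')) * S x
          + (((norm e)\<^sup>2 + N x) * C x - 2 * I x) * (C x * c' / S x)) / (2 * (S x)\<^sup>2) - E * c' / (S x * \<omega>)) (at x)"
      using dn[folded N_def] di[folded I_def] dc[folded C_def] dS dA S \<omega>
      by (auto intro!: derivative_eq_intros simp: field_simps power2_eq_square)
    thus ?thesis unfolding defs outer_action_def outer_time_def .
  qed
  also have "\<omega> * ((2 * (g x \<bullet> g') * c + ?A * c' - 2 * (e \<bullet> g')) * s + (?A * c - 2 * (e \<bullet> g x)) * (c * c' / s)) / (2 * s\<^sup>2)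
      - E * c' / (s * \<omega>) = (- outer_vel \<omega> R2 (g x) e) \<bullet> g'"
  proof -
    have "(?A * c' * s + (?A * c - 2 * (e \<bullet> g x)) * (c * c' / s)) = c' / s * (?A * (s\<^sup>2 + c\<^sup>2) - 2 * (e \<bullet> g x) * c)"
      using s(1) by (simp add: field_simps power2_eq_square)
    also have "?A * (s\<^sup>2 + c\<^sup>2) - 2 * (e \<bullet> g x) * c = R2 * s\<^sup>2" unfolding s(2) using quadratic by (simp add: algebra_simps)
    finally have k: "(?A * c' * s + (?A * c - 2 * (e \<bullet> g x)) * (c * c' / s)) = c' * R2 * s"
      using s(1) by (simp add: field_simps power2_eq_square)
    have "\<omega> * ((2 * (g x \<bullet> g') * c + ?A * c' - 2 * (e \<bullet> g')) * s + (?A * c - 2 * (e \<bullet> g x)) * (c * c' / s)) / (2 * s\<^sup>2)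
       = \<omega> * ((2 * (g x \<bullet> g') * c - 2 * (e \<bullet> g')) * s + (?A * c' * s + (?A * c - 2 * (e \<bullet> g x)) * (c * c' / s))) / (2 * s\<^sup>2)"
      by (simp add: algebra_simps)
    also have "\<dots> = \<omega> * ((2 * (g x \<bullet> g') * c - 2 * (e \<bullet> g')) * s + c' * R2 * s) / (2 * s\<^sup>2)"
      by (simp only: k)
    also have "\<dots> = \<omega> * ((g x \<bullet> g') * c - e \<bullet> g') / s + (\<omega> * R2 / 2) * c' / s"
    proof -
      have "\<omega> * ((2 * G * C - 2 * H) * S + c' * R * S) / (2 * S\<^sup>2) = \<omega> * (G * C - H) / S + (\<omega> * R / 2) * c' / S"
        if "S \<noteq> 0" for S G H C R :: real using that by (simp add: field_simps power2_eq_square)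
      thus ?thesis using s(1) by (metis less_irrefl)
    qed
    also have "\<omega> * R2 / 2 = E / \<omega>" using \<omega>R2 \<omega> by (simp add: field_simps power2_eq_square)
    finally have "\<omega> * ((2 * (g x \<bullet> g') * c + ?A * c' - 2 * (e \<bullet> g')) * s + (?A * c - 2 * (e \<bullet> g x)) * (c * c' / s)) / (2 * s\<^sup>2)
        - E * c' / (s * \<omega>) = \<omega> * ((g x \<bullet> g') * c - e \<bullet> g') / s"
      by (simp add: mult.commute)
    also have "\<dots> = (- outer_vel \<omega> R2 (g x) e) \<bullet> g'"
      unfolding outer_vel_def outer_sym(2)[of R2 "g x" e] using s(1)
      by (simp add: inner_simps inner_commute field_simps)
    finally show ?thesis .
  qed
  finally show ?thesis .
qed

section \<open>Inner arcs\<close>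

text \<open>For square roots \<open>a\<close>, \<open>b\<close> of \<open>p\<close>, \<open>q\<close> with \<open>a \<bullet> b < 0\<close>, one has \<open>inner_d p q = - (a \<bullet> b)\<close> and
  \<open>inner_m p q = a b\<close>; these do not depend on the choice of \<open>a\<close>. The Levi-Civita arc from \<open>a\<close> to \<open>b\<close>
  in time \<open>\<sigma>\<close> has energy \<open>2 k\<^sup>2\<close> iff \<open>C = cosh (k \<sigma>)\<close> satisfies
  \<open>\<mu> (C\<^sup>2 - 1) = 2 k\<^sup>2 (|p| + |q| - 2 C (a \<bullet> b))\<close>.\<close>

definition inner_d :: "complex \<Rightarrow> complex \<Rightarrow> real" where
  "inner_d p q = sqrt ((norm p * norm q + p \<bullet> q) / 2)"

definition inner_m :: "complex \<Rightarrow> complex \<Rightarrow> complex" where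
  "inner_m p q = - ((norm q *\<^sub>R p + norm p *\<^sub>R q) /\<^sub>R (2 * inner_d p q))"

definition inner_C :: "real \<Rightarrow> real \<Rightarrow> complex \<Rightarrow> complex \<Rightarrow> real" where
  "inner_C \<mu> k p q = (2 * k\<^sup>2 * inner_d p q + sqrt ((2 * k\<^sup>2 * inner_d p q)\<^sup>2 + \<mu> * (\<mu> + 2 * k\<^sup>2 * (norm p + norm q)))) / \<mu>"

definition inner_S :: "real \<Rightarrow> real \<Rightarrow> complex \<Rightarrow> complex \<Rightarrow> real" where
  "inner_S \<mu> k p q = sqrt ((inner_C \<mu> k p q)\<^sup>2 - 1)"

definition inner_sigma :: "real \<Rightarrow> real \<Rightarrow> complex \<Rightarrow> complex \<Rightarrow> real" where
  "inner_sigma \<mu> k p q = arcosh (inner_C \<mu> k p q) / k"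

definition inner_vel :: "real \<Rightarrow> real \<Rightarrow> complex \<Rightarrow> complex \<Rightarrow> complex" where
  "inner_vel \<mu> k p q = (2 * k / (inner_S \<mu> k p q * norm p)) *\<^sub>R (inner_m p q - inner_C \<mu> k p q *\<^sub>R p)"

definition inner_action :: "real \<Rightarrow> real \<Rightarrow> complex \<Rightarrow> complex \<Rightarrow> real" where
  "inner_action \<mu> k p q = k * ((norm p + norm q) * inner_C \<mu> k p q + 2 * inner_d p q) / inner_S \<mu> k p q
     + \<mu> * inner_sigma \<mu> k p q / 2"

lemma inner_sym:
  "inner_d q p = inner_d p q" "inner_m q p = inner_m p q" "inner_C \<mu> k q p = inner_C \<mu> k p q"
  "inner_S \<mu> k q p = inner_S \<mu> k p q" "inner_sigma \<mu> k q p = inner_sigma \<mu> k p q"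
  by (simp_all add: inner_d_def inner_m_def inner_C_def inner_S_def inner_sigma_def inner_commute
      add.commute mult.commute)

text \<open>The straight-line homotopy stays in an open half-plane that does not contain 0.\<close>

lemma homotopic_halfplane_linepath:
  fixes g :: "real \<Rightarrow> complex"
  assumes "path g" "\<And>t. t \<in> {0..1} \<Longrightarrow> 0 < g t \<bullet> d"
  shows "homotopic_paths (- {0}) g (linepath (g 0) (g 1))"
proof (rule homotopic_paths_linear)
  show "closed_segment (g t) (linepath (g 0) (g 1) t) \<subseteq> - {0}" if t: "t \<in> {0..1}" for t
  proof -
    have conv: "convex {z. 0 < z \<bullet> d}" using convex_halfspace_gt[of 0 d] by (simp add: inner_commute)
    have "linepath (g 0) (g 1) t \<in> closed_segment (g 0) (g 1)" using t by (simp add: linepath_in_path)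
    also have "closed_segment (g 0) (g 1) \<subseteq> {z. 0 < z \<bullet> d}"
      by (rule closed_segment_subset[OF _ _ conv]) (use assms(2) in auto)
    finally have "closed_segment (g t) (linepath (g 0) (g 1) t) \<subseteq> {z. 0 < z \<bullet> d}"
      by (intro closed_segment_subset conv) (use assms(2) t in auto)
    thus ?thesis by auto
  qed
qed (use assms(1) in \<open>auto simp: pathstart_def pathfinish_def linepath_0' linepath_1'\<close>)

text \<open>Nonnegative combinations of a and b form a sector of angle below pi/2, so their squares
  lie in a sector of angle below pi around the direction of a b.\<close>

lemma halfplane_square:
  fixes a b :: complex
  assumes "0 < a \<bullet> b" "0 \<le> l" "0 \<le> n" "0 < l + n"
  shows "0 < (l *\<^sub>R a + n *\<^sub>R b)\<^sup>2 \<bullet> (a * b)"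
proof -
  have nz: "a \<noteq> 0" "b \<noteq> 0" using assms(1) by auto
  have "(l *\<^sub>R a + n *\<^sub>R b)\<^sup>2 \<bullet> (a * b) = l\<^sup>2 * ((norm a)\<^sup>2 * (a \<bullet> b)) + 2 * l * n * ((norm a)\<^sup>2 * (norm b)\<^sup>2) + n\<^sup>2 * ((norm b)\<^sup>2 * (a \<bullet> b))"
    unfolding inner_complex_def cmod_power2 by (simp add: power2_eq_square algebra_simps)
  moreover have "0 < (norm a)\<^sup>2 * (a \<bullet> b)" "0 < (norm b)\<^sup>2 * (a \<bullet> b)" using nz assms(1) by auto
  moreover have "0 < l\<^sup>2 \<or> 0 < n\<^sup>2" using assms by (cases "l = 0") auto
  moreover have "0 \<le> 2 * l * n * ((norm a)\<^sup>2 * (norm b)\<^sup>2)" using assms by simp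
  ultimately show ?thesis
    by (smt (verit) mult_nonneg_nonneg mult_pos_pos zero_le_power2)
qed

lemma square_path_direct:
  fixes a b :: complex
  assumes "0 < a \<bullet> b"
  shows "homotopic_paths (- {0}) (\<lambda>t. (linepath a b t)\<^sup>2) (linepath (a\<^sup>2) (b\<^sup>2))"
proof -
  have "homotopic_paths (- {0}) (\<lambda>t. (linepath a b t)\<^sup>2) (linepath ((linepath a b 0)\<^sup>2) ((linepath a b 1)\<^sup>2))"
  proof (rule homotopic_halfplane_linepath)
    show "path (\<lambda>t. (linepath a b t)\<^sup>2)" unfolding path_def by (intro continuous_intros continuous_on_linepath)
    show "0 < (linepath a b t)\<^sup>2 \<bullet> (a * b)" if "t \<in> {0..1}" for t
      unfolding linepath_def by (rule halfplane_square[OF assms]) (use that in auto)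
  qed
  thus ?thesis by (simp add: linepath_def)
qed

text \<open>The square map is a covering of the punctured plane, so the end point of the lifted path decides
  whether the path is homotopic to the segment.\<close>

lemma square_path_indirect:
  fixes h :: "real \<Rightarrow> complex"
  assumes "path h" "\<And>t. t \<in> {0..1} \<Longrightarrow> h t \<noteq> 0" "h 0 \<bullet> h 1 < 0"
  shows "\<not> homotopic_paths (- {0}) (\<lambda>t. (h t)\<^sup>2) (linepath ((h 0)\<^sup>2) ((h 1)\<^sup>2))"
proof
  assume hom: "homotopic_paths (- {0}) (\<lambda>t. (h t)\<^sup>2) (linepath ((h 0)\<^sup>2) ((h 1)\<^sup>2))"
  let ?l = "linepath (h 0) (- h 1)"
  have pos: "0 < h 0 \<bullet> - h 1" using assms(3) by simp
  have l: "?l t \<noteq> 0" if "t \<in> {0..1}" for t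
  proof
    assume "?l t = 0"
    hence "0 < (0::complex)\<^sup>2 \<bullet> (h 0 * - h 1)"
      using halfplane_square[OF pos, of "1 - t" t] that unfolding linepath_def by auto
    thus False by simp
  qed
  have "homotopic_paths (- {0}) (\<lambda>t. (h t)\<^sup>2) (\<lambda>t. (?l t)\<^sup>2)"
    using homotopic_paths_trans[OF hom homotopic_paths_sym] square_path_direct[OF pos] by simp
  hence "pathfinish h = pathfinish ?l"
  proof (rule covering_space_monodromy[OF covering_space_power_punctured_plane[of 2], rotated 5])
    show "path (\<lambda>t. (h t)\<^sup>2)" using assms(1) unfolding path_def by (intro continuous_intros)
    show "path (\<lambda>t. (?l t)\<^sup>2)" unfolding path_def by (intro continuous_intros continuous_on_linepath)
  qed (use assms(1,2) l in \<open>auto simp: path_image_def pathstart_def linepath_0'\<close>)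
  hence "h 1 = - h 1" by (simp add: pathfinish_def linepath_1')
  hence "2 * h 1 = 0" by (metis eq_neg_iff_add_eq_0 mult_2)
  thus False using assms(3) by simp
qed

text \<open>Solves the two-point problem in regularized time; the second part makes the energy
  condition an equation for C once |a|, |b| and a . b are given.\<close>

lemma hyp_boundary:
  assumes k: "0 < k" and \<sigma>: "0 < \<sigma>"
  defines "C \<equiv> cosh (k * \<sigma>)" and "S \<equiv> sinh (k * \<sigma>)"
  shows "hyp k a w \<sigma> = b \<longleftrightarrow> w = (k / S) *\<^sub>R (b - C *\<^sub>R a)"
    and "(norm ((k / S) *\<^sub>R (b - C *\<^sub>R a)))\<^sup>2 * S\<^sup>2 = k\<^sup>2 * ((norm b)\<^sup>2 - 2 * (a \<bullet> b) * C + C\<^sup>2 * (norm a)\<^sup>2)"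
proof -
  have S: "0 < S" using k \<sigma> by (simp add: S_def)
  have "hyp k a w \<sigma> = b \<longleftrightarrow> (S / k) *\<^sub>R w = b - C *\<^sub>R a"
    unfolding hyp_def C_def S_def by (auto simp: algebra_simps)
  also have "\<dots> \<longleftrightarrow> w = (k / S) *\<^sub>R (b - C *\<^sub>R a)"
  proof
    assume "(S / k) *\<^sub>R w = b - C *\<^sub>R a"
    hence "(k / S) *\<^sub>R ((S / k) *\<^sub>R w) = (k / S) *\<^sub>R (b - C *\<^sub>R a)" by simp
    thus "w = (k / S) *\<^sub>R (b - C *\<^sub>R a)" using S k by simp
  qed (use S k in simp)
  finally show "hyp k a w \<sigma> = b \<longleftrightarrow> w = (k / S) *\<^sub>R (b - C *\<^sub>R a)" .
  have "(norm (b - C *\<^sub>R a))\<^sup>2 = (norm b)\<^sup>2 - 2 * (a \<bullet> b) * C + C\<^sup>2 * (norm a)\<^sup>2"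
    unfolding power2_norm_eq_inner by (simp add: inner_simps inner_commute power2_eq_square algebra_simps)
  thus "(norm ((k / S) *\<^sub>R (b - C *\<^sub>R a)))\<^sup>2 * S\<^sup>2 = k\<^sup>2 * ((norm b)\<^sup>2 - 2 * (a \<bullet> b) * C + C\<^sup>2 * (norm a)\<^sup>2)"
    using S by (simp add: power_mult_distrib power_divide)
qed

text \<open>An arc has at most one collision: eliminating b from two zeros leaves sinh (k (y - x)) a
  = 0.\<close>

lemma hyp_zero_unique:
  assumes "k \<noteq> 0" "a \<noteq> 0" "hyp k a b x = 0" "hyp k a b y = 0"
  shows "x = y"
proof -
  have "sinh (k * y) *\<^sub>R (k *\<^sub>R hyp k a b x) - sinh (k * x) *\<^sub>R (k *\<^sub>R hyp k a b y) = (k * sinh (k * y - k * x)) *\<^sub>R a"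
    unfolding hyp_def sinh_diff using assms(1) by (simp add: algebra_simps)
  hence "sinh (k * (y - x)) = 0" using assms by (simp add: right_diff_distrib)
  thus ?thesis using assms(1) by simp
qed

lemma lc_time_surj:
  assumes "k \<noteq> 0" "0 \<le> \<sigma>" "s \<in> {0..lc_time k a b \<sigma>}"
  obtains \<tau> where "\<tau> \<in> {0..\<sigma>}" "s = lc_time k a b \<tau>"
proof -
  have "\<exists>\<tau>\<ge>0. \<tau> \<le> \<sigma> \<and> lc_time k a b \<tau> = s"
    using assms by (intro IVT' lc_time_cont) auto
  thus ?thesis using that by force
qed

lemma lc_uminus: "hyp k (- a) (- b) \<tau> = - hyp k a b \<tau>" "lc_time k (- a) (- b) \<tau> = lc_time k a b \<tau>"
  by (simp_all add: hyp_def lc_time_def)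

locale inner_arcs =
  fixes \<mu> k :: real and p q :: complex
  assumes \<mu>: "0 < \<mu>" and k: "0 < k" and pq: "p \<noteq> 0" "q \<noteq> 0" and nonantipodal: "0 < norm p * norm q + p \<bullet> q"
begin

abbreviation "d \<equiv> inner_d p q"
abbreviation "m \<equiv> inner_m p q"
abbreviation "C \<equiv> inner_C \<mu> k p q"
abbreviation "S \<equiv> inner_S \<mu> k p q"
abbreviation "\<sigma> \<equiv> inner_sigma \<mu> k p q"

definition "a = csqrt p"
text \<open>Of the two square roots of q, the one with a . b < 0; the squared arc then goes round
  the origin on the other side from the segment. For q = p it is -a, and the arc is the
  collision-ejection along the radius.\<close>

definition "b = m / a"
definition "w = (k / S) *\<^sub>R (b - C *\<^sub>R a)"

lemma d: "0 < d" "d\<^sup>2 = (norm p * norm q + p \<bullet> q) / 2"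
  unfolding inner_d_def using nonantipodal by auto

lemma m_square: "m\<^sup>2 = p * q"
proof -
  have r: "of_real (norm p) * of_real (norm p) = p * cnj p" "of_real (norm q) * of_real (norm q) = q * cnj q"
    using norm_square_cnj[of p] norm_square_cnj[of q] by (simp_all add: power2_eq_square)
  have "of_real (2 * (p \<bullet> q)) = p * cnj q + cnj p * q"
    by (simp add: complex_eq_iff inner_complex_def)
  moreover have "of_real (4 * d\<^sup>2) = of_real (2 * (p \<bullet> q)) + 2 * (of_real (norm p) * of_real (norm q) :: complex)"
    unfolding d(2) by simp
  ultimately have d2: "of_real (4 * d\<^sup>2) = p * cnj q + cnj p * q + 2 * (of_real (norm p) * of_real (norm q))" by simp
  have "of_real (4 * d\<^sup>2) * m\<^sup>2 = (of_real (norm q) * p + of_real (norm p) * q)\<^sup>2"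
    unfolding inner_m_def using d(1) by (simp add: scaleR_conv_of_real power2_eq_square field_simps)
  also have "\<dots> = (of_real (norm q) * of_real (norm q)) * p\<^sup>2 + 2 * (of_real (norm p) * of_real (norm q)) * (p * q) + (of_real (norm p) * of_real (norm p)) * q\<^sup>2"
    by (simp add: power2_eq_square algebra_simps)
  also have "\<dots> = of_real (4 * d\<^sup>2) * (p * q)"
    unfolding r d2 by (simp add: power2_eq_square algebra_simps)
  finally show ?thesis using d(1) by simp
qed

lemma norm_m: "norm m = sqrt (norm p * norm q)"
proof -
  have "(norm m)\<^sup>2 = norm p * norm q" using arg_cong[OF m_square, of norm] by (simp add: norm_power norm_mult)
  thus ?thesis by (metis norm_ge_zero real_sqrt_unique)
qed

lemma ab: "a\<^sup>2 = p" "a \<noteq> 0" "b\<^sup>2 = q" "b \<noteq> 0" "a * b = m" "a \<bullet> b = - d"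
  "(norm a)\<^sup>2 = norm p" "(norm b)\<^sup>2 = norm q"
proof -
  show a2: "a\<^sup>2 = p" by (simp add: a_def)
  show a0: "a \<noteq> 0" using pq by (simp add: a_def)
  show b2: "b\<^sup>2 = q" unfolding b_def power_divide m_square a2 using pq by simp
  show "b \<noteq> 0" using b2 pq by auto
  show abm: "a * b = m" using a0 by (simp add: b_def)
  show na: "(norm a)\<^sup>2 = norm p" "(norm b)\<^sup>2 = norm q" using a2 b2 by (metis norm_power)+
  have "(a\<^sup>2) \<bullet> (a * b) = (norm a)\<^sup>2 * (a \<bullet> b)"
    unfolding inner_complex_def cmod_power2 by (simp add: power2_eq_square algebra_simps)
  hence "norm p * (a \<bullet> b) = p \<bullet> m" unfolding a2 abm na by simp
  also have "\<dots> = - (norm p * (norm p * norm q + p \<bullet> q) / (2 * d))"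
    unfolding inner_m_def using d(1) by (simp add: inner_simps dot_square_norm power2_eq_square field_simps)
  also have "norm p * norm q + p \<bullet> q = 2 * d\<^sup>2" using d(2) by simp
  also have "- (norm p * (2 * d\<^sup>2) / (2 * d)) = norm p * (- d)" using d(1) by (simp add: power2_eq_square)
  finally show "a \<bullet> b = - d" using pq by (metis mult_left_cancel norm_eq_zero)
qed

text \<open>The last estimate is what makes large energies useful: for fixed \<mu> and d bounded
  below, C grows at least like k^2.\<close>

lemma C: "\<mu> * (C\<^sup>2 - 1) = 2 * k\<^sup>2 * (norm p + norm q + 2 * d * C)" "1 < C" "4 * k\<^sup>2 * d \<le> \<mu> * C"
proof -
  define r where "r = sqrt ((2 * k\<^sup>2 * d)\<^sup>2 + \<mu> * (\<mu> + 2 * k\<^sup>2 * (norm p + norm q)))"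
  have nn: "0 \<le> \<mu> * (\<mu> + 2 * k\<^sup>2 * (norm p + norm q))" using \<mu> by simp
  have r: "r\<^sup>2 = (2 * k\<^sup>2 * d)\<^sup>2 + \<mu> * (\<mu> + 2 * k\<^sup>2 * (norm p + norm q))" unfolding r_def using nn by simp
  have rC: "r = \<mu> * C - 2 * k\<^sup>2 * d" unfolding inner_C_def r_def using \<mu> by simp
  have "2 * k\<^sup>2 * d \<le> r" unfolding r_def using nn by (intro real_le_rsqrt) simp
  thus ge: "4 * k\<^sup>2 * d \<le> \<mu> * C" unfolding rC by (simp add: algebra_simps)
  have "\<mu> * (\<mu> * (C\<^sup>2 - 1)) = \<mu> * (2 * k\<^sup>2 * (norm p + norm q + 2 * d * C))"
    using r unfolding rC by (simp add: power2_eq_square algebra_simps)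
  thus quad: "\<mu> * (C\<^sup>2 - 1) = 2 * k\<^sup>2 * (norm p + norm q + 2 * d * C)" using \<mu> by simp
  have "0 < 4 * k\<^sup>2 * d" using k d by simp
  hence C0: "0 < C" using ge \<mu> by (metis less_le_trans zero_less_mult_pos)
  have "0 < norm p + norm q + 2 * d * C" using pq d C0 by (intro add_pos_pos) auto
  hence "0 < \<mu> * (C\<^sup>2 - 1)" unfolding quad using k by simp
  hence "1\<^sup>2 < C\<^sup>2" using \<mu> zero_less_mult_pos by fastforce
  thus "1 < C" using C0 power_less_imp_less_base by fastforce
qed

text \<open>The roots of the quadratic add up to 4 k^2 d / \<mu>, which is at most C; the other root
  is therefore not positive.\<close>

lemma C_unique:
  assumes "0 < x" "\<mu> * (x\<^sup>2 - 1) = 2 * k\<^sup>2 * (norm p + norm q + 2 * d * x)"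
  shows "x = C"
proof (rule ccontr)
  assume ne: "x \<noteq> C"
  have "(x - C) * (\<mu> * (x + C) - 4 * k\<^sup>2 * d) = 0" using assms(2) C(1) by algebra
  hence "\<mu> * (x + C) - 4 * k\<^sup>2 * d = 0" using ne by simp
  hence "\<mu> * x + \<mu> * C = 4 * k\<^sup>2 * d" by (simp add: algebra_simps)
  hence "\<mu> * x \<le> 0" using C(3) by linarith
  thus False using \<mu> assms(1) by (simp add: mult_le_0_iff)
qed

lemma \<sigma>: "0 < \<sigma>" "cosh (k * \<sigma>) = C" "sinh (k * \<sigma>) = S"
proof -
  have e: "k * \<sigma> = arcosh C" using k by (simp add: inner_sigma_def)
  have "0 < arcosh C" using C(2) by simp
  thus "0 < \<sigma>" using k by (simp add: inner_sigma_def)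
  show c: "cosh (k * \<sigma>) = C" unfolding e using C(2) by (simp add: cosh_arcosh_real)
  have "0 \<le> sinh (k * \<sigma>)" unfolding e using \<open>0 < arcosh C\<close> by simp
  moreover have "(sinh (k * \<sigma>))\<^sup>2 = C\<^sup>2 - 1" using cosh_square_eq[of "k * \<sigma>"] c by simp
  ultimately show "sinh (k * \<sigma>) = S" unfolding inner_S_def by (metis real_sqrt_unique)
qed

lemma S: "0 < S" "S\<^sup>2 = C\<^sup>2 - 1" "S < C"
proof -
  show s: "0 < S" using \<sigma> k by (metis mult_pos_pos sinh_real_pos_iff)
  show e: "S\<^sup>2 = C\<^sup>2 - 1" using cosh_square_eq[of "k * \<sigma>"] \<sigma> by simp
  show "S < C" using e C(2) by (intro power_less_imp_less_base[of S 2 C]) auto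
qed

lemma \<mu>S: "\<mu> * S\<^sup>2 = 2 * k\<^sup>2 * (norm p + norm q + 2 * d * C)"
  using C(1) S(2) by simp

lemma hyp_ends: "hyp k a w 0 = a" "hyp k a w \<sigma> = b"
  using hyp_boundary(1)[OF k \<sigma>(1), of a w b] by (simp_all add: w_def \<sigma>)

lemma w_energy: "2 * (norm w)\<^sup>2 = \<mu> + 2 * k\<^sup>2 * (norm a)\<^sup>2" "k\<^sup>2 * (norm a)\<^sup>2 < (norm w)\<^sup>2"
proof -
  have "(norm w)\<^sup>2 * S\<^sup>2 = k\<^sup>2 * (norm q + 2 * d * C + C\<^sup>2 * norm p)"
    using hyp_boundary(2)[OF k \<sigma>(1), of b a] unfolding \<sigma> w_def[symmetric] ab by simp
  also have "C\<^sup>2 = S\<^sup>2 + 1" using S by simp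
  finally have "2 * (norm w)\<^sup>2 * S\<^sup>2 = 2 * k\<^sup>2 * (norm p + norm q + 2 * d * C) + 2 * k\<^sup>2 * norm p * S\<^sup>2"
    by (simp add: algebra_simps)
  hence "(2 * (norm w)\<^sup>2) * S\<^sup>2 = (\<mu> + 2 * k\<^sup>2 * norm p) * S\<^sup>2" unfolding \<mu>S[symmetric] by (simp add: algebra_simps)
  moreover have "S\<^sup>2 \<noteq> 0" using S(1) by simp
  ultimately have "2 * (norm w)\<^sup>2 = \<mu> + 2 * k\<^sup>2 * norm p" using mult_right_cancel by blast
  thus e: "2 * (norm w)\<^sup>2 = \<mu> + 2 * k\<^sup>2 * (norm a)\<^sup>2" by (simp add: ab)
  show "k\<^sup>2 * (norm a)\<^sup>2 < (norm w)\<^sup>2" using e \<mu> by simp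
qed

lemma vel_start: "2 * w / cnj a = inner_vel \<mu> k p q"
proof -
  have n: "a * cnj a = of_real (norm p)" using norm_square_cnj[of a] ab by (simp flip: of_real_power)
  have "2 * w / cnj a = 2 * (a * w) / (a * cnj a)" using ab by simp
  also have "\<dots> = 2 * (a * w) / of_real (norm p)" by (simp only: n)
  also have "a * w = (k / S) *\<^sub>R (a * b - C *\<^sub>R a\<^sup>2)"
    unfolding w_def by (simp add: algebra_simps power2_eq_square)
  also have "\<dots> = (k / S) *\<^sub>R (m - C *\<^sub>R p)" by (simp only: ab)
  finally show ?thesis unfolding inner_vel_def by (simp add: scaleR_conv_of_real field_simps)
qed

lemma hyp_vel_end: "hyp_vel k a w \<sigma> = (k / S) *\<^sub>R (C *\<^sub>R b - a)"
proof -
  have "S *\<^sub>R hyp_vel k a w \<sigma> = C *\<^sub>R (S *\<^sub>R w) + (k * S\<^sup>2) *\<^sub>R a"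
    unfolding hyp_vel_def \<sigma> by (simp add: algebra_simps power2_eq_square)
  also have "S *\<^sub>R w = k *\<^sub>R (b - C *\<^sub>R a)" unfolding w_def using S by simp
  also have "C *\<^sub>R (k *\<^sub>R (b - C *\<^sub>R a)) + (k * S\<^sup>2) *\<^sub>R a = S *\<^sub>R ((k / S) *\<^sub>R (C *\<^sub>R b - a))"
    unfolding S(2) using S(1) by (simp add: algebra_simps power2_eq_square)
  finally show ?thesis using S(1) by (metis less_irrefl scaleR_left_imp_eq)
qed

lemma vel_end: "2 * hyp_vel k a w \<sigma> / cnj b = - inner_vel \<mu> k q p"
proof -
  have n: "b * cnj b = of_real (norm q)" using norm_square_cnj[of b] ab by (simp flip: of_real_power)
  have "2 * hyp_vel k a w \<sigma> / cnj b = 2 * (b * hyp_vel k a w \<sigma>) / (b * cnj b)" using ab by simp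
  also have "\<dots> = 2 * (b * hyp_vel k a w \<sigma>) / of_real (norm q)" by (simp only: n)
  also have "b * hyp_vel k a w \<sigma> = - ((k / S) *\<^sub>R (a * b - C *\<^sub>R b\<^sup>2))"
    unfolding hyp_vel_end by (simp add: algebra_simps power2_eq_square)
  also have "\<dots> = - ((k / S) *\<^sub>R (m - C *\<^sub>R q))" by (simp only: ab)
  finally show ?thesis unfolding inner_vel_def inner_sym(2)[of q p] inner_sym(3)[of \<mu> k q p] inner_sym(4)[of \<mu> k q p] by (simp add: scaleR_conv_of_real field_simps)
qed

lemma hyp_comb: "hyp k a w \<tau> = (sinh (k * (\<sigma> - \<tau>)) / S) *\<^sub>R a + (sinh (k * \<tau>) / S) *\<^sub>R b"
proof -
  have e: "sinh (k * (\<sigma> - \<tau>)) = S * cosh (k * \<tau>) - C * sinh (k * \<tau>)"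
    using sinh_diff[of "k * \<sigma>" "k * \<tau>"] by (simp add: right_diff_distrib \<sigma>)
  show ?thesis unfolding hyp_def w_def e using S(1) k by (simp add: algebra_simps diff_divide_distrib)
qed

lemma cosh_half: "(cosh (k * \<sigma> / 2))\<^sup>2 = (C + 1) / 2"
  using cosh_double_cosh[of "k * \<sigma> / 2"] \<sigma> by simp

text \<open>Compares the weights in \<open>hyp_comb\<close> during the half of the motion nearer to
  one end: even after multiplication by cosh (k \<sigma> / 2), the weight of the far end is at most
  the loss of weight at the near end. The identities are sum-to-product formulas.\<close>

lemma hyp_radial_aux:
  assumes xy: "0 < y" "y \<le> x" "x + y = k * \<sigma>"
  shows "sinh y / S * cosh (k * \<sigma> / 2) \<le> 1 - sinh x / S" "0 < sinh y / S"
proof -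
  have 1: "cosh (y / 2) * cosh ((x + y) / 2) \<le> cosh (x + y / 2)"
  proof -
    have "cosh (y / 2) * cosh ((x + y) / 2) = (cosh (x / 2 + y) + cosh (x / 2)) / 2"
    proof -
      have e: "(x + y) / 2 + y / 2 = x / 2 + y" "(x + y) / 2 - y / 2 = x / 2" by argo+
      show ?thesis using cosh_add[of "(x + y) / 2" "y / 2", unfolded e] cosh_diff[of "(x + y) / 2" "y / 2", unfolded e]
        by (simp add: mult.commute)
    qed
    also have "\<dots> \<le> (cosh (x + y / 2) + cosh (x + y / 2)) / 2"
      using xy by (intro divide_right_mono add_mono) (auto simp: cosh_real_nonneg_le_iff)
    finally show ?thesis by simp
  qed
  have 2: "sinh y = 2 * sinh (y / 2) * cosh (y / 2)" using sinh_double[of "y / 2"] by simp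
  have 3: "sinh (x + y) - sinh x = 2 * sinh (y / 2) * cosh (x + y / 2)"
  proof -
    have e: "x + y / 2 + y / 2 = x + y" "x + y / 2 - y / 2 = x" by argo+
    show ?thesis using sinh_add[of "x + y / 2" "y / 2", unfolded e] sinh_diff[of "x + y / 2" "y / 2", unfolded e]
      by (simp add: mult.commute)
  qed
  have "sinh y * cosh ((x + y) / 2) \<le> sinh (x + y) - sinh x"
    unfolding 2 3 using mult_left_mono[OF 1, of "2 * sinh (y / 2)"] xy by (simp add: mult.assoc)
  hence "sinh y * cosh (k * \<sigma> / 2) \<le> S - sinh x" using xy(3) \<sigma> by simp
  hence "sinh y * cosh (k * \<sigma> / 2) / S \<le> (S - sinh x) / S" using S(1) by (intro divide_right_mono) auto
  thus "sinh y / S * cosh (k * \<sigma> / 2) \<le> 1 - sinh x / S" using S(1) by (simp add: diff_divide_distrib)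
  show "0 < sinh y / S" using xy S by simp
qed

text \<open>Squaring the combination gives l^2 p + n^2 q + 2 l n m. If l is the weight of the nearer
  end p, put t = 1 - l^2; the other terms are at most 3 R n, and n cosh (k \<sigma> / 2) \<le> 1 - l
  \<le> t, so after division by t they are at most 3 R / cosh (k \<sigma> / 2).\<close>

lemma hyp_radial:
  assumes \<tau>: "0 < \<tau>" "\<tau> < \<sigma>" and R: "norm p \<le> R" "norm q \<le> R" and \<eta>: "3 * R \<le> \<eta> * cosh (k * \<sigma> / 2)" "0 < \<eta>"
  obtains t u where "0 < t" "t \<le> 1" "norm u \<le> \<eta>"
    "(hyp k a w \<tau>)\<^sup>2 = p - t *\<^sub>R (p + u) \<or> (hyp k a w \<tau>)\<^sup>2 = q - t *\<^sub>R (q + u)"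
proof -
  define x y where "x = k * (\<sigma> - \<tau>)" and "y = k * \<tau>"
  have xy: "0 < x" "0 < y" "x + y = k * \<sigma>" using \<tau> k by (auto simp: x_def y_def algebra_simps)
  define l n where "l = sinh x / S" and "n = sinh y / S"
  have z: "(hyp k a w \<tau>)\<^sup>2 = l\<^sup>2 *\<^sub>R p + n\<^sup>2 *\<^sub>R q + (2 * l * n) *\<^sub>R m"
  proof -
    have "(l *\<^sub>R a + n *\<^sub>R b)\<^sup>2 = l\<^sup>2 *\<^sub>R a\<^sup>2 + n\<^sup>2 *\<^sub>R b\<^sup>2 + (2 * l * n) *\<^sub>R (a * b)"
      by (simp add: power2_eq_square algebra_simps scaleR_conv_of_real)
    thus ?thesis unfolding hyp_comb l_def[symmetric, unfolded x_def] n_def[symmetric, unfolded y_def] ab .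
  qed
  have R0: "0 < R" using R pq by (meson less_le_trans zero_less_norm_iff)
  have nm: "norm m \<le> R" unfolding norm_m
    using mult_mono[OF R(1) R(2)] R0 by (intro real_le_lsqrt) (auto simp: power2_eq_square)
  define K where "K = cosh (k * \<sigma> / 2)"
  have K: "1 \<le> K" unfolding K_def by (rule cosh_real_ge_1)
  have key: "\<exists>t u. 0 < t \<and> t \<le> 1 \<and> norm u \<le> \<eta> \<and> l\<^sup>2 *\<^sub>R p + n\<^sup>2 *\<^sub>R q + (2 * l * n) *\<^sub>R m = p - t *\<^sub>R (p + u)"
    if l: "0 < l" and n: "0 < n" and ln: "n * K \<le> 1 - l" and R: "norm p \<le> R" "norm q \<le> R" for l n :: real and p q :: complex
  proof -
    define t where "t = 1 - l\<^sup>2"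
    have nK: "0 < n * K" using n K by simp
    have l1: "l < 1" using ln nK by linarith
    have "n * 1 \<le> n * K" using K n by (intro mult_left_mono) auto
    hence n1: "n \<le> 1" using ln l by linarith
    have t: "t = (1 - l) * (1 + l)" by (simp add: t_def power2_eq_square algebra_simps)
    have "1 - l \<le> t" unfolding t using l l1 by (simp add: mult_le_cancel_left1)
    hence tn: "n * K \<le> t" using ln by linarith
    have t0: "0 < t" using tn nK by linarith
    define u where "u = - ((n\<^sup>2 *\<^sub>R q + (2 * l * n) *\<^sub>R m) /\<^sub>R t)"
    have "norm (n\<^sup>2 *\<^sub>R q + (2 * l * n) *\<^sub>R m) \<le> n\<^sup>2 * norm q + (2 * l * n) * norm m"
      using norm_triangle_ineq[of "n\<^sup>2 *\<^sub>R q" "(2 * l * n) *\<^sub>R m"] l n by simp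
    also have "\<dots> \<le> (n * 1) * R + (2 * 1 * n) * R"
      unfolding power2_eq_square using l n l1 n1 R nm R0 by (intro add_mono mult_mono) auto
    also have "\<dots> = n * (3 * R)" by simp
    also have "\<dots> \<le> n * (\<eta> * K)" using \<eta> n by (intro mult_left_mono) (auto simp: K_def)
    also have "\<dots> \<le> \<eta> * t" using tn \<eta>(2) by (simp add: mult.left_commute)
    finally have "norm u \<le> \<eta>" unfolding u_def using t0 by (simp add: divide_simps mult.commute)
    moreover have "t *\<^sub>R u = - (n\<^sup>2 *\<^sub>R q + (2 * l * n) *\<^sub>R m)" unfolding u_def using t0 by simp
    hence "l\<^sup>2 *\<^sub>R p + n\<^sup>2 *\<^sub>R q + (2 * l * n) *\<^sub>R m = p - t *\<^sub>R (p + u)"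
      unfolding scaleR_add_right by (simp add: t_def algebra_simps)
    moreover have "t \<le> 1" by (simp add: t_def)
    ultimately show ?thesis using t0 by blast
  qed
  show ?thesis
  proof (cases "y \<le> x")
    case True
    note * = hyp_radial_aux[OF xy(2) True xy(3)]
    have "0 < l" unfolding l_def using xy S by simp
    from key[OF this *(2)[folded n_def] *(1)[folded n_def l_def K_def] R] obtain t u where
      "0 < t" "t \<le> 1" "norm u \<le> \<eta>" "(hyp k a w \<tau>)\<^sup>2 = p - t *\<^sub>R (p + u)" unfolding z by blast
    thus ?thesis using that by blast
  next
    case False
    hence yx: "x \<le> y" "y + x = k * \<sigma>" using xy by auto
    note * = hyp_radial_aux[OF xy(1) yx]
    have "0 < n" unfolding n_def using xy S by simp
    from key[OF this *(2)[folded l_def] *(1)[folded n_def l_def K_def] R(2,1)] obtain t u where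
      "0 < t" "t \<le> 1" "norm u \<le> \<eta>" "n\<^sup>2 *\<^sub>R q + l\<^sup>2 *\<^sub>R p + (2 * n * l) *\<^sub>R m = q - t *\<^sub>R (q + u)" by blast
    moreover have "n\<^sup>2 *\<^sub>R q + l\<^sup>2 *\<^sub>R p + (2 * n * l) *\<^sub>R m = (hyp k a w \<tau>)\<^sup>2"
      unfolding z by (simp add: algebra_simps)
    ultimately show ?thesis using that by metis
  qed
qed

lemma vel_energy: "1 / 2 * (norm (inner_vel \<mu> k p q))\<^sup>2 = 2 * k\<^sup>2 + \<mu> / norm p"
proof -
  have "1 / 2 * (norm (2 * w / cnj a))\<^sup>2 = 2 * (norm w)\<^sup>2 / (norm a)\<^sup>2"
    by (simp add: norm_divide norm_mult power_divide power_mult_distrib)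
  thus ?thesis unfolding vel_start w_energy(1) ab using pq by (simp add: field_simps)
qed

definition "T = lc_time k a w \<sigma>"
definition "z = lc_traj k a w"

lemma T: "0 < T"
  using lc_time_strict_mono[of k a w] w_energy(2) k \<sigma>(1) unfolding T_def strict_mono_def
  by (metis lc_time_0 less_irrefl)

lemma z_time: "z (lc_time k a w \<tau>) = (hyp k a w \<tau>)\<^sup>2"
  unfolding z_def using lc_traj_time(1)[of k a w] k w_energy(2) by simp

lemma z_ends: "z 0 = p" "z T = q"
  using z_time[of 0] z_time[of \<sigma>] hyp_ends ab by (simp_all add: T_def)

lemma z_surj:
  assumes "s \<in> {0..T}"
  obtains \<tau> where "\<tau> \<in> {0..\<sigma>}" "s = lc_time k a w \<tau>"
  using lc_time_surj[of k \<sigma> s a w] assms k \<sigma>(1) unfolding T_def by auto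

lemma z_surj_open:
  assumes "s \<in> {0<..<T}"
  obtains \<tau> where "\<tau> \<in> {0<..<\<sigma>}" "s = lc_time k a w \<tau>"
proof -
  obtain \<tau> where \<tau>: "\<tau> \<in> {0..\<sigma>}" "s = lc_time k a w \<tau>" using z_surj[of s] assms by auto
  have "\<tau> \<noteq> 0" "\<tau> \<noteq> \<sigma>" using assms \<tau>(2) unfolding T_def by auto
  thus ?thesis using \<tau> by (intro that[of \<tau>]) auto
qed

lemma z_sol: "lc_kepler_sol \<mu> (2 * k\<^sup>2) T z"
  unfolding T_def z_def by (rule lc_traj_sol) (use k \<mu> w_energy \<sigma> in auto)

text \<open>A zero makes a and b real multiples of each other, so q is a positive multiple of p; the
  second assumption then forces q = p.\<close>

lemma hyp_nonzero:
  assumes "p \<noteq> q" "\<And>r. 0 < r \<Longrightarrow> q = r *\<^sub>R p \<Longrightarrow> q = p" "\<tau> \<in> {0..\<sigma>}"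
  shows "hyp k a w \<tau> \<noteq> 0"
proof
  assume h: "hyp k a w \<tau> = 0"
  define l n where "l = sinh (k * (\<sigma> - \<tau>)) / S" and "n = sinh (k * \<tau>) / S"
  have ln: "l *\<^sub>R a = - (n *\<^sub>R b)" using h unfolding hyp_comb l_def n_def by (simp add: eq_neg_iff_add_eq_0)
  have "\<tau> \<noteq> 0" "\<tau> \<noteq> \<sigma>" using h hyp_ends ab by auto
  hence pos: "0 < l" "0 < n" using assms(3) S k by (auto simp: l_def n_def)
  have "(l *\<^sub>R a)\<^sup>2 = (n *\<^sub>R b)\<^sup>2" unfolding ln by simp
  hence "l\<^sup>2 *\<^sub>R a\<^sup>2 = n\<^sup>2 *\<^sub>R b\<^sup>2" by (simp add: power2_eq_square)
  hence "l\<^sup>2 *\<^sub>R p = n\<^sup>2 *\<^sub>R q" by (simp only: ab)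
  hence "(1 / n\<^sup>2) *\<^sub>R (l\<^sup>2 *\<^sub>R p) = (1 / n\<^sup>2) *\<^sub>R (n\<^sup>2 *\<^sub>R q)" by simp
  hence "q = (l\<^sup>2 / n\<^sup>2) *\<^sub>R p" using pos by simp
  thus False using assms(1) assms(2)[of "l\<^sup>2 / n\<^sup>2"] pos by simp
qed

text \<open>For p different from q the lift \<open>?h\<close> is a path from a to b in the punctured
  plane with a . b < 0, and \<open>square_path_indirect\<close> gives the homotopy class.\<close>

lemma is_inner_arc:
  assumes ray: "\<And>r. 0 < r \<Longrightarrow> q = r *\<^sub>R p \<Longrightarrow> q = p" and H: "E + h = 2 * k\<^sup>2"
    and D: "\<And>\<tau>. 0 < \<tau> \<Longrightarrow> \<tau> < \<sigma> \<Longrightarrow> (hyp k a w \<tau>)\<^sup>2 \<in> D"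
  shows "inner_arc \<mu> E h D p q T z"
proof -
  have "z s \<in> D" if "s \<in> {0<..<T}" for s
    using z_surj_open[OF that] D z_time by (metis greaterThanLessThan_iff)
  moreover have "(\<exists>v. newton_sol (kepler_force \<mu>) T z v \<and> (\<forall>s\<in>{0..T}. z s \<noteq> 0 \<and> 1 / 2 * (norm (v s))\<^sup>2 = V_inner \<mu> E h (z s))) \<and>
      TnT p q T z" if ne: "p \<noteq> q"
  proof (intro conjI exI[of _ "lc_vel k a w"] ballI)
    have nz: "hyp k a w \<tau> \<noteq> 0" if "\<tau> \<in> {0..\<sigma>}" for \<tau> using hyp_nonzero[OF ne ray that] .
    show "newton_sol (kepler_force \<mu>) T z (lc_vel k a w)"
      unfolding newton_sol_def
    proof (intro ballI)
      fix s assume "s \<in> {0..T}"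
      then obtain \<tau> where \<tau>: "\<tau> \<in> {0..\<sigma>}" "s = lc_time k a w \<tau>" by (rule z_surj)
      show "(z has_vector_derivative lc_vel k a w s) (at s within {0..T}) \<and> (lc_vel k a w has_vector_derivative kepler_force \<mu> (z s)) (at s within {0..T})"
        unfolding \<tau>(2) z_def
        by (rule conjI; rule has_vector_derivative_at_within, rule lc_traj_deriv lc_vel_deriv)
          (use k \<mu> w_energy nz[OF \<tau>(1)] in auto)
    qed
    fix s assume "s \<in> {0..T}"
    then obtain \<tau> where \<tau>: "\<tau> \<in> {0..\<sigma>}" "s = lc_time k a w \<tau>" by (rule z_surj)
    show "z s \<noteq> 0" unfolding \<tau>(2) z_time using nz[OF \<tau>(1)] by simp
    show "1 / 2 * (norm (lc_vel k a w s))\<^sup>2 = V_inner \<mu> E h (z s)"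
      unfolding \<tau>(2) V_inner_def H z_def by (rule lc_energy) (use k \<mu> w_energy nz[OF \<tau>(1)] in auto)
  next
    have nz: "hyp k a w \<tau> \<noteq> 0" if "\<tau> \<in> {0..\<sigma>}" for \<tau> using hyp_nonzero[OF ne ray that] .
    let ?\<tau> = "inv (lc_time k a w)"
    have inv: "?\<tau> (lc_time k a w x) = x" for x
      using strict_mono_imp_inj_on[OF lc_time_strict_mono[of k a w]] k w_energy(2) by simp
    let ?h = "\<lambda>t. hyp k a w (?\<tau> (T * t))"
    have in01: "T * t \<in> {0..T}" if "t \<in> {0..1}" for t using that T by (auto simp: mult_left_le)
    have ct: "continuous_on {0..T} ?\<tau>"
    proof (rule continuous_at_imp_continuous_on, rule ballI)
      fix s assume "s \<in> {0..T}"
      then obtain \<tau> where "\<tau> \<in> {0..\<sigma>}" "s = lc_time k a w \<tau>" by (rule z_surj)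
      thus "isCont ?\<tau> s" using lc_time_inv(1)[of k a w \<tau>] k w_energy(2) by simp
    qed
    have ch: "continuous_on UNIV (hyp k a w)" unfolding hyp_def[abs_def] using k by (intro continuous_intros) auto
    have "path ?h" unfolding path_def
      by (rule continuous_on_compose2[OF ch continuous_on_compose2[OF ct]]) (use T in \<open>auto intro!: continuous_intros simp: mult_left_le\<close>)
    moreover have "?h t \<noteq> 0" if t: "t \<in> {0..1}" for t
    proof -
      obtain \<tau> where "\<tau> \<in> {0..\<sigma>}" "T * t = lc_time k a w \<tau>" using z_surj[OF in01[OF t]] .
      thus ?thesis using nz inv by simp
    qed
    moreover have h01: "?h 0 = a" "?h 1 = b" using inv[of 0] inv[of \<sigma>] hyp_ends unfolding T_def by auto
    moreover have "a \<bullet> b < 0" using ab d by simp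
    ultimately have "\<not> homotopic_paths (- {0}) (\<lambda>t. (?h t)\<^sup>2) (linepath ((?h 0)\<^sup>2) ((?h 1)\<^sup>2))"
      by (intro square_path_indirect) auto
    thus "TnT p q T z" unfolding TnT_def h01 ab z_def lc_traj_def .
  qed
  ultimately show ?thesis unfolding inner_arc_def using T z_ends z_sol H by auto
qed

text \<open>Any competitor lifts to a hyperbolic arc between square roots a' and b' of p and q, so
  a' . b' is d or -d. The value d is impossible: for p = q it contradicts the energy equation, as C'
  > 1, and for p different from q the arc would be homotopic to the segment. With -d the quadratic
  fixes C' and hence the duration, and only a common sign of a' and w' remains, which squaring
  removes.\<close>

lemma inner_arc_lc_unique:
  assumes H: "E + h = 2 * k\<^sup>2" and arc: "inner_arc \<mu> E h D p q T' z'"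
  shows "T' = T" "\<forall>s\<in>{0..T}. z' s = z s"
proof -
  have T': "0 < T'" "z' 0 = p" "z' T' = q" using arc by (auto simp: inner_arc_def)
  have lc: "lc_kepler_sol \<mu> (2 * k\<^sup>2) T' z'"
  proof (cases "p = q")
    case True thus ?thesis using arc H by (auto simp: inner_arc_def)
  next
    case False
    then obtain v where "newton_sol (kepler_force \<mu>) T' z' v"
      "\<forall>s\<in>{0..T'}. z' s \<noteq> 0 \<and> 1 / 2 * (norm (v s))\<^sup>2 = V_inner \<mu> E h (z' s)"
      using arc by (auto simp: inner_arc_def)
    thus ?thesis using kepler_imp_lc[of \<mu> T' z' v k] T' k unfolding V_inner_def H by auto
  qed
  obtain \<sigma>' a' w' where s: "0 < \<sigma>'" "2 * (norm w')\<^sup>2 = \<mu> + 2 * k\<^sup>2 * (norm a')\<^sup>2" "T' = lc_time k a' w' \<sigma>'"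
    "\<And>\<tau>. \<tau> \<in> {0..\<sigma>'} \<Longrightarrow> z' (lc_time k a' w' \<tau>) = (hyp k a' w' \<tau>)\<^sup>2"
    using lc_kepler_sol_explicit[OF lc] k by (metis less_irrefl)
  define b' where "b' = hyp k a' w' \<sigma>'"
  have a'2: "a'\<^sup>2 = a\<^sup>2" "b'\<^sup>2 = b\<^sup>2" using s(4)[of 0] s(4)[of \<sigma>'] s(1,3) T' ab by (auto simp: b'_def)
  hence na: "(norm a')\<^sup>2 = norm p" "(norm b')\<^sup>2 = norm q" using ab by (metis norm_power)+
  define C' S' where "C' = cosh (k * \<sigma>')" and "S' = sinh (k * \<sigma>')"
  have CS: "1 < C'" "0 < S'" "S'\<^sup>2 = C'\<^sup>2 - 1" unfolding C'_def S'_def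
    using k s(1) cosh_real_ge_1[of "k * \<sigma>'"] cosh_square_eq[of "k * \<sigma>'"] cosh_real_one_iff[of "k * \<sigma>'"]
    by (auto simp: less_le)
  have w': "w' = (k / S') *\<^sub>R (b' - C' *\<^sub>R a')"
    using hyp_boundary(1)[OF k s(1), of a' w' b'] by (simp add: b'_def C'_def S'_def)
  have quad: "\<mu> * (C'\<^sup>2 - 1) = 2 * k\<^sup>2 * (norm p + norm q - 2 * (a' \<bullet> b') * C')"
  proof -
    have "(norm w')\<^sup>2 * S'\<^sup>2 = k\<^sup>2 * (norm q - 2 * (a' \<bullet> b') * C' + C'\<^sup>2 * norm p)"
      using hyp_boundary(2)[OF k s(1), of b' a'] unfolding C'_def[symmetric] S'_def[symmetric] w'[symmetric] na by simp
    moreover have "(2 * (norm w')\<^sup>2) * S'\<^sup>2 = (\<mu> + 2 * k\<^sup>2 * norm p) * S'\<^sup>2" unfolding s(2) na ..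
    ultimately show ?thesis unfolding CS(3) by (simp add: algebra_simps)
  qed
  have sign: "a' \<bullet> b' = - d"
  proof (rule ccontr)
    assume ne: "a' \<bullet> b' \<noteq> - d"
    have sg: "a' = a \<or> a' = - a" "b' = b \<or> b' = - b" using a'2 by (auto simp: power2_eq_iff)
    hence abd: "a' \<bullet> b' = d" using ne ab by auto
    show False
    proof (cases "p = q")
      case True
      have "a' = b'"
      proof -
        have "a'\<^sup>2 = b'\<^sup>2" using a'2 ab True by simp
        moreover have "a' \<noteq> - b'"
        proof
          assume "a' = - b'"
          hence "d = - (norm b')\<^sup>2" using abd by (simp add: dot_square_norm)
          thus False using d(1) zero_le_power2[of "norm b'"] by linarith
        qed
        ultimately show ?thesis by (auto simp: power2_eq_iff)
      qed
      hence "a' \<bullet> b' = norm p" using na by (simp add: dot_square_norm)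
      hence "\<mu> * (C'\<^sup>2 - 1) = 4 * k\<^sup>2 * norm p * (1 - C')" using quad True by (simp add: algebra_simps)
      moreover have "0 < \<mu> * (C'\<^sup>2 - 1)" using \<mu> CS by (metis mult_pos_pos zero_less_power)
      moreover have "4 * k\<^sup>2 * norm p * (1 - C') \<le> 0" using CS(1) by (simp add: mult_nonneg_nonpos)
      ultimately show False by linarith
    next
      case False
      hence tnt: "TnT p q T' z'" using arc by (auto simp: inner_arc_def)
      have sm: "(norm w')\<^sup>2 > k\<^sup>2 * (norm a')\<^sup>2" using s(2) \<mu> by simp
      have cz: "continuous_on {0..T'} z'"
      proof -
        obtain v where "newton_sol (kepler_force \<mu>) T' z' v" using arc False by (auto simp: inner_arc_def)
        thus ?thesis unfolding newton_sol_def
          using has_vector_derivative_continuous continuous_on_eq_continuous_within by blast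
      qed
      have in01: "T' * t \<in> {0..T'}" if "t \<in> {0..1}" for t using that T' by (auto simp: mult_left_le)
      have "homotopic_paths (- {0}) (\<lambda>t. z' (T' * t)) (linepath (z' (T' * 0)) (z' (T' * 1)))"
      proof (rule homotopic_halfplane_linepath)
        show "path (\<lambda>t. z' (T' * t))" unfolding path_def
          by (rule continuous_on_compose2[OF cz]) (use T' in \<open>auto intro!: continuous_intros simp: mult_left_le\<close>)
        fix t :: real assume t: "t \<in> {0..1}"
        obtain \<tau> where \<tau>: "\<tau> \<in> {0..\<sigma>'}" "T' * t = lc_time k a' w' \<tau>"
          using lc_time_surj[of k \<sigma>' "T' * t" a' w'] in01[OF t] k s(1,3) by auto
        have e: "sinh (k * (\<sigma>' - \<tau>)) = S' * cosh (k * \<tau>) - C' * sinh (k * \<tau>)"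
          using sinh_diff[of "k * \<sigma>'" "k * \<tau>"] by (simp add: right_diff_distrib C'_def S'_def)
        have "hyp k a' w' \<tau> = (sinh (k * (\<sigma>' - \<tau>)) / S') *\<^sub>R a' + (sinh (k * \<tau>) / S') *\<^sub>R b'"
          unfolding hyp_def e by (subst w') (use CS k in \<open>simp add: algebra_simps diff_divide_distrib\<close>)
        moreover have "0 < ((sinh (k * (\<sigma>' - \<tau>)) / S') *\<^sub>R a' + (sinh (k * \<tau>) / S') *\<^sub>R b')\<^sup>2 \<bullet> (a' * b')"
        proof (rule halfplane_square)
          show "0 < sinh (k * (\<sigma>' - \<tau>)) / S' + sinh (k * \<tau>) / S'"
            using \<tau>(1) CS k s(1) by (cases "\<tau> = 0") (auto intro!: add_nonneg_pos)
        qed (use abd d \<tau>(1) CS k in auto)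
        ultimately show "0 < z' (T' * t) \<bullet> (a' * b')" using s(4)[OF \<tau>(1)] \<tau>(2) by simp
      qed
      thus False using tnt T' by (simp add: TnT_def)
    qed
  qed
  have C': "C' = C" by (rule C_unique) (use CS quad sign in auto)
  have \<sigma>': "\<sigma>' = \<sigma>"
  proof -
    have "k * \<sigma>' = arcosh C'" unfolding C'_def using k s(1) by (simp add: arcosh_cosh_real)
    thus ?thesis unfolding C' inner_sigma_def using k by (simp add: field_simps)
  qed
  have S'': "S' = S" using \<sigma>' \<sigma> by (simp add: S'_def)
  have sg: "a' = a \<or> a' = - a" "b' = b \<or> b' = - b" using a'2 by (auto simp: power2_eq_iff)
  hence cases: "(a' = a \<and> b' = b) \<or> (a' = - a \<and> b' = - b)" using sign ab d by auto
  hence ww: "(a' = a \<and> w' = w) \<or> (a' = - a \<and> w' = - w)"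
    unfolding w' w_def C' S'' by (auto simp: algebra_simps)
  hence same: "lc_time k a' w' \<tau> = lc_time k a w \<tau>" "(hyp k a' w' \<tau>)\<^sup>2 = (hyp k a w \<tau>)\<^sup>2" for \<tau>
    by (auto simp: lc_uminus)
  show TT: "T' = T" unfolding s(3) same \<sigma>' T_def ..
  show "\<forall>s\<in>{0..T}. z' s = z s"
  proof
    fix x assume "x \<in> {0..T}"
    then obtain \<tau> where "\<tau> \<in> {0..\<sigma>}" "x = lc_time k a w \<tau>" by (rule z_surj)
    thus "z' x = z x" using s(4)[of \<tau>] z_time[of \<tau>] unfolding same \<sigma>' by simp
  qed
qed

text \<open>In regularized time the integrand is 2 sqrt 2 |w'|^2, with primitive \<open>G\<close>.
  In physical time the derivative of \<open>G\<close> is infinite at a collision, hence the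
  fundamental theorem with a finite exceptional set.\<close>

lemma inner_jacobi:
  assumes H: "E + h = 2 * k\<^sup>2" and arc: "inner_arc \<mu> E h D p q T' z'"
  shows "jacobi_length (V_inner \<mu> E h) T' z' = sqrt 2 * inner_action \<mu> k p q"
proof -
  note u = inner_arc_lc_unique[OF H arc]
  let ?\<tau> = "inv (lc_time k a w)"
  have inv: "?\<tau> (lc_time k a w x) = x" for x
    using strict_mono_imp_inj_on[OF lc_time_strict_mono[of k a w]] k w_energy(2) by simp
  define G where "G = (\<lambda>\<tau>. sqrt 2 * (hyp k a w \<tau> \<bullet> hyp_vel k a w \<tau> + \<mu> * \<tau> / 2))"
  have dG: "(G has_real_derivative sqrt 2 * (2 * (norm (hyp_vel k a w \<tau>))\<^sup>2)) (at \<tau>)" for \<tau>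
  proof -
    have "((\<lambda>\<tau>. hyp k a w \<tau> \<bullet> hyp_vel k a w \<tau>) has_real_derivative
        hyp k a w \<tau> \<bullet> (k\<^sup>2 *\<^sub>R hyp k a w \<tau>) + hyp_vel k a w \<tau> \<bullet> hyp_vel k a w \<tau>) (at \<tau>)"
      unfolding has_real_derivative_iff_has_vector_derivative
      by (rule bounded_bilinear.has_vector_derivative[OF bounded_bilinear_inner hyp_deriv]) (use k in auto)
    moreover have "hyp k a w \<tau> \<bullet> (k\<^sup>2 *\<^sub>R hyp k a w \<tau>) + hyp_vel k a w \<tau> \<bullet> hyp_vel k a w \<tau> + \<mu> / 2 = 2 * (norm (hyp_vel k a w \<tau>))\<^sup>2"
      using hyp_energy[of k a w \<tau>] w_energy(1) k by (simp add: dot_square_norm)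
    ultimately show ?thesis unfolding G_def by (auto intro!: derivative_eq_intros)
  qed
  let ?f = "\<lambda>s. norm (vector_derivative z' (at s within {0..T})) * sqrt (V_inner \<mu> E h (z' s))"
  define X where "X = lc_time k a w ` {\<tau>. hyp k a w \<tau> = 0}"
  have "finite {\<tau>. hyp k a w \<tau> = 0}"
  proof (rule finite_subset)
    show "{\<tau>. hyp k a w \<tau> = 0} \<subseteq> {SOME \<tau>. hyp k a w \<tau> = 0}"
    proof
      fix x assume x: "x \<in> {\<tau>. hyp k a w \<tau> = 0}"
      hence "hyp k a w (SOME \<tau>. hyp k a w \<tau> = 0) = 0" by (metis (mono_tags) mem_Collect_eq someI)
      thus "x \<in> {SOME \<tau>. hyp k a w \<tau> = 0}" using hyp_zero_unique[of k a w] x k ab by auto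
    qed
  qed simp
  hence finX: "finite X" unfolding X_def by (rule finite_imageI)
  have "(?f has_integral (G (?\<tau> T) - G (?\<tau> 0))) {0..T}"
  proof (rule fundamental_theorem_of_calculus_interior_strong[OF finX, where f = "\<lambda>s. G (?\<tau> s)"])
    fix s assume s: "s \<in> {0<..<T} - X"
    then obtain \<tau> where \<tau>: "\<tau> \<in> {0<..<\<sigma>}" "s = lc_time k a w \<tau>" using z_surj_open by blast
    have nz: "hyp k a w \<tau> \<noteq> 0" using s \<tau> unfolding X_def by blast
    have sT: "s \<in> {0..T}" using s by auto
    have "(G \<circ> ?\<tau> has_real_derivative sqrt 2 * (2 * (norm (hyp_vel k a w \<tau>))\<^sup>2) * inverse ((norm (hyp k a w \<tau>))\<^sup>2)) (at s)"
      unfolding \<tau>(2) by (rule DERIV_chain) (use dG inv lc_time_inv(2)[of k a w \<tau>] k w_energy(2) nz in auto)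
    moreover have "sqrt 2 * (2 * (norm (hyp_vel k a w \<tau>))\<^sup>2) * inverse ((norm (hyp k a w \<tau>))\<^sup>2) = ?f s"
    proof -
      have "(z has_vector_derivative lc_vel k a w s) (at s within {0..T})"
        unfolding \<tau>(2) z_def
        by (rule has_vector_derivative_at_within, rule lc_traj_deriv) (use k w_energy(2) nz in auto)
      from has_vector_derivative_transform[OF sT _ this, of z']
      have "(z' has_vector_derivative lc_vel k a w s) (at s within {0..T})" using u by simp
      hence vd: "vector_derivative z' (at s within {0..T}) = lc_vel k a w s"
        using vector_derivative_within_cbox[of 0 T s z'] T sT by simp
      have V: "V_inner \<mu> E h (z' s) = (norm (lc_vel k a w s))\<^sup>2 / 2"
        using lc_energy[of k \<mu> w a \<tau>] u(2) sT k \<mu> w_energy nz unfolding V_inner_def H z_def \<tau>(2) by simp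
      have "sqrt (V_inner \<mu> E h (z' s)) = norm (lc_vel k a w s) / sqrt 2" unfolding V by (simp add: real_sqrt_divide)
      hence "?f s = (norm (lc_vel k a w s))\<^sup>2 / sqrt 2" unfolding vd by (simp add: power2_eq_square)
      also have "\<dots> = 4 / sqrt 2 * ((norm (hyp_vel k a w \<tau>))\<^sup>2 / (norm (hyp k a w \<tau>))\<^sup>2)"
        unfolding \<tau>(2) using lc_traj_time(2)[of k a w \<tau>] k w_energy(2)
        by (simp add: norm_divide norm_mult power_divide power_mult_distrib)
      also have "4 / sqrt 2 = sqrt 2 * (2::real)" by (simp add: real_divide_square_eq field_simps)
      finally show ?thesis by (simp add: divide_inverse mult_ac)
    qed
    ultimately show "((\<lambda>s. G (?\<tau> s)) has_vector_derivative ?f s) (at s)"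
      by (simp add: has_real_derivative_iff_has_vector_derivative o_def)
  next
    show "continuous_on {0..T} (\<lambda>s. G (?\<tau> s))"
    proof (rule continuous_at_imp_continuous_on, rule ballI)
      fix s assume "s \<in> {0..T}"
      then obtain \<tau> where "\<tau> \<in> {0..\<sigma>}" "s = lc_time k a w \<tau>" by (rule z_surj)
      hence "isCont ?\<tau> s" using lc_time_inv(1)[of k a w \<tau>] k w_energy(2) by simp
      thus "isCont (\<lambda>s. G (?\<tau> s)) s" using isCont_o2 DERIV_isCont[OF dG] by blast
    qed
  qed (use T in auto)
  hence "jacobi_length (V_inner \<mu> E h) T' z' = G (?\<tau> T) - G (?\<tau> 0)"
    unfolding jacobi_length_def u(1) by (rule integral_unique)
  also have "\<dots> = G \<sigma> - G 0" using inv[of \<sigma>] inv[of 0] unfolding T_def by simp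
  also have "\<dots> = sqrt 2 * (b \<bullet> ((k / S) *\<^sub>R (C *\<^sub>R b - a)) - a \<bullet> w + \<mu> * \<sigma> / 2)"
    unfolding G_def hyp_ends hyp_vel_end hyp_0 by (simp add: algebra_simps)
  also have "b \<bullet> ((k / S) *\<^sub>R (C *\<^sub>R b - a)) - a \<bullet> w = k * ((norm p + norm q) * C + 2 * d) / S"
  proof -
    have "b \<bullet> ((k / S) *\<^sub>R (C *\<^sub>R b - a)) - a \<bullet> w = (k / S) * (((norm a)\<^sup>2 + (norm b)\<^sup>2) * C - 2 * (a \<bullet> b))"
      unfolding w_def power2_norm_eq_inner by (simp add: inner_simps inner_commute algebra_simps)
    thus ?thesis unfolding ab by simp
  qed
  finally show ?thesis unfolding inner_action_def .
qed

end

text \<open>First variation at the initial point, hence the minus sign; the action is half the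
  integral of |z'|^2, hence the factor 1/2. The derivative \<open>C'\<close> of C is only shown to
  exist: its terms cancel by \<mu> S^2 = 2 k^2 (|p| + |q| + 2 d C), and the explicit dependence on
  |p| and d is left.\<close>

lemma inner_action_deriv:
  assumes "inner_arcs \<mu> k (g x) q" and g: "(g has_vector_derivative g') (at x)"
  shows "((\<lambda>x. inner_action \<mu> k (g x) q) has_real_derivative - (inner_vel \<mu> k (g x) q \<bullet> g') / 2) (at x)"
proof -
  interpret inner_arcs \<mu> k "g x" q by fact
  have np: "0 < norm (g x)" using pq by simp
  define N Q where "N = (\<lambda>x. norm (g x))" and "Q = (\<lambda>x. g x \<bullet> q)"
  define I J where "I = g x \<bullet> g'" and "J = q \<bullet> g'"
  define d' where "d' = (I / N x * norm q + J) / (4 * d)"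
  have dN: "(N has_real_derivative I / N x) (at x)"
  proof -
    have "((\<lambda>x. sqrt (g x \<bullet> g x)) has_real_derivative inverse (sqrt (g x \<bullet> g x)) / 2 * (2 * I)) (at x)"
    proof (rule DERIV_chain2[OF DERIV_real_sqrt])
      show "((\<lambda>x. g x \<bullet> g x) has_real_derivative 2 * I) (at x)"
        unfolding has_real_derivative_iff_has_vector_derivative I_def
        using bounded_bilinear.has_vector_derivative[OF bounded_bilinear_inner g g] by (simp add: inner_commute)
    qed (use pq in auto)
    thus ?thesis unfolding N_def norm_eq_sqrt_inner by (simp add: field_simps)
  qed
  have dQ: "(Q has_real_derivative J) (at x)"
    unfolding has_real_derivative_iff_has_vector_derivative Q_def J_def
    using bounded_linear.has_vector_derivative[OF bounded_linear_inner_left[of q] g] by (simp add: inner_commute[of q])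
  define dd CC SS sig where "dd = (\<lambda>x. inner_d (g x) q)" and "CC = (\<lambda>x. inner_C \<mu> k (g x) q)"
    and "SS = (\<lambda>x. inner_S \<mu> k (g x) q)" and "sig = (\<lambda>x. inner_sigma \<mu> k (g x) q)"
  have ddd: "(dd has_real_derivative d') (at x)"
  proof -
    have "((\<lambda>x. (N x * norm q + Q x) / 2) has_real_derivative (I / N x * norm q + J) / 2) (at x)"
      by (intro DERIV_cdivide DERIV_add DERIV_cmult_right dN dQ)
    note der = this
    have pos: "0 < (N x * norm q + Q x) / 2" using nonantipodal by (simp add: N_def Q_def)
    have "((\<lambda>x. sqrt ((N x * norm q + Q x) / 2)) has_real_derivative
      inverse (sqrt ((N x * norm q + Q x) / 2)) / 2 * ((I / N x * norm q + J) / 2)) (at x)"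
      by (rule DERIV_chain2[OF DERIV_real_sqrt[OF pos] der])
    hence "(dd has_real_derivative inverse (dd x) / 2 * ((I / N x * norm q + J) / 2)) (at x)"
      by (simp only: dd_def inner_d_def N_def Q_def)
    moreover have "inverse (dd x) / 2 * ((I / N x * norm q + J) / 2) = d'"
      unfolding d'_def dd_def by (simp add: field_simps)
    ultimately show ?thesis by simp
  qed
  obtain C' where dC: "(CC has_real_derivative C') (at x)"
  proof -
    have pos: "0 < (2 * k\<^sup>2 * dd x)\<^sup>2 + \<mu> * (\<mu> + 2 * k\<^sup>2 * (N x + norm q))"
    proof -
      have "0 < \<mu> + 2 * k\<^sup>2 * (N x + norm q)" using \<mu> by (intro add_pos_nonneg) (auto simp: N_def)
      from add_nonneg_pos[OF zero_le_power2 mult_pos_pos[OF \<mu> this]] show ?thesis .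
    qed
    have "((\<lambda>x. 2 * k\<^sup>2 * dd x) has_real_derivative 2 * k\<^sup>2 * d') (at x)" by (rule DERIV_cmult[OF ddd])
    note 1 = this DERIV_power[OF this, of 2]
    have "((\<lambda>x. \<mu> * (\<mu> + 2 * k\<^sup>2 * (N x + norm q))) has_real_derivative \<mu> * (0 + 2 * k\<^sup>2 * (I / N x + 0))) (at x)"
      by (intro DERIV_cmult DERIV_add DERIV_const dN)
    from DERIV_cdivide[OF DERIV_add[OF 1(1) DERIV_chain2[OF DERIV_real_sqrt[OF pos] DERIV_add[OF 1(2) this]]], of \<mu>]
    show ?thesis using that unfolding CC_def inner_C_def dd_def N_def by blast
  qed
  have SS: "SS x = S" "0 < SS x" "CC x = C" using S by (auto simp: SS_def CC_def)
  have dS: "(SS has_real_derivative CC x * C' / SS x) (at x)"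
  proof -
    have "((\<lambda>x. (CC x)\<^sup>2 - 1) has_real_derivative 2 * CC x * C') (at x)"
      using DERIV_diff[OF DERIV_power[OF dC, of 2] DERIV_const] by (simp add: mult_ac)
    note der = this
    have pos: "0 < (CC x)\<^sup>2 - 1" using S SS by (metis zero_less_power)
    have "((\<lambda>x. sqrt ((CC x)\<^sup>2 - 1)) has_real_derivative inverse (sqrt ((CC x)\<^sup>2 - 1)) / 2 * (2 * CC x * C')) (at x)"
      by (rule DERIV_chain2[OF DERIV_real_sqrt[OF pos] der])
    hence "(SS has_real_derivative inverse (SS x) / 2 * (2 * CC x * C')) (at x)"
      by (simp only: SS_def inner_S_def CC_def)
    moreover have "inverse (SS x) / 2 * (2 * CC x * C') = CC x * C' / SS x" by (simp add: field_simps)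
    ultimately show ?thesis by simp
  qed
  have dsig: "(sig has_real_derivative C' / (k * SS x)) (at x)"
  proof -
    have "((\<lambda>x. arcosh (CC x)) has_real_derivative 1 / SS x * C') (at x)"
    proof (rule DERIV_chain2[OF _ dC])
      show "(arcosh has_real_derivative 1 / SS x) (at (CC x))"
        using arcosh_real_has_field_derivative[of "CC x" UNIV] C(2) SS(3) unfolding SS_def inner_S_def CC_def by simp
    qed
    from DERIV_cdivide[OF this, of k] show ?thesis unfolding sig_def inner_sigma_def CC_def by (simp add: mult.commute)
  qed
  have "((\<lambda>x. k * ((N x + norm q) * CC x + 2 * dd x) / SS x + \<mu> * sig x / 2) has_real_derivative
     k * ((I / N x * CC x + (N x + norm q) * C' + 2 * d') * SS x - ((N x + norm q) * CC x + 2 * dd x) * (CC x * C' / SS x)) / (SS x)\<^sup>2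
      + \<mu> * (C' / (k * SS x)) / 2) (at x)"
    using dN ddd dC dS dsig SS(2)
    by (auto intro!: derivative_eq_intros simp: power2_eq_square) (simp add: field_simps)
  also have "k * ((I / N x * CC x + (N x + norm q) * C' + 2 * d') * SS x - ((N x + norm q) * CC x + 2 * dd x) * (CC x * C' / SS x)) / (SS x)\<^sup>2
      + \<mu> * (C' / (k * SS x)) / 2 = k * (I / N x * CC x + 2 * d') / SS x"
  proof -
    \<comment> \<open>X and Y stand for the contributions of |p| and d; the last assumption cancels
      all terms in \<open>c'\<close>.\<close>
    have gen: "k * ((X + A * c' + Y) * s - (A * c + e) * (c * c' / s)) / s\<^sup>2 + \<mu> * (c' / (k * s)) / 2 = k * (X + Y) / s"
      if "s \<noteq> 0" "s\<^sup>2 = c\<^sup>2 - 1" "\<mu> * s\<^sup>2 = 2 * k\<^sup>2 * (A + e * c)" for X A c' Y s c e :: real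
    proof -
      have "\<mu> * (c' / (k * s)) / 2 = (\<mu> * s\<^sup>2) * c' / (2 * k * s ^ 3)" using that(1) by (simp add: power2_eq_square power3_eq_cube)
      also have "\<dots> = k * (A + e * c) * c' / s ^ 3" unfolding that(3) using k by (simp add: power2_eq_square)
      finally have 1: "\<mu> * (c' / (k * s)) / 2 = k * (A + e * c) * c' / s ^ 3" .
      have "k * ((X + A * c' + Y) * s - (A * c + e) * (c * c' / s)) / s\<^sup>2 = k * (X + Y) / s + k * c' * (A * (s\<^sup>2 - c\<^sup>2) - e * c) / s ^ 3"
        using that(1) by (simp add: power2_eq_square power3_eq_cube field_simps)
      also have "s\<^sup>2 - c\<^sup>2 = -1" using that(2) by simp
      finally show ?thesis unfolding 1 by (simp add: algebra_simps flip: add_divide_distrib diff_divide_distrib)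
    qed
    show ?thesis by (rule gen[of "SS x" "CC x" "N x + norm q" "2 * dd x"])
      (use SS S \<mu>S in \<open>auto simp: N_def dd_def\<close>)
  qed
  also have "\<dots> = - (inner_vel \<mu> k (g x) q \<bullet> g') / 2"
  proof -
    have "inner_vel \<mu> k (g x) q \<bullet> g' = 2 * k / (S * norm (g x)) * (m \<bullet> g' - C * I)"
      unfolding inner_vel_def by (simp add: inner_simps I_def)
    moreover have "m \<bullet> g' = - (norm (g x) * (2 * d'))"
      unfolding inner_m_def d'_def N_def I_def J_def using np d(1) by (simp add: inner_simps field_simps)
    ultimately show ?thesis unfolding SS N_def using np S by (simp add: field_simps)
  qed
  finally show ?thesis unfolding inner_action_def N_def CC_def dd_def SS_def sig_def .
qed

section \<open>Admissibility\<close>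

text \<open>Equality in the Cauchy-Schwarz inequality for p and -q. The right-hand side bounds 2 d^2
  away from 0, with d the quantity \<open>inner_d\<close> on which inner arcs depend.\<close>

lemma antipodal_iff:
  assumes "\<gamma> x \<noteq> 0" "\<gamma> y \<noteq> 0"
  shows "\<not> antipodal \<gamma> x y \<longleftrightarrow> 0 < norm (\<gamma> x) * norm (\<gamma> y) + \<gamma> x \<bullet> \<gamma> y"
proof -
  let ?p = "\<gamma> x" and ?q = "\<gamma> y"
  have nonneg: "0 \<le> norm ?p * norm ?q + ?p \<bullet> ?q"
    using Cauchy_Schwarz_ineq2[of ?p ?q] by linarith
  have "antipodal \<gamma> x y \<longleftrightarrow> norm ?p * norm ?q + ?p \<bullet> ?q = 0"
  proof
    assume "antipodal \<gamma> x y"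
    then obtain u where u: "0 \<le> u" "u \<le> 1" "(1 - u) *\<^sub>R ?p + u *\<^sub>R ?q = 0"
      unfolding antipodal_def closed_segment_def by auto
    have "u \<noteq> 0" using u assms by auto
    define r where "r = (1 - u) / u"
    have r: "0 \<le> r" using u by (simp add: r_def)
    have "?q = - (r *\<^sub>R ?p)"
    proof -
      have "(1 / u) *\<^sub>R ((1 - u) *\<^sub>R ?p + u *\<^sub>R ?q) = 0" using u by simp
      thus ?thesis using \<open>u \<noteq> 0\<close> by (simp add: scaleR_add_right r_def add_eq_0_iff)
    qed
    thus "norm ?p * norm ?q + ?p \<bullet> ?q = 0" using r by (simp add: dot_square_norm power2_eq_square)
  next
    assume "norm ?p * norm ?q + ?p \<bullet> ?q = 0"
    hence "?p \<bullet> - ?q = norm ?p * norm (- ?q)" by simp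
    hence "norm ?p *\<^sub>R (- ?q) = norm (- ?q) *\<^sub>R ?p" by (simp only: norm_cauchy_schwarz_eq)
    hence e: "norm ?q *\<^sub>R ?p + norm ?p *\<^sub>R ?q = 0" by (simp add: eq_neg_iff_add_eq_0[symmetric])
    define n where "n = norm ?p + norm ?q"
    have n: "0 < n" using assms by (simp add: n_def add_pos_pos)
    have "(1 - norm ?p / n) *\<^sub>R ?p + (norm ?p / n) *\<^sub>R ?q = (1 / n) *\<^sub>R (norm ?q *\<^sub>R ?p + norm ?p *\<^sub>R ?q)"
    proof -
      have "1 - norm ?p / n = norm ?q / n" using n by (simp add: n_def field_simps)
      thus ?thesis by (simp add: scaleR_add_right)
    qed
    hence "0 = (1 - norm ?p / n) *\<^sub>R ?p + (norm ?p / n) *\<^sub>R ?q" using e by simp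
    moreover have "0 \<le> norm ?p / n" "norm ?p / n \<le> 1" using n by (auto simp: n_def)
    ultimately show "antipodal \<gamma> x y" unfolding antipodal_def closed_segment_def by blast
  qed
  thus ?thesis using nonneg by linarith
qed

text \<open>Intervals around the central configurations on which all arcs are nearly radial.\<close>

locale billiard_intervals = arclength_domain +
  fixes \<omega> \<mu> E R2 \<kappa> :: real and m :: nat and a b \<alpha> \<beta> \<eta> \<rho> :: "nat \<Rightarrow> real"
  assumes \<omega>: "0 < \<omega>" and \<mu>: "0 < \<mu>" and E: "0 < E" and R2: "R2 = 2 * E / \<omega>\<^sup>2" and \<kappa>: "0 < \<kappa>"
    and hill: "\<And>x. x \<in> {0..L} \<Longrightarrow> (norm (\<gamma> x))\<^sup>2 < R2"
    and m2: "2 \<le> m"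
    and ends: "\<And>i. i \<in> {1..m} \<Longrightarrow> 0 \<le> a i \<and> a i < \<alpha> i \<and> \<alpha> i < \<beta> i \<and> \<beta> i < b i \<and> b i \<le> L"
    and disj: "disjoint_family_on (\<lambda>i. {a i<..<b i}) {1..m}"
    and radial: "\<And>i x. i \<in> {1..m} \<Longrightarrow> x \<in> {a i<..<b i} \<Longrightarrow> radial_point (\<eta> i) x"
    and pairs: "\<And>i x y. i \<in> {1..m} \<Longrightarrow> x \<in> {a i<..<b i} \<Longrightarrow> y \<in> {a i<..<b i} \<Longrightarrow>
      outer_pair R2 (\<rho> i) (\<gamma> x) (\<gamma> y) \<and> 2 / \<rho> i * norm (\<gamma> y - \<gamma> x) \<le> \<eta> i"
    and NA: "\<And>i j x y. i \<in> {1..m} \<Longrightarrow> j \<in> NA \<gamma> m a b i \<Longrightarrow> x \<in> {a i<..<b i} \<Longrightarrow> y \<in> {a j<..<b j} \<Longrightarrow>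
      \<kappa> \<le> norm (\<gamma> x) * norm (\<gamma> y) + \<gamma> x \<bullet> \<gamma> y"
    and NA_self: "\<And>i. i \<in> {1..m} \<Longrightarrow> i \<in> NA \<gamma> m a b i \<and> (\<exists>j\<in>NA \<gamma> m a b i. j \<noteq> i)"
    and slopes: "\<And>i. i \<in> {1..m} \<Longrightarrow> (\<gamma> (\<alpha> i) \<bullet> \<gamma>' (\<alpha> i)) * (\<gamma> (\<beta> i) \<bullet> \<gamma>' (\<beta> i)) < 0"
begin

lemma in_L: "i \<in> {1..m} \<Longrightarrow> x \<in> {a i<..<b i} \<Longrightarrow> x \<in> {0<..<L}"
  using radial by (auto simp: radial_point_def)

lemma in_L': "i \<in> {1..m} \<Longrightarrow> x \<in> {a i<..<b i} \<Longrightarrow> x \<in> {0..L}"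
  using in_L by (meson greaterThanLessThan_subseteq_atLeastAtMost_iff less_imp_le order_refl subsetD)

lemma in_ab: "i \<in> {1..m} \<Longrightarrow> x \<in> {\<alpha> i..\<beta> i} \<Longrightarrow> x \<in> {a i<..<b i}"
  using ends[of i] by auto

lemma NA_mem: "j \<in> NA \<gamma> m a b i \<Longrightarrow> j \<in> {1..m}"
  by (simp add: NA_def)

lemma NA_commute: "i \<in> {1..m} \<Longrightarrow> j \<in> NA \<gamma> m a b i \<Longrightarrow> i \<in> NA \<gamma> m a b j"
  unfolding NA_def not_antipodal_sets_def antipodal_def using closed_segment_commute by fastforce

lemma \<eta>: "i \<in> {1..m} \<Longrightarrow> 0 < \<eta> i"
  using radial[of i "\<alpha> i"] ends[of i] by (auto simp: radial_point_def)

abbreviation "nrm \<equiv> outward_normal D L \<gamma>"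

text \<open>The case u = 0 of \<open>radial_point\<close>. It supplies the assumption of
  \<open>is_inner_arc\<close> that distinct end points are not on a common ray.\<close>

lemma same_ray:
  assumes "i \<in> {1..m}" "x \<in> {a i<..<b i}" "y \<in> {0..L}" "0 < r" "\<gamma> y = r *\<^sub>R \<gamma> x"
  shows "\<gamma> y = \<gamma> x"
proof -
  have cone: "\<And>t. 0 < t \<Longrightarrow> t \<le> 1 \<Longrightarrow> \<gamma> x - t *\<^sub>R \<gamma> x \<in> D" "\<And>t. 0 < t \<Longrightarrow> \<gamma> x + t *\<^sub>R \<gamma> x \<notin> closure D"
    using radial[OF assms(1,2)] unfolding radial_point_def
    by (metis add_0_right less_imp_le norm_zero)+
  have "\<gamma> y \<in> frontier D" using on_frontier assms(3) .
  hence f: "\<gamma> y \<notin> D" "\<gamma> y \<in> closure D" using frontier_disjoint by (auto simp: frontier_def)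
  consider "r < 1" | "r = 1" | "1 < r" by linarith
  thus ?thesis
  proof cases
    case 1
    have "\<gamma> y = \<gamma> x - (1 - r) *\<^sub>R \<gamma> x" using assms(5) by (simp add: algebra_simps)
    thus ?thesis using cone(1)[of "1 - r"] 1 assms(4) f by simp
  next
    case 3
    have "\<gamma> y = \<gamma> x + (r - 1) *\<^sub>R \<gamma> x" using assms(5) by (simp add: algebra_simps)
    thus ?thesis using cone(2)[of "r - 1"] 3 f by simp
  qed (use assms in simp)
qed

lemma outer_arcs: "i \<in> {1..m} \<Longrightarrow> x \<in> {a i<..<b i} \<Longrightarrow> y \<in> {a i<..<b i} \<Longrightarrow> outer_arcs \<omega> E R2 (\<rho> i) (\<gamma> x) (\<gamma> y)"
  using pairs \<omega> E R2 by unfold_locales blast+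

lemma outer_outside:
  assumes "i \<in> {1..m}" "x \<in> {a i<..<b i}" "y \<in> {a i<..<b i}"
    and t: "0 < t" "t < outer_time \<omega> R2 (\<gamma> x) (\<gamma> y)"
  shows "osc \<omega> (\<gamma> x) (outer_vel \<omega> R2 (\<gamma> x) (\<gamma> y)) t \<notin> closure D"
proof -
  interpret outer_arcs \<omega> E R2 "\<rho> i" "\<gamma> x" "\<gamma> y" by (rule outer_arcs[OF assms(1-3)])
  have close: "2 / \<rho> i * norm (\<gamma> y - \<gamma> x) \<le> \<eta> i" using pairs[OF assms(1-3)] by blast
  obtain r u where "0 < r" "norm u \<le> \<eta> i"
    "osc \<omega> (\<gamma> x) (outer_vel \<omega> R2 (\<gamma> x) (\<gamma> y)) t = \<gamma> x + r *\<^sub>R (\<gamma> x + u) \<or>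
     osc \<omega> (\<gamma> x) (outer_vel \<omega> R2 (\<gamma> x) (\<gamma> y)) t = \<gamma> y + r *\<^sub>R (\<gamma> y + u)"
    by (rule osc_radial[OF t close])
  thus ?thesis using radial[OF assms(1,2)] radial[OF assms(1,3)] unfolding radial_point_def by metis
qed

text \<open>With p and q the images of x and y, the velocity is a positive multiple of q - c p = (1
  - c) p + (q - p); as 1 - c \<ge> \<rho>, the radial part dominates the short chord.\<close>

lemma outer_vel_normal:
  assumes "i \<in> {1..m}" "x \<in> {a i<..<b i}" "y \<in> {a i<..<b i}"
  shows "0 < nrm x \<bullet> outer_vel \<omega> R2 (\<gamma> x) (\<gamma> y)"
proof -
  interpret outer_arcs \<omega> E R2 "\<rho> i" "\<gamma> x" "\<gamma> y" by (rule outer_arcs[OF assms(1-3)])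
  note n = radial_normal[OF radial[OF assms(1,2)]]
  have close: "norm (\<gamma> y - \<gamma> x) \<le> \<eta> i * \<rho> i / 2" using pairs[OF assms(1-3)] \<rho> by (simp add: field_simps)
  have "\<bar>nrm x \<bullet> (\<gamma> y - \<gamma> x)\<bar> \<le> norm (\<gamma> y - \<gamma> x)"
    using Cauchy_Schwarz_ineq2[of "nrm x" "\<gamma> y - \<gamma> x"] n(1) by simp
  moreover have "\<eta> i * \<rho> i / 2 < \<rho> i * (nrm x \<bullet> \<gamma> x)"
  proof -
    have "\<eta> i * \<rho> i / 2 < \<rho> i * \<eta> i" using \<rho> \<eta>[OF assms(1)] by simp
    also have "\<dots> \<le> \<rho> i * (nrm x \<bullet> \<gamma> x)" using n(3) \<rho> by (intro mult_left_mono) auto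
    finally show ?thesis .
  qed
  moreover have "\<rho> i * (nrm x \<bullet> \<gamma> x) \<le> (1 - c) * (nrm x \<bullet> \<gamma> x)"
    using c n(3) \<eta>[OF assms(1)] by (intro mult_right_mono) auto
  ultimately have "0 < (1 - c) * (nrm x \<bullet> \<gamma> x) + nrm x \<bullet> (\<gamma> y - \<gamma> x)" using close by linarith
  also have "\<dots> = nrm x \<bullet> (\<gamma> y - c *\<^sub>R \<gamma> x)" by (simp add: inner_diff_right algebra_simps)
  finally show ?thesis unfolding outer_vel_def using \<omega> s by simp
qed

lemma outer_vel_bound:
  assumes "i \<in> {1..m}" "x \<in> {a i<..<b i}" "y \<in> {a i<..<b i}"
  shows "norm (outer_vel \<omega> R2 (\<gamma> x) (\<gamma> y)) \<le> sqrt (2 * E)"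
proof -
  interpret outer_arcs \<omega> E R2 "\<rho> i" "\<gamma> x" "\<gamma> y" by (rule outer_arcs[OF assms(1-3)])
  have "(norm v)\<^sup>2 \<le> 2 * E" using v_energy unfolding V_outer_def by simp
  thus ?thesis by (rule real_le_rsqrt)
qed

definition TE :: "real \<Rightarrow> real \<Rightarrow> real" where "TE x y = outer_time \<omega> R2 (\<gamma> x) (\<gamma> y)"

lemma outer_property:
  assumes i: "i \<in> {1..m}"
  shows "outer_arc_property \<omega> E D \<gamma> TE (a i) (b i)"
  unfolding outer_arc_property_def
proof
  let ?I = "{a i<..<b i}"
  have sub: "?I \<subseteq> {0..L}" using in_L'[OF i] by blast
  have c1: "continuous_on (?I \<times> ?I) (\<lambda>z. \<gamma> (fst z))" and c2: "continuous_on (?I \<times> ?I) (\<lambda>z. \<gamma> (snd z))"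
    by (intro continuous_on_compose2[OF continuous_on_subset[OF cont sub]] continuous_intros; auto)+
  have R2p: "R2 \<noteq> 0" using R2 E \<omega> by simp
  have cc: "continuous_on (?I \<times> ?I) (\<lambda>z. outer_cos R2 (\<gamma> (fst z)) (\<gamma> (snd z)))"
    unfolding outer_cos_def outer_disc_def by (intro continuous_intros c1 c2) (use R2p in auto)
  have "continuous_on (?I \<times> ?I) (\<lambda>z. outer_time \<omega> R2 (\<gamma> (fst z)) (\<gamma> (snd z)))"
    unfolding outer_time_def
  proof (intro continuous_intros cc ballI)
    fix z assume "z \<in> ?I \<times> ?I"
    hence "fst z \<in> ?I" "snd z \<in> ?I" by auto
    then interpret outer_arcs \<omega> E R2 "\<rho> i" "\<gamma> (fst z)" "\<gamma> (snd z)" by (rule outer_arcs[OF i])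
    show "-1 \<le> c \<and> c \<le> 1" using c by auto
  qed (use \<omega> in auto)
  thus "continuous_on (?I \<times> ?I) (\<lambda>(x, y). TE x y)" by (simp add: TE_def case_prod_unfold)
  have i0: "\<alpha> i \<in> ?I" using ends[OF i] by auto
  interpret o: outer_arcs \<omega> E R2 "\<rho> i" "\<gamma> (\<alpha> i)" "\<gamma> (\<alpha> i)" by (rule outer_arcs[OF i i0 i0])
  show "\<exists>\<delta>>0. \<forall>x\<in>?I. \<forall>y\<in>?I. \<exists>z. outer_arc \<omega> E D (\<gamma> x) (\<gamma> y) (TE x y) z \<and>
      (\<forall>T' z'. outer_arc \<omega> E D (\<gamma> x) (\<gamma> y) T' z' \<and> \<bar>T' - TE x y\<bar> < \<delta> \<longrightarrow> T' = TE x y \<and> (\<forall>s\<in>{0..T'}. z' s = z s))"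
  proof (intro exI[of _ "min (\<rho> i) (arccos (1 - \<rho> i)) / \<omega>"] conjI ballI)
    have "\<rho> i \<le> 1" using o.c by linarith
    hence "0 < arccos (1 - \<rho> i)" using arccos_lt_bounded[of "1 - \<rho> i"] o.\<rho> by simp
    thus "0 < min (\<rho> i) (arccos (1 - \<rho> i)) / \<omega>" using o.\<rho> \<omega> by simp
    fix x y assume xy: "x \<in> ?I" "y \<in> ?I"
    interpret outer_arcs \<omega> E R2 "\<rho> i" "\<gamma> x" "\<gamma> y" by (rule outer_arcs[OF i xy])
    show "\<exists>z. outer_arc \<omega> E D (\<gamma> x) (\<gamma> y) (TE x y) z \<and>
      (\<forall>T' z'. outer_arc \<omega> E D (\<gamma> x) (\<gamma> y) T' z' \<and> \<bar>T' - TE x y\<bar> < min (\<rho> i) (arccos (1 - \<rho> i)) / \<omega> \<longrightarrow> T' = TE x y \<and> (\<forall>s\<in>{0..T'}. z' s = z s))"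
    proof (intro exI[of _ "osc \<omega> (\<gamma> x) v"] conjI allI impI)
      show "outer_arc \<omega> E D (\<gamma> x) (\<gamma> y) (TE x y) (osc \<omega> (\<gamma> x) v)" unfolding TE_def
        by (rule is_outer_arc) (use outer_outside[OF i xy] closure_subset in blast)
      fix T' z' assume *: "outer_arc \<omega> E D (\<gamma> x) (\<gamma> y) T' z' \<and> \<bar>T' - TE x y\<bar> < min (\<rho> i) (arccos (1 - \<rho> i)) / \<omega>"
      show "T' = TE x y" "\<forall>s\<in>{0..T'}. z' s = osc \<omega> (\<gamma> x) v s"
        using outer_arc_unique[of D T' z'] * unfolding TE_def by auto
    qed
  qed
qed

text \<open>The choice in \<open>S_outer\<close> is harmless: every outer arc with this travel time
  has the length given by \<open>outer_jacobi\<close>.\<close>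

lemma outer_S_deriv:
  assumes i: "i \<in> {1..m}" and xe: "x \<in> {a i<..<b i}" "e \<in> {a i<..<b i}"
  shows "((\<lambda>x. S_outer \<omega> E D \<gamma> TE e x) has_real_derivative (- outer_vel \<omega> R2 (\<gamma> x) (\<gamma> e)) \<bullet> \<gamma>' x / sqrt 2) (at x)"
proof (rule has_field_derivative_transform_within_open[where S = "{a i<..<b i}"])
  show "((\<lambda>x. outer_action \<omega> E R2 (\<gamma> e) (\<gamma> x) / sqrt 2) has_real_derivative (- outer_vel \<omega> R2 (\<gamma> x) (\<gamma> e)) \<bullet> \<gamma>' x / sqrt 2) (at x)"
    by (rule DERIV_cdivide, rule outer_action_deriv[OF outer_arcs[OF i xe(2,1)] deriv_at[OF in_L[OF i xe(1)]]])
  fix y assume y: "y \<in> {a i<..<b i}"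
  interpret outer_arcs \<omega> E R2 "\<rho> i" "\<gamma> e" "\<gamma> y" by (rule outer_arcs[OF i xe(2) y])
  have "outer_arc \<omega> E D (\<gamma> e) (\<gamma> y) T (osc \<omega> (\<gamma> e) v)"
    by (rule is_outer_arc) (use outer_outside[OF i xe(2) y] closure_subset in blast)
  hence "outer_arc \<omega> E D (\<gamma> e) (\<gamma> y) T (SOME z. outer_arc \<omega> E D (\<gamma> e) (\<gamma> y) T z)"
    by (rule someI[where P = "outer_arc \<omega> E D (\<gamma> e) (\<gamma> y) T"])
  from outer_jacobi[OF this] show "outer_action \<omega> E R2 (\<gamma> e) (\<gamma> y) / sqrt 2 = S_outer \<omega> E D \<gamma> TE e y"
    unfolding S_outer_def TE_def by simp
qed (use xe in auto)

definition kin :: "real \<Rightarrow> real" where "kin h = sqrt ((E + h) / 2)"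

text \<open>Uniform lower bounds for \<open>C = cosh (k \<sigma>)\<close> make the inner arcs nearly radial and let them dominate
  the change-sign expression.\<close>

definition large :: "real \<Rightarrow> bool" where
  "large h \<longleftrightarrow> 0 < h \<and>
    (\<forall>i\<in>{1..m}. \<forall>j\<in>NA \<gamma> m a b i. \<forall>x\<in>{a i<..<b i}. \<forall>y\<in>{a j<..<b j}.
       2 * (3 * sqrt R2)\<^sup>2 \<le> (min (\<eta> i) (\<eta> j))\<^sup>2 * inner_C \<mu> (kin h) (\<gamma> x) (\<gamma> y) \<and>
       sqrt R2 < \<eta> i * inner_C \<mu> (kin h) (\<gamma> x) (\<gamma> y) \<and>
       (\<forall>z\<in>{\<alpha> i, \<beta> i}. 2 * sqrt R2 \<le> \<bar>\<gamma> z \<bullet> \<gamma>' z\<bar> * inner_C \<mu> (kin h) (\<gamma> x) (\<gamma> y)) \<and>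
       (\<forall>z\<in>{\<alpha> i, \<beta> i}. sqrt (2 * E) * sqrt R2 < kin h * \<bar>\<gamma> z \<bullet> \<gamma>' z\<bar>))"

lemma R: "0 < sqrt R2" "x \<in> {0..L} \<Longrightarrow> norm (\<gamma> x) \<le> sqrt R2" "0 < R2"
proof -
  show r: "0 < R2" using R2 E \<omega> by simp
  thus "0 < sqrt R2" by simp
  show "norm (\<gamma> x) \<le> sqrt R2" if "x \<in> {0..L}" using hill[OF that] by (intro real_le_rsqrt) simp
qed

lemma slope_nz: "i \<in> {1..m} \<Longrightarrow> z \<in> {\<alpha> i, \<beta> i} \<Longrightarrow> 0 < \<bar>\<gamma> z \<bullet> \<gamma>' z\<bar>"
  using slopes[of i] by auto

lemma inner_arcs:
  assumes "i \<in> {1..m}" "j \<in> NA \<gamma> m a b i" "x \<in> {a i<..<b i}" "y \<in> {a j<..<b j}" "0 < h"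
  shows "inner_arcs \<mu> (kin h) (\<gamma> x) (\<gamma> y)"
proof
  show "0 < kin h" using assms E by (simp add: kin_def)
  show "0 < norm (\<gamma> x) * norm (\<gamma> y) + \<gamma> x \<bullet> \<gamma> y" using NA[OF assms(1-4)] \<kappa> by linarith
qed (use \<mu> nonzero in_L'[OF assms(1,3)] in_L'[OF NA_mem[OF assms(2)] assms(4)] in auto)

lemma kin_sq: "0 < h \<Longrightarrow> E + h = 2 * (kin h)\<^sup>2"
  using E by (simp add: kin_def)

text \<open>C is at least 4 k^2 d / \<mu>, where d \<ge> sqrt (\<kappa> / 2) by the uniform bound on
  non-antipodal pairs and 2 k^2 = E + h. \<open>A0\<close> collects the thresholds for C and
  \<open>B0\<close> those for k over all indices; two of the entries of \<open>h0\<close> make C and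
  k exceed them.\<close>

lemma eventually_large: "\<exists>h0>0. \<forall>h>h0. large h"
proof -
  define A where "A = (\<lambda>i j. Max {2 * (3 * sqrt R2)\<^sup>2 / (min (\<eta> i) (\<eta> j))\<^sup>2, 2 * sqrt R2 / \<eta> i,
    2 * sqrt R2 / \<bar>\<gamma> (\<alpha> i) \<bullet> \<gamma>' (\<alpha> i)\<bar>, 2 * sqrt R2 / \<bar>\<gamma> (\<beta> i) \<bullet> \<gamma>' (\<beta> i)\<bar>, 1})"
  define B where "B = (\<lambda>i. max (sqrt (2 * E) * sqrt R2 / \<bar>\<gamma> (\<alpha> i) \<bullet> \<gamma>' (\<alpha> i)\<bar>) (sqrt (2 * E) * sqrt R2 / \<bar>\<gamma> (\<beta> i) \<bullet> \<gamma>' (\<beta> i)\<bar>))"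
  define A0 where "A0 = Max ((\<lambda>(i, j). A i j) ` ({1..m} \<times> {1..m}))"
  define B0 where "B0 = Max (B ` {1..m})"
  have A0: "A i j \<le> A0" if "i \<in> {1..m}" "j \<in> {1..m}" for i j
    unfolding A0_def by (rule Max_ge) (use that in auto)
  have B0: "B i \<le> B0" if "i \<in> {1..m}" for i unfolding B0_def by (rule Max_ge) (use that in auto)
  define h0 where "h0 = max 1 (max (A0 * \<mu> / (2 * sqrt (\<kappa> / 2))) (2 * B0\<^sup>2))"
  show ?thesis
  proof (intro exI[of _ h0] conjI allI impI)
    show "0 < h0" by (simp add: h0_def)
    fix h assume h: "h0 < h"
    have h1: "0 < h" "A0 * \<mu> / (2 * sqrt (\<kappa> / 2)) < h" "2 * B0\<^sup>2 < h" using h by (auto simp: h0_def)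
    have kB: "B0 < kin h"
    proof -
      have "B0\<^sup>2 < (E + h) / 2" using h1(3) E by argo
      hence "\<bar>B0\<bar> < kin h" unfolding kin_def by (metis real_sqrt_abs real_sqrt_less_iff)
      thus ?thesis by linarith
    qed
    show "large h" unfolding large_def
    proof (intro conjI ballI h1)
      fix i j x y assume ij: "i \<in> {1..m}" "j \<in> NA \<gamma> m a b i" "x \<in> {a i<..<b i}" "y \<in> {a j<..<b j}"
      interpret inner_arcs \<mu> "kin h" "\<gamma> x" "\<gamma> y" by (rule inner_arcs[OF ij h1(1)])
      have j: "j \<in> {1..m}" using ij(2) by (rule NA_mem)
      have sk: "0 < sqrt (\<kappa> / 2)" using \<kappa> by simp
      have dk: "sqrt (\<kappa> / 2) \<le> d" unfolding inner_d_def using NA[OF ij] by (intro real_sqrt_le_mono) simp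
      have "A0 * \<mu> < h * (2 * sqrt (\<kappa> / 2))" using h1(2) sk by (simp add: divide_less_eq)
      also have "\<dots> \<le> (E + h) * (2 * d)" using h1 E dk sk by (intro mult_mono) auto
      also have "\<dots> = 4 * (kin h)\<^sup>2 * d" unfolding kin_sq[OF h1(1)] by simp
      also have "\<dots> \<le> \<mu> * C" by (rule C)
      finally have AC: "A0 < C" using \<mu> by (simp add: mult.commute)
      have Ai: "X \<le> C" if "X \<in> {2 * (3 * sqrt R2)\<^sup>2 / (min (\<eta> i) (\<eta> j))\<^sup>2, 2 * sqrt R2 / \<eta> i,
          2 * sqrt R2 / \<bar>\<gamma> (\<alpha> i) \<bullet> \<gamma>' (\<alpha> i)\<bar>, 2 * sqrt R2 / \<bar>\<gamma> (\<beta> i) \<bullet> \<gamma>' (\<beta> i)\<bar>, 1}" for X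
      proof -
        have "X \<le> A i j" unfolding A_def by (rule Max_ge) (use that in auto)
        thus ?thesis using A0[OF ij(1) j] AC by linarith
      qed
      have \<eta>2: "0 < \<eta> i" "0 < min (\<eta> i) (\<eta> j)" using \<eta> ij(1) j by auto
      have "2 * (3 * sqrt R2)\<^sup>2 / (min (\<eta> i) (\<eta> j))\<^sup>2 \<le> C" by (rule Ai) simp
      thus "2 * (3 * sqrt R2)\<^sup>2 \<le> (min (\<eta> i) (\<eta> j))\<^sup>2 * C"
        using \<eta>2(2) by (simp only: divide_le_eq zero_less_power mult.commute if_True)
      have "2 * sqrt R2 / \<eta> i \<le> C" by (rule Ai) simp
      hence "2 * sqrt R2 \<le> \<eta> i * C" using \<eta>2 by (simp add: divide_le_eq mult.commute)
      thus "sqrt R2 < \<eta> i * C" using R(1) by linarith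
      fix z assume z: "z \<in> {\<alpha> i, \<beta> i}"
      have nz: "0 < \<bar>\<gamma> z \<bullet> \<gamma>' z\<bar>" by (rule slope_nz[OF ij(1) z])
      have "2 * sqrt R2 / \<bar>\<gamma> z \<bullet> \<gamma>' z\<bar> \<le> C" by (rule Ai) (use z in auto)
      thus "2 * sqrt R2 \<le> \<bar>\<gamma> z \<bullet> \<gamma>' z\<bar> * C" using nz by (simp only: divide_le_eq mult.commute if_True)
      have "sqrt (2 * E) * sqrt R2 / \<bar>\<gamma> z \<bullet> \<gamma>' z\<bar> \<le> B i" using z unfolding B_def by auto
      hence "sqrt (2 * E) * sqrt R2 / \<bar>\<gamma> z \<bullet> \<gamma>' z\<bar> < kin h" using B0[OF ij(1)] kB by linarith
      thus "sqrt (2 * E) * sqrt R2 < kin h * \<bar>\<gamma> z \<bullet> \<gamma>' z\<bar>" using nz by (simp only: divide_less_eq if_True)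
    qed
  qed
qed

section \<open>Inner arcs between two given boundary parameters at large energy\<close>

context
  fixes h i j x y
  assumes large: "large h" and ij: "i \<in> {1..m}" "j \<in> NA \<gamma> m a b i" "x \<in> {a i<..<b i}" "y \<in> {a j<..<b j}"
begin

interpretation I: inner_arcs \<mu> "kin h" "\<gamma> x" "\<gamma> y"
  by (rule inner_arcs[OF ij]) (use large in \<open>simp add: large_def\<close>)

lemma jm: "j \<in> {1..m}" using ij(2) by (rule NA_mem)

lemma xyL: "x \<in> {0..L}" "y \<in> {0..L}" using in_L'[OF ij(1,3)] in_L'[OF jm ij(4)] .

text \<open>In this order: arcs stay in D; they leave the boundary transversally; at the ends of
  [\<alpha> i, \<beta> i] the term with C dominates \<open>inner_m\<close> in the tangential
  velocity; there the inner part dominates the outer speed.\<close>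

lemma largeD:
  "2 * (3 * sqrt R2)\<^sup>2 \<le> (min (\<eta> i) (\<eta> j))\<^sup>2 * I.C" "sqrt R2 < \<eta> i * I.C"
  "z \<in> {\<alpha> i, \<beta> i} \<Longrightarrow> 2 * sqrt R2 \<le> \<bar>\<gamma> z \<bullet> \<gamma>' z\<bar> * I.C"
  "z \<in> {\<alpha> i, \<beta> i} \<Longrightarrow> sqrt (2 * E) * sqrt R2 < kin h * \<bar>\<gamma> z \<bullet> \<gamma>' z\<bar>"
  using large ij unfolding large_def by blast+

lemma norm_m_le: "norm (inner_m (\<gamma> x) (\<gamma> y)) \<le> sqrt R2"
  unfolding I.norm_m using mult_mono[OF R(2)[OF xyL(1)] R(2)[OF xyL(2)]] R by (intro real_sqrt_le_mono) auto

text \<open>(cosh (k \<sigma> / 2))^2 = (C + 1) / 2 turns the bound on C into the hypothesis of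
  \<open>hyp_radial\<close>, with the smaller of the two cone sizes.\<close>

lemma inner_inside:
  assumes "0 < \<tau>" "\<tau> < I.\<sigma>"
  shows "(hyp (kin h) (inner_arcs.a (\<gamma> x)) (inner_arcs.w \<mu> (kin h) (\<gamma> x) (\<gamma> y)) \<tau>)\<^sup>2 \<in> D"
proof -
  define e where "e = min (\<eta> i) (\<eta> j)"
  have e: "0 < e" "e \<le> \<eta> i" "e \<le> \<eta> j" using \<eta>[OF ij(1)] \<eta>[OF jm] by (auto simp: e_def)
  have ch: "0 \<le> cosh (kin h * I.\<sigma> / 2)" by simp
  have "3 * sqrt R2 \<le> e * cosh (kin h * I.\<sigma> / 2)"
  proof (rule power2_le_imp_le)
    have "(3 * sqrt R2)\<^sup>2 \<le> e\<^sup>2 * (I.C / 2)" using largeD(1) unfolding e_def by simp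
    also have "\<dots> \<le> e\<^sup>2 * (cosh (kin h * I.\<sigma> / 2))\<^sup>2" unfolding I.cosh_half by (intro mult_left_mono) auto
    finally show "(3 * sqrt R2)\<^sup>2 \<le> (e * cosh (kin h * I.\<sigma> / 2))\<^sup>2" by (simp add: power_mult_distrib)
  qed (use e ch in simp)
  then obtain t u where "0 < t" "t \<le> 1" "norm u \<le> e"
    "(hyp (kin h) I.a I.w \<tau>)\<^sup>2 = \<gamma> x - t *\<^sub>R (\<gamma> x + u) \<or> (hyp (kin h) I.a I.w \<tau>)\<^sup>2 = \<gamma> y - t *\<^sub>R (\<gamma> y + u)"
    by (rule I.hyp_radial[OF assms R(2)[OF xyL(1)] R(2)[OF xyL(2)] _ e(1)])
  moreover have "norm u \<le> \<eta> i" "norm u \<le> \<eta> j" using calculation(3) e by auto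
  ultimately show ?thesis
    using radial[OF ij(1,3)] radial[OF jm ij(4)] unfolding radial_point_def by metis
qed

lemma inner_ray: "0 < r \<Longrightarrow> \<gamma> y = r *\<^sub>R \<gamma> x \<Longrightarrow> \<gamma> y = \<gamma> x"
  using same_ray[OF ij(1,3) xyL(2)] .

lemma hpos: "0 < h" using large by (simp add: large_def)

lemma inner_arc_T: "inner_arc \<mu> E h D (\<gamma> x) (\<gamma> y) I.T I.z"
  by (rule I.is_inner_arc[OF inner_ray kin_sq[OF hpos] inner_inside])

lemma inner_arc_ex1:
  "\<exists>T z. inner_arc \<mu> E h D (\<gamma> x) (\<gamma> y) T z \<and>
    (\<forall>T' z'. inner_arc \<mu> E h D (\<gamma> x) (\<gamma> y) T' z' \<longrightarrow> T' = T \<and> (\<forall>s\<in>{0..T}. z' s = z s))"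
  using inner_arc_T I.inner_arc_lc_unique[OF kin_sq[OF hpos]] by blast

lemma S_inner_eq: "S_inner \<mu> E D \<gamma> x y h = sqrt 2 * inner_action \<mu> (kin h) (\<gamma> x) (\<gamma> y)"
proof -
  define Tz where "Tz = (SOME (T, z). inner_arc \<mu> E h D (\<gamma> x) (\<gamma> y) T z)"
  have "case Tz of (T, z) \<Rightarrow> inner_arc \<mu> E h D (\<gamma> x) (\<gamma> y) T z"
    unfolding Tz_def by (rule someI[of _ "(I.T, I.z)"]) (use inner_arc_T in simp)
  thus ?thesis unfolding S_inner_def Tz_def[symmetric]
    using I.inner_jacobi[OF kin_sq[OF hpos]] by (auto simp: case_prod_unfold Let_def)
qed

text \<open>With p = \<open>\<gamma> x\<close>, the velocity is a positive multiple of m - C p, and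
  C times the normal part of p exceeds |m|.\<close>

lemma inner_vel_normal: "nrm x \<bullet> inner_vel \<mu> (kin h) (\<gamma> x) (\<gamma> y) < 0"
proof -
  note n = radial_normal[OF radial[OF ij(1,3)]]
  have "nrm x \<bullet> I.m \<le> sqrt R2" using norm_cauchy_schwarz[of "nrm x" I.m] n(1) norm_m_le by simp
  moreover have "\<eta> i * I.C \<le> (nrm x \<bullet> \<gamma> x) * I.C" using n(3) I.C(2) by (intro mult_right_mono) auto
  ultimately have "nrm x \<bullet> (I.m - I.C *\<^sub>R \<gamma> x) < 0"
    using largeD(2) by (simp add: inner_diff_right mult.commute)
  moreover have "0 < 2 * kin h / (I.S * norm (\<gamma> x))" using I.k I.S I.pq by simp
  ultimately show ?thesis unfolding inner_vel_def inner_scaleR_right by (intro mult_pos_neg)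
qed

text \<open>With g = \<open>\<gamma> x \<bullet> \<gamma>' x\<close>, the inner part is P (C g - m .
  t) for the unit tangent t at x. Since |m . t| is at most sqrt R2, it has the sign of g and exceeds
  the outer speed in size. The sign thus depends on x alone, not on the neighbouring points e and
  y.\<close>

lemma slope_sign:
  assumes x: "x \<in> {\<alpha> i, \<beta> i}" and e: "e \<in> {a i<..<b i}"
  shows "0 < ((- outer_vel \<omega> R2 (\<gamma> x) (\<gamma> e) - inner_vel \<mu> (kin h) (\<gamma> x) (\<gamma> y)) \<bullet> \<gamma>' x) * (\<gamma> x \<bullet> \<gamma>' x)"
proof -
  define g where "g = \<gamma> x \<bullet> \<gamma>' x"
  have g: "0 < \<bar>g\<bar>" unfolding g_def by (rule slope_nz[OF ij(1) x])
  have u: "norm (\<gamma>' x) = 1" by (rule unit[OF xyL(1)])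
  have np: "0 < norm (\<gamma> x)" "norm (\<gamma> x) \<le> sqrt R2" using I.pq R(2)[OF xyL(1)] by auto
  have o: "\<bar>outer_vel \<omega> R2 (\<gamma> x) (\<gamma> e) \<bullet> \<gamma>' x\<bar> \<le> sqrt (2 * E)"
    using Cauchy_Schwarz_ineq2[of "outer_vel \<omega> R2 (\<gamma> x) (\<gamma> e)" "\<gamma>' x"] outer_vel_bound[OF ij(1,3) e] u by simp
  have mg: "\<bar>I.m \<bullet> \<gamma>' x\<bar> \<le> sqrt R2"
    using Cauchy_Schwarz_ineq2[of I.m "\<gamma>' x"] norm_m_le u by simp
  define P where "P = 2 * kin h / (I.S * norm (\<gamma> x))"
  have P: "0 < P" unfolding P_def using I.k I.S np by simp
  \<comment> \<open>S < C removes S from the denominator of P, and half of |g| C absorbs sqrt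
    R2.\<close>
  have "kin h * \<bar>g\<bar> / norm (\<gamma> x) \<le> P * (\<bar>g\<bar> * I.C - sqrt R2)"
  proof -
    have "kin h * \<bar>g\<bar> / norm (\<gamma> x) = P * (\<bar>g\<bar> * I.S / 2)" unfolding P_def using I.S np by simp
    also have "\<dots> \<le> P * (\<bar>g\<bar> * I.C / 2)" using P I.S g by (intro mult_left_mono) auto
    also have "\<dots> \<le> P * (\<bar>g\<bar> * I.C - sqrt R2)" using P largeD(3)[OF x] unfolding g_def by (intro mult_left_mono) auto
    finally show ?thesis .
  qed
  moreover have "sqrt (2 * E) < kin h * \<bar>g\<bar> / norm (\<gamma> x)"
  proof -
    have "sqrt (2 * E) * norm (\<gamma> x) \<le> sqrt (2 * E) * sqrt R2" using np E by (intro mult_left_mono) auto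
    also have "\<dots> < kin h * \<bar>g\<bar>" using largeD(4)[OF x] unfolding g_def .
    finally show ?thesis using np by (simp add: less_divide_eq)
  qed
  ultimately have main: "sqrt (2 * E) < P * (\<bar>g\<bar> * I.C - sqrt R2)" by linarith
  have iv: "- (inner_vel \<mu> (kin h) (\<gamma> x) (\<gamma> y) \<bullet> \<gamma>' x) = P * (I.C * g - I.m \<bullet> \<gamma>' x)"
    unfolding inner_vel_def P_def g_def by (simp add: inner_simps algebra_simps)
  have "\<bar>g\<bar> * (P * (\<bar>g\<bar> * I.C - sqrt R2) - sqrt (2 * E)) \<le>
     (P * (I.C * g - I.m \<bullet> \<gamma>' x) - outer_vel \<omega> R2 (\<gamma> x) (\<gamma> e) \<bullet> \<gamma>' x) * g"
  proof -
    define M where "M = I.m \<bullet> \<gamma>' x"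
    define Q where "Q = outer_vel \<omega> R2 (\<gamma> x) (\<gamma> e) \<bullet> \<gamma>' x"
    have a: "P * (M * g) \<le> P * (sqrt R2 * \<bar>g\<bar>)"
    proof -
      have "M * g \<le> \<bar>M\<bar> * \<bar>g\<bar>" by (simp flip: abs_mult)
      also have "\<dots> \<le> sqrt R2 * \<bar>g\<bar>" using mg by (intro mult_right_mono) (auto simp: M_def)
      finally show ?thesis using P by simp
    qed
    have b: "Q * g \<le> sqrt (2 * E) * \<bar>g\<bar>"
    proof -
      have "Q * g \<le> \<bar>Q\<bar> * \<bar>g\<bar>" by (simp flip: abs_mult)
      also have "\<dots> \<le> sqrt (2 * E) * \<bar>g\<bar>" using o by (intro mult_right_mono) (auto simp: Q_def)
      finally show ?thesis .
    qed
    have "\<bar>g\<bar> * (P * (\<bar>g\<bar> * I.C)) = P * I.C * (g * g)" by simp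
    thus ?thesis using a b unfolding M_def[symmetric] Q_def[symmetric] by (simp add: algebra_simps)
  qed
  moreover have "0 < \<bar>g\<bar> * (P * (\<bar>g\<bar> * I.C - sqrt R2) - sqrt (2 * E))" using g main by simp
  moreover have "(- outer_vel \<omega> R2 (\<gamma> x) (\<gamma> e) - inner_vel \<mu> (kin h) (\<gamma> x) (\<gamma> y)) \<bullet> \<gamma>' x =
      P * (I.C * g - I.m \<bullet> \<gamma>' x) - outer_vel \<omega> R2 (\<gamma> x) (\<gamma> e) \<bullet> \<gamma>' x"
    unfolding iv[symmetric] by (simp add: inner_diff_left)
  ultimately show ?thesis unfolding g_def[symmetric] by simp
qed

end

lemma inner_S_deriv:
  assumes "large h" "i \<in> {1..m}" "j \<in> NA \<gamma> m a b i" "x \<in> {a i<..<b i}" "y \<in> {a j<..<b j}"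
  shows "((\<lambda>x. S_inner \<mu> E D \<gamma> x y h) has_real_derivative - (inner_vel \<mu> (kin h) (\<gamma> x) (\<gamma> y) \<bullet> \<gamma>' x) / sqrt 2) (at x)"
proof (rule has_field_derivative_transform_within_open[where S = "{a i<..<b i}"])
  have "inner_arcs \<mu> (kin h) (\<gamma> x) (\<gamma> y)" using inner_arcs[OF assms(2-5)] assms(1) by (simp add: large_def)
  note d = DERIV_cmult[OF inner_action_deriv[OF this deriv_at[OF in_L[OF assms(2,4)]]], of "sqrt 2"]
  have "(2 / sqrt 2) * t / 2 = t / sqrt 2" for t :: real by simp
  hence "sqrt 2 * t / 2 = t / sqrt 2" for t :: real by (simp only: real_div_sqrt[of 2, simplified])
  with d
  show "((\<lambda>x. sqrt 2 * inner_action \<mu> (kin h) (\<gamma> x) (\<gamma> y)) has_real_derivative - (inner_vel \<mu> (kin h) (\<gamma> x) (\<gamma> y) \<bullet> \<gamma>' x) / sqrt 2) (at x)"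
    by simp
  show "sqrt 2 * inner_action \<mu> (kin h) (\<gamma> u) (\<gamma> y) = S_inner \<mu> E D \<gamma> u y h" if "u \<in> {a i<..<b i}" for u
    using S_inner_eq[OF assms(1-3) that assms(5)] by simp
qed (use assms in auto)

theorem admissible:
  assumes h0: "0 < h0" "\<And>h. h > h0 \<Longrightarrow> large h"
  shows "admissible_with \<omega> \<mu> E D L \<gamma> TE m a b h0 \<alpha> \<beta> h0"
  unfolding admissible_with_def
proof (intro conjI ballI C1 outer_property)
  show "inner_arc_property \<mu> E D L \<gamma> m a b h0" unfolding inner_arc_property_def
  proof (intro conjI ballI allI impI m2 disj h0(1))
    fix i j x y h assume "i \<in> {1..m}" "j \<in> NA \<gamma> m a b i" "x \<in> {a i<..<b i}" "y \<in> {a j<..<b j}" "h0 < h"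
    thus "\<exists>T z. inner_arc \<mu> E h D (\<gamma> x) (\<gamma> y) T z \<and>
      (\<forall>T' z'. inner_arc \<mu> E h D (\<gamma> x) (\<gamma> y) T' z' \<longrightarrow> T' = T \<and> (\<forall>s\<in>{0..T}. z' s = z s))"
      using inner_arc_ex1[OF h0(2)] by blast
  next
    fix i assume "i \<in> {1..m}"
    thus "0 \<le> a i" "a i < b i" "b i \<le> L" using ends[of i] by auto
  qed (use NA_self in auto)
  show "change_sign_property \<omega> \<mu> E D \<gamma> TE m a b h0 \<alpha> \<beta> h0" unfolding change_sign_property_def
  proof (intro conjI ballI allI impI)
    fix h i e y assume h: "h0 < h" and i: "i \<in> {1..m}" and e: "e \<in> {\<alpha> i..\<beta> i}"
      and y: "y \<in> (\<Union>j\<in>NA \<gamma> m a b i. {\<alpha> j..\<beta> j})"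
    then obtain j where j: "j \<in> NA \<gamma> m a b i" "y \<in> {\<alpha> j..\<beta> j}" by blast
    have jm: "j \<in> {1..m}" using NA_mem j(1) .
    note l = h0(2)[OF h]
    have e': "e \<in> {a i<..<b i}" and y': "y \<in> {a j<..<b j}" using in_ab i e jm j(2) by auto
    have \<alpha>: "\<alpha> i \<in> {a i<..<b i}" and \<beta>: "\<beta> i \<in> {a i<..<b i}" using ends[OF i] by auto
    let ?d = "\<lambda>x. (- outer_vel \<omega> R2 (\<gamma> x) (\<gamma> e)) \<bullet> \<gamma>' x / sqrt 2 + - (inner_vel \<mu> (kin h) (\<gamma> x) (\<gamma> y) \<bullet> \<gamma>' x) / sqrt 2"
    have d: "?d x = (- outer_vel \<omega> R2 (\<gamma> x) (\<gamma> e) - inner_vel \<mu> (kin h) (\<gamma> x) (\<gamma> y)) \<bullet> \<gamma>' x / sqrt 2" for x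
      by (simp add: inner_diff_left diff_divide_distrib)
    have s: "0 < ?d x * (\<gamma> x \<bullet> \<gamma>' x)" if "x \<in> {\<alpha> i, \<beta> i}" for x
    proof -
      have "x \<in> {a i<..<b i}" using that \<alpha> \<beta> by auto
      from slope_sign[OF l i j(1) this y' that e'] show ?thesis unfolding d by simp
    qed
    have "?d (\<alpha> i) * ?d (\<beta> i) < 0"
      using s[of "\<alpha> i"] s[of "\<beta> i"] slopes[OF i]
      by (auto simp: zero_less_mult_iff mult_less_0_iff simp del: inner_minus_left)
    thus "\<exists>dE\<alpha> dI\<alpha> dE\<beta> dI\<beta>.
          ((\<lambda>x. S_outer \<omega> E D \<gamma> TE e x) has_real_derivative dE\<alpha>) (at (\<alpha> i)) \<and>
          ((\<lambda>x. S_inner \<mu> E D \<gamma> x y h) has_real_derivative dI\<alpha>) (at (\<alpha> i)) \<and>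
          ((\<lambda>x. S_outer \<omega> E D \<gamma> TE e x) has_real_derivative dE\<beta>) (at (\<beta> i)) \<and>
          ((\<lambda>x. S_inner \<mu> E D \<gamma> x y h) has_real_derivative dI\<beta>) (at (\<beta> i)) \<and>
          (dE\<alpha> + dI\<alpha>) * (dE\<beta> + dI\<beta>) < 0"
      using outer_S_deriv[OF i \<alpha> e'] outer_S_deriv[OF i \<beta> e'] inner_S_deriv[OF l i j(1) \<alpha> y'] inner_S_deriv[OF l i j(1) \<beta> y']
      by blast
  qed (use ends in auto)
qed

end

section \<open>The return map as a composition of two reversible half steps\<close>

text \<open>The Levi-Civita square of the hyperbolic motion with \<open>a\<^sup>2 = p\<close> and initial velocity \<open>b = V (cnj a) / 2\<close>,
  written so that it is polynomial in \<open>p\<close>, \<open>|p|\<close> and \<open>V\<close>.\<close>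

definition kep :: "real \<Rightarrow> complex \<Rightarrow> complex \<Rightarrow> real \<Rightarrow> complex" where
  "kep k p V \<tau> = (cosh (k * \<tau>))\<^sup>2 *\<^sub>R p + (cosh (k * \<tau>) * sinh (k * \<tau>) / k) *\<^sub>R (norm p *\<^sub>R V)
     + ((sinh (k * \<tau>))\<^sup>2 / (4 * k\<^sup>2)) *\<^sub>R (V\<^sup>2 * cnj p)"

text \<open>The derivative of \<open>kep\<close> in regularized time, equal to |z| times the
  physical velocity; hence the factors \<open>norm q\<close> in the end conditions below.\<close>

definition kep_vel :: "real \<Rightarrow> complex \<Rightarrow> complex \<Rightarrow> real \<Rightarrow> complex" where
  "kep_vel k p V \<tau> = (2 * k * cosh (k * \<tau>) * sinh (k * \<tau>)) *\<^sub>R p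
     + ((cosh (k * \<tau>))\<^sup>2 + (sinh (k * \<tau>))\<^sup>2) *\<^sub>R (norm p *\<^sub>R V)
     + (sinh (k * \<tau>) * cosh (k * \<tau>) / (2 * k)) *\<^sub>R (V\<^sup>2 * cnj p)"

lemma kep_0 [simp]: "kep k p V 0 = p" "kep_vel k p V 0 = norm p *\<^sub>R V"
  by (simp_all add: kep_def kep_vel_def)

lemma kep_deriv:
  assumes "k \<noteq> 0"
  shows "(kep k p V has_vector_derivative kep_vel k p V \<tau>) (at \<tau>)"
  using assms unfolding kep_def kep_vel_def
  by (auto intro!: derivative_eq_intros simp: power2_eq_square field_simps scaleR_conv_of_real)

lemma kep_hyp:
  assumes k: "k \<noteq> 0"
  shows "kep k (a\<^sup>2) V \<tau> = (hyp k a (V * cnj a / 2) \<tau>)\<^sup>2"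
    "kep_vel k (a\<^sup>2) V \<tau> = 2 * hyp k a (V * cnj a / 2) \<tau> * hyp_vel k a (V * cnj a / 2) \<tau>"
proof -
  have n: "complex_of_real (norm (a\<^sup>2)) = a * cnj a" unfolding norm_power by (simp add: norm_square_cnj)
  show "kep k (a\<^sup>2) V \<tau> = (hyp k a (V * cnj a / 2) \<tau>)\<^sup>2"
    "kep_vel k (a\<^sup>2) V \<tau> = 2 * hyp k a (V * cnj a / 2) \<tau> * hyp_vel k a (V * cnj a / 2) \<tau>"
    unfolding kep_def kep_vel_def hyp_def hyp_vel_def scaleR_conv_of_real n
    using k by (simp_all add: power2_eq_square field_simps)
qed

lemma hyp_reverse:
  assumes k: "k \<noteq> 0"
  shows "hyp k (hyp k a b \<sigma>) (- hyp_vel k a b \<sigma>) \<tau> = hyp k a b (\<sigma> - \<tau>)"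
    "hyp_vel k (hyp k a b \<sigma>) (- hyp_vel k a b \<sigma>) \<tau> = - hyp_vel k a b (\<sigma> - \<tau>)"
  unfolding hyp_def hyp_vel_def right_diff_distrib cosh_diff sinh_diff
  using k by (simp_all add: algebra_simps diff_divide_distrib)

lemma osc_reverse:
  assumes "\<omega> \<noteq> 0"
  shows "osc \<omega> (osc \<omega> p v s) (- osc_vel \<omega> p v s) t = osc \<omega> p v (s - t)"
    "osc_vel \<omega> (osc \<omega> p v s) (- osc_vel \<omega> p v s) t = - osc_vel \<omega> p v (s - t)"
  unfolding osc_def osc_vel_def right_diff_distrib cos_diff sin_diff
  using assms by (simp_all add: algebra_simps diff_divide_distrib add_divide_distrib)

lemma kep_reverse:
  assumes k: "k \<noteq> 0" and q: "q = kep k p V \<sigma>" "q \<noteq> 0" and V2: "kep_vel k p V \<sigma> = norm q *\<^sub>R V2"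
  shows "kep k q (- V2) \<tau> = kep k p V (\<sigma> - \<tau>)" "kep_vel k q (- V2) \<tau> = - kep_vel k p V (\<sigma> - \<tau>)"
proof -
  define a b where "a = csqrt p" and "b = V * cnj a / 2"
  have a: "a\<^sup>2 = p" by (simp add: a_def)
  define a' where "a' = hyp k a b \<sigma>"
  have a': "a'\<^sup>2 = q" "a' \<noteq> 0" using q kep_hyp(1)[OF k, of a V \<sigma>] unfolding a a'_def b_def by auto
  have "2 * a' * hyp_vel k a b \<sigma> = of_real (norm q) * V2"
    using V2 kep_hyp(2)[OF k, of a V \<sigma>] unfolding a a'_def b_def by (simp add: scaleR_conv_of_real)
  also have "complex_of_real (norm q) = a' * cnj a'" unfolding a'(1)[symmetric] norm_power by (simp add: norm_square_cnj)
  finally have hv: "- hyp_vel k a b \<sigma> = - V2 * cnj a' / 2" using a'(2) by (simp add: mult.commute)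
  show "kep k q (- V2) \<tau> = kep k p V (\<sigma> - \<tau>)" "kep_vel k q (- V2) \<tau> = - kep_vel k p V (\<sigma> - \<tau>)"
    using kep_hyp[OF k, of a' "- V2" \<tau>, folded hv] kep_hyp[OF k, of a V "\<sigma> - \<tau>"] hyp_reverse[OF k, of a b \<sigma> \<tau>]
    unfolding a a' b_def[symmetric] a'_def[symmetric] by simp_all
qed

text \<open>Physical time is eliminated. The curve \<open>kep\<close> depends on p and V only, since
  the sign of the root of p cancels, so an arc with prescribed one-sided end velocities amounts to a
  regularized time at which \<open>kep\<close> and \<open>kep_vel\<close> take given values.\<close>

lemma lc_arc_iff:
  assumes k: "0 < k" and \<mu>: "0 < \<mu>" and pq: "p \<noteq> 0" "q \<noteq> 0" and V: "1 / 2 * (norm V)\<^sup>2 = 2 * k\<^sup>2 + \<mu> / norm p"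
  shows "(\<exists>T>0. \<exists>y. lc_kepler_sol \<mu> (2 * k\<^sup>2) T y \<and> y 0 = p \<and> (y has_vector_derivative V) (at 0 within {0..T}) \<and>
      (\<forall>s\<in>{0<..<T}. y s \<in> D) \<and> y T = q \<and> (y has_vector_derivative V2) (at T within {0..T})) \<longleftrightarrow>
    (\<exists>\<sigma>>0. (\<forall>\<tau>\<in>{0<..<\<sigma>}. kep k p V \<tau> \<in> D) \<and> kep k p V \<sigma> = q \<and> kep_vel k p V \<sigma> = norm q *\<^sub>R V2)"
    (is "?L \<longleftrightarrow> ?R")
proof
  assume ?L
  then obtain T y where T: "0 < T" "lc_kepler_sol \<mu> (2 * k\<^sup>2) T y" "y 0 = p" "(y has_vector_derivative V) (at 0 within {0..T})"
    "\<forall>s\<in>{0<..<T}. y s \<in> D" "y T = q" "(y has_vector_derivative V2) (at T within {0..T})" by blast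
  have k0: "k \<noteq> 0" using k by simp
  obtain \<sigma> a b where s: "0 < \<sigma>" "2 * (norm b)\<^sup>2 = \<mu> + 2 * k\<^sup>2 * (norm a)\<^sup>2" "T = lc_time k a b \<sigma>"
    "\<forall>\<tau>\<in>{0..\<sigma>}. y (lc_time k a b \<tau>) = (hyp k a b \<tau>)\<^sup>2"
    using lc_kepler_sol_explicit[OF T(2) k0] by blast
  have en: "k\<^sup>2 * (norm a)\<^sup>2 < (norm b)\<^sup>2" using s(2) \<mu> by simp
  have sm: "strict_mono (lc_time k a b)" by (rule lc_time_strict_mono[OF k0 en])
  have a: "a\<^sup>2 = p" using bspec[OF s(4), of 0] s(1) T(3) by simp
  hence a0: "a \<noteq> 0" using pq by auto
  have hq: "(hyp k a b \<sigma>)\<^sup>2 = q" using bspec[OF s(4), of \<sigma>] s(1,3) T(6) by simp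
  hence h0: "hyp k a b \<sigma> \<noteq> 0" using pq by auto
  have "V = 2 * hyp_vel k a b 0 / cnj (hyp k a b 0)"
    by (rule lc_velocity[OF k0 en s(1), where z = y]) (use s T(4) a0 in auto)
  hence b: "b = V * cnj a / 2" using a0 by simp
  have V2: "V2 = 2 * hyp_vel k a b \<sigma> / cnj (hyp k a b \<sigma>)"
    by (rule lc_velocity[OF k0 en s(1), where z = y]) (use s T(7) h0 in auto)
  show ?R
  proof (intro exI[of _ \<sigma>] conjI ballI s(1))
    fix \<tau> assume \<tau>: "\<tau> \<in> {0<..<\<sigma>}"
    have "lc_time k a b 0 < lc_time k a b \<tau>" "lc_time k a b \<tau> < lc_time k a b \<sigma>"
      using \<tau> by (auto intro!: strict_monoD[OF sm] simp del: lc_time_0)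
    hence "y (lc_time k a b \<tau>) \<in> D" using T(5) s(3) by simp
    thus "kep k p V \<tau> \<in> D" using kep_hyp(1)[OF k0, of a V \<tau>] s(4) \<tau> unfolding a b[symmetric] by simp
  next
    show "kep k p V \<sigma> = q" using kep_hyp(1)[OF k0, of a V \<sigma>] hq unfolding a b[symmetric] by simp
    have "complex_of_real (norm q) = hyp k a b \<sigma> * cnj (hyp k a b \<sigma>)"
      unfolding hq[symmetric] norm_power by (simp add: norm_square_cnj)
    thus "kep_vel k p V \<sigma> = norm q *\<^sub>R V2"
      using kep_hyp(2)[OF k0, of a V \<sigma>] h0 unfolding a b[symmetric] V2 by (simp add: scaleR_conv_of_real)
  qed
next
  assume ?R
  then obtain \<sigma> where \<sigma>: "0 < \<sigma>" "\<forall>\<tau>\<in>{0<..<\<sigma>}. kep k p V \<tau> \<in> D" "kep k p V \<sigma> = q" "kep_vel k p V \<sigma> = norm q *\<^sub>R V2" by blast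
  have k0: "k \<noteq> 0" using k by simp
  define a b where "a = csqrt p" and "b = V * cnj a / 2"
  have a: "a\<^sup>2 = p" by (simp add: a_def)
  hence a0: "a \<noteq> 0" and na: "(norm a)\<^sup>2 = norm p" using pq by (auto simp flip: norm_power)
  have kh: "kep k p V \<tau> = (hyp k a b \<tau>)\<^sup>2" "kep_vel k p V \<tau> = 2 * hyp k a b \<tau> * hyp_vel k a b \<tau>" for \<tau>
    using kep_hyp[OF k0, of a V \<tau>] unfolding a b_def by auto
  have "2 * (norm b)\<^sup>2 = (norm a)\<^sup>2 * (1 / 2 * (norm V)\<^sup>2)"
    by (simp add: b_def norm_mult norm_divide power_mult_distrib power_divide)
  also have "\<dots> = \<mu> + 2 * k\<^sup>2 * (norm a)\<^sup>2" unfolding V na using pq by (simp add: field_simps)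
  finally have en2: "2 * (norm b)\<^sup>2 = \<mu> + 2 * k\<^sup>2 * (norm a)\<^sup>2" .
  have en: "k\<^sup>2 * (norm a)\<^sup>2 < (norm b)\<^sup>2" using en2 \<mu> by simp
  have sm: "strict_mono (lc_time k a b)" by (rule lc_time_strict_mono[OF k0 en])
  define T y where "T = lc_time k a b \<sigma>" and "y = lc_traj k a b"
  have yt: "y (lc_time k a b \<tau>) = (hyp k a b \<tau>)\<^sup>2" for \<tau> unfolding y_def by (rule lc_traj_time(1)[OF k0 en])
  have hq: "(hyp k a b \<sigma>)\<^sup>2 = q" using \<sigma>(3) kh by simp
  hence h0: "hyp k a b \<sigma> \<noteq> 0" using pq by auto
  have dy: "(y has_vector_derivative 2 * hyp_vel k a b \<tau> / cnj (hyp k a b \<tau>)) (at (lc_time k a b \<tau>))" if "hyp k a b \<tau> \<noteq> 0" for \<tau>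
    unfolding y_def using lc_traj_deriv[OF k0 en that] lc_traj_time(2)[OF k0 en] by simp
  show ?L
  proof (intro exI[of _ T] exI[of _ y] conjI ballI)
    have "lc_time k a b 0 < lc_time k a b \<sigma>" using sm \<sigma>(1) by (simp only: strict_mono_def)
    thus "0 < T" by (simp add: T_def)
    show "lc_kepler_sol \<mu> (2 * k\<^sup>2) T y" unfolding T_def y_def by (rule lc_traj_sol[OF k0 \<mu> en2 \<sigma>(1)])
    show "y 0 = p" using yt[of 0] a by simp
    show "y T = q" using yt[of \<sigma>] hq by (simp add: T_def)
    have "(y has_vector_derivative 2 * b / cnj a) (at 0)" using dy[of 0] a0 by simp
    moreover have "2 * b / cnj a = V" using a0 by (simp add: b_def)
    ultimately show "(y has_vector_derivative V) (at 0 within {0..T})" by (simp add: has_vector_derivative_at_within)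
    have "(y has_vector_derivative 2 * hyp_vel k a b \<sigma> / cnj (hyp k a b \<sigma>)) (at T)" using dy[OF h0] by (simp add: T_def)
    moreover have "2 * hyp_vel k a b \<sigma> / cnj (hyp k a b \<sigma>) = V2"
    proof -
      have "complex_of_real (norm q) = hyp k a b \<sigma> * cnj (hyp k a b \<sigma>)"
        unfolding hq[symmetric] norm_power by (simp add: norm_square_cnj)
      hence "hyp k a b \<sigma> * (2 * hyp_vel k a b \<sigma>) = hyp k a b \<sigma> * (cnj (hyp k a b \<sigma>) * V2)"
        using \<sigma>(4) kh(2)[of \<sigma>] by (simp add: scaleR_conv_of_real mult_ac)
      thus ?thesis using h0 by (simp add: field_simps)
    qed
    ultimately show "(y has_vector_derivative V2) (at T within {0..T})" by (simp add: has_vector_derivative_at_within)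
    fix s assume s: "s \<in> {0<..<T}"
    then obtain \<tau> where \<tau>: "\<tau> \<in> {0..\<sigma>}" "s = lc_time k a b \<tau>"
      using lc_time_surj[OF k0, of \<sigma> s a b] \<sigma>(1) unfolding T_def by auto
    have "\<tau> \<noteq> 0" "\<tau> \<noteq> \<sigma>" using s \<tau>(2) unfolding T_def by auto
    thus "y s \<in> D" unfolding \<tau>(2) yt kh(1)[symmetric] using \<sigma>(2) \<tau>(1) by auto
  qed
qed

lemma first_exit_unique:
  fixes s s' :: real
  assumes "0 < s" "0 < s'" "\<And>t. 0 < t \<Longrightarrow> t < s \<Longrightarrow> f t \<in> U" "\<And>t. 0 < t \<Longrightarrow> t < s' \<Longrightarrow> f t \<in> U" "f s \<notin> U" "f s' \<notin> U"
  shows "s = s'"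
  using assms by (metis linorder_neqE_linordered_idom)

text \<open>Upper bound: just after s the limit curve is in the open set W, so nearby curves have
  left U by then. Lower bound: otherwise a subsequence of exit times tends to some t < s; t = 0 is
  excluded by \<open>start\<close>, and for 0 < t the limit point lies in the open set U although
  all exit points lie outside U.\<close>

lemma exit_time_tendsto:
  fixes P :: "'a::topological_space \<Rightarrow> real \<Rightarrow> 'b::topological_space"
  assumes cont: "\<And>r t T. strict_mono (r :: nat \<Rightarrow> nat) \<Longrightarrow> T \<longlonglongrightarrow> t \<Longrightarrow> (\<lambda>n. P (X (r n)) (T n)) \<longlonglongrightarrow> P x t"
    and UW: "open U" "open W" "U \<inter> W = {}"
    and S: "\<And>n. 0 < S n" "\<And>n t. 0 < t \<Longrightarrow> t < S n \<Longrightarrow> P (X n) t \<in> U" "\<And>n. P (X n) (S n) \<notin> U"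
    and s: "\<And>t. 0 < t \<Longrightarrow> t < s \<Longrightarrow> P x t \<in> U"
    and start: "\<And>r. strict_mono r \<Longrightarrow> (\<lambda>n. S (r n)) \<longlonglongrightarrow> 0 \<Longrightarrow> False"
    and cross: "\<And>e. 0 < e \<Longrightarrow> \<exists>t. s < t \<and> t < s + e \<and> 0 < t \<and> P x t \<in> W"
  shows "S \<longlonglongrightarrow> s"
proof (rule order_tendstoI)
  fix u assume u: "s < u"
  obtain t where t: "s < t" "t < s + (u - s)" "0 < t" "P x t \<in> W" using cross[of "u - s"] u by auto
  have "(\<lambda>n. P (X n) t) \<longlonglongrightarrow> P x t" using cont[of id "\<lambda>_. t" t] by (simp add: strict_mono_def)
  hence "\<forall>\<^sub>F n in sequentially. P (X n) t \<in> W" using topological_tendstoD UW(2) t(4) by blast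
  thus "\<forall>\<^sub>F n in sequentially. S n < u"
  proof eventually_elim
    case (elim n)
    hence "P (X n) t \<notin> U" using UW(3) by blast
    hence "\<not> t < S n" using S(2)[OF t(3)] by blast
    thus ?case using t(2) by simp
  qed
next
  fix l assume l: "l < s"
  show "\<forall>\<^sub>F n in sequentially. l < S n"
  proof (rule ccontr)
    assume "\<not> (\<forall>\<^sub>F n in sequentially. l < S n)"
    hence "\<exists>\<^sub>F n in sequentially. S n \<le> l" by (simp add: not_eventually not_less)
    hence inf: "infinite {n. S n \<le> l}" by (simp add: INFM_iff_infinite frequently_cofinite[symmetric] cofinite_eq_sequentially)
    define r where "r = enumerate {n. S n \<le> l}"
    have r: "strict_mono r" "\<And>n. S (r n) \<le> l"
      using strict_mono_enumerate[OF inf] enumerate_in_set[OF inf] by (auto simp: r_def)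
    have "bounded (range (\<lambda>n. S (r n)))"
    proof (rule boundedI[of _ "\<bar>l\<bar>"])
      fix y assume "y \<in> range (\<lambda>n. S (r n))"
      then obtain n where "y = S (r n)" by blast
      thus "norm y \<le> \<bar>l\<bar>" using r(2)[of n] S(1)[of "r n"] by simp
    qed
    then obtain q t where q: "strict_mono q" "(\<lambda>n. S (r (q n))) \<longlonglongrightarrow> t"
      using bounded_imp_convergent_subsequence[of "\<lambda>n. S (r n)"] by (auto simp: o_def)
    have rq: "strict_mono (\<lambda>n. r (q n))" using r(1) q(1) by (auto simp: strict_mono_def)
    have t0: "0 \<le> t" by (rule LIMSEQ_le_const[OF q(2)]) (use S(1) in \<open>auto intro: less_imp_le\<close>)
    have tl: "t \<le> l" by (rule LIMSEQ_le_const2[OF q(2)]) (use r(2) in auto)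
    have "t \<noteq> 0" using start[OF rq] q(2) by auto
    hence "P x t \<in> U" using s t0 tl l by auto
    moreover have "(\<lambda>n. P (X (r (q n))) (S (r (q n)))) \<longlonglongrightarrow> P x t" by (rule cont[OF rq q(2)])
    ultimately have "\<forall>\<^sub>F n in sequentially. P (X (r (q n))) (S (r (q n))) \<in> U" using topological_tendstoD UW(1) by blast
    hence "\<forall>\<^sub>F n in sequentially. False" by (rule eventually_mono) (use S(3) in blast)
    thus False by simp
  qed
qed

text \<open>Used to divide the displacement along a flow by its time: each coefficient of the flow
  contributes a difference quotient at 0.\<close>

lemma quotient_tendsto:
  fixes c :: "real \<Rightarrow> real" and W :: "nat \<Rightarrow> complex"
  assumes "(c has_real_derivative c') (at 0)" "T \<longlonglongrightarrow> 0" "\<And>n. T n \<noteq> 0" "W \<longlonglongrightarrow> w"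
  shows "(\<lambda>n. ((c (T n) - c 0) / T n) *\<^sub>R W n) \<longlonglongrightarrow> c' *\<^sub>R w"
proof (rule tendsto_scaleR[OF _ assms(4)])
  have "((\<lambda>h. (c (0 + h) - c 0) / h) \<longlongrightarrow> c') (at 0)" using assms(1) by (simp only: DERIV_def)
  moreover have "filterlim T (at 0) sequentially" using assms(2,3) by (simp add: filterlim_at)
  ultimately have "((\<lambda>n. (c (0 + T n) - c 0) / T n) \<longlonglongrightarrow> c')" by (rule filterlim_compose)
  thus "(\<lambda>n. (c (T n) - c 0) / T n) \<longlonglongrightarrow> c'" by simp
qed

section \<open>Transversal crossing of the boundary\<close>

context arclength_domain
begin

text \<open>Displacement divided by time tends to the transversal vector V, so
  \<open>transversal\<close> forbids boundary points after short times.\<close>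

lemma no_short_return:
  assumes \<xi>: "\<xi> \<in> {0<..<L}" "X \<longlonglongrightarrow> \<xi>" and n: "n \<bullet> \<gamma>' \<xi> = 0" "n \<bullet> V \<noteq> 0"
    and T: "T \<longlonglongrightarrow> 0" "\<And>j. 0 < T j" and d: "d \<longlonglongrightarrow> V" and f: "\<And>j. \<gamma> (X j) + T j *\<^sub>R d j \<in> frontier D"
  shows False
proof -
  define c where "c = \<bar>n \<bullet> V\<bar> / 2"
  have c: "0 < c" "c < \<bar>n \<bullet> V\<bar>" using n(2) by (auto simp: c_def)
  obtain e where e: "0 < e" "\<forall>\<xi>' s d. \<bar>\<xi>' - \<xi>\<bar> < e \<longrightarrow> 0 < s \<longrightarrow> s < e \<longrightarrow> norm d \<le> norm V + 1 \<longrightarrow> c \<le> \<bar>n \<bullet> d\<bar> \<longrightarrow> \<gamma> \<xi>' + s *\<^sub>R d \<notin> frontier D"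
    using transversal[OF \<xi>(1) n(1) c(1), of "norm V + 1"] by blast
  have "\<forall>\<^sub>F j in sequentially. \<bar>X j - \<xi>\<bar> < e" using tendstoD[OF \<xi>(2) e(1)] by (simp add: dist_real_def)
  moreover have "\<forall>\<^sub>F j in sequentially. T j < e" by (rule order_tendstoD(2)[OF T(1) e(1)])
  moreover have "\<forall>\<^sub>F j in sequentially. norm (d j) < norm V + 1" by (rule order_tendstoD(2)[OF tendsto_norm[OF d]]) simp
  moreover have "\<forall>\<^sub>F j in sequentially. c < \<bar>n \<bullet> d j\<bar>"
    by (rule order_tendstoD(1)[OF tendsto_rabs[OF tendsto_inner[OF tendsto_const d]] c(2)])
  ultimately have "\<forall>\<^sub>F j in sequentially. False"
    by eventually_elim (use e(2) T(2) f in \<open>meson less_imp_le\<close>)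
  thus False by simp
qed

text \<open>The difference quotients at s tend to V, so for small positive h they are bounded and
  keep at least half of its normal part; \<open>radial_sides\<close> then applies.\<close>

lemma crossing:
  assumes rad: "radial_point e \<xi>" and f: "f s = \<gamma> \<xi>" "(f has_vector_derivative V) (at s)" and \<delta>: "0 < \<delta>"
  shows "outward_normal D L \<gamma> \<xi> \<bullet> V < 0 \<Longrightarrow> \<exists>t. s < t \<and> t < s + \<delta> \<and> f t \<in> D"
    and "0 < outward_normal D L \<gamma> \<xi> \<bullet> V \<Longrightarrow> \<exists>t. s < t \<and> t < s + \<delta> \<and> f t \<notin> closure D"
proof -
  let ?n = "outward_normal D L \<gamma> \<xi>"
  let ?d = "\<lambda>h. (f (s + h) - f s) /\<^sub>R h"
  have lim: "(?d \<longlongrightarrow> V) (at_right 0)"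
  proof -
    have "((\<lambda>y. (f y - f s) /\<^sub>R (y - s)) \<longlongrightarrow> V) (at s)"
      using f(2) unfolding has_vector_derivative_def has_derivative_at_within
    proof -
      have "((\<lambda>y. (f y - f s - (y - s) *\<^sub>R V) /\<^sub>R (y - s)) \<longlongrightarrow> 0) (at s)"
        using f(2) unfolding has_vector_derivative_def has_derivative_iff_norm
        by (simp add: divide_inverse mult.commute tendsto_norm_zero_iff[symmetric, of "\<lambda>y. (f y - f s - (y - s) *\<^sub>R V) /\<^sub>R (y - s)"])
      hence "((\<lambda>y. (f y - f s - (y - s) *\<^sub>R V) /\<^sub>R (y - s) + V) \<longlongrightarrow> 0 + V) (at s)" by (intro tendsto_add tendsto_const)
      hence lim0: "((\<lambda>y. (f y - f s - (y - s) *\<^sub>R V) /\<^sub>R (y - s) + V) \<longlongrightarrow> V) (at s)" by simp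
      have "\<forall>\<^sub>F y in at s. (f y - f s - (y - s) *\<^sub>R V) /\<^sub>R (y - s) + V = (f y - f s) /\<^sub>R (y - s)"
        by (auto simp: eventually_at_filter scaleR_diff_right)
      from Lim_transform_eventually[OF lim0 this] show ?thesis .
    qed
    hence "((\<lambda>h. (f (s + h) - f s) /\<^sub>R (s + h - s)) \<longlongrightarrow> V) (at 0)"
      by (simp add: LIM_offset_zero_iff[of s "\<lambda>y. (f y - f s) /\<^sub>R (y - s)"])
    thus ?thesis by (simp add: filterlim_at_split)
  qed
  have key: "\<exists>h. 0 < h \<and> h < \<delta> \<and> h < e' \<and> norm (?d h) \<le> norm V + 1 \<and> \<bar>?n \<bullet> V\<bar> / 2 \<le> sgn (?n \<bullet> V) * (?n \<bullet> ?d h)"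
    if "?n \<bullet> V \<noteq> 0" "0 < e'" for e'
  proof -
    have "\<forall>\<^sub>F h in at_right 0. norm (?d h) < norm V + 1" by (rule order_tendstoD(2)[OF tendsto_norm[OF lim]]) simp
    moreover have "\<forall>\<^sub>F h in at_right 0. \<bar>?n \<bullet> V\<bar> / 2 < sgn (?n \<bullet> V) * (?n \<bullet> ?d h)"
    proof (rule order_tendstoD(1)[OF tendsto_mult[OF tendsto_const tendsto_inner[OF tendsto_const lim]]])
      show "\<bar>?n \<bullet> V\<bar> / 2 < sgn (?n \<bullet> V) * (?n \<bullet> V)" using that(1) by (cases "0 < ?n \<bullet> V") auto
    qed
    moreover have "\<forall>\<^sub>F h in at_right 0. 0 < h \<and> h < \<delta> \<and> h < (e'::real)"
      using eventually_at_right_real[of 0 "min \<delta> e'"] \<delta> that(2) by (auto elim: eventually_mono)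
    ultimately have "\<forall>\<^sub>F h in at_right 0. 0 < h \<and> h < \<delta> \<and> h < e' \<and> norm (?d h) \<le> norm V + 1 \<and> \<bar>?n \<bullet> V\<bar> / 2 \<le> sgn (?n \<bullet> V) * (?n \<bullet> ?d h)"
      by eventually_elim (auto intro: less_imp_le)
    thus ?thesis using eventually_happens' trivial_limit_at_right_real by blast
  qed
  have fh: "f (s + h) = \<gamma> \<xi> + h *\<^sub>R ?d h" if "0 < h" for h using that f(1) by simp
  {
    assume neg: "?n \<bullet> V < 0"
    obtain e' where e': "0 < e'" "\<And>s d. 0 < s \<Longrightarrow> s < e' \<Longrightarrow> norm d \<le> norm V + 1 \<Longrightarrow> ?n \<bullet> d \<le> - (\<bar>?n \<bullet> V\<bar> / 2) \<Longrightarrow> \<gamma> \<xi> + s *\<^sub>R d \<in> D"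
      using radial_sides[OF rad, of "\<bar>?n \<bullet> V\<bar> / 2" "norm V + 1"] neg by (metis abs_of_neg half_gt_zero neg_0_less_iff_less)
    obtain h where h: "0 < h" "h < \<delta>" "h < e'" "norm (?d h) \<le> norm V + 1" "\<bar>?n \<bullet> V\<bar> / 2 \<le> sgn (?n \<bullet> V) * (?n \<bullet> ?d h)"
      using key[OF _ e'(1)] neg by auto
    have "f (s + h) \<in> D" by (subst fh[OF h(1)], rule e'(2)[OF h(1,3,4)]) (use h(5) neg in simp)
    thus "\<exists>t. s < t \<and> t < s + \<delta> \<and> f t \<in> D" using h by (intro exI[of _ "s + h"]) auto
  next
    assume pos: "0 < ?n \<bullet> V"
    obtain e' where e': "0 < e'" "\<And>s d. 0 < s \<Longrightarrow> s < e' \<Longrightarrow> norm d \<le> norm V + 1 \<Longrightarrow> \<bar>?n \<bullet> V\<bar> / 2 \<le> ?n \<bullet> d \<Longrightarrow> \<gamma> \<xi> + s *\<^sub>R d \<notin> closure D"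
      using radial_sides[OF rad, of "\<bar>?n \<bullet> V\<bar> / 2" "norm V + 1"] pos by (metis abs_of_pos half_gt_zero)
    obtain h where h: "0 < h" "h < \<delta>" "h < e'" "norm (?d h) \<le> norm V + 1" "\<bar>?n \<bullet> V\<bar> / 2 \<le> sgn (?n \<bullet> V) * (?n \<bullet> ?d h)"
      using key[OF _ e'(1)] pos by auto
    have "f (s + h) \<notin> closure D" by (subst fh[OF h(1)], rule e'(2)[OF h(1,3,4)]) (use h(5) pos in simp)
    thus "\<exists>t. s < t \<and> t < s + \<delta> \<and> f t \<notin> closure D" using h by (intro exI[of _ "s + h"]) auto
  }
qed

lemma param_tendsto:
  assumes "\<xi> \<in> {0<..<L}" "\<And>n. X n \<in> {0..L}" "(\<lambda>n. \<gamma> (X n)) \<longlonglongrightarrow> \<gamma> \<xi>"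
  shows "X \<longlonglongrightarrow> \<xi>"
proof (rule tendstoI)
  fix e :: real assume "0 < e"
  then obtain d where d: "0 < d" "\<And>\<xi>'. \<xi>' \<in> {0..L} \<Longrightarrow> dist (\<gamma> \<xi>') (\<gamma> \<xi>) < d \<Longrightarrow> \<bar>\<xi>' - \<xi>\<bar> < e"
    using param_close[OF assms(1)] by metis
  show "\<forall>\<^sub>F n in sequentially. dist (X n) \<xi> < e"
    using tendstoD[OF assms(3) d(1)] by (rule eventually_mono) (use d(2) assms(2) in \<open>simp add: dist_real_def\<close>)
qed

end

section \<open>The two half steps: explicit form, reversal and continuity\<close>

context billiard_intervals
begin

abbreviation "Xp \<equiv> Xi_plus \<omega> E D L \<gamma> \<alpha> \<beta>"
abbreviation "Xm \<equiv> Xi_minus \<omega> E D L \<gamma> \<alpha> \<beta>"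
abbreviation "refr h \<equiv> refraction \<mu> E h D L \<gamma>"

definition outer_step :: "((real \<times> complex) \<times> (real \<times> complex)) set" where
  "outer_step = {((x, v), (y, u)). \<exists>r\<in>{1..m}. (x, v) \<in> Xp r \<and> (y, u) \<in> Xm r \<and>
     (\<exists>s>0. (\<forall>t\<in>{0<..<s}. osc \<omega> (\<gamma> x) v t \<notin> closure D) \<and> osc \<omega> (\<gamma> x) v s = \<gamma> y \<and> osc_vel \<omega> (\<gamma> x) v s = u)}"

definition inner_step :: "real \<Rightarrow> ((real \<times> complex) \<times> (real \<times> complex)) set" where
  "inner_step h = {((y, u), (x, v)). \<exists>r\<in>{1..m}. \<exists>r'\<in>NA \<gamma> m a b r. (y, u) \<in> Xm r \<and> (x, v) \<in> Xp r' \<and>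
     (\<exists>\<sigma>>0. (\<forall>\<tau>\<in>{0<..<\<sigma>}. kep (kin h) (\<gamma> y) (refr h y u) \<tau> \<in> D) \<and> kep (kin h) (\<gamma> y) (refr h y u) \<sigma> = \<gamma> x \<and>
        kep_vel (kin h) (\<gamma> y) (refr h y u) \<sigma> = norm (\<gamma> x) *\<^sub>R refr h x v)}"

lemma outer_step_iff: "((x, v), (y, u)) \<in> outer_step \<longleftrightarrow> (\<exists>r\<in>{1..m}. (x, v) \<in> Xp r \<and> (y, u) \<in> Xm r \<and>
     (\<exists>s>0. (\<forall>t\<in>{0<..<s}. osc \<omega> (\<gamma> x) v t \<notin> closure D) \<and> osc \<omega> (\<gamma> x) v s = \<gamma> y \<and> osc_vel \<omega> (\<gamma> x) v s = u))"
  unfolding outer_step_def by simp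

lemma inner_step_iff: "((y, u), (x, v)) \<in> inner_step h \<longleftrightarrow> (\<exists>r\<in>{1..m}. \<exists>r'\<in>NA \<gamma> m a b r. (y, u) \<in> Xm r \<and> (x, v) \<in> Xp r' \<and>
     (\<exists>\<sigma>>0. (\<forall>\<tau>\<in>{0<..<\<sigma>}. kep (kin h) (\<gamma> y) (refr h y u) \<tau> \<in> D) \<and> kep (kin h) (\<gamma> y) (refr h y u) \<sigma> = \<gamma> x \<and>
        kep_vel (kin h) (\<gamma> y) (refr h y u) \<sigma> = norm (\<gamma> x) *\<^sub>R refr h x v))"
  unfolding inner_step_def by simp

lemma index_unique:
  assumes "i \<in> {1..m}" "j \<in> {1..m}" "x \<in> {\<alpha> i..\<beta> i}" "x \<in> {\<alpha> j..\<beta> j}"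
  shows "i = j"
proof (rule ccontr)
  assume "i \<noteq> j"
  hence "{a i<..<b i} \<inter> {a j<..<b j} = {}" using disj assms(1,2) unfolding disjoint_family_on_def by blast
  thus False using in_ab assms by blast
qed

lemma state:
  assumes "r \<in> {1..m}" "(x, v) \<in> Xp r \<or> (x, v) \<in> Xm r"
  shows "x \<in> {a r<..<b r}" "x \<in> {0<..<L}" "x \<in> {0..L}" "radial_point (\<eta> r) x" "1 / 2 * (norm v)\<^sup>2 = V_outer \<omega> E (\<gamma> x)"
    "nrm x \<bullet> v \<noteq> 0" "norm (\<gamma>' x) = 1" "norm (nrm x) = 1" "nrm x \<bullet> \<gamma>' x = 0" "\<gamma> x \<noteq> 0"
proof -
  show x: "x \<in> {a r<..<b r}" using assms in_ab by (auto simp: Xi_plus_def Xi_minus_def)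
  show "x \<in> {0<..<L}" "radial_point (\<eta> r) x" using in_L[OF assms(1) x] radial[OF assms(1) x] .
  show L: "x \<in> {0..L}" by (rule in_L'[OF assms(1) x])
  show "norm (\<gamma>' x) = 1" "\<gamma> x \<noteq> 0" using unit nonzero L by auto
  show "norm (nrm x) = 1" "nrm x \<bullet> \<gamma>' x = 0" using radial_normal[OF radial[OF assms(1) x]] by auto
  show "1 / 2 * (norm v)\<^sup>2 = V_outer \<omega> E (\<gamma> x)" "nrm x \<bullet> v \<noteq> 0" using assms(2) by (auto simp: Xi_plus_def Xi_minus_def)
qed

lemma orthonormal_decomposition:
  fixes n t v :: complex
  assumes "norm n = 1" "norm t = 1" "n \<bullet> t = 0"
  shows "v = (v \<bullet> t) *\<^sub>R t + (v \<bullet> n) *\<^sub>R n" "(norm v)\<^sup>2 = (v \<bullet> t)\<^sup>2 + (v \<bullet> n)\<^sup>2"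
proof -
  have *: "Re n * Re t + Im n * Im t = 0" "(Re n)\<^sup>2 + (Im n)\<^sup>2 = 1" "(Re t)\<^sup>2 + (Im t)\<^sup>2 = 1"
    using assms by (auto simp: inner_complex_def cmod_def)
  have e: "Re t * Re t = Im n * Im n" "Im t * Im t = Re n * Re n" "Re t * Im t = - Re n * Im n"
    using * by algebra+
  show d: "v = (v \<bullet> t) *\<^sub>R t + (v \<bullet> n) *\<^sub>R n"
  proof -
    have "Re v = (Re v * Re t + Im v * Im t) * Re t + (Re v * Re n + Im v * Im n) * Re n"
      "Im v = (Re v * Re t + Im v * Im t) * Im t + (Re v * Re n + Im v * Im n) * Im n"
      using * e by algebra+
    thus ?thesis by (simp add: complex_eq_iff inner_complex_def)
  qed
  have "(norm v)\<^sup>2 = v \<bullet> ((v \<bullet> t) *\<^sub>R t + (v \<bullet> n) *\<^sub>R n)" using d by (simp add: power2_norm_eq_inner)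
  thus "(norm v)\<^sup>2 = (v \<bullet> t)\<^sup>2 + (v \<bullet> n)\<^sup>2" by (simp add: inner_add_right power2_eq_square)
qed

lemma refr_eq:
  assumes "x \<in> {0..L}"
  shows "refr h x v = (v \<bullet> \<gamma>' x) *\<^sub>R \<gamma>' x + (sgn (v \<bullet> nrm x) * sqrt (2 * V_inner \<mu> E h (\<gamma> x) - (v \<bullet> \<gamma>' x)\<^sup>2)) *\<^sub>R nrm x"
  unfolding refraction_def Let_def unit_tangent_eq[OF assms] ..

lemma refr_props:
  assumes r: "r \<in> {1..m}" "(x, v) \<in> Xp r \<or> (x, v) \<in> Xm r" and h: "0 < h"
  shows "refr h x v \<bullet> \<gamma>' x = v \<bullet> \<gamma>' x"
    "refr h x v \<bullet> nrm x = sgn (v \<bullet> nrm x) * sqrt (2 * V_inner \<mu> E h (\<gamma> x) - (v \<bullet> \<gamma>' x)\<^sup>2)"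
    "0 < 2 * V_inner \<mu> E h (\<gamma> x) - (v \<bullet> \<gamma>' x)\<^sup>2"
    "1 / 2 * (norm (refr h x v))\<^sup>2 = 2 * (kin h)\<^sup>2 + \<mu> / norm (\<gamma> x)"
    "refr h x (- v) = - refr h x v"
proof -
  note s = state[OF r]
  note onb = orthonormal_decomposition[OF s(8,7,9)]
  have tt: "\<gamma>' x \<bullet> \<gamma>' x = 1" "nrm x \<bullet> nrm x = 1" "\<gamma>' x \<bullet> nrm x = 0" using s by (auto simp: dot_square_norm inner_commute)
  show 1: "refr h x v \<bullet> \<gamma>' x = v \<bullet> \<gamma>' x"
    and 2: "refr h x v \<bullet> nrm x = sgn (v \<bullet> nrm x) * sqrt (2 * V_inner \<mu> E h (\<gamma> x) - (v \<bullet> \<gamma>' x)\<^sup>2)"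
    unfolding refr_eq[OF s(3)] using tt s(9) by (simp_all add: inner_add_left)
  have "(v \<bullet> \<gamma>' x)\<^sup>2 \<le> 2 * V_outer \<omega> E (\<gamma> x)" using onb(2)[of v] s(5) zero_le_power2[of "v \<bullet> nrm x"] by argo
  also have "\<dots> \<le> 2 * E" by (simp add: V_outer_def)
  also have "\<dots> < 2 * V_inner \<mu> E h (\<gamma> x)" unfolding V_inner_def using h \<mu> by (simp add: add_pos_nonneg)
  finally show 3: "0 < 2 * V_inner \<mu> E h (\<gamma> x) - (v \<bullet> \<gamma>' x)\<^sup>2" by simp
  have sg: "(sgn (v \<bullet> nrm x))\<^sup>2 = 1" using s(6) by (simp add: sgn_if inner_commute power2_eq_square)
  have "(norm (refr h x v))\<^sup>2 = 2 * V_inner \<mu> E h (\<gamma> x)"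
    unfolding onb(2)[of "refr h x v"] 1 2 power_mult_distrib sg using 3 by simp
  thus "1 / 2 * (norm (refr h x v))\<^sup>2 = 2 * (kin h)\<^sup>2 + \<mu> / norm (\<gamma> x)"
    unfolding V_inner_def using kin_sq[OF h] by simp
  show "refr h x (- v) = - refr h x v" unfolding refr_eq[OF s(3)] by (simp add: sgn_minus)
qed

text \<open>Refraction can be undone: it keeps the tangential part, and energy and outward direction
  determine the normal part. The formula is suited to limits in x and in the refracted
  velocity.\<close>

lemma Xp_velocity:
  assumes r: "r \<in> {1..m}" "(x, v) \<in> Xp r" and h: "0 < h"
  defines "A \<equiv> refr h x v \<bullet> \<gamma>' x"
  shows "v = A *\<^sub>R \<gamma>' x + sqrt (2 * V_outer \<omega> E (\<gamma> x) - A\<^sup>2) *\<^sub>R nrm x"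
proof -
  have r': "(x, v) \<in> Xp r \<or> (x, v) \<in> Xm r" using r(2) by blast
  note s = state[OF r(1) r']
  note onb = orthonormal_decomposition[OF s(8,7,9)]
  have A: "A = v \<bullet> \<gamma>' x" unfolding A_def by (rule refr_props(1)[OF r(1) r' h])
  have "0 < v \<bullet> nrm x" using r(2) by (simp add: Xi_plus_def inner_commute)
  moreover have "(v \<bullet> nrm x)\<^sup>2 = 2 * V_outer \<omega> E (\<gamma> x) - A\<^sup>2" using onb(2)[of v] s(5) unfolding A by simp
  ultimately have "v \<bullet> nrm x = sqrt (2 * V_outer \<omega> E (\<gamma> x) - A\<^sup>2)" by (metis less_imp_le real_sqrt_unique)
  thus ?thesis using onb(1)[of v] unfolding A by simp
qed

text \<open>Uniqueness for the equations replaces solutions by the explicit flows. For the converse,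
  the two half steps may name different indices for the intermediate state; disjointness of the
  intervals identifies them.\<close>

lemma return_map_eq:
  assumes h: "0 < h"
  shows "return_map \<omega> \<mu> E D L \<gamma> m a b \<alpha> \<beta> h = outer_step O inner_step h"
proof -
  have k: "0 < kin h" using h E by (simp add: kin_def)
  have w0: "\<omega> \<noteq> 0" using \<omega> by simp
  have lc: "(\<exists>s2>0. \<exists>y. lc_kepler_sol \<mu> (E + h) s2 y \<and> y 0 = \<gamma> \<xi>1 \<and>
              (y has_vector_derivative refr h \<xi>1 v1) (at 0 within {0..s2}) \<and>
              (\<forall>s\<in>{0<..<s2}. y s \<in> D) \<and> y s2 = \<gamma> \<xi>2 \<and>
              (y has_vector_derivative refr h \<xi>2 v2) (at s2 within {0..s2})) \<longleftrightarrow>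
      (\<exists>\<sigma>>0. (\<forall>\<tau>\<in>{0<..<\<sigma>}. kep (kin h) (\<gamma> \<xi>1) (refr h \<xi>1 v1) \<tau> \<in> D) \<and> kep (kin h) (\<gamma> \<xi>1) (refr h \<xi>1 v1) \<sigma> = \<gamma> \<xi>2 \<and>
        kep_vel (kin h) (\<gamma> \<xi>1) (refr h \<xi>1 v1) \<sigma> = norm (\<gamma> \<xi>2) *\<^sub>R refr h \<xi>2 v2)"
    if "r \<in> {1..m}" "(\<xi>1, v1) \<in> Xm r" "r' \<in> {1..m}" "(\<xi>2, v2) \<in> Xp r'" for r r' \<xi>1 v1 \<xi>2 v2
    unfolding kin_sq[OF h]
  proof (rule lc_arc_iff[OF k \<mu>])
    show "\<gamma> \<xi>1 \<noteq> 0" "\<gamma> \<xi>2 \<noteq> 0" using state(10)[OF that(1), of \<xi>1 v1] state(10)[OF that(3), of \<xi>2 v2] that(2,4) by blast+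
    show "1 / 2 * (norm (refr h \<xi>1 v1))\<^sup>2 = 2 * (kin h)\<^sup>2 + \<mu> / norm (\<gamma> \<xi>1)"
      using refr_props(4)[OF that(1) _ h, of \<xi>1 v1] that(2) by blast
  qed
  show ?thesis
  proof (intro equalityI subrelI)
    fix p q assume pq: "(p, q) \<in> return_map \<omega> \<mu> E D L \<gamma> m a b \<alpha> \<beta> h"
    obtain \<xi> v \<xi>2 v2 where e: "p = (\<xi>, v)" "q = (\<xi>2, v2)" by (cases p; cases q) blast
    obtain r s1 z u \<xi>1 s2 y r' where *: "r \<in> {1..m}" "(\<xi>, v) \<in> Xp r" "0 < s1"
      "newton_sol (harmonic_force \<omega>) s1 z u" "z 0 = \<gamma> \<xi>" "u 0 = v" "\<forall>s\<in>{0<..<s1}. z s \<notin> closure D" "z s1 = \<gamma> \<xi>1"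
      "(\<xi>1, u s1) \<in> Xm r" "0 < s2" "lc_kepler_sol \<mu> (E + h) s2 y" "y 0 = \<gamma> \<xi>1"
      "(y has_vector_derivative refr h \<xi>1 (u s1)) (at 0 within {0..s2})" "\<forall>s\<in>{0<..<s2}. y s \<in> D" "y s2 = \<gamma> \<xi>2"
      "(y has_vector_derivative refr h \<xi>2 v2) (at s2 within {0..s2})" "r' \<in> NA \<gamma> m a b r" "(\<xi>2, v2) \<in> Xp r'"
      using pq unfolding return_map_def e by auto
    have zs: "z t = osc \<omega> (\<gamma> \<xi>) v t" "u t = osc_vel \<omega> (\<gamma> \<xi>) v t" if "t \<in> {0..s1}" for t
      using newton_sol_harmonic[OF *(4) w0 that] *(5,6) by auto
    have "\<forall>t\<in>{0<..<s1}. osc \<omega> (\<gamma> \<xi>) v t \<notin> closure D" using *(7) zs(1) by auto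
    moreover have "osc \<omega> (\<gamma> \<xi>) v s1 = \<gamma> \<xi>1" "osc_vel \<omega> (\<gamma> \<xi>) v s1 = u s1" using zs[of s1] *(3,8) by auto
    ultimately have "(p, (\<xi>1, u s1)) \<in> outer_step" unfolding outer_step_iff e using *(1-3,9) by blast
    moreover have "((\<xi>1, u s1), q) \<in> inner_step h"
    proof -
      have "\<exists>\<sigma>>0. (\<forall>\<tau>\<in>{0<..<\<sigma>}. kep (kin h) (\<gamma> \<xi>1) (refr h \<xi>1 (u s1)) \<tau> \<in> D) \<and> kep (kin h) (\<gamma> \<xi>1) (refr h \<xi>1 (u s1)) \<sigma> = \<gamma> \<xi>2 \<and>
        kep_vel (kin h) (\<gamma> \<xi>1) (refr h \<xi>1 (u s1)) \<sigma> = norm (\<gamma> \<xi>2) *\<^sub>R refr h \<xi>2 v2"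
        unfolding lc[OF *(1,9) NA_mem[OF *(17)] *(18), symmetric] using *(10-16) by blast
      thus ?thesis unfolding inner_step_iff e using *(1,9,17,18) by blast
    qed
    ultimately show "(p, q) \<in> outer_step O inner_step h" by blast
  next
    fix p q assume "(p, q) \<in> outer_step O inner_step h"
    then obtain w where pw: "(p, w) \<in> outer_step" "(w, q) \<in> inner_step h" by blast
    obtain \<xi> v \<xi>1 v1 \<xi>2 v2 where e: "p = (\<xi>, v)" "w = (\<xi>1, v1)" "q = (\<xi>2, v2)" by (cases p; cases q; cases w) blast
    obtain r s1 where *: "r \<in> {1..m}" "(\<xi>, v) \<in> Xp r" "(\<xi>1, v1) \<in> Xm r" "0 < s1" "\<forall>t\<in>{0<..<s1}. osc \<omega> (\<gamma> \<xi>) v t \<notin> closure D"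
      "osc \<omega> (\<gamma> \<xi>) v s1 = \<gamma> \<xi>1" "osc_vel \<omega> (\<gamma> \<xi>) v s1 = v1" using pw(1) unfolding outer_step_iff e by blast
    obtain r0 r' where **: "r0 \<in> {1..m}" "r' \<in> NA \<gamma> m a b r0" "(\<xi>1, v1) \<in> Xm r0" "(\<xi>2, v2) \<in> Xp r'"
      "\<exists>\<sigma>>0. (\<forall>\<tau>\<in>{0<..<\<sigma>}. kep (kin h) (\<gamma> \<xi>1) (refr h \<xi>1 v1) \<tau> \<in> D) \<and> kep (kin h) (\<gamma> \<xi>1) (refr h \<xi>1 v1) \<sigma> = \<gamma> \<xi>2 \<and>
        kep_vel (kin h) (\<gamma> \<xi>1) (refr h \<xi>1 v1) \<sigma> = norm (\<gamma> \<xi>2) *\<^sub>R refr h \<xi>2 v2"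
      using pw(2) unfolding inner_step_iff e by blast
    have r0: "r0 = r" using index_unique[OF **(1) *(1), of \<xi>1] **(3) *(3) by (auto simp: Xi_minus_def)
    from **(5)[folded lc[OF **(1,3) NA_mem[OF **(2)] **(4)]]
    obtain s2 y where y: "0 < s2" "lc_kepler_sol \<mu> (E + h) s2 y" "y 0 = \<gamma> \<xi>1"
      "(y has_vector_derivative refr h \<xi>1 v1) (at 0 within {0..s2})" "\<forall>s\<in>{0<..<s2}. y s \<in> D" "y s2 = \<gamma> \<xi>2"
      "(y has_vector_derivative refr h \<xi>2 v2) (at s2 within {0..s2})" by blast
    show "(p, q) \<in> return_map \<omega> \<mu> E D L \<gamma> m a b \<alpha> \<beta> h"
      unfolding return_map_def e
      apply (simp only: mem_Collect_eq case_prod_conv)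
      apply (rule bexI[OF _ *(1)], rule conjI[OF *(2)])
      apply (rule exI[of _ s1], rule conjI[OF *(4)])
      apply (rule exI[of _ "osc \<omega> (\<gamma> \<xi>) v"], rule exI[of _ "osc_vel \<omega> (\<gamma> \<xi>) v"], rule exI[of _ \<xi>1], rule exI[of _ v1])
      using newton_sol_osc[OF w0] * y ** r0 by (metis osc_0)
  qed
qed

lemma outer_step_single: "(p, q) \<in> outer_step \<Longrightarrow> (p, q') \<in> outer_step \<Longrightarrow> q = q'"
proof -
  assume pq: "(p, q) \<in> outer_step" and pq': "(p, q') \<in> outer_step"
  obtain x v y u y' u' where e: "p = (x, v)" "q = (y, u)" "q' = (y', u')" by (cases p; cases q; cases q') blast
  obtain r s where *: "r \<in> {1..m}" "(y, u) \<in> Xm r" "0 < s" "\<forall>t\<in>{0<..<s}. osc \<omega> (\<gamma> x) v t \<notin> closure D"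
      "osc \<omega> (\<gamma> x) v s = \<gamma> y" "osc_vel \<omega> (\<gamma> x) v s = u" using pq unfolding outer_step_iff e by blast
  obtain r' s' where **: "r' \<in> {1..m}" "(y', u') \<in> Xm r'" "0 < s'" "\<forall>t\<in>{0<..<s'}. osc \<omega> (\<gamma> x) v t \<notin> closure D"
      "osc \<omega> (\<gamma> x) v s' = \<gamma> y'" "osc_vel \<omega> (\<gamma> x) v s' = u'" using pq' unfolding outer_step_iff e by blast
  have y: "y \<in> {0<..<L}" "y' \<in> {0..L}"
    using state(2)[OF *(1), of y u] state(3)[OF **(1), of y' u'] *(2) **(2) by blast+
  have f: "\<gamma> y \<in> closure D" "\<gamma> y' \<in> closure D" using on_frontier y by (auto simp: frontier_def)
  have "s = s'" by (rule first_exit_unique[where f = "osc \<omega> (\<gamma> x) v" and U = "- closure D"]) (use * ** f in auto)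
  hence "\<gamma> y = \<gamma> y'" "u = u'" using * ** by auto
  thus "q = q'" using inj_interior[OF y] e by simp
qed

lemma outer_step_reverse:
  assumes "((x, v), (y, u)) \<in> outer_step"
  shows "((y, - u), (x, - v)) \<in> outer_step"
proof -
  have w0: "\<omega> \<noteq> 0" using \<omega> by simp
  obtain r s where *: "r \<in> {1..m}" "(x, v) \<in> Xp r" "(y, u) \<in> Xm r" "0 < s" "\<forall>t\<in>{0<..<s}. osc \<omega> (\<gamma> x) v t \<notin> closure D"
      "osc \<omega> (\<gamma> x) v s = \<gamma> y" "osc_vel \<omega> (\<gamma> x) v s = u" using assms unfolding outer_step_iff by blast
  have rev: "osc \<omega> (\<gamma> y) (- u) t = osc \<omega> (\<gamma> x) v (s - t)" "osc_vel \<omega> (\<gamma> y) (- u) t = - osc_vel \<omega> (\<gamma> x) v (s - t)" for t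
    using osc_reverse[OF w0, of "\<gamma> x" v s t] *(6,7) by auto
  have "(y, - u) \<in> Xp r" "(x, - v) \<in> Xm r" using *(2,3) by (auto simp: Xi_plus_def Xi_minus_def)
  moreover have "\<exists>s>0. (\<forall>t\<in>{0<..<s}. osc \<omega> (\<gamma> y) (- u) t \<notin> closure D) \<and> osc \<omega> (\<gamma> y) (- u) s = \<gamma> x \<and> osc_vel \<omega> (\<gamma> y) (- u) s = - v"
    unfolding rev using *(4,5) by (intro exI[of _ s]) auto
  ultimately show ?thesis unfolding outer_step_iff using *(1) by blast
qed

lemma inner_step_single:
  assumes h: "0 < h" and pq: "(p, q) \<in> inner_step h" and pq': "(p, q') \<in> inner_step h"
  shows "q = q'"
proof -
  obtain x v y u y' u' where e: "p = (x, v)" "q = (y, u)" "q' = (y', u')" by (cases p; cases q; cases q') blast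
  let ?f = "kep (kin h) (\<gamma> x) (refr h x v)"
  let ?f' = "kep_vel (kin h) (\<gamma> x) (refr h x v)"
  obtain r s where *: "r \<in> {1..m}" "(y, u) \<in> Xp r" "0 < s" "\<forall>t\<in>{0<..<s}. ?f t \<in> D"
      "?f s = \<gamma> y" "?f' s = norm (\<gamma> y) *\<^sub>R refr h y u" using pq unfolding inner_step_iff e by (metis NA_mem)
  obtain r' s' where **: "r' \<in> {1..m}" "(y', u') \<in> Xp r'" "0 < s'" "\<forall>t\<in>{0<..<s'}. ?f t \<in> D"
      "?f s' = \<gamma> y'" "?f' s' = norm (\<gamma> y') *\<^sub>R refr h y' u'" using pq' NA_mem unfolding inner_step_iff e by blast
  have y: "y \<in> {0<..<L}" "y' \<in> {0..L}" "\<gamma> y \<noteq> 0"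
    using state(2,10)[OF *(1), of y u] state(3)[OF **(1), of y' u'] *(2) **(2) by blast+
  have f: "\<gamma> y \<notin> D" "\<gamma> y' \<notin> D" using on_frontier frontier_disjoint y by auto
  have "s = s'" by (rule first_exit_unique[where f = ?f and U = D]) (use * ** f in auto)
  hence "\<gamma> y = \<gamma> y'" using * ** by auto
  hence yy: "y = y'" using inj_interior[OF y(1,2)] by simp
  have "refr h y u = refr h y' u'" using * ** \<open>s = s'\<close> y(3) yy by simp
  hence "u = u'" using Xp_velocity[OF *(1,2) h] Xp_velocity[OF **(1,2) h] yy by metis
  thus ?thesis using yy e by simp
qed

lemma inner_step_reverse:
  assumes h: "0 < h" and pq: "((x, v), (y, u)) \<in> inner_step h"
  shows "((y, - u), (x, - v)) \<in> inner_step h"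
proof -
  have k0: "kin h \<noteq> 0" using h E by (simp add: kin_def)
  let ?V = "refr h x v" and ?V2 = "refr h y u"
  obtain r r' s where *: "r \<in> {1..m}" "r' \<in> NA \<gamma> m a b r" "(x, v) \<in> Xm r" "(y, u) \<in> Xp r'" "0 < s"
    "\<forall>t\<in>{0<..<s}. kep (kin h) (\<gamma> x) ?V t \<in> D" "kep (kin h) (\<gamma> x) ?V s = \<gamma> y"
    "kep_vel (kin h) (\<gamma> x) ?V s = norm (\<gamma> y) *\<^sub>R ?V2" using pq unfolding inner_step_iff by blast
  have r': "r' \<in> {1..m}" using NA_mem *(2) .
  have y0: "\<gamma> y \<noteq> 0" using state(10)[OF r'] *(4) by blast
  note rev = kep_reverse[OF k0 *(7)[symmetric] y0 *(8)]
  have m: "refr h x (- v) = - ?V" "refr h y (- u) = - ?V2"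
    using refr_props(5)[OF *(1) _ h, of x v] refr_props(5)[OF r' _ h, of y u] *(3,4) by blast+
  have "(y, - u) \<in> Xm r'" "(x, - v) \<in> Xp r" using *(3,4) by (auto simp: Xi_plus_def Xi_minus_def)
  moreover have "r \<in> NA \<gamma> m a b r'" by (rule NA_commute[OF *(1,2)])
  moreover have "\<exists>\<sigma>>0. (\<forall>\<tau>\<in>{0<..<\<sigma>}. kep (kin h) (\<gamma> y) (refr h y (- u)) \<tau> \<in> D) \<and> kep (kin h) (\<gamma> y) (refr h y (- u)) \<sigma> = \<gamma> x \<and>
        kep_vel (kin h) (\<gamma> y) (refr h y (- u)) \<sigma> = norm (\<gamma> x) *\<^sub>R refr h x (- v)"
    unfolding m rev using *(5,6) by (intro exI[of _ s]) auto
  ultimately show ?thesis unfolding inner_step_iff using r' by blast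
qed

lemma gamma_tendsto: "x \<in> {0<..<L} \<Longrightarrow> X \<longlonglongrightarrow> x \<Longrightarrow> (\<lambda>n. \<gamma> (X n)) \<longlonglongrightarrow> \<gamma> x"
  "x \<in> {0<..<L} \<Longrightarrow> X \<longlonglongrightarrow> x \<Longrightarrow> (\<lambda>n. \<gamma>' (X n)) \<longlonglongrightarrow> \<gamma>' x"
  using isCont_interior isCont_tendsto_compose by blast+

text \<open>A description of the normal by continuous data: \<i> times the tangent, up to the sign
  of its radial part, which is not 0.\<close>

lemma normal_formula:
  assumes "radial_point e x"
  shows "nrm x = sgn ((\<i> * \<gamma>' x) \<bullet> \<gamma> x) *\<^sub>R (\<i> * \<gamma>' x)" "(\<i> * \<gamma>' x) \<bullet> \<gamma> x \<noteq> 0"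
proof -
  note n = radial_normal[OF assms]
  have x: "x \<in> {0..L}" "0 < e" using assms by (auto simp: radial_point_def)
  let ?j = "\<i> * \<gamma>' x"
  have j: "norm ?j = 1" "?j \<bullet> \<gamma>' x = 0" using unit[OF x(1)] by (auto simp: norm_mult inner_complex_def)
  have "nrm x = ?j \<or> nrm x = - ?j" by (rule complex_orth_unique[OF j(1) n(1) unit[OF x(1)] j(2) n(2)])
  thus "nrm x = sgn (?j \<bullet> \<gamma> x) *\<^sub>R ?j" "?j \<bullet> \<gamma> x \<noteq> 0" using n(3) x(2) by (auto simp: sgn_if)
qed

lemma normal_tendsto:
  assumes "radial_point e x" "X \<longlonglongrightarrow> x" "\<And>n. \<exists>e. radial_point e (X n)"
  shows "(\<lambda>n. nrm (X n)) \<longlonglongrightarrow> nrm x"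
proof -
  have x: "x \<in> {0<..<L}" using assms(1) by (simp add: radial_point_def)
  have "(\<lambda>n. sgn ((\<i> * \<gamma>' (X n)) \<bullet> \<gamma> (X n)) *\<^sub>R (\<i> * \<gamma>' (X n))) \<longlonglongrightarrow> sgn ((\<i> * \<gamma>' x) \<bullet> \<gamma> x) *\<^sub>R (\<i> * \<gamma>' x)"
    by (intro tendsto_intros gamma_tendsto[OF x assms(2)] normal_formula(2)[OF assms(1)])
  moreover have "nrm (X n) = sgn ((\<i> * \<gamma>' (X n)) \<bullet> \<gamma> (X n)) *\<^sub>R (\<i> * \<gamma>' (X n))" for n
    using assms(3) normal_formula(1) by blast
  ultimately show ?thesis using normal_formula(1)[OF assms(1)] by simp
qed

text \<open>Continuity on the domain of the step, as p itself has an image. The return time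
  converges by \<open>exit_time_tendsto\<close>: the initial velocity is transversal, so return
  times cannot shrink to 0, and the final velocity points into D, so the limit curve enters D right
  after s.\<close>

lemma outer_step_tendsto:
  assumes pq: "(p, q) \<in> outer_step" and PQ: "\<And>n. (P n, Q n) \<in> outer_step" and lim: "P \<longlonglongrightarrow> p"
  shows "Q \<longlonglongrightarrow> q"
proof -
  have w0: "\<omega> \<noteq> 0" using \<omega> by simp
  define X V where "X = (\<lambda>n. fst (P n))" and "V = (\<lambda>n. snd (P n))"
  define Y U where "Y = (\<lambda>n. fst (Q n))" and "U = (\<lambda>n. snd (Q n))"
  obtain x v y u where e: "p = (x, v)" "q = (y, u)" by (cases p; cases q) blast
  have XV: "X \<longlonglongrightarrow> x" "V \<longlonglongrightarrow> v" using tendsto_fst[OF lim] tendsto_snd[OF lim] by (auto simp: X_def V_def e)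
  obtain r s where *: "r \<in> {1..m}" "(x, v) \<in> Xp r" "(y, u) \<in> Xm r" "0 < s" "\<forall>t\<in>{0<..<s}. osc \<omega> (\<gamma> x) v t \<notin> closure D"
      "osc \<omega> (\<gamma> x) v s = \<gamma> y" "osc_vel \<omega> (\<gamma> x) v s = u" using pq unfolding outer_step_iff e by blast
  have "\<exists>s r. r \<in> {1..m} \<and> (X n, V n) \<in> Xp r \<and> (Y n, U n) \<in> Xm r \<and> 0 < s \<and> (\<forall>t\<in>{0<..<s}. osc \<omega> (\<gamma> (X n)) (V n) t \<notin> closure D) \<and>
      osc \<omega> (\<gamma> (X n)) (V n) s = \<gamma> (Y n) \<and> osc_vel \<omega> (\<gamma> (X n)) (V n) s = U n" for n
  proof -
    have "((X n, V n), (Y n, U n)) \<in> outer_step" using PQ[of n] by (simp add: X_def V_def Y_def U_def)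
    thus ?thesis unfolding outer_step_iff by blast
  qed
  then obtain S where "\<And>n. \<exists>r. r \<in> {1..m} \<and> (X n, V n) \<in> Xp r \<and> (Y n, U n) \<in> Xm r \<and> 0 < S n \<and> (\<forall>t\<in>{0<..<S n}. osc \<omega> (\<gamma> (X n)) (V n) t \<notin> closure D) \<and>
      osc \<omega> (\<gamma> (X n)) (V n) (S n) = \<gamma> (Y n) \<and> osc_vel \<omega> (\<gamma> (X n)) (V n) (S n) = U n" by metis
  then obtain r' where S: "\<And>n. r' n \<in> {1..m}" "\<And>n. (X n, V n) \<in> Xp (r' n)" "\<And>n. (Y n, U n) \<in> Xm (r' n)" "\<And>n. 0 < S n"
      "\<And>n. \<forall>t\<in>{0<..<S n}. osc \<omega> (\<gamma> (X n)) (V n) t \<notin> closure D"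
      "\<And>n. osc \<omega> (\<gamma> (X n)) (V n) (S n) = \<gamma> (Y n)" "\<And>n. osc_vel \<omega> (\<gamma> (X n)) (V n) (S n) = U n" by metis
  note sx = state[OF *(1), of x v] note sy = state[OF *(1), of y u]
  have x: "x \<in> {0<..<L}" "nrm x \<bullet> \<gamma>' x = 0" "nrm x \<bullet> v \<noteq> 0" using sx(2,6,9) *(2) by blast+
  have y: "y \<in> {0<..<L}" "radial_point (\<eta> r) y" "y \<in> {0..L}" using sy(2-4) *(3) by blast+
  have Yn: "Y n \<in> {0..L}" for n using state(3)[OF S(1)] S(3) by blast
  have gX: "(\<lambda>n. \<gamma> (X n)) \<longlonglongrightarrow> \<gamma> x" by (rule gamma_tendsto[OF x(1) XV(1)])
  have St: "S \<longlonglongrightarrow> s"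
  proof (rule exit_time_tendsto[where P = "\<lambda>z t. osc \<omega> (fst z) (snd z) t" and X = "\<lambda>n. (\<gamma> (X n), V n)" and x = "(\<gamma> x, v)" and U = "- closure D" and W = D])
    fix \<phi> :: "nat \<Rightarrow> nat" and t :: real and T :: "nat \<Rightarrow> real" assume \<phi>: "strict_mono \<phi>" "T \<longlonglongrightarrow> t"
    note l = LIMSEQ_subseq_LIMSEQ[OF gX \<phi>(1), unfolded o_def] LIMSEQ_subseq_LIMSEQ[OF XV(2) \<phi>(1), unfolded o_def]
    show "(\<lambda>n. osc \<omega> (fst (\<gamma> (X (\<phi> n)), V (\<phi> n))) (snd (\<gamma> (X (\<phi> n)), V (\<phi> n))) (T n)) \<longlonglongrightarrow> osc \<omega> (fst (\<gamma> x, v)) (snd (\<gamma> x, v)) t"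
      unfolding osc_def fst_conv snd_conv by (intro tendsto_intros l \<phi>(2) w0)
  next
    fix \<phi> :: "nat \<Rightarrow> nat" assume \<phi>: "strict_mono \<phi>" "(\<lambda>n. S (\<phi> n)) \<longlonglongrightarrow> 0"
    note l = LIMSEQ_subseq_LIMSEQ[OF gX \<phi>(1), unfolded o_def] LIMSEQ_subseq_LIMSEQ[OF XV(2) \<phi>(1), unfolded o_def]
      LIMSEQ_subseq_LIMSEQ[OF XV(1) \<phi>(1), unfolded o_def]
    \<comment> \<open>Displacement divided by time, written through difference quotients of the
      coefficients of the flow so that its limit v can be read off.\<close>
    define d where "d = (\<lambda>n. ((cos (\<omega> * S (\<phi> n)) - cos (\<omega> * 0)) / S (\<phi> n)) *\<^sub>R \<gamma> (X (\<phi> n)) + ((sin (\<omega> * S (\<phi> n)) / \<omega> - sin (\<omega> * 0) / \<omega>) / S (\<phi> n)) *\<^sub>R V (\<phi> n))"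
    have nz: "S (\<phi> n) \<noteq> 0" for n using S(4)[of "\<phi> n"] by simp
    have "((\<lambda>t. cos (\<omega> * t)) has_real_derivative 0) (at 0)" "((\<lambda>t. sin (\<omega> * t) / \<omega>) has_real_derivative 1) (at 0)"
      using w0 by (auto intro!: derivative_eq_intros)
    from tendsto_add[OF quotient_tendsto[OF this(1) \<phi>(2) nz l(1)] quotient_tendsto[OF this(2) \<phi>(2) nz l(2)]]
    have d: "d \<longlonglongrightarrow> v" unfolding d_def by simp
    show False
    proof (rule no_short_return[OF x(1) l(3) x(2,3) \<phi>(2) S(4) d])
      fix n
      have "\<gamma> (X (\<phi> n)) + S (\<phi> n) *\<^sub>R d n = osc \<omega> (\<gamma> (X (\<phi> n))) (V (\<phi> n)) (S (\<phi> n))"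
        unfolding d_def osc_def using nz[of n] by (simp add: scaleR_add_right) (simp add: algebra_simps)
      thus "\<gamma> (X (\<phi> n)) + S (\<phi> n) *\<^sub>R d n \<in> frontier D" using S(6) on_frontier[OF Yn] by simp
    qed
  next
    fix e :: real assume e: "0 < e"
    have "nrm y \<bullet> u < 0" using *(3) by (simp add: Xi_minus_def)
    moreover have "(osc \<omega> (\<gamma> x) v has_vector_derivative u) (at s)"
      using osc_deriv(1)[OF w0, of "\<gamma> x" v s UNIV] *(7) by simp
    ultimately have "\<exists>t. s < t \<and> t < s + e \<and> osc \<omega> (\<gamma> x) v t \<in> D"
      using crossing(1)[OF y(2), of "osc \<omega> (\<gamma> x) v" s u e] *(6) e by blast
    thus "\<exists>t>s. t < s + e \<and> 0 < t \<and> osc \<omega> (fst (\<gamma> x, v)) (snd (\<gamma> x, v)) t \<in> D"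
      using *(4) by (auto intro: less_trans)
  next
    show "osc \<omega> (fst (\<gamma> (X n), V n)) (snd (\<gamma> (X n), V n)) (S n) \<notin> - closure D" for n
      using S(6) on_frontier[OF Yn] by (simp add: frontier_def)
  qed (use S(4,5) *(5) D(1) closure_subset[of D] in auto)
  have "(\<lambda>n. osc \<omega> (\<gamma> (X n)) (V n) (S n)) \<longlonglongrightarrow> osc \<omega> (\<gamma> x) v s"
    unfolding osc_def by (intro tendsto_intros gX XV St w0)
  hence "(\<lambda>n. \<gamma> (Y n)) \<longlonglongrightarrow> \<gamma> y" unfolding S(6) *(6) .
  hence Yt: "Y \<longlonglongrightarrow> y" by (rule param_tendsto[OF y(1) Yn])
  have "(\<lambda>n. osc_vel \<omega> (\<gamma> (X n)) (V n) (S n)) \<longlonglongrightarrow> osc_vel \<omega> (\<gamma> x) v s"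
    unfolding osc_vel_def by (intro tendsto_intros gX XV St w0)
  hence Ut: "U \<longlonglongrightarrow> u" unfolding S(7) *(7) .
  have "(\<lambda>n. (Y n, U n)) \<longlonglongrightarrow> (y, u)" by (rule tendsto_Pair[OF Yt Ut])
  thus ?thesis by (simp add: Y_def U_def e)
qed

lemma inner_step_tendsto:
  assumes h: "0 < h" and pq: "(p, q) \<in> inner_step h" and PQ: "\<And>n. (P n, Q n) \<in> inner_step h" and lim: "P \<longlonglongrightarrow> p"
  shows "Q \<longlonglongrightarrow> q"
proof -
  let ?k = "kin h"
  have k0: "?k \<noteq> 0" using h E by (simp add: kin_def)
  define X V where "X = (\<lambda>n. fst (P n))" and "V = (\<lambda>n. snd (P n))"
  define Y U where "Y = (\<lambda>n. fst (Q n))" and "U = (\<lambda>n. snd (Q n))"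
  obtain x v y u where e: "p = (x, v)" "q = (y, u)" by (cases p; cases q) blast
  have XV: "X \<longlonglongrightarrow> x" "V \<longlonglongrightarrow> v" using tendsto_fst[OF lim] tendsto_snd[OF lim] by (auto simp: X_def V_def e)
  define Z where "Z = (\<lambda>n. refr h (X n) (V n))"
  define z where "z = refr h x v"
  obtain r r0 s where *: "r \<in> {1..m}" "r0 \<in> NA \<gamma> m a b r" "(x, v) \<in> Xm r" "(y, u) \<in> Xp r0" "0 < s" "\<forall>t\<in>{0<..<s}. kep ?k (\<gamma> x) z t \<in> D"
      "kep ?k (\<gamma> x) z s = \<gamma> y" "kep_vel ?k (\<gamma> x) z s = norm (\<gamma> y) *\<^sub>R refr h y u" using pq unfolding inner_step_iff e z_def by blast
  have "\<exists>s r r0. r \<in> {1..m} \<and> r0 \<in> {1..m} \<and> (X n, V n) \<in> Xm r \<and> (Y n, U n) \<in> Xp r0 \<and> 0 < s \<and> (\<forall>t\<in>{0<..<s}. kep ?k (\<gamma> (X n)) (Z n) t \<in> D) \<and>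
      kep ?k (\<gamma> (X n)) (Z n) s = \<gamma> (Y n) \<and> kep_vel ?k (\<gamma> (X n)) (Z n) s = norm (\<gamma> (Y n)) *\<^sub>R refr h (Y n) (U n)" for n
  proof -
    have "((X n, V n), (Y n, U n)) \<in> inner_step h" using PQ[of n] by (simp add: X_def V_def Y_def U_def)
    thus ?thesis unfolding inner_step_iff Z_def using NA_mem by blast
  qed
  then obtain S where "\<And>n. \<exists>r r0. r \<in> {1..m} \<and> r0 \<in> {1..m} \<and> (X n, V n) \<in> Xm r \<and> (Y n, U n) \<in> Xp r0 \<and> 0 < S n \<and> (\<forall>t\<in>{0<..<S n}. kep ?k (\<gamma> (X n)) (Z n) t \<in> D) \<and>
      kep ?k (\<gamma> (X n)) (Z n) (S n) = \<gamma> (Y n) \<and> kep_vel ?k (\<gamma> (X n)) (Z n) (S n) = norm (\<gamma> (Y n)) *\<^sub>R refr h (Y n) (U n)" by metis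
  then obtain r' r1 where S: "\<And>n. r' n \<in> {1..m}" "\<And>n. r1 n \<in> {1..m}" "\<And>n. (X n, V n) \<in> Xm (r' n)" "\<And>n. (Y n, U n) \<in> Xp (r1 n)" "\<And>n. 0 < S n"
      "\<And>n. \<forall>t\<in>{0<..<S n}. kep ?k (\<gamma> (X n)) (Z n) t \<in> D"
      "\<And>n. kep ?k (\<gamma> (X n)) (Z n) (S n) = \<gamma> (Y n)" "\<And>n. kep_vel ?k (\<gamma> (X n)) (Z n) (S n) = norm (\<gamma> (Y n)) *\<^sub>R refr h (Y n) (U n)" by metis
  have r0: "r0 \<in> {1..m}" using NA_mem *(2) .
  have xr: "(x, v) \<in> Xp r \<or> (x, v) \<in> Xm r" and yr: "(y, u) \<in> Xp r0 \<or> (y, u) \<in> Xm r0" using * by auto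
  note sx = state[OF *(1) xr] note sy = state[OF r0 yr]
  have Xr: "(X n, V n) \<in> Xp (r' n) \<or> (X n, V n) \<in> Xm (r' n)" and Yr: "(Y n, U n) \<in> Xp (r1 n) \<or> (Y n, U n) \<in> Xm (r1 n)" for n
    using S(3,4) by auto
  have Yn: "Y n \<in> {0..L}" and Xn: "X n \<in> {0..L}" for n using state(3)[OF S(2) Yr] state(3)[OF S(1) Xr] .
  have gX: "(\<lambda>n. \<gamma> (X n)) \<longlonglongrightarrow> \<gamma> x" "(\<lambda>n. \<gamma>' (X n)) \<longlonglongrightarrow> \<gamma>' x" by (rule gamma_tendsto[OF sx(2) XV(1)])+
  have nX: "(\<lambda>n. nrm (X n)) \<longlonglongrightarrow> nrm x" by (rule normal_tendsto[OF sx(4) XV(1)]) (use state(4)[OF S(1) Xr] in blast)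
  have Zt: "Z \<longlonglongrightarrow> z"
  proof -
    \<comment> \<open>On incoming states the sign is constantly -1, so the refraction formula is
      continuous there.\<close>
    have neg: "sgn (V n \<bullet> nrm (X n)) = -1" "sgn (v \<bullet> nrm x) = -1" for n
      using S(3)[of n] *(3) by (auto simp: Xi_minus_def inner_commute sgn_if)
    show ?thesis unfolding Z_def z_def refr_eq[OF Xn] refr_eq[OF sx(3)] neg V_inner_def
      by (intro tendsto_intros gX nX XV) (use sx(10) in auto)
  qed
  have zn: "0 < nrm x \<bullet> (- z)"
  proof -
    have "v \<bullet> nrm x < 0" using *(3) by (simp add: Xi_minus_def inner_commute)
    hence "z \<bullet> nrm x < 0" unfolding z_def refr_props(2)[OF *(1) xr h] using refr_props(3)[OF *(1) xr h] by simp
    thus ?thesis by (simp add: inner_commute)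
  qed
  have un: "0 < nrm y \<bullet> refr h y u"
  proof -
    have "0 < u \<bullet> nrm y" using *(4) by (simp add: Xi_plus_def inner_commute)
    hence "0 < refr h y u \<bullet> nrm y" unfolding refr_props(2)[OF r0 yr h] using refr_props(3)[OF r0 yr h] by simp
    thus ?thesis by (simp add: inner_commute)
  qed
  have St: "S \<longlonglongrightarrow> s"
  proof (rule exit_time_tendsto[where P = "\<lambda>z t. kep ?k (fst z) (snd z) t" and X = "\<lambda>n. (\<gamma> (X n), Z n)" and x = "(\<gamma> x, z)" and U = D and W = "- closure D"])
    fix \<phi> :: "nat \<Rightarrow> nat" and t :: real and T :: "nat \<Rightarrow> real" assume \<phi>: "strict_mono \<phi>" "T \<longlonglongrightarrow> t"
    note l = LIMSEQ_subseq_LIMSEQ[OF gX(1) \<phi>(1), unfolded o_def] LIMSEQ_subseq_LIMSEQ[OF Zt \<phi>(1), unfolded o_def]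
    show "(\<lambda>n. kep ?k (fst (\<gamma> (X (\<phi> n)), Z (\<phi> n))) (snd (\<gamma> (X (\<phi> n)), Z (\<phi> n))) (T n)) \<longlonglongrightarrow> kep ?k (fst (\<gamma> x, z)) (snd (\<gamma> x, z)) t"
      unfolding kep_def fst_conv snd_conv by (intro tendsto_intros l \<phi>(2)) (use k0 in auto)
  next
    fix \<phi> :: "nat \<Rightarrow> nat" assume \<phi>: "strict_mono \<phi>" "(\<lambda>n. S (\<phi> n)) \<longlonglongrightarrow> 0"
    note l = LIMSEQ_subseq_LIMSEQ[OF gX(1) \<phi>(1), unfolded o_def] LIMSEQ_subseq_LIMSEQ[OF Zt \<phi>(1), unfolded o_def]
      LIMSEQ_subseq_LIMSEQ[OF XV(1) \<phi>(1), unfolded o_def]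
    define c1 c2 c3 where "c1 = (\<lambda>t. (cosh (?k * t))\<^sup>2)" and "c2 = (\<lambda>t. cosh (?k * t) * sinh (?k * t) / ?k)"
      and "c3 = (\<lambda>t. (sinh (?k * t))\<^sup>2 / (4 * ?k\<^sup>2))"
    define W2 W3 where "W2 = (\<lambda>n. norm (\<gamma> (X (\<phi> n))) *\<^sub>R Z (\<phi> n))" and "W3 = (\<lambda>n. (Z (\<phi> n))\<^sup>2 * cnj (\<gamma> (X (\<phi> n))))"
    define d where "d = (\<lambda>n. ((c1 (S (\<phi> n)) - c1 0) / S (\<phi> n)) *\<^sub>R \<gamma> (X (\<phi> n)) + ((c2 (S (\<phi> n)) - c2 0) / S (\<phi> n)) *\<^sub>R W2 n
      + ((c3 (S (\<phi> n)) - c3 0) / S (\<phi> n)) *\<^sub>R W3 n)"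
    have nz: "S (\<phi> n) \<noteq> 0" for n using S(5)[of "\<phi> n"] by simp
    have W: "W2 \<longlonglongrightarrow> norm (\<gamma> x) *\<^sub>R z" "W3 \<longlonglongrightarrow> z\<^sup>2 * cnj (\<gamma> x)" unfolding W2_def W3_def by (intro tendsto_intros l)+
    have dc: "(c1 has_real_derivative 0) (at 0)" "(c2 has_real_derivative 1) (at 0)" "(c3 has_real_derivative 0) (at 0)"
      unfolding c1_def c2_def c3_def using k0 by (auto intro!: derivative_eq_intros)
    from tendsto_add[OF tendsto_add[OF quotient_tendsto[OF dc(1) \<phi>(2) nz l(1)] quotient_tendsto[OF dc(2) \<phi>(2) nz W(1)]] quotient_tendsto[OF dc(3) \<phi>(2) nz W(2)]]
    have d: "d \<longlonglongrightarrow> norm (\<gamma> x) *\<^sub>R z" unfolding d_def by simp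
    have nn: "nrm x \<bullet> (norm (\<gamma> x) *\<^sub>R z) \<noteq> 0" using zn sx(10) by simp
    show False
    proof (rule no_short_return[OF sx(2) l(3) sx(9) nn \<phi>(2) S(5) d])
      fix n
      have c0: "c1 0 = 1" "c2 0 = 0" "c3 0 = 0" by (auto simp: c1_def c2_def c3_def)
      have "S (\<phi> n) *\<^sub>R d n = (c1 (S (\<phi> n)) - 1) *\<^sub>R \<gamma> (X (\<phi> n)) + c2 (S (\<phi> n)) *\<^sub>R W2 n + c3 (S (\<phi> n)) *\<^sub>R W3 n"
        unfolding d_def c0 using nz[of n] by (simp add: scaleR_add_right)
      hence "\<gamma> (X (\<phi> n)) + S (\<phi> n) *\<^sub>R d n = kep ?k (\<gamma> (X (\<phi> n))) (Z (\<phi> n)) (S (\<phi> n))"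
        unfolding kep_def c1_def c2_def c3_def W2_def W3_def by (simp add: algebra_simps)
      thus "\<gamma> (X (\<phi> n)) + S (\<phi> n) *\<^sub>R d n \<in> frontier D" using S(7) on_frontier[OF Yn] by simp
    qed
  next
    fix e :: real assume e: "0 < e"
    have dk: "(kep ?k (\<gamma> x) z has_vector_derivative norm (\<gamma> y) *\<^sub>R refr h y u) (at s)"
      using kep_deriv[OF k0, of "\<gamma> x" z s] *(8) by simp
    have "0 < nrm y \<bullet> (norm (\<gamma> y) *\<^sub>R refr h y u)" using un sy(10) by simp
    hence "\<exists>t. s < t \<and> t < s + e \<and> kep ?k (\<gamma> x) z t \<notin> closure D"
      using crossing(2)[OF sy(4), of "kep ?k (\<gamma> x) z" s "norm (\<gamma> y) *\<^sub>R refr h y u" e] *(7) dk e by blast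
    thus "\<exists>t>s. t < s + e \<and> 0 < t \<and> kep ?k (fst (\<gamma> x, z)) (snd (\<gamma> x, z)) t \<in> - closure D"
      using *(5) by (auto intro: less_trans)
  next
    show "kep ?k (fst (\<gamma> (X n), Z n)) (snd (\<gamma> (X n), Z n)) (S n) \<notin> D" for n
      using S(7) on_frontier[OF Yn] frontier_disjoint by simp
  qed (use S(5,6) *(6) D(1) closure_subset[of D] in auto)
  have "(\<lambda>n. kep ?k (\<gamma> (X n)) (Z n) (S n)) \<longlonglongrightarrow> kep ?k (\<gamma> x) z s"
    unfolding kep_def by (intro tendsto_intros gX Zt St) (use k0 in auto)
  hence gY: "(\<lambda>n. \<gamma> (Y n)) \<longlonglongrightarrow> \<gamma> y" unfolding S(7) *(7) .
  hence Yt: "Y \<longlonglongrightarrow> y" by (rule param_tendsto[OF sy(2) Yn])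
  have gY': "(\<lambda>n. \<gamma>' (Y n)) \<longlonglongrightarrow> \<gamma>' y" by (rule gamma_tendsto[OF sy(2) Yt])
  have nY: "(\<lambda>n. nrm (Y n)) \<longlonglongrightarrow> nrm y" by (rule normal_tendsto[OF sy(4) Yt]) (use state(4)[OF S(2) Yr] in blast)
  \<comment> \<open>Division by |z| gives the refracted end velocities, from which
    \<open>Xp_velocity\<close> recovers the outgoing ones.\<close>
  have "(\<lambda>n. kep_vel ?k (\<gamma> (X n)) (Z n) (S n) /\<^sub>R norm (\<gamma> (Y n))) \<longlonglongrightarrow> kep_vel ?k (\<gamma> x) z s /\<^sub>R norm (\<gamma> y)"
    unfolding kep_vel_def by (intro tendsto_intros gX Zt St gY) (use k0 sy(10) in auto)
  hence Rt: "(\<lambda>n. refr h (Y n) (U n)) \<longlonglongrightarrow> refr h y u"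
    unfolding S(8) *(8) using sy(10) nonzero[OF Yn] by simp
  have Ueq: "U n = (refr h (Y n) (U n) \<bullet> \<gamma>' (Y n)) *\<^sub>R \<gamma>' (Y n) + sqrt (2 * V_outer \<omega> E (\<gamma> (Y n)) - (refr h (Y n) (U n) \<bullet> \<gamma>' (Y n))\<^sup>2) *\<^sub>R nrm (Y n)" for n
    by (rule Xp_velocity[OF S(2,4) h])
  have "(\<lambda>n. (refr h (Y n) (U n) \<bullet> \<gamma>' (Y n)) *\<^sub>R \<gamma>' (Y n) + sqrt (2 * V_outer \<omega> E (\<gamma> (Y n)) - (refr h (Y n) (U n) \<bullet> \<gamma>' (Y n))\<^sup>2) *\<^sub>R nrm (Y n))
    \<longlonglongrightarrow> (refr h y u \<bullet> \<gamma>' y) *\<^sub>R \<gamma>' y + sqrt (2 * V_outer \<omega> E (\<gamma> y) - (refr h y u \<bullet> \<gamma>' y)\<^sup>2) *\<^sub>R nrm y"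
    unfolding V_outer_def by (intro tendsto_intros Rt gY gY' nY)
  hence Ut: "U \<longlonglongrightarrow> u" using Ueq Xp_velocity[OF r0 *(4) h] by simp
  have "(\<lambda>n. (Y n, U n)) \<longlonglongrightarrow> (y, u)" by (rule tendsto_Pair[OF Yt Ut])
  thus ?thesis by (simp add: Y_def U_def e)
qed

end

section \<open>Words, itineraries and a countable Poincare-Miranda theorem\<close>

lemma geometric_summable_int:
  fixes c :: real
  assumes "0 \<le> c" "c < 1"
  shows "(\<lambda>k::int. c ^ nat \<bar>k\<bar>) summable_on UNIV"
proof -
  have geo: "(\<lambda>n::nat. c ^ n) summable_on UNIV"
    using assms by (intro norm_summable_imp_summable_on) (auto simp: summable_geometric)
  have 1: "(\<lambda>k::int. c ^ nat \<bar>k\<bar>) summable_on range int"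
    by (subst summable_on_reindex) (use geo in \<open>auto simp: o_def\<close>)
  have 2: "(\<lambda>k::int. c ^ nat \<bar>k\<bar>) summable_on range (\<lambda>n. - int n - 1)"
  proof (subst summable_on_reindex)
    have "c ^ nat \<bar>- int n - 1\<bar> = c * c ^ n" for n
    proof -
      have "nat \<bar>- int n - 1\<bar> = Suc n" by simp
      thus ?thesis by simp
    qed
    thus "(\<lambda>k::int. c ^ nat \<bar>k\<bar>) \<circ> (\<lambda>n. - int n - 1) summable_on UNIV"
      using summable_on_cmult_right[OF geo, of c] by (simp add: o_def)
  qed (auto simp: inj_on_def)
  have "k \<in> range int \<union> range (\<lambda>n. - int n - 1)" for k :: int
  proof (cases "0 \<le> k")
    case True
    thus ?thesis by (metis UnI1 rangeI zero_le_imp_eq_int)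
  next
    case False
    hence "k = - int (nat (- k - 1)) - 1" by simp
    thus ?thesis by blast
  qed
  hence "UNIV = range int \<union> range (\<lambda>n. - int n - 1)" by blast
  moreover have "range int \<inter> range (\<lambda>n. - int n - 1) = {}" by auto
  ultimately show ?thesis using summable_on_Un_disjoint[OF 1 2] by simp
qed

lemma word_dist_summable: "(\<lambda>k::int. (if l k = l' k then 0 else 1) / 4 ^ nat \<bar>k\<bar> :: real) summable_on UNIV"
  by (rule summable_on_comparison_test[OF geometric_summable_int[of "1/4"]]) (auto simp: power_divide)

lemma word_metric: "Metric_space M word_dist"
proof
  fix l l' l'' :: "int \<Rightarrow> nat"
  show "0 \<le> word_dist l l'" unfolding word_dist_def by (rule infsum_nonneg) auto
  show "word_dist l l' = word_dist l' l" unfolding word_dist_def by (rule infsum_cong) auto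
  show "word_dist l l' = 0 \<longleftrightarrow> l = l'"
  proof
    assume 0: "word_dist l l' = 0"
    show "l = l'"
    proof
      fix k
      have "(if l k = l' k then 0 else 1) / 4 ^ nat \<bar>k\<bar> = (0::real)"
        by (rule nonneg_infsum_le_0D[OF _ word_dist_summable[of l l']])
          (use 0 in \<open>auto simp: word_dist_def\<close>)
      thus "l k = l' k" by (auto split: if_splits)
    qed
  qed (simp add: word_dist_def)
  show "word_dist l l'' \<le> word_dist l l' + word_dist l' l''"
    unfolding word_dist_def infsum_add[OF word_dist_summable word_dist_summable, symmetric]
    by (rule infsum_mono[OF word_dist_summable summable_on_add[OF word_dist_summable word_dist_summable]])
      (auto simp: divide_simps)
qed

text \<open>4^-|k| is the product of two factors 2^-|k|; where the words differ, one factor is at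
  most 2^-N and the other stays summable.\<close>

lemma word_dist_le:
  assumes "\<And>k. \<bar>k\<bar> \<le> int N \<Longrightarrow> l k = l' k"
  shows "word_dist l l' \<le> (1/2) ^ N * (\<Sum>\<^sub>\<infinity>k::int. (1/2) ^ nat \<bar>k\<bar>)"
proof -
  have "word_dist l l' \<le> (\<Sum>\<^sub>\<infinity>k::int. (1/2) ^ N * (1/2) ^ nat \<bar>k\<bar>)"
    unfolding word_dist_def
  proof (rule infsum_mono[OF word_dist_summable])
    show "(\<lambda>k::int. (1/2::real) ^ N * (1/2) ^ nat \<bar>k\<bar>) summable_on UNIV"
      by (intro summable_on_cmult_right geometric_summable_int) auto
    fix k :: int
    show "(if l k = l' k then 0 else 1) / 4 ^ nat \<bar>k\<bar> \<le> (1/2::real) ^ N * (1/2) ^ nat \<bar>k\<bar>"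
    proof (cases "\<bar>k\<bar> \<le> int N")
      case False
      hence "N \<le> nat \<bar>k\<bar>" by linarith
      hence "(1/2::real) ^ nat \<bar>k\<bar> \<le> (1/2) ^ N" by (intro power_decreasing) auto
      hence "(1/2::real) ^ nat \<bar>k\<bar> * (1/2) ^ nat \<bar>k\<bar> \<le> (1/2) ^ N * (1/2) ^ nat \<bar>k\<bar>" by (intro mult_right_mono) auto
      moreover have "(1/2::real) ^ nat \<bar>k\<bar> * (1/2) ^ nat \<bar>k\<bar> = 1 / 4 ^ nat \<bar>k\<bar>"
        unfolding power_mult_distrib[symmetric] by (simp add: power_divide)
      ultimately show ?thesis by simp
    qed (use assms in auto)
  qed
  also have "\<dots> = (1/2) ^ N * (\<Sum>\<^sub>\<infinity>k::int. (1/2) ^ nat \<bar>k\<bar>)"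
    by (rule infsum_cmult_right) (intro geometric_summable_int; simp)
  finally show ?thesis .
qed

section \<open>Two-sided iterates of a single-valued and injective relation\<close>

locale bijective_relation =
  fixes F :: "('a \<times> 'a) set"
  assumes single: "(x, y) \<in> F \<Longrightarrow> (x, z) \<in> F \<Longrightarrow> y = z" and inj: "(x, y) \<in> F \<Longrightarrow> (z, y) \<in> F \<Longrightarrow> x = z"
begin

lemma pow_single: "(x, y) \<in> F ^^ n \<Longrightarrow> (x, z) \<in> F ^^ n \<Longrightarrow> y = z"
proof (induction n arbitrary: y z)
  case (Suc n)
  then obtain u w where "(x, u) \<in> F ^^ n" "(u, y) \<in> F" "(x, w) \<in> F ^^ n" "(w, z) \<in> F" by auto
  thus ?case using Suc.IH single by metis
qed simp

lemma pow_inj: "(x, y) \<in> F ^^ n \<Longrightarrow> (z, y) \<in> F ^^ n \<Longrightarrow> x = z"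
proof (induction n arbitrary: y)
  case (Suc n)
  then obtain u w where "(x, u) \<in> F ^^ n" "(u, y) \<in> F" "(z, w) \<in> F ^^ n" "(w, y) \<in> F" by auto
  thus ?case using Suc.IH inj by metis
qed simp

lemma iterate_nonneg: "(x, y) \<in> F ^^ n \<Longrightarrow> iterate F (int n) x = y"
  unfolding iterate_def using pow_single by (simp add: the_equality)

lemma iterate_neg: "(y, x) \<in> F ^^ n \<Longrightarrow> iterate F (- int n) x = y"
proof (cases n)
  case (Suc k)
  assume "(y, x) \<in> F ^^ n"
  hence "(THE z. (z, x) \<in> F ^^ n) = y" using pow_inj by blast
  thus ?thesis unfolding iterate_def Suc by (simp del: relpow.simps of_nat_Suc)
qed (simp add: iterate_def)

lemma orbit:
  assumes "\<And>k. (f k, f (k + 1)) \<in> F"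
  shows "f 0 \<in> invariant_set F" "iterate F k (f 0) = f k"
proof -
  have pow: "(f k, f (k + int n)) \<in> F ^^ n" for k n
  proof (induction n)
    case (Suc n)
    have "(f (k + int n), f (k + int n + 1)) \<in> F" by (rule assms)
    moreover have "f (k + int n + 1) = f (k + int (Suc n))" by (rule arg_cong[of _ _ f]) simp
    ultimately show ?case using Suc relpow_Suc_I[of "f k" "f (k + int n)" n F] by metis
  qed simp
  have neg: "(f (- int n), f 0) \<in> F ^^ n" for n using pow[of "- int n" n] by simp
  have pos: "(f 0, f (int n)) \<in> F ^^ n" for n using pow[of 0 n] by simp
  show "f 0 \<in> invariant_set F" unfolding invariant_set_def using neg pos by blast
  show "iterate F k (f 0) = f k"
  proof (cases "0 \<le> k")
    case True
    thus ?thesis using iterate_nonneg[OF pos[of "nat k"]] by simp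
  next
    case False
    thus ?thesis using iterate_neg[OF neg[of "nat (- k)"]] by simp
  qed
qed

lemma iterate_step:
  assumes "x \<in> invariant_set F"
  shows "(iterate F k x, iterate F (k + 1) x) \<in> F"
proof (cases "0 \<le> k")
  case True
  then obtain n where n: "k = int n" by (rule nonneg_int_cases)
  obtain y where y: "(x, y) \<in> F ^^ Suc n" using assms unfolding invariant_set_def by blast
  then obtain z where z: "(x, z) \<in> F ^^ n" "(z, y) \<in> F" by auto
  have "iterate F (k + 1) x = y" using iterate_nonneg[OF y] n by (simp add: add.commute)
  thus ?thesis using iterate_nonneg[OF z(1)] z(2) n by simp
next
  case False
  hence "k = - int (Suc (nat (- k - 1)))" by simp
  then obtain n where n: "k = - int (Suc n)" by blast
  obtain y where y: "(y, x) \<in> F ^^ Suc n" using assms unfolding invariant_set_def by blast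
  then obtain z where z: "(y, z) \<in> F" "(z, x) \<in> F ^^ n" by (meson relpow_Suc_D2)
  have "k + 1 = - int n" using n by simp
  thus ?thesis using iterate_neg[OF y] iterate_neg[OF z(2)] z(1) n by (metis)
qed

lemma iterate_0 [simp]: "iterate F 0 x = x"
  using iterate_nonneg[of x x 0] by simp

text \<open>The shifted sequence of iterates is again an orbit, so \<open>orbit\<close> identifies
  its iterates.\<close>

lemma iterate_shift:
  assumes "x \<in> invariant_set F"
  shows "iterate F 1 x \<in> invariant_set F" "iterate F k (iterate F 1 x) = iterate F (k + 1) x"
  using orbit[of "\<lambda>k. iterate F (k + 1) x", OF iterate_step[OF assms]] by simp_all

text \<open>Convergence is an abstract predicate; the two assumptions are continuity of the map and
  of its inverse, used upwards and downwards from k = 0.\<close>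

lemma iterate_tendsto:
  fixes X :: "nat \<Rightarrow> 'a" and conv :: "(nat \<Rightarrow> 'a) \<Rightarrow> 'a \<Rightarrow> bool"
  assumes top: "\<And>p q P Q. (p, q) \<in> F \<Longrightarrow> (\<And>n. (P n, Q n) \<in> F) \<Longrightarrow> conv P p \<Longrightarrow> conv Q q"
    "\<And>p q P Q. (p, q) \<in> F \<Longrightarrow> (\<And>n. (P n, Q n) \<in> F) \<Longrightarrow> conv Q q \<Longrightarrow> conv P p"
    and X: "\<And>n. X n \<in> invariant_set F" "x \<in> invariant_set F" "conv X x"
  shows "conv (\<lambda>n. iterate F k (X n)) (iterate F k x)"
proof (induction k rule: int_induct[where k = 0])
  case base
  thus ?case using X by simp
next
  case (step1 k)
  show ?case by (rule top(1)[OF iterate_step[OF X(2)] iterate_step[OF X(1)] step1(2)])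
next
  case (step2 k)
  show ?case
    using top(2)[OF iterate_step[OF X(2), of "k - 1"] iterate_step[OF X(1), where k = "k - 1"]] step2(2) by simp
qed

end

text \<open>Kuhn's lemma on the first \<open>n\<close> coordinates with mesh \<open>1/(n+1)\<close>; the approximate zeros accumulate at a
  common zero.\<close>

lemma countable_poincare_miranda:
  fixes A B :: "nat \<Rightarrow> real" and G :: "nat \<Rightarrow> (nat \<Rightarrow> real) \<Rightarrow> real"
  defines "cube \<equiv> {y. \<forall>i. A i \<le> y i \<and> y i \<le> B i}"
  assumes AB: "\<And>k. A k < B k" "\<And>k. \<bar>A k\<bar> \<le> M" "\<And>k. \<bar>B k\<bar> \<le> M"
    and cont: "\<And>k Y y. (\<And>n. Y n \<in> cube) \<Longrightarrow> y \<in> cube \<Longrightarrow> (\<And>i. (\<lambda>n. Y n i) \<longlonglongrightarrow> y i) \<Longrightarrow> (\<lambda>n. G k (Y n)) \<longlonglongrightarrow> G k y"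
    and lo: "\<And>k y. y \<in> cube \<Longrightarrow> y k = A k \<Longrightarrow> G k y < 0"
    and hi: "\<And>k y. y \<in> cube \<Longrightarrow> y k = B k \<Longrightarrow> 0 < G k y"
  shows "\<exists>y\<in>cube. \<forall>k. G k y = 0"
proof -
  \<comment> \<open>Grid points of relative mesh 1/(n+1) in the first n coordinates; the remaining
    coordinates are frozen at their lower ends.\<close>
  define pt where "pt = (\<lambda>n (x :: nat \<Rightarrow> nat) k. if k < n then A k + real (x k) / real (Suc n) * (B k - A k) else A k)"
  have pt_cube: "pt n x \<in> cube" if "\<forall>i<n. x i \<le> Suc n" for n x
  proof -
    have "A i \<le> pt n x i \<and> pt n x i \<le> B i" for i
    proof (cases "i < n")
      case True
      have q: "0 \<le> real (x i) / real (Suc n)" "real (x i) / real (Suc n) \<le> 1" using that True by auto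
      have "0 \<le> real (x i) / real (Suc n) * (B i - A i)" using q AB(1)[of i] by simp
      moreover have "real (x i) / real (Suc n) * (B i - A i) \<le> 1 * (B i - A i)"
        using q AB(1)[of i] by (intro mult_right_mono) auto
      ultimately show ?thesis using True by (simp add: pt_def)
    qed (use AB(1)[of i] in \<open>simp add: pt_def\<close>)
    thus ?thesis by (simp add: cube_def)
  qed
  \<comment> \<open>Label 0 marks a negative value of G; by \<open>lo\<close> and \<open>hi\<close>
    the labels on opposite faces are 0 and 1, as Kuhn's lemma demands.\<close>
  define label where "label = (\<lambda>n x i. if G i (pt n x) < 0 then 0 else (1::nat))"
  have "\<exists>q. (\<forall>i<n. q i < Suc n) \<and> (\<forall>i<n. \<exists>r s. (\<forall>j<n. q j \<le> r j \<and> r j \<le> q j + 1) \<and> (\<forall>j<n. q j \<le> s j \<and> s j \<le> q j + 1) \<and> label n r i \<noteq> label n s i)" for n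
  proof (rule kuhn_lemma[of "Suc n" n "label n"])
    show "\<forall>x. (\<forall>i<n. x i \<le> Suc n) \<longrightarrow> (\<forall>i<n. x i = 0 \<longrightarrow> label n x i = 0)"
      using lo pt_cube by (auto simp: label_def pt_def)
    show "\<forall>x. (\<forall>i<n. x i \<le> Suc n) \<longrightarrow> (\<forall>i<n. x i = Suc n \<longrightarrow> label n x i = 1)"
    proof (intro allI impI)
      fix x i assume x: "\<forall>i<n. x i \<le> Suc n" "i < n" "x i = Suc n"
      have "pt n x i = B i" using x by (simp add: pt_def)
      thus "label n x i = 1" using hi[OF pt_cube[OF x(1)], of i] by (simp add: label_def)
    qed
  qed (simp, simp add: label_def, blast)
  then obtain q where q: "\<And>n. \<forall>i<n. q n i < Suc n"
    "\<And>n. \<forall>i<n. \<exists>r s. (\<forall>j<n. q n j \<le> r j \<and> r j \<le> q n j + 1) \<and> (\<forall>j<n. q n j \<le> s j \<and> s j \<le> q n j + 1) \<and> label n r i \<noteq> label n s i"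
    by metis
  define Y where "Y = (\<lambda>n. pt n (q n))"
  have Yb: "Y n \<in> cube" for n unfolding Y_def using pt_cube[of n "q n"] q(1)[of n] by (simp add: less_imp_le)
  have Yn: "norm (Y n i) \<le> M" for n i
  proof -
    have "A i \<le> Y n i" "Y n i \<le> B i" using Yb by (auto simp: cube_def)
    thus ?thesis using AB(2,3)[of i] by (simp add: abs_le_iff)
  qed
  have "\<exists>\<phi> :: nat \<Rightarrow> nat. strict_mono \<phi> \<and> (\<forall>i. \<exists>l. (\<lambda>n. Y (\<phi> n) i) \<longlonglongrightarrow> l)"
    by (rule function_convergent_subsequence[of "UNIV :: nat set" Y M]) (use Yn in \<open>simp_all, blast\<close>)
  then obtain \<phi> where \<phi>: "strict_mono \<phi>" "\<And>i. \<exists>l. (\<lambda>n. Y (\<phi> n) i) \<longlonglongrightarrow> l" by blast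
  then obtain y where y: "\<And>i. (\<lambda>n. Y (\<phi> n) i) \<longlonglongrightarrow> y i" by metis
  have yb: "y \<in> cube"
  proof -
    have "A i \<le> y i \<and> y i \<le> B i" for i
    proof
      show "A i \<le> y i" by (rule LIMSEQ_le_const[OF y]) (use Yb in \<open>auto simp: cube_def\<close>)
      show "y i \<le> B i" by (rule LIMSEQ_le_const2[OF y]) (use Yb in \<open>auto simp: cube_def\<close>)
    qed
    thus ?thesis by (simp add: cube_def)
  qed
  have near: "\<bar>pt n r i - Y n i\<bar> \<le> (B i - A i) / real (Suc n)" if "\<forall>j<n. q n j \<le> r j \<and> r j \<le> q n j + 1" for n r i
  proof (cases "i < n")
    case True
    have "pt n r i - Y n i = (real (r i) - real (q n i)) / real (Suc n) * (B i - A i)"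
      using True by (simp add: pt_def Y_def diff_divide_distrib algebra_simps)
    moreover have "q n i \<le> r i" "r i \<le> q n i + 1" using that True by auto
    hence "0 \<le> (real (r i) - real (q n i)) / real (Suc n)" "(real (r i) - real (q n i)) / real (Suc n) \<le> 1 / real (Suc n)"
      by (auto intro!: divide_right_mono)
    hence "\<bar>(real (r i) - real (q n i)) / real (Suc n) * (B i - A i)\<bar> \<le> 1 / real (Suc n) * (B i - A i)"
      using AB(1)[of i] by (simp only: abs_mult abs_of_nonneg) (intro mult_mono, auto)
    ultimately show ?thesis by simp
  qed (use AB(1)[of i] in \<open>simp add: pt_def Y_def\<close>)
  have "G i y = 0" for i
  proof -
    \<comment> \<open>Skipping the first terms ensures that i < \<psi> n, so that Kuhn's lemma
      speaks about coordinate i.\<close>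
    define \<psi> where "\<psi> = (\<lambda>n. \<phi> (n + Suc i))"
    have \<psi>: "i < \<psi> n" "n < \<psi> n" for n using strict_mono_imp_increasing[OF \<phi>(1), of "n + Suc i"] by (auto simp: \<psi>_def)
    have Y\<psi>: "(\<lambda>n. Y (\<psi> n) j) \<longlonglongrightarrow> y j" for j unfolding \<psi>_def by (rule LIMSEQ_ignore_initial_segment[OF y])
    have "\<exists>r s. (\<forall>j<\<psi> n. q (\<psi> n) j \<le> r j \<and> r j \<le> q (\<psi> n) j + 1) \<and> (\<forall>j<\<psi> n. q (\<psi> n) j \<le> s j \<and> s j \<le> q (\<psi> n) j + 1) \<and>
       G i (pt (\<psi> n) r) < 0 \<and> 0 \<le> G i (pt (\<psi> n) s)" for n
    proof -
      obtain r s where rs: "\<forall>j<\<psi> n. q (\<psi> n) j \<le> r j \<and> r j \<le> q (\<psi> n) j + 1" "\<forall>j<\<psi> n. q (\<psi> n) j \<le> s j \<and> s j \<le> q (\<psi> n) j + 1"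
        "label (\<psi> n) r i \<noteq> label (\<psi> n) s i" using q(2)[of "\<psi> n"] \<psi>(1) by blast
      from rs(3) have "(G i (pt (\<psi> n) r) < 0 \<and> 0 \<le> G i (pt (\<psi> n) s)) \<or> (G i (pt (\<psi> n) s) < 0 \<and> 0 \<le> G i (pt (\<psi> n) r))"
        by (auto simp: label_def split: if_splits)
      thus ?thesis using rs(1,2) by blast
    qed
    then obtain r s where rs: "\<And>n. \<forall>j<\<psi> n. q (\<psi> n) j \<le> r n j \<and> r n j \<le> q (\<psi> n) j + 1" "\<And>n. \<forall>j<\<psi> n. q (\<psi> n) j \<le> s n j \<and> s n j \<le> q (\<psi> n) j + 1"
       "\<And>n. G i (pt (\<psi> n) (r n)) < 0" "\<And>n. 0 \<le> G i (pt (\<psi> n) (s n))" by metis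
    \<comment> \<open>All vertices of the Kuhn cubes converge to y, since the mesh tends to 0; those
      with negative and those with nonnegative value then force \<open>G i y = 0\<close>.\<close>
    have conv: "(\<lambda>n. G i (pt (\<psi> n) (u n))) \<longlonglongrightarrow> G i y"
      if u: "\<And>n. \<forall>j<\<psi> n. q (\<psi> n) j \<le> u n j \<and> u n j \<le> q (\<psi> n) j + 1" for u
    proof (rule cont[OF _ yb])
      show "pt (\<psi> n) (u n) \<in> cube" for n
      proof (rule pt_cube, intro allI impI)
        fix j assume "j < \<psi> n"
        thus "u n j \<le> Suc (\<psi> n)" using u[of n] q(1)[of "\<psi> n"] by (metis Suc_eq_plus1 Suc_leI add_le_mono1 dual_order.trans le_trans not_less_eq_eq order_less_imp_le)
      qed
      fix j
      have "(\<lambda>n. pt (\<psi> n) (u n) j - Y (\<psi> n) j) \<longlonglongrightarrow> 0"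
      proof (rule Lim_null_comparison)
        show "\<forall>\<^sub>F n in sequentially. norm (pt (\<psi> n) (u n) j - Y (\<psi> n) j) \<le> (B j - A j) * inverse (real (Suc n))"
        proof (rule always_eventually, rule allI)
          fix n
          have "norm (pt (\<psi> n) (u n) j - Y (\<psi> n) j) \<le> (B j - A j) / real (Suc (\<psi> n))" using near[OF u] by simp
          also have "\<dots> \<le> (B j - A j) / real (Suc n)" using \<psi>(2)[of n] AB(1)[of j] by (intro divide_left_mono) auto
          finally show "norm (pt (\<psi> n) (u n) j - Y (\<psi> n) j) \<le> (B j - A j) * inverse (real (Suc n))" by (simp add: divide_inverse)
        qed
        show "(\<lambda>n. (B j - A j) * inverse (real (Suc n))) \<longlonglongrightarrow> 0"
          using tendsto_mult_right_zero[OF LIMSEQ_inverse_real_of_nat] .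
      qed
      from tendsto_add[OF this Y\<psi>[of j]] show "(\<lambda>n. pt (\<psi> n) (u n) j) \<longlonglongrightarrow> y j" by simp
    qed
    have "G i y \<le> 0" by (rule LIMSEQ_le_const2[OF conv[OF rs(1)]]) (use rs(3) less_imp_le in blast)
    moreover have "0 \<le> G i y" by (rule LIMSEQ_le_const[OF conv[OF rs(2)]]) (use rs(4) in blast)
    ultimately show ?thesis by simp
  qed
  thus ?thesis using yb by blast
qed

section \<open>Symbolic dynamics\<close>

context billiard_intervals
begin

text \<open>sqrt 2 times the sum of the derivatives at p of the outer length from e to p and of the
  inner length from p to q. It vanishes iff the arriving outer and the departing inner velocity have
  the same tangential part, which is Snell's law.\<close>

definition slope :: "real \<Rightarrow> real \<Rightarrow> real \<Rightarrow> real \<Rightarrow> real" where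
  "slope h e p q = (- outer_vel \<omega> R2 (\<gamma> p) (\<gamma> e) - inner_vel \<mu> (kin h) (\<gamma> p) (\<gamma> q)) \<bullet> \<gamma>' p"

lemma slope_tendsto:
  assumes i: "i \<in> {1..m}" "j \<in> NA \<gamma> m a b i" and pe: "p \<in> {a i<..<b i}" "e \<in> {a i<..<b i}" "q \<in> {a j<..<b j}" and h: "0 < h"
    and l: "P \<longlonglongrightarrow> p" "X \<longlonglongrightarrow> e" "Q \<longlonglongrightarrow> q"
  shows "(\<lambda>n. slope h (X n) (P n) (Q n)) \<longlonglongrightarrow> slope h e p q"
proof -
  have j: "j \<in> {1..m}" using NA_mem i(2) .
  interpret O: outer_arcs \<omega> E R2 "\<rho> i" "\<gamma> p" "\<gamma> e" by (rule outer_arcs[OF i(1) pe(1,2)])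
  interpret I: inner_arcs \<mu> "kin h" "\<gamma> p" "\<gamma> q" by (rule inner_arcs[OF i pe(1,3) h])
  have gp: "(\<lambda>n. \<gamma> (P n)) \<longlonglongrightarrow> \<gamma> p" "(\<lambda>n. \<gamma>' (P n)) \<longlonglongrightarrow> \<gamma>' p" by (rule gamma_tendsto[OF in_L[OF i(1) pe(1)] l(1)])+
  have ge: "(\<lambda>n. \<gamma> (X n)) \<longlonglongrightarrow> \<gamma> e" by (rule gamma_tendsto[OF in_L[OF i(1) pe(2)] l(2)])
  have gq: "(\<lambda>n. \<gamma> (Q n)) \<longlonglongrightarrow> \<gamma> q" by (rule gamma_tendsto[OF in_L[OF j pe(3)] l(3)])
  have c: "(\<lambda>n. outer_cos R2 (\<gamma> (P n)) (\<gamma> (X n))) \<longlonglongrightarrow> O.c"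
    unfolding outer_cos_def outer_disc_def by (intro tendsto_intros gp ge) (use O.R2_pos in auto)
  have ov: "(\<lambda>n. outer_vel \<omega> R2 (\<gamma> (P n)) (\<gamma> (X n))) \<longlonglongrightarrow> O.v"
    unfolding outer_vel_def by (intro tendsto_intros gp ge c) (use O.s in auto)
  have d: "(\<lambda>n. inner_d (\<gamma> (P n)) (\<gamma> (Q n))) \<longlonglongrightarrow> I.d" unfolding inner_d_def by (intro tendsto_intros gp gq) auto
  have mm: "(\<lambda>n. inner_m (\<gamma> (P n)) (\<gamma> (Q n))) \<longlonglongrightarrow> I.m" unfolding inner_m_def by (intro tendsto_intros gp gq d) (use I.d in auto)
  have C: "(\<lambda>n. inner_C \<mu> (kin h) (\<gamma> (P n)) (\<gamma> (Q n))) \<longlonglongrightarrow> I.C"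
    unfolding inner_C_def by (intro tendsto_intros gp gq d) (use I.\<mu> in auto)
  have S: "(\<lambda>n. inner_S \<mu> (kin h) (\<gamma> (P n)) (\<gamma> (Q n))) \<longlonglongrightarrow> I.S"
    unfolding inner_S_def by (intro tendsto_intros C)
  have iv: "(\<lambda>n. inner_vel \<mu> (kin h) (\<gamma> (P n)) (\<gamma> (Q n))) \<longlonglongrightarrow> inner_vel \<mu> (kin h) (\<gamma> p) (\<gamma> q)"
    unfolding inner_vel_def by (intro tendsto_intros gp gq mm C S) (use I.S I.pq in auto)
  show ?thesis unfolding slope_def by (intro tendsto_intros ov iv gp)
qed

lemma refr_char:
  assumes r: "r \<in> {1..m}" "(x, v) \<in> Xp r \<or> (x, v) \<in> Xm r" and h: "0 < h"
    and V: "1 / 2 * (norm V)\<^sup>2 = V_inner \<mu> E h (\<gamma> x)" "V \<bullet> \<gamma>' x = v \<bullet> \<gamma>' x" "sgn (V \<bullet> nrm x) = sgn (v \<bullet> nrm x)"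
  shows "refr h x v = V"
proof -
  note s = state[OF r]
  note onb = orthonormal_decomposition[OF s(8,7,9), of V]
  have "(V \<bullet> nrm x)\<^sup>2 = 2 * V_inner \<mu> E h (\<gamma> x) - (v \<bullet> \<gamma>' x)\<^sup>2" using onb(2) V(1,2) by simp
  hence "\<bar>V \<bullet> nrm x\<bar> = sqrt (2 * V_inner \<mu> E h (\<gamma> x) - (v \<bullet> \<gamma>' x)\<^sup>2)" by (metis real_sqrt_abs)
  hence "V \<bullet> nrm x = sgn (v \<bullet> nrm x) * sqrt (2 * V_inner \<mu> E h (\<gamma> x) - (v \<bullet> \<gamma>' x)\<^sup>2)"
    using V(3) by (metis abs_mult_sgn mult.commute)
  thus ?thesis unfolding refr_eq[OF s(3)] using onb(1) V(2) by simp
qed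

lemma outer_states:
  assumes i: "i \<in> {1..m}" and x: "x \<in> {\<alpha> i..\<beta> i}" and y: "y \<in> {\<alpha> i..\<beta> i}"
  shows "(x, outer_vel \<omega> R2 (\<gamma> x) (\<gamma> y)) \<in> Xp i" "(y, - outer_vel \<omega> R2 (\<gamma> y) (\<gamma> x)) \<in> Xm i"
    "((x, outer_vel \<omega> R2 (\<gamma> x) (\<gamma> y)), (y, - outer_vel \<omega> R2 (\<gamma> y) (\<gamma> x))) \<in> outer_step"
proof -
  have x': "x \<in> {a i<..<b i}" and y': "y \<in> {a i<..<b i}" using in_ab[OF i] x y by auto
  interpret A: outer_arcs \<omega> E R2 "\<rho> i" "\<gamma> x" "\<gamma> y" by (rule outer_arcs[OF i x' y'])
  interpret B: outer_arcs \<omega> E R2 "\<rho> i" "\<gamma> y" "\<gamma> x" by (rule outer_arcs[OF i y' x'])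
  show 1: "(x, outer_vel \<omega> R2 (\<gamma> x) (\<gamma> y)) \<in> Xp i"
    unfolding Xi_plus_def using x A.v_energy outer_vel_normal[OF i x' y'] by simp
  show 2: "(y, - outer_vel \<omega> R2 (\<gamma> y) (\<gamma> x)) \<in> Xm i"
    unfolding Xi_minus_def using y B.v_energy outer_vel_normal[OF i y' x'] by simp
  show "((x, outer_vel \<omega> R2 (\<gamma> x) (\<gamma> y)), (y, - outer_vel \<omega> R2 (\<gamma> y) (\<gamma> x))) \<in> outer_step"
    unfolding outer_step_iff
  proof (intro bexI[OF _ i] conjI 1 2 exI[of _ A.T] ballI)
    fix t assume "t \<in> {0<..<A.T}"
    thus "osc \<omega> (\<gamma> x) (outer_vel \<omega> R2 (\<gamma> x) (\<gamma> y)) t \<notin> closure D" using outer_outside[OF i x' y'] by simp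
  qed (use A.T(1) A.osc_end in auto)
qed

text \<open>The first zero slope says that the arriving outer velocity at y refracts into the
  initial velocity of the inner arc. The second, read backwards in time, says that the outgoing
  velocity at x refracts into the final velocity of that arc. The signs of the normal parts come
  from \<open>inner_vel_normal\<close> and \<open>outer_vel_normal\<close>.\<close>

lemma inner_state:
  assumes lg: "large h" and i: "i \<in> {1..m}" "j \<in> NA \<gamma> m a b i" and y: "y \<in> {\<alpha> i..\<beta> i}" and e: "e \<in> {\<alpha> i..\<beta> i}"
    and x: "x \<in> {\<alpha> j..\<beta> j}" and f: "f \<in> {\<alpha> j..\<beta> j}"
    and sl: "slope h e y x = 0" "slope h f x y = 0"
  shows "((y, - outer_vel \<omega> R2 (\<gamma> y) (\<gamma> e)), (x, outer_vel \<omega> R2 (\<gamma> x) (\<gamma> f))) \<in> inner_step h"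
proof -
  have j: "j \<in> {1..m}" using NA_mem i(2) .
  have ji: "i \<in> NA \<gamma> m a b j" by (rule NA_commute[OF i])
  have y': "y \<in> {a i<..<b i}" and e': "e \<in> {a i<..<b i}" and x': "x \<in> {a j<..<b j}" and f': "f \<in> {a j<..<b j}"
    using in_ab[OF i(1)] in_ab[OF j] y e x f by auto
  have h: "0 < h" using lg by (simp add: large_def)
  interpret I: inner_arcs \<mu> "kin h" "\<gamma> y" "\<gamma> x" by (rule inner_arcs[OF i y' x' h])
  interpret J: inner_arcs \<mu> "kin h" "\<gamma> x" "\<gamma> y" by (rule inner_arcs[OF j ji x' y' h])
  have k0: "kin h \<noteq> 0" using I.k by simp
  note s1 = outer_states(2)[OF i(1) e y] and s2 = outer_states(1)[OF j x f]
  have V: "V_inner \<mu> E h z = 2 * (kin h)\<^sup>2 + \<mu> / norm z" for z unfolding V_inner_def using kin_sq[OF h] by simp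
  have r1: "refr h y (- outer_vel \<omega> R2 (\<gamma> y) (\<gamma> e)) = inner_vel \<mu> (kin h) (\<gamma> y) (\<gamma> x)"
  proof (rule refr_char[OF i(1) disjI2[OF s1] h])
    show "1 / 2 * (norm (inner_vel \<mu> (kin h) (\<gamma> y) (\<gamma> x)))\<^sup>2 = V_inner \<mu> E h (\<gamma> y)" unfolding V by (rule I.vel_energy)
    show "inner_vel \<mu> (kin h) (\<gamma> y) (\<gamma> x) \<bullet> \<gamma>' y = - outer_vel \<omega> R2 (\<gamma> y) (\<gamma> e) \<bullet> \<gamma>' y"
      using sl(1) unfolding slope_def by (simp add: inner_diff_left)
    have "inner_vel \<mu> (kin h) (\<gamma> y) (\<gamma> x) \<bullet> nrm y < 0" using inner_vel_normal[OF lg i y' x'] by (simp add: inner_commute)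
    moreover have "- outer_vel \<omega> R2 (\<gamma> y) (\<gamma> e) \<bullet> nrm y < 0" using outer_vel_normal[OF i(1) y' e'] by (simp add: inner_commute)
    ultimately show "sgn (inner_vel \<mu> (kin h) (\<gamma> y) (\<gamma> x) \<bullet> nrm y) = sgn (- outer_vel \<omega> R2 (\<gamma> y) (\<gamma> e) \<bullet> nrm y)"
      by (simp add: sgn_if)
  qed
  have r2: "refr h x (outer_vel \<omega> R2 (\<gamma> x) (\<gamma> f)) = - inner_vel \<mu> (kin h) (\<gamma> x) (\<gamma> y)"
  proof (rule refr_char[OF j disjI1[OF s2] h])
    show "1 / 2 * (norm (- inner_vel \<mu> (kin h) (\<gamma> x) (\<gamma> y)))\<^sup>2 = V_inner \<mu> E h (\<gamma> x)" unfolding V using J.vel_energy by simp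
    show "- inner_vel \<mu> (kin h) (\<gamma> x) (\<gamma> y) \<bullet> \<gamma>' x = outer_vel \<omega> R2 (\<gamma> x) (\<gamma> f) \<bullet> \<gamma>' x"
      using sl(2) unfolding slope_def by (simp add: inner_diff_left)
    have "0 < - inner_vel \<mu> (kin h) (\<gamma> x) (\<gamma> y) \<bullet> nrm x" using inner_vel_normal[OF lg j ji x' y'] by (simp add: inner_commute)
    moreover have "0 < outer_vel \<omega> R2 (\<gamma> x) (\<gamma> f) \<bullet> nrm x" using outer_vel_normal[OF j x' f'] by (simp add: inner_commute)
    ultimately show "sgn (- inner_vel \<mu> (kin h) (\<gamma> x) (\<gamma> y) \<bullet> nrm x) = sgn (outer_vel \<omega> R2 (\<gamma> x) (\<gamma> f) \<bullet> nrm x)"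
      by (simp only: sgn_if) simp
  qed
  have w: "inner_vel \<mu> (kin h) (\<gamma> y) (\<gamma> x) * cnj I.a / 2 = I.w" using I.vel_start I.ab(2) by (simp add: field_simps)
  have kh: "kep (kin h) (\<gamma> y) (inner_vel \<mu> (kin h) (\<gamma> y) (\<gamma> x)) \<tau> = (hyp (kin h) I.a I.w \<tau>)\<^sup>2"
    "kep_vel (kin h) (\<gamma> y) (inner_vel \<mu> (kin h) (\<gamma> y) (\<gamma> x)) \<tau> = 2 * hyp (kin h) I.a I.w \<tau> * hyp_vel (kin h) I.a I.w \<tau>" for \<tau>
    using kep_hyp[OF k0, of I.a "inner_vel \<mu> (kin h) (\<gamma> y) (\<gamma> x)" \<tau>] unfolding w I.ab(1) .
  show ?thesis unfolding inner_step_iff r1 r2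
  proof (intro bexI[OF _ i(1)] bexI[OF _ i(2)] conjI s1 s2 exI[of _ I.\<sigma>] ballI)
    show "0 < I.\<sigma>" by (rule I.\<sigma>)
    show "kep (kin h) (\<gamma> y) (inner_vel \<mu> (kin h) (\<gamma> y) (\<gamma> x)) t \<in> D" if "t \<in> {0<..<I.\<sigma>}" for t
      unfolding kh using inner_inside[OF lg i y' x'] that by simp
    show "kep (kin h) (\<gamma> y) (inner_vel \<mu> (kin h) (\<gamma> y) (\<gamma> x)) I.\<sigma> = \<gamma> x" unfolding kh I.hyp_ends by (rule I.ab)
    have n: "complex_of_real (norm (\<gamma> x)) = I.b * cnj I.b" using norm_square_cnj[of I.b] I.ab(8) by (simp flip: of_real_power)
    show "kep_vel (kin h) (\<gamma> y) (inner_vel \<mu> (kin h) (\<gamma> y) (\<gamma> x)) I.\<sigma> = norm (\<gamma> x) *\<^sub>R - inner_vel \<mu> (kin h) (\<gamma> x) (\<gamma> y)"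
      unfolding kh I.hyp_ends I.vel_end[symmetric] scaleR_conv_of_real n using I.ab(4) by simp
  qed
qed

lemma realize_word:
  assumes lg: "large h" and l: "l \<in> words \<gamma> m a b"
  shows "\<exists>f. (\<forall>k. (f k, f (k + 1)) \<in> outer_step O inner_step h) \<and> (\<forall>k. fst (f k) \<in> {\<alpha> (l k)..\<beta> (l k)})"
proof -
  have h: "0 < h" using lg by (simp add: large_def)
  have lm: "l k \<in> {1..m}" and lN: "l (k + 1) \<in> NA \<gamma> m a b (l k)" for k using l by (auto simp: words_def)
  have lN': "l k \<in> NA \<gamma> m a b (l (k + 1))" for k by (rule NA_commute[OF lm lN])
  \<comment> \<open>Boundary points of the orbit are numbered by integers: 2 k is the start and 2 k
    + 1 the end of the k-th outer arc, so both carry the letter \<open>l k\<close>.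
    \<open>en\<close> is the neighbour along the outer arc and \<open>qn\<close> the neighbour along
    the inner arc.\<close>
  define en qn where "en = (\<lambda>z::int. if even z then z + 1 else z - 1)" and "qn = (\<lambda>z::int. if even z then z - 1 else z + 1)"
  define I where "I = (\<lambda>z::int. l (z div 2))"
  have Im: "I z \<in> {1..m}" for z using lm by (simp add: I_def)
  have Ie: "I (en z) = I z" for z unfolding I_def en_def by (cases "even z") (auto elim!: evenE oddE)
  have Iq: "I (qn z) \<in> NA \<gamma> m a b (I z)" for z
  proof (cases "even z")
    case True
    then obtain j where "z = 2 * j" by (rule evenE)
    moreover have "(2 * j - 1) div 2 = j - 1" by simp
    ultimately show ?thesis using lN'[of "j - 1"] by (simp add: I_def qn_def)
  next
    case False
    then obtain j where z: "z = 2 * j + 1" by (rule oddE)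
    moreover have "(2 * j + 1 + 1) div 2 = j + 1" by simp
    ultimately show ?thesis using lN[of j] by (simp add: I_def qn_def add.commute)
  qed
  \<comment> \<open>\<open>int_decode\<close> enumerates the integers, which puts the two-sided
    system in the form of \<open>countable_poincare_miranda\<close>.\<close>
  define A B where "A = (\<lambda>n. \<alpha> (I (int_decode n)))" and "B = (\<lambda>n. \<beta> (I (int_decode n)))"
  define u where "u = (\<lambda>(y :: nat \<Rightarrow> real) z. y (int_encode z))"
  \<comment> \<open>The constant factor normalizes the sign: by \<open>slope_sign\<close> and the
    opposite signs in \<open>slopes\<close>, G is negative at \<alpha> and positive at \<beta>,
    whatever the other coordinates are.\<close>
  define G where "G = (\<lambda>n y. let z = int_decode n in
    - (\<gamma> (\<alpha> (I z)) \<bullet> \<gamma>' (\<alpha> (I z))) * slope h (u y (en z)) (u y z) (u y (qn z)))"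
  have ub: "u y z \<in> {\<alpha> (I z)..\<beta> (I z)}" if "y \<in> {y. \<forall>i. A i \<le> y i \<and> y i \<le> B i}" for y z
    using that unfolding A_def B_def u_def by (auto dest!: spec[of _ "int_encode z"])
  have ub': "u y z \<in> {a (I z)<..<b (I z)}" if "y \<in> {y. \<forall>i. A i \<le> y i \<and> y i \<le> B i}" for y z
    using in_ab[OF Im ub[OF that]] .
  have sgn: "0 < slope h (u y (en z)) (u y z) (u y (qn z)) * (\<gamma> (u y z) \<bullet> \<gamma>' (u y z))"
    if y: "y \<in> {y. \<forall>i. A i \<le> y i \<and> y i \<le> B i}" and z: "u y z \<in> {\<alpha> (I z), \<beta> (I z)}" for y z
    unfolding slope_def
    by (rule slope_sign[OF lg Im Iq ub'[OF y] ub'[OF y] z]) (use ub'[OF y, of "en z"] Ie in simp)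
  have "\<exists>y\<in>{y. \<forall>i. A i \<le> y i \<and> y i \<le> B i}. \<forall>n. G n y = 0"
  proof (rule countable_poincare_miranda[where M = L])
    fix n
    note e = ends[OF Im[of "int_decode n"]]
    show "A n < B n" "\<bar>A n\<bar> \<le> L" "\<bar>B n\<bar> \<le> L" using e unfolding A_def B_def by auto
  next
    fix n Y y assume Y: "\<And>n. Y n \<in> {y. \<forall>i. A i \<le> y i \<and> y i \<le> B i}" "y \<in> {y. \<forall>i. A i \<le> y i \<and> y i \<le> B i}" "\<And>i. (\<lambda>n. Y n i) \<longlonglongrightarrow> y i"
    let ?z = "int_decode n"
    have "(\<lambda>j. slope h (u (Y j) (en ?z)) (u (Y j) ?z) (u (Y j) (qn ?z))) \<longlonglongrightarrow> slope h (u y (en ?z)) (u y ?z) (u y (qn ?z))"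
      by (rule slope_tendsto[OF Im Iq ub'[OF Y(2)] _ ub'[OF Y(2)] h])
        (use ub'[OF Y(2), of "en ?z"] Ie Y(3) in \<open>auto simp: u_def\<close>)
    thus "(\<lambda>j. G n (Y j)) \<longlonglongrightarrow> G n y" unfolding G_def Let_def by (intro tendsto_intros)
  next
    fix n y assume y: "y \<in> {y. \<forall>i. A i \<le> y i \<and> y i \<le> B i}"
    let ?z = "int_decode n"
    have uz: "u y ?z = y n" by (simp add: u_def)
    {
      assume "y n = A n"
      hence "u y ?z = \<alpha> (I ?z)" by (simp add: uz A_def)
      thus "G n y < 0" using sgn[OF y, of ?z] unfolding G_def Let_def by (simp add: mult.commute)
    next
      assume "y n = B n"
      hence u: "u y ?z = \<beta> (I ?z)" by (simp add: uz B_def)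
      hence "0 < slope h (u y (en ?z)) (u y ?z) (u y (qn ?z)) * (\<gamma> (\<beta> (I ?z)) \<bullet> \<gamma>' (\<beta> (I ?z)))" using sgn[OF y, of ?z] by simp
      thus "0 < G n y" using slopes[OF Im[of ?z]] unfolding G_def Let_def
        by (auto simp: zero_less_mult_iff mult_less_0_iff)
    }
  qed
  then obtain y where y: "y \<in> {y. \<forall>i. A i \<le> y i \<and> y i \<le> B i}" "\<And>n. G n y = 0" by blast
  have zero: "slope h (u y (en z)) (u y z) (u y (qn z)) = 0" for z
  proof -
    have "G (int_encode z) y = 0" by (rule y(2))
    moreover have "\<gamma> (\<alpha> (I z)) \<bullet> \<gamma>' (\<alpha> (I z)) \<noteq> 0" using slope_nz[OF Im, of "\<alpha> (I z)"] by auto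
    ultimately show ?thesis unfolding G_def Let_def by simp
  qed
  define X Z where "X = (\<lambda>k. u y (2 * k))" and "Z = (\<lambda>k. u y (2 * k + 1))"
  have XZ: "X k \<in> {\<alpha> (l k)..\<beta> (l k)}" "Z k \<in> {\<alpha> (l k)..\<beta> (l k)}" for k
    using ub[OF y(1), of "2 * k"] ub[OF y(1), of "2 * k + 1"] by (simp_all add: X_def Z_def I_def)
  have sZ: "slope h (X k) (Z k) (X (k + 1)) = 0" for k using zero[of "2 * k + 1"] by (simp add: en_def qn_def X_def Z_def algebra_simps)
  have sX: "slope h (Z (k + 1)) (X (k + 1)) (Z k) = 0" for k
    using zero[of "2 * (k + 1)"] by (simp add: en_def qn_def X_def Z_def algebra_simps)
  define f where "f = (\<lambda>k. (X k, outer_vel \<omega> R2 (\<gamma> (X k)) (\<gamma> (Z k))))"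
  have "(f k, f (k + 1)) \<in> outer_step O inner_step h" for k
  proof (rule relcompI)
    show "(f k, (Z k, - outer_vel \<omega> R2 (\<gamma> (Z k)) (\<gamma> (X k)))) \<in> outer_step"
      unfolding f_def by (rule outer_states(3)[OF lm XZ])
    show "((Z k, - outer_vel \<omega> R2 (\<gamma> (Z k)) (\<gamma> (X k))), f (k + 1)) \<in> inner_step h"
      unfolding f_def by (rule inner_state[OF lg lm lN XZ(2) XZ(1) XZ sZ sX])
  qed
  thus ?thesis using XZ(1) by (intro exI[of _ f]) (auto simp: f_def)
qed

theorem symbolic:
  assumes lg: "large h"
  shows "symbolic_dynamics \<omega> \<mu> E D L \<gamma> m a b \<alpha> \<beta> h"
proof -
  have h: "0 < h" using lg by (simp add: large_def)
  define F where "F = return_map \<omega> \<mu> E D L \<gamma> m a b \<alpha> \<beta> h"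
  have F: "F = outer_step O inner_step h" unfolding F_def by (rule return_map_eq[OF h])
  \<comment> \<open>Velocity reversal. It carries each half step to its inverse, which reduces
    injectivity of F to single-valuedness and continuity of the inverse to continuity of the half
    steps.\<close>
  define J where "J = (\<lambda>p :: real \<times> complex. (fst p, - snd p))"
  have JJ: "J (J p) = p" for p by (simp add: J_def)
  have rev1: "(p, q) \<in> outer_step \<Longrightarrow> (J q, J p) \<in> outer_step" for p q
    using outer_step_reverse[of "fst p" "snd p" "fst q" "snd q"] by (simp add: J_def)
  have rev2: "(p, q) \<in> inner_step h \<Longrightarrow> (J q, J p) \<in> inner_step h" for p q
    using inner_step_reverse[OF h, of "fst p" "snd p" "fst q" "snd q"] by (simp add: J_def)
  have Jlim: "(\<lambda>n. J (P n)) \<longlonglongrightarrow> J p" if "P \<longlonglongrightarrow> p" for P p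
    unfolding J_def by (intro tendsto_intros that)
  interpret bijective_relation F
  proof
    fix x y z assume "(x, y) \<in> F" "(x, z) \<in> F"
    thus "y = z" unfolding F using outer_step_single inner_step_single[OF h] by blast
  next
    fix x y z assume "(x, y) \<in> F" "(z, y) \<in> F"
    then obtain v w where "(x, v) \<in> outer_step" "(v, y) \<in> inner_step h" "(z, w) \<in> outer_step" "(w, y) \<in> inner_step h"
      unfolding F by blast
    hence "J v = J w" "(J v, J x) \<in> outer_step" "(J w, J z) \<in> outer_step"
      using rev1 rev2 inner_step_single[OF h] by blast+
    hence "J x = J z" using outer_step_single by metis
    thus "x = z" using JJ by metis
  qed
  have lim1: "Q \<longlonglongrightarrow> q" if pq: "(p, q) \<in> F" and PQ: "\<And>n. (P n, Q n) \<in> F" and l: "P \<longlonglongrightarrow> p" for p q P Q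
  proof -
    obtain v where v: "(p, v) \<in> outer_step" "(v, q) \<in> inner_step h" using pq unfolding F by blast
    have "\<forall>n. \<exists>v. (P n, v) \<in> outer_step \<and> (v, Q n) \<in> inner_step h" using PQ unfolding F by blast
    then obtain V where V: "\<And>n. (P n, V n) \<in> outer_step" "\<And>n. (V n, Q n) \<in> inner_step h" by metis
    show ?thesis by (rule inner_step_tendsto[OF h v(2) V(2) outer_step_tendsto[OF v(1) V(1) l]])
  qed
  have lim2: "P \<longlonglongrightarrow> p" if pq: "(p, q) \<in> F" and PQ: "\<And>n. (P n, Q n) \<in> F" and l: "Q \<longlonglongrightarrow> q" for p q P Q
  proof -
    obtain v where v: "(p, v) \<in> outer_step" "(v, q) \<in> inner_step h" using pq unfolding F by blast
    have "\<forall>n. \<exists>v. (P n, v) \<in> outer_step \<and> (v, Q n) \<in> inner_step h" using PQ unfolding F by blast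
    then obtain V where V: "\<And>n. (P n, V n) \<in> outer_step" "\<And>n. (V n, Q n) \<in> inner_step h" by metis
    have "(\<lambda>n. J (V n)) \<longlonglongrightarrow> J v" by (rule inner_step_tendsto[OF h rev2[OF v(2)] rev2[OF V(2)] Jlim[OF l]])
    from outer_step_tendsto[OF rev1[OF v(1)] rev1[OF V(1)] this]
    have "(\<lambda>n. J (P n)) \<longlonglongrightarrow> J p" .
    from Jlim[OF this] show ?thesis by (simp add: JJ)
  qed
  let ?X = "invariant_set F" and ?\<pi> = "itinerary F m \<alpha> \<beta>"
  have it_lim: "(\<lambda>n. iterate F k (X n)) \<longlonglongrightarrow> iterate F k x" if "\<And>n. X n \<in> ?X" "x \<in> ?X" "X \<longlonglongrightarrow> x" for X x k
    by (rule iterate_tendsto[where conv = "\<lambda>X x. X \<longlonglongrightarrow> x", OF lim1 lim2 that])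
  have F_state: "\<exists>r\<in>{1..m}. \<exists>r'\<in>NA \<gamma> m a b r. fst p \<in> {\<alpha> r..\<beta> r} \<and> fst q \<in> {\<alpha> r'..\<beta> r'}" if pq: "(p, q) \<in> F" for p q
  proof -
    obtain v where v: "(p, v) \<in> outer_step" "(v, q) \<in> inner_step h" using pq unfolding F by blast
    obtain p1 p2 q1 q2 v1 v2 where e: "p = (p1, p2)" "q = (q1, q2)" "v = (v1, v2)" by (cases p; cases q; cases v) blast
    obtain r where r: "r \<in> {1..m}" "(p1, p2) \<in> Xp r" "(v1, v2) \<in> Xm r" using v(1) unfolding e outer_step_iff by blast
    obtain s s' where s: "s \<in> {1..m}" "s' \<in> NA \<gamma> m a b s" "(v1, v2) \<in> Xm s" "(q1, q2) \<in> Xp s'"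
      using v(2) unfolding e inner_step_iff by blast
    have "s = r" using index_unique[OF s(1) r(1), of v1] r s by (auto simp: Xi_minus_def)
    moreover have "p1 \<in> {\<alpha> r..\<beta> r}" "q1 \<in> {\<alpha> s'..\<beta> s'}" using r(2) s(4) by (auto simp: Xi_plus_def)
    ultimately show ?thesis using r(1) s(2) e by auto
  qed
  have pi_eq: "?\<pi> x j = r" if "r \<in> {1..m}" "fst (iterate F j x) \<in> {\<alpha> r..\<beta> r}" for x j r
    unfolding itinerary_def by (rule the_equality) (use that index_unique in blast)+
  have pi_mem: "?\<pi> x j \<in> {1..m}" "fst (iterate F j x) \<in> {\<alpha> (?\<pi> x j)..\<beta> (?\<pi> x j)}" if "x \<in> ?X" for x j
    using F_state[OF iterate_step[OF that, of j]] pi_eq by metis+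
  have pi_words: "?\<pi> x \<in> words \<gamma> m a b" if x: "x \<in> ?X" for x
    unfolding words_def
  proof (intro CollectI allI conjI)
    fix j
    show "?\<pi> x j \<in> {1..m}" by (rule pi_mem[OF x])
    obtain r r' where r: "r \<in> {1..m}" "r' \<in> NA \<gamma> m a b r" "fst (iterate F j x) \<in> {\<alpha> r..\<beta> r}" "fst (iterate F (j + 1) x) \<in> {\<alpha> r'..\<beta> r'}"
      using F_state[OF iterate_step[OF x, of j]] by blast
    show "?\<pi> x (j + 1) \<in> NA \<gamma> m a b (?\<pi> x j)" using pi_eq[OF r(1,3)] pi_eq[OF NA_mem[OF r(2)] r(4)] r(2) by simp
  qed
  \<comment> \<open>Iterates depend continuously on the state, and the limit parameter lies in one
    of the open intervals \<open>{a r<..<b r}\<close>; these are disjoint, so nearby parameters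
    carry the same letter.\<close>
  have locally_constant: "\<exists>d>0. \<forall>y\<in>?X. dist y x < d \<longrightarrow> ?\<pi> y j = ?\<pi> x j" if x: "x \<in> ?X" for x j
  proof (rule ccontr)
    assume "\<not> (\<exists>d>0. \<forall>y\<in>?X. dist y x < d \<longrightarrow> ?\<pi> y j = ?\<pi> x j)"
    hence "\<forall>n. \<exists>y\<in>?X. dist y x < inverse (real (Suc n)) \<and> ?\<pi> y j \<noteq> ?\<pi> x j" by (metis inverse_positive_iff_positive of_nat_0_less_iff zero_less_Suc)
    then obtain Y where Y: "\<And>n. Y n \<in> ?X" "\<And>n. dist (Y n) x < inverse (real (Suc n))" "\<And>n. ?\<pi> (Y n) j \<noteq> ?\<pi> x j" by metis
    have "Y \<longlonglongrightarrow> x"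
    proof (rule tendsto_dist_iff[THEN iffD2], rule real_tendsto_sandwich[OF _ _ tendsto_const LIMSEQ_inverse_real_of_nat])
      show "\<forall>\<^sub>F n in sequentially. dist (Y n) x \<le> inverse (real (Suc n))"
        using less_imp_le[OF Y(2)] by (intro always_eventually) blast
    qed auto
    hence lim: "(\<lambda>n. fst (iterate F j (Y n))) \<longlonglongrightarrow> fst (iterate F j x)" by (intro tendsto_fst it_lim Y x)
    let ?r = "?\<pi> x j"
    note r = pi_mem[OF x, of j]
    have "fst (iterate F j x) \<in> {a ?r<..<b ?r}" by (rule in_ab[OF r])
    hence "\<forall>\<^sub>F n in sequentially. fst (iterate F j (Y n)) \<in> {a ?r<..<b ?r}"
      using topological_tendstoD[OF lim open_greaterThanLessThan] by blast
    from eventually_happens'[OF sequentially_bot this] obtain n where n: "fst (iterate F j (Y n)) \<in> {a ?r<..<b ?r}" by blast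
    note r' = pi_mem[OF Y(1)[of n], of j]
    have "fst (iterate F j (Y n)) \<in> {a (?\<pi> (Y n) j)<..<b (?\<pi> (Y n) j)}" by (rule in_ab[OF r'])
    hence "?\<pi> (Y n) j = ?r" using n disj r(1) r'(1) unfolding disjoint_family_on_def by blast
    thus False using Y(3) by blast
  qed
  have cont: "continuous_map (top_of_set ?X) (Metric_space.mtopology (words \<gamma> m a b) word_dist) ?\<pi>"
    unfolding Metric_space.continuous_map_to_metric[OF word_metric]
  proof (intro ballI allI impI)
    fix x and \<epsilon> :: real assume "x \<in> topspace (top_of_set ?X)" and \<epsilon>: "0 < \<epsilon>"
    hence x: "x \<in> ?X" by simp
    define K where "K = (\<Sum>\<^sub>\<infinity>k::int. (1/2::real) ^ nat \<bar>k\<bar>)"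
    have K: "0 \<le> K" unfolding K_def by (rule infsum_nonneg) auto
    have "(\<lambda>n. (1/2::real) ^ n * K) \<longlonglongrightarrow> 0 * K" by (intro tendsto_intros LIMSEQ_realpow_zero) auto
    from order_tendstoD(2)[OF this, of \<epsilon>] have "\<forall>\<^sub>F n in sequentially. (1/2::real) ^ n * K < \<epsilon>" using \<epsilon> by simp
    from eventually_happens'[OF sequentially_bot this] obtain N where N: "(1/2::real) ^ N * K < \<epsilon>" by blast
    obtain d where d: "\<And>j. 0 < d j" "\<And>j y. y \<in> ?X \<Longrightarrow> dist y x < d j \<Longrightarrow> ?\<pi> y j = ?\<pi> x j"
      using locally_constant[OF x] by metis
    \<comment> \<open>Agreement on the window |j| \<le> N suffices, since
      \<open>word_dist_le\<close> bounds the rest; only finitely many radii are involved.\<close>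
    define e where "e = Min (d ` {- int N..int N})"
    have e: "0 < e" "\<And>j. \<bar>j\<bar> \<le> int N \<Longrightarrow> e \<le> d j" unfolding e_def using d(1) by (auto intro!: Min_le imageI)
    show "\<exists>U. openin (top_of_set ?X) U \<and> x \<in> U \<and> (\<forall>y\<in>U. ?\<pi> y \<in> Metric_space.mball (words \<gamma> m a b) word_dist (?\<pi> x) \<epsilon>)"
    proof (intro exI[of _ "?X \<inter> ball x e"] conjI ballI)
      show "openin (top_of_set ?X) (?X \<inter> ball x e)" by (simp add: openin_open_Int)
      show "x \<in> ?X \<inter> ball x e" using x e by simp
      fix y assume y: "y \<in> ?X \<inter> ball x e"
      have "word_dist (?\<pi> x) (?\<pi> y) \<le> (1/2) ^ N * K" unfolding K_def
      proof (rule word_dist_le)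
        fix k :: int assume "\<bar>k\<bar> \<le> int N"
        hence "dist y x < d k" using y e(2)[of k] by (simp add: dist_commute)
        thus "?\<pi> x k = ?\<pi> y k" using d(2)[of y k] y by simp
      qed
      thus "?\<pi> y \<in> Metric_space.mball (words \<gamma> m a b) word_dist (?\<pi> x) \<epsilon>"
        unfolding Metric_space.in_mball[OF word_metric] using pi_words x y N by auto
    qed
  qed
  have surj: "?\<pi> ` ?X = words \<gamma> m a b"
  proof (intro equalityI image_subsetI subsetI)
    fix l assume l: "l \<in> words \<gamma> m a b"
    obtain f where f: "\<And>k. (f k, f (k + 1)) \<in> F" "\<And>k. fst (f k) \<in> {\<alpha> (l k)..\<beta> (l k)}"
      using realize_word[OF lg l] unfolding F by blast
    note o = orbit[of f, OF f(1)]
    have "?\<pi> (f 0) = l"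
    proof
      fix j
      have "l j \<in> {1..m}" using l by (simp add: words_def)
      thus "?\<pi> (f 0) j = l j" by (rule pi_eq) (use o(2) f(2) in simp)
    qed
    thus "l \<in> ?\<pi> ` ?X" using o(1) by blast
  qed (rule pi_words)
  have shift: "iterate F 1 x \<in> ?X \<and> ?\<pi> (iterate F 1 x) = right_shift (?\<pi> x)" if x: "x \<in> ?X" for x
    using iterate_shift[OF x] unfolding itinerary_def right_shift_def by simp
  show ?thesis unfolding symbolic_dynamics_def Let_def F_def[symmetric] using cont surj shift by blast
qed

end

section \<open>Neighbourhoods of strict central configurations\<close>

lemma antipodal_ray:
  assumes "antipodal \<gamma> x y" "\<gamma> x \<noteq> 0" "\<gamma> y \<noteq> 0"
  obtains s where "0 < s" "\<gamma> y = - (s *\<^sub>R \<gamma> x)"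
proof -
  obtain u where u: "0 \<le> u" "u \<le> 1" "(1 - u) *\<^sub>R \<gamma> x + u *\<^sub>R \<gamma> y = 0"
    using assms(1) unfolding antipodal_def in_segment by auto
  have "u \<noteq> 0" "u \<noteq> 1" using u(3) assms by auto
  moreover have "\<gamma> y = - (((1 - u) / u) *\<^sub>R \<gamma> x)"
  proof -
    have "u *\<^sub>R \<gamma> y = - ((1 - u) *\<^sub>R \<gamma> x)" using u(3) by (simp add: eq_neg_iff_add_eq_0 add.commute)
    hence "(1 / u) *\<^sub>R (u *\<^sub>R \<gamma> y) = (1 / u) *\<^sub>R (- ((1 - u) *\<^sub>R \<gamma> x))" by (rule arg_cong)
    thus ?thesis using \<open>u \<noteq> 0\<close> by simp
  qed
  ultimately show ?thesis using that[of "(1 - u) / u"] u by auto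
qed

lemma antipodal_commute: "antipodal \<gamma> x y = antipodal \<gamma> y x"
  by (simp add: antipodal_def closed_segment_commute)

lemma eventually_small: "0 < c \<Longrightarrow> \<forall>\<^sub>F e in at_right (0::real). e < c"
  unfolding eventually_at_right_field by blast

context arclength_domain
begin

text \<open>\<eta> comes from the cones and \<rho> from the pair condition; only then is the
  interval shrunk so that its chords are short relative to both. Stating this for all small half
  widths e allows finitely many such conditions to be met together.\<close>

lemma outer_nearby:
  assumes \<xi>: "\<xi> \<in> {0<..<L}" and crit: "\<gamma> \<xi> \<bullet> \<gamma>' \<xi> = 0"
    and ray: "{s *\<^sub>R \<gamma> \<xi> | s. 0 \<le> s} \<inter> frontier D = {\<gamma> \<xi>}" and hill: "(norm (\<gamma> \<xi>))\<^sup>2 < R2"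
  shows "\<exists>\<eta> \<rho>. \<forall>\<^sub>F e in at_right 0. \<forall>x\<in>{\<xi> - e<..<\<xi> + e}. \<forall>y\<in>{\<xi> - e<..<\<xi> + e}.
    radial_point \<eta> x \<and> outer_pair R2 \<rho> (\<gamma> x) (\<gamma> y) \<and> 2 / \<rho> * norm (\<gamma> y - \<gamma> x) \<le> \<eta>"
proof -
  obtain \<eta> e1 where r: "0 < \<eta>" "0 < e1" "\<And>x. \<bar>x - \<xi>\<bar> < e1 \<Longrightarrow> radial_point \<eta> x"
    by (rule central_radial[OF \<xi> crit ray]) (rule that)
  have "\<gamma> \<xi> \<noteq> 0" using nonzero \<xi> by auto
  then obtain \<rho> e2 where o: "0 < \<rho>" "0 < e2" "\<And>x y. norm (x - \<gamma> \<xi>) < e2 \<Longrightarrow> norm (y - \<gamma> \<xi>) < e2 \<Longrightarrow> outer_pair R2 \<rho> x y"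
    using hill by (rule outer_pair_nearby) (rule that)
  have "0 < min e2 (\<eta> * \<rho> / 4)" using r o by simp
  then obtain e3 where c: "0 < e3" "\<And>x. norm (x - \<xi>) < e3 \<Longrightarrow> norm (\<gamma> x - \<gamma> \<xi>) < min e2 (\<eta> * \<rho> / 4)"
    using isCont_interior(1)[OF \<xi>] unfolding isCont_def LIM_def dist_norm
    by (metis norm_zero diff_self)
  have "\<forall>\<^sub>F e in at_right 0. e < min e1 e3" using r(2) c(1) by (intro eventually_small) simp
  hence "\<forall>\<^sub>F e in at_right 0. \<forall>x\<in>{\<xi> - e<..<\<xi> + e}. \<forall>y\<in>{\<xi> - e<..<\<xi> + e}.
    radial_point \<eta> x \<and> outer_pair R2 \<rho> (\<gamma> x) (\<gamma> y) \<and> 2 / \<rho> * norm (\<gamma> y - \<gamma> x) \<le> \<eta>"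
  proof eventually_elim
    case (elim e)
    show ?case
    proof (intro ballI)
      fix x y assume xy: "x \<in> {\<xi> - e<..<\<xi> + e}" "y \<in> {\<xi> - e<..<\<xi> + e}"
      hence x: "\<bar>x - \<xi>\<bar> < e1" "norm (x - \<xi>) < e3" "norm (y - \<xi>) < e3" using elim by auto
      note n = c(2)[OF x(2)] c(2)[OF x(3)]
      have "norm (\<gamma> y - \<gamma> x) \<le> norm (\<gamma> y - \<gamma> \<xi>) + norm (\<gamma> x - \<gamma> \<xi>)" by norm
      hence "norm (\<gamma> y - \<gamma> x) \<le> \<eta> * \<rho> / 2" using n by linarith
      hence "2 / \<rho> * norm (\<gamma> y - \<gamma> x) \<le> \<eta>" using o(1) by (simp add: field_simps)
      thus "radial_point \<eta> x \<and> outer_pair R2 \<rho> (\<gamma> x) (\<gamma> y) \<and> 2 / \<rho> * norm (\<gamma> y - \<gamma> x) \<le> \<eta>"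
        using r(3)[OF x(1)] o(3)[of "\<gamma> x" "\<gamma> y"] n by auto
    qed
  qed
  thus ?thesis by blast
qed

text \<open>The half width e doubles as the lower bound; it becomes the constant \<kappa> of the
  locale.\<close>

lemma not_antipodal_nearby:
  assumes "\<xi> \<in> {0<..<L}" "\<xi>' \<in> {0<..<L}" "\<not> antipodal \<gamma> \<xi> \<xi>'"
  shows "\<forall>\<^sub>F e in at_right 0. \<forall>x\<in>{\<xi> - e<..<\<xi> + e}. \<forall>y\<in>{\<xi>' - e<..<\<xi>' + e}.
    e < norm (\<gamma> x) * norm (\<gamma> y) + \<gamma> x \<bullet> \<gamma> y"
proof -
  define g where "g = (\<lambda>z. norm (\<gamma> (fst z)) * norm (\<gamma> (snd z)) + \<gamma> (fst z) \<bullet> \<gamma> (snd z))"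
  have g0: "0 < g (\<xi>, \<xi>')" unfolding g_def
    using antipodal_iff[of \<gamma> \<xi> \<xi>'] nonzero[of \<xi>] nonzero[of \<xi>'] assms by simp
  have t: "((\<lambda>z. \<gamma> (fst z)) \<longlongrightarrow> \<gamma> \<xi>) (nhds (\<xi>, \<xi>'))" "((\<lambda>z. \<gamma> (snd z)) \<longlongrightarrow> \<gamma> \<xi>') (nhds (\<xi>, \<xi>'))"
    using isCont_tendsto_compose[OF isCont_interior(1)[OF assms(1)] tendsto_fst[OF filterlim_ident, of "(\<xi>, \<xi>')", unfolded fst_conv]]
      isCont_tendsto_compose[OF isCont_interior(1)[OF assms(2)] tendsto_snd[OF filterlim_ident, of "(\<xi>, \<xi>')", unfolded snd_conv]]
    by simp_all
  have "(g \<longlongrightarrow> g (\<xi>, \<xi>')) (nhds (\<xi>, \<xi>'))" unfolding g_def using t by (auto intro!: tendsto_intros)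
  hence "\<forall>\<^sub>F z in nhds (\<xi>, \<xi>'). g (\<xi>, \<xi>') / 2 < g z" using g0 by (intro order_tendstoD(1)) auto
  then obtain d where d: "0 < d" "\<And>z. dist z (\<xi>, \<xi>') < d \<Longrightarrow> g (\<xi>, \<xi>') / 2 < g z"
    unfolding eventually_nhds_metric by blast
  have "\<forall>\<^sub>F e in at_right 0. e < min (d / 2) (g (\<xi>, \<xi>') / 2)" using d(1) g0 by (intro eventually_small) simp
  thus ?thesis
  proof eventually_elim
    case (elim e)
    show ?case
    proof (intro ballI)
      fix x y assume "x \<in> {\<xi> - e<..<\<xi> + e}" "y \<in> {\<xi>' - e<..<\<xi>' + e}"
      hence "dist x \<xi> + dist y \<xi>' < d" using elim by (auto simp: dist_real_def)
      moreover have "dist (x, y) (\<xi>, \<xi>') \<le> dist x \<xi> + dist y \<xi>'"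
        unfolding dist_Pair_Pair by (rule sqrt_sum_squares_le_sum) auto
      ultimately have "g (\<xi>, \<xi>') / 2 < g (x, y)" by (intro d(2)) linarith
      thus "e < norm (\<gamma> x) * norm (\<gamma> y) + \<gamma> x \<bullet> \<gamma> y" using elim by (simp add: g_def)
    qed
  qed
qed

text \<open>At a strict extremum the increments of |\<gamma>|^2 before and after \<xi> have opposite
  signs; the mean value theorem turns them into slopes at points \<alpha> and \<beta> on either
  side.\<close>

lemma slopes_nearby:
  assumes \<xi>: "\<xi> \<in> {0<..<L}"
    and ext: "(\<forall>\<^sub>F x in at \<xi>. norm (\<gamma> x) < norm (\<gamma> \<xi>)) \<or> (\<forall>\<^sub>F x in at \<xi>. norm (\<gamma> x) > norm (\<gamma> \<xi>))"
  shows "\<forall>\<^sub>F e in at_right 0. \<exists>\<alpha> \<beta>. \<xi> - e < \<alpha> \<and> \<alpha> < \<xi> \<and> \<xi> < \<beta> \<and> \<beta> < \<xi> + e \<and>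
    (\<gamma> \<alpha> \<bullet> \<gamma>' \<alpha>) * (\<gamma> \<beta> \<bullet> \<gamma>' \<beta>) < 0"
proof -
  define N where "N = (\<lambda>x. (norm (\<gamma> x))\<^sup>2)"
  have N': "(N has_real_derivative 2 * (\<gamma> x \<bullet> \<gamma>' x)) (at x)" if "x \<in> {0<..<L}" for x
  proof -
    have g: "(\<gamma> has_derivative (\<lambda>h. h *\<^sub>R \<gamma>' x)) (at x)" using deriv_at[OF that] by (simp add: has_vector_derivative_def)
    have "((\<lambda>x. \<gamma> x \<bullet> \<gamma> x) has_derivative (\<lambda>h. \<gamma> x \<bullet> (h *\<^sub>R \<gamma>' x) + (h *\<^sub>R \<gamma>' x) \<bullet> \<gamma> x)) (at x)"
      by (rule has_derivative_inner[OF g g])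
    moreover have "(\<lambda>x. \<gamma> x \<bullet> \<gamma> x) = N" by (simp add: N_def power2_norm_eq_inner fun_eq_iff)
    moreover have "(\<lambda>h. \<gamma> x \<bullet> (h *\<^sub>R \<gamma>' x) + (h *\<^sub>R \<gamma>' x) \<bullet> \<gamma> x) = (*) (2 * (\<gamma> x \<bullet> \<gamma>' x))"
      by (auto simp: fun_eq_iff inner_commute)
    ultimately show ?thesis unfolding has_field_derivative_def by simp
  qed
  obtain d where d: "0 < d" "(\<forall>x. x \<noteq> \<xi> \<and> dist x \<xi> < d \<longrightarrow> N x < N \<xi>) \<or> (\<forall>x. x \<noteq> \<xi> \<and> dist x \<xi> < d \<longrightarrow> N x > N \<xi>)"
    using ext unfolding eventually_at N_def by (metis UNIV_I norm_ge_zero power_strict_mono zero_less_numeral)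
  have "\<forall>\<^sub>F e in at_right 0. e < Min {d, \<xi>, L - \<xi>}" using d(1) \<xi> by (intro eventually_small) simp
  moreover have "\<forall>\<^sub>F e in at_right (0::real). 0 < e" by (simp add: eventually_at_right_less)
  ultimately show ?thesis
  proof eventually_elim
    case (elim e)
    hence e: "0 < e" "e < d" "e < \<xi>" "e < L - \<xi>" by auto
    have "\<exists>z. \<xi> - e / 2 < z \<and> z < \<xi> \<and> N \<xi> - N (\<xi> - e / 2) = (\<xi> - (\<xi> - e / 2)) * (2 * (\<gamma> z \<bullet> \<gamma>' z))"
      by (rule MVT2) (use e N' in auto)
    then obtain \<alpha> where \<alpha>: "\<xi> - e / 2 < \<alpha>" "\<alpha> < \<xi>" "N \<xi> - N (\<xi> - e / 2) = e * (\<gamma> \<alpha> \<bullet> \<gamma>' \<alpha>)" by auto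
    have "\<exists>z. \<xi> < z \<and> z < \<xi> + e / 2 \<and> N (\<xi> + e / 2) - N \<xi> = (\<xi> + e / 2 - \<xi>) * (2 * (\<gamma> z \<bullet> \<gamma>' z))"
      by (rule MVT2) (use e N' in auto)
    then obtain \<beta> where \<beta>: "\<xi> < \<beta>" "\<beta> < \<xi> + e / 2" "N (\<xi> + e / 2) - N \<xi> = e * (\<gamma> \<beta> \<bullet> \<gamma>' \<beta>)" by auto
    have near: "\<xi> - e / 2 \<noteq> \<xi> \<and> dist (\<xi> - e / 2) \<xi> < d" "\<xi> + e / 2 \<noteq> \<xi> \<and> dist (\<xi> + e / 2) \<xi> < d" using e by (auto simp: dist_real_def)
    have "(N (\<xi> - e / 2) < N \<xi> \<and> N (\<xi> + e / 2) < N \<xi>) \<or> (N (\<xi> - e / 2) > N \<xi> \<and> N (\<xi> + e / 2) > N \<xi>)"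
      using d(2) near by blast
    hence "(e * (\<gamma> \<alpha> \<bullet> \<gamma>' \<alpha>)) * (e * (\<gamma> \<beta> \<bullet> \<gamma>' \<beta>)) < 0"
      unfolding \<alpha>(3)[symmetric] \<beta>(3)[symmetric] by (auto simp: mult_less_0_iff)
    hence "(\<gamma> \<alpha> \<bullet> \<gamma>' \<alpha>) * (\<gamma> \<beta> \<bullet> \<gamma>' \<beta>) < 0" using e(1) by (auto simp: mult_less_0_iff zero_less_mult_iff)
    moreover have "\<xi> - e < \<alpha>" "\<beta> < \<xi> + e" using \<alpha>(1) \<beta>(2) e(1) by linarith+
    ultimately show ?case using \<alpha>(2) \<beta>(1) by blast
  qed
qed

lemma billiard_intervals_exist:
  fixes X :: "nat \<Rightarrow> real"
  assumes par: "0 < \<omega>" "0 < \<mu>" "0 < E" and hill: "\<And>x. x \<in> {0..L} \<Longrightarrow> (norm (\<gamma> x))\<^sup>2 < 2 * E / \<omega>\<^sup>2"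
    and m: "2 \<le> m" and X: "\<And>i. i \<in> {1..m} \<Longrightarrow> X i \<in> {0<..<L}" and injX: "inj_on X {1..m}"
    and crit: "\<And>i. i \<in> {1..m} \<Longrightarrow> \<gamma> (X i) \<bullet> \<gamma>' (X i) = 0"
    and ray: "\<And>i. i \<in> {1..m} \<Longrightarrow> {s *\<^sub>R \<gamma> (X i) | s. 0 \<le> s} \<inter> frontier D = {\<gamma> (X i)}"
    and ext: "\<And>i. i \<in> {1..m} \<Longrightarrow> (\<forall>\<^sub>F x in at (X i). norm (\<gamma> x) < norm (\<gamma> (X i))) \<or> (\<forall>\<^sub>F x in at (X i). norm (\<gamma> x) > norm (\<gamma> (X i)))"
    and two: "m = 2 \<Longrightarrow> \<not> antipodal \<gamma> (X 1) (X 2)"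
  shows "\<exists>\<kappa> a b \<alpha> \<beta> \<eta> \<rho>. billiard_intervals D L \<gamma> \<gamma>' \<omega> \<mu> E (2 * E / \<omega>\<^sup>2) \<kappa> m a b \<alpha> \<beta> \<eta> \<rho>"
proof -
  let ?R2 = "2 * E / \<omega>\<^sup>2" and ?I = "\<lambda>e i. {X i - e<..<X i + e}"
  have nz: "\<gamma> (X i) \<noteq> 0" if "i \<in> {1..m}" for i using nonzero[of "X i"] X[OF that] by auto
  have "\<forall>i\<in>{1..m}. \<exists>\<eta> \<rho>. \<forall>\<^sub>F e in at_right 0. \<forall>x\<in>?I e i. \<forall>y\<in>?I e i.
    radial_point \<eta> x \<and> outer_pair ?R2 \<rho> (\<gamma> x) (\<gamma> y) \<and> 2 / \<rho> * norm (\<gamma> y - \<gamma> x) \<le> \<eta>"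
  proof
    fix i assume i: "i \<in> {1..m}"
    have "X i \<in> {0..L}" using X[OF i] by auto
    from outer_nearby[OF X[OF i] crit[OF i] ray[OF i] hill[OF this]]
    show "\<exists>\<eta> \<rho>. \<forall>\<^sub>F e in at_right 0. \<forall>x\<in>?I e i. \<forall>y\<in>?I e i.
      radial_point \<eta> x \<and> outer_pair ?R2 \<rho> (\<gamma> x) (\<gamma> y) \<and> 2 / \<rho> * norm (\<gamma> y - \<gamma> x) \<le> \<eta>" .
  qed
  then obtain \<eta> \<rho> where "\<forall>i\<in>{1..m}. \<forall>\<^sub>F e in at_right 0. \<forall>x\<in>?I e i. \<forall>y\<in>?I e i.
    radial_point (\<eta> i) x \<and> outer_pair ?R2 (\<rho> i) (\<gamma> x) (\<gamma> y) \<and> 2 / \<rho> i * norm (\<gamma> y - \<gamma> x) \<le> \<eta> i"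
    unfolding bchoice_iff by (elim exE) (rule that)
  hence ev1: "\<forall>\<^sub>F e in at_right 0. \<forall>i\<in>{1..m}. \<forall>x\<in>?I e i. \<forall>y\<in>?I e i.
    radial_point (\<eta> i) x \<and> outer_pair ?R2 (\<rho> i) (\<gamma> x) (\<gamma> y) \<and> 2 / \<rho> i * norm (\<gamma> y - \<gamma> x) \<le> \<eta> i"
    (is "eventually ?P1 _") by (intro eventually_ball_finite) auto
  have ev2: "\<forall>\<^sub>F e in at_right 0. \<forall>p\<in>{p \<in> {1..m} \<times> {1..m}. \<not> antipodal \<gamma> (X (fst p)) (X (snd p))}.
      \<forall>x\<in>?I e (fst p). \<forall>y\<in>?I e (snd p). e < norm (\<gamma> x) * norm (\<gamma> y) + \<gamma> x \<bullet> \<gamma> y"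
    (is "eventually ?P2 _") by (rule eventually_ball_finite) (use not_antipodal_nearby X in auto)
  have ev3: "\<forall>\<^sub>F e in at_right 0. \<forall>p\<in>{p \<in> {1..m} \<times> {1..m}. fst p \<noteq> snd p}. e < \<bar>X (fst p) - X (snd p)\<bar> / 2"
    (is "eventually ?P3 _")
  proof (rule eventually_ball_finite, simp, intro ballI eventually_small)
    fix p assume "p \<in> {p \<in> {1..m} \<times> {1..m}. fst p \<noteq> snd p}"
    hence "X (fst p) \<noteq> X (snd p)" using inj_onD[OF injX, of "fst p" "snd p"] by (cases p) auto
    thus "0 < \<bar>X (fst p) - X (snd p)\<bar> / 2" by simp
  qed
  have ev4: "\<forall>\<^sub>F e in at_right 0. \<forall>i\<in>{1..m}. e < min (X i) (L - X i)"
    (is "eventually ?P4 _")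
    by (rule eventually_ball_finite, simp, intro ballI eventually_small) (use X in \<open>simp add: less_diff_eq\<close>)
  have ev5: "\<forall>\<^sub>F e in at_right 0. \<forall>i\<in>{1..m}. \<exists>\<alpha> \<beta>. X i - e < \<alpha> \<and> \<alpha> < X i \<and> X i < \<beta> \<and> \<beta> < X i + e \<and>
      (\<gamma> \<alpha> \<bullet> \<gamma>' \<alpha>) * (\<gamma> \<beta> \<bullet> \<gamma>' \<beta>) < 0"
    (is "eventually ?P5 _") by (rule eventually_ball_finite) (use slopes_nearby[OF X ext] in auto)
  have ev6: "\<forall>\<^sub>F e in at_right (0::real). 0 < e" by (simp add: eventually_at_right_less)
  have "\<forall>\<^sub>F e in at_right 0. ?P1 e \<and> ?P2 e \<and> ?P3 e \<and> ?P4 e \<and> ?P5 e \<and> 0 < e"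
    by (intro eventually_conj ev1 ev2 ev3 ev4 ev5 ev6)
  hence "\<exists>e. ?P1 e \<and> ?P2 e \<and> ?P3 e \<and> ?P4 e \<and> ?P5 e \<and> 0 < e"
    by (rule eventually_happens'[rotated]) simp
  then obtain e where ee: "?P1 e \<and> ?P2 e \<and> ?P3 e \<and> ?P4 e \<and> ?P5 e \<and> 0 < e" ..
  hence e: "0 < e"
    and rad: "\<And>i x y. i \<in> {1..m} \<Longrightarrow> x \<in> ?I e i \<Longrightarrow> y \<in> ?I e i \<Longrightarrow>
      radial_point (\<eta> i) x \<and> outer_pair ?R2 (\<rho> i) (\<gamma> x) (\<gamma> y) \<and> 2 / \<rho> i * norm (\<gamma> y - \<gamma> x) \<le> \<eta> i"
    and eL: "\<And>i. i \<in> {1..m} \<Longrightarrow> e < min (X i) (L - X i)"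
    and sl: "?P5 e"
    by (elim conjE, blast)+
  have na: "e < norm (\<gamma> x) * norm (\<gamma> y) + \<gamma> x \<bullet> \<gamma> y"
    if "i \<in> {1..m}" "j \<in> {1..m}" "\<not> antipodal \<gamma> (X i) (X j)" "x \<in> ?I e i" "y \<in> ?I e j" for i j x y
  proof -
    have "?P2 e" using ee by (elim conjE)
    from bspec[OF this, of "(i, j)"] show ?thesis using that by auto
  qed
  have sep: "e < \<bar>X i - X j\<bar> / 2" if "i \<in> {1..m}" "j \<in> {1..m}" "i \<noteq> j" for i j
  proof -
    have "?P3 e" using ee by (elim conjE)
    from bspec[OF this, of "(i, j)"] show ?thesis using that by auto
  qed
  obtain \<alpha> \<beta> where ab: "\<And>i. i \<in> {1..m} \<Longrightarrow> X i - e < \<alpha> i \<and> \<alpha> i < X i \<and> X i < \<beta> i \<and> \<beta> i < X i + e \<and> (\<gamma> (\<alpha> i) \<bullet> \<gamma>' (\<alpha> i)) * (\<gamma> (\<beta> i) \<bullet> \<gamma>' (\<beta> i)) < 0"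
    using sl by metis
  define a b where "a = (\<lambda>i. X i - e)" and "b = (\<lambda>i. X i + e)"
  have Xab: "X i \<in> {a i<..<b i}" for i using e by (simp add: a_def b_def)
  have nzI: "\<gamma> x \<noteq> 0" if "i \<in> {1..m}" "x \<in> {a i<..<b i}" for i x
    using nonzero[of x] eL[OF that(1)] that(2) by (auto simp: a_def b_def)
  have NA_iff: "j \<in> NA \<gamma> m a b i \<longleftrightarrow> j \<in> {1..m} \<and> \<not> antipodal \<gamma> (X i) (X j)" if i: "i \<in> {1..m}" for i j
  proof
    assume "j \<in> NA \<gamma> m a b i"
    thus "j \<in> {1..m} \<and> \<not> antipodal \<gamma> (X i) (X j)" unfolding NA_def not_antipodal_sets_def using Xab by blast
  next
    assume j: "j \<in> {1..m} \<and> \<not> antipodal \<gamma> (X i) (X j)"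
    have "\<not> antipodal \<gamma> x y" if xy: "x \<in> {a i<..<b i}" "y \<in> {a j<..<b j}" for x y
      unfolding antipodal_iff[of \<gamma> x y, OF nzI[OF i xy(1)] nzI[OF conjunct1[OF j] xy(2)]]
      using na[of i j x y] i j xy e by (simp add: a_def b_def)
    thus "j \<in> NA \<gamma> m a b i" using j unfolding NA_def not_antipodal_sets_def by blast
  qed
  have self: "\<not> antipodal \<gamma> (X i) (X i)" if "i \<in> {1..m}" for i
    unfolding antipodal_iff[of \<gamma> "X i" "X i", OF nz[OF that] nz[OF that]] using nz[OF that] by (simp add: add_pos_pos)
  \<comment> \<open>For m = 2 this is the hypothesis. For m \<ge> 3, two configurations antipodal to
    the same one lie on a common ray, which meets the boundary only once, so at most one index is
    excluded.\<close>
  have other: "\<exists>j\<in>{1..m}. j \<noteq> i \<and> \<not> antipodal \<gamma> (X i) (X j)" if i: "i \<in> {1..m}" for i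
  proof (cases "m = 2")
    case True
    hence "{1..m} = {1, 2}" by auto
    moreover have "\<not> antipodal \<gamma> (X 1) (X 2)" "\<not> antipodal \<gamma> (X 2) (X 1)" using two True antipodal_commute by blast+
    ultimately show ?thesis using i by auto
  next
    case False
    have "card ({1..m} - {i}) = m - 1" using i by simp
    hence "2 \<le> card ({1..m} - {i})" using False m by simp
    then obtain S where S: "S \<subseteq> {1..m} - {i}" "card S = 2" using obtain_subset_with_card_n by metis
    then obtain j k where "S = {j, k}" "j \<noteq> k" unfolding card_2_iff by blast
    hence jk: "j \<in> {1..m}" "k \<in> {1..m}" "j \<noteq> k" using S(1) by auto
    have jki: "j \<noteq> i" "k \<noteq> i" using S(1) \<open>S = {j, k}\<close> by auto
    show ?thesis
    proof (rule ccontr)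
      assume "\<not> ?thesis"
      hence anti: "antipodal \<gamma> (X i) (X j)" "antipodal \<gamma> (X i) (X k)" using jk(1,2) jki by blast+
      obtain s where s: "0 < s" "\<gamma> (X j) = - (s *\<^sub>R \<gamma> (X i))"
        by (rule antipodal_ray[of \<gamma> "X i" "X j", OF anti(1) nz[OF i] nz[OF jk(1)]]) (rule that)
      obtain t where t: "0 < t" "\<gamma> (X k) = - (t *\<^sub>R \<gamma> (X i))"
        by (rule antipodal_ray[of \<gamma> "X i" "X k", OF anti(2) nz[OF i] nz[OF jk(2)]]) (rule that)
      note st = s t
      have "\<gamma> (X k) = (t / s) *\<^sub>R \<gamma> (X j)" using st by simp
      moreover have "0 \<le> t / s" using st by simp
      ultimately have "\<gamma> (X k) \<in> {s *\<^sub>R \<gamma> (X j) | s. 0 \<le> s}" by blast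
      moreover have Xk: "X k \<in> {0..L}" using X[OF jk(2)] by auto
      ultimately have "\<gamma> (X k) \<in> {\<gamma> (X j)}" using ray[OF jk(1)] on_frontier by blast
      hence "X j = X k" using inj_interior[OF X[OF jk(1)] Xk] by simp
      thus False using inj_onD[OF injX _ jk(1,2)] jk(3) by blast
    qed
  qed
  have "billiard_intervals D L \<gamma> \<gamma>' \<omega> \<mu> E ?R2 e m a b \<alpha> \<beta> \<eta> \<rho>"
  proof unfold_locales
    show "disjoint_family_on (\<lambda>i. {a i<..<b i}) {1..m}"
      unfolding disjoint_family_on_def
    proof (intro ballI impI equals0I)
      fix i j x assume ij: "i \<in> {1..m}" "j \<in> {1..m}" "i \<noteq> j" and x: "x \<in> {a i<..<b i} \<inter> {a j<..<b j}"
      have "\<bar>x - X i\<bar> < e" "\<bar>x - X j\<bar> < e" using x by (auto simp: a_def b_def)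
      moreover have "2 * e < \<bar>X i - X j\<bar>" using sep[OF ij] by simp
      ultimately show False by linarith
    qed
    fix i assume i: "i \<in> {1..m}"
    show "0 \<le> a i \<and> a i < \<alpha> i \<and> \<alpha> i < \<beta> i \<and> \<beta> i < b i \<and> b i \<le> L"
      using ab[OF i] eL[OF i] by (auto simp: a_def b_def)
    show "(\<gamma> (\<alpha> i) \<bullet> \<gamma>' (\<alpha> i)) * (\<gamma> (\<beta> i) \<bullet> \<gamma>' (\<beta> i)) < 0" using ab[OF i] by blast
    show "i \<in> NA \<gamma> m a b i \<and> (\<exists>j\<in>NA \<gamma> m a b i. j \<noteq> i)"
      using NA_iff[OF i] self[OF i] other[OF i] i by blast
    fix x assume x: "x \<in> {a i<..<b i}"
    hence xi: "x \<in> ?I e i" by (simp add: a_def b_def)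
    show "radial_point (\<eta> i) x" using rad[OF i xi xi] by blast
    {
      fix y assume "y \<in> {a i<..<b i}"
      hence yi: "y \<in> ?I e i" by (simp add: a_def b_def)
      show "outer_pair ?R2 (\<rho> i) (\<gamma> x) (\<gamma> y) \<and> 2 / \<rho> i * norm (\<gamma> y - \<gamma> x) \<le> \<eta> i" using rad[OF i xi yi] by blast
    next
      fix j y assume j: "j \<in> NA \<gamma> m a b i" and y: "y \<in> {a j<..<b j}"
      hence yj: "y \<in> ?I e j" by (simp add: a_def b_def)
      show "e \<le> norm (\<gamma> x) * norm (\<gamma> y) + \<gamma> x \<bullet> \<gamma> y"
        using na[OF i _ _ xi yj] j unfolding NA_iff[OF i] by (simp add: less_imp_le)
    }
  qed (use par e hill m in auto)
  thus ?thesis by blast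
qed

end

section \<open>The base point\<close>

context arclength_domain
begin

lemma critical_orthogonal:
  assumes \<xi>: "\<xi> \<in> {0..L}" and d: "((\<lambda>x. norm (\<gamma> x)) has_real_derivative 0) (at \<xi> within {0..L})"
  shows "\<gamma> \<xi> \<bullet> \<gamma>' \<xi> = 0"
proof -
  have g: "(\<gamma> has_derivative (\<lambda>h. h *\<^sub>R \<gamma>' \<xi>)) (at \<xi> within {0..L})" using deriv[OF \<xi>] by (simp add: has_vector_derivative_def)
  have "((\<lambda>x. \<gamma> x \<bullet> \<gamma> x) has_derivative (\<lambda>h. \<gamma> \<xi> \<bullet> (h *\<^sub>R \<gamma>' \<xi>) + (h *\<^sub>R \<gamma>' \<xi>) \<bullet> \<gamma> \<xi>)) (at \<xi> within {0..L})"
    by (rule has_derivative_inner[OF g g])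
  moreover have "(\<lambda>h. \<gamma> \<xi> \<bullet> (h *\<^sub>R \<gamma>' \<xi>) + (h *\<^sub>R \<gamma>' \<xi>) \<bullet> \<gamma> \<xi>) = (\<lambda>h. h *\<^sub>R (2 * (\<gamma> \<xi> \<bullet> \<gamma>' \<xi>)))"
    by (auto simp: fun_eq_iff inner_commute)
  ultimately have 1: "((\<lambda>x. \<gamma> x \<bullet> \<gamma> x) has_vector_derivative 2 * (\<gamma> \<xi> \<bullet> \<gamma>' \<xi>)) (at \<xi> within {0..L})"
    by (simp add: has_vector_derivative_def)
  have "((\<lambda>x. norm (\<gamma> x) * norm (\<gamma> x)) has_real_derivative 0 * norm (\<gamma> \<xi>) + 0 * norm (\<gamma> \<xi>)) (at \<xi> within {0..L})"
    by (rule DERIV_mult[OF d d])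
  hence 2: "((\<lambda>x. \<gamma> x \<bullet> \<gamma> x) has_vector_derivative 0) (at \<xi> within {0..L})"
    by (simp add: has_real_derivative_iff_has_vector_derivative dot_square_norm power2_eq_square)
  have "\<xi> \<in> cbox 0 L" using \<xi> by simp
  from vector_derivative_unique_within_closed_interval[OF L this, unfolded cbox_interval, OF 1 2]
  show ?thesis by simp
qed

text \<open>If the two one-sided tangents at \<open>\<gamma> 0\<close> were opposite, both branches would leave \<open>\<gamma> 0\<close> to the same
  side, and two short segments on the other side would join the parts of the ray before and behind
  \<open>\<gamma> 0\<close> without meeting the boundary.\<close>

lemma no_cusp:
  assumes crit: "\<gamma> 0 \<bullet> \<gamma>' 0 = 0" "\<gamma> 0 \<bullet> \<gamma>' L = 0"
    and ray: "{s *\<^sub>R \<gamma> 0 | s. 0 \<le> s} \<inter> frontier D = {\<gamma> 0}"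
  shows "\<gamma>' L = \<gamma>' 0"
proof (rule ccontr)
  assume ne: "\<gamma>' L \<noteq> \<gamma>' 0"
  define p where "p = \<gamma> 0"
  define e where "e = \<gamma>' 0"
  have p: "p \<noteq> 0" "\<gamma> L = p" using nonzero[of 0] L closed_curve by (auto simp: p_def)
  have e: "norm e = 1" "p \<bullet> e = 0" using unit[of 0] L crit by (auto simp: e_def p_def)
  have "\<gamma>' L = - e"
  proof -
    have "norm ((1 / norm p) *\<^sub>R p) = 1" using p by simp
    from complex_orth_unique[of e "\<gamma>' L", OF _ _ this]
    show ?thesis using e unit[of L] L crit ne p by (auto simp: e_def p_def inner_commute)
  qed
  have d: "((\<lambda>x. \<gamma> x \<bullet> e) has_real_derivative \<gamma>' x \<bullet> e) (at x within {0..L})" if "x \<in> {0..L}" for x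
    unfolding has_real_derivative_iff_has_vector_derivative
    by (rule bounded_linear.has_vector_derivative[OF bounded_linear_inner_left deriv[OF that]])
  have d0: "((\<lambda>x. \<gamma> x \<bullet> e) has_real_derivative 1) (at 0 within {0..L})"
    using d[of 0] L e by (simp add: e_def dot_square_norm)
  have dL: "((\<lambda>x. \<gamma> x \<bullet> e) has_real_derivative - 1) (at L within {0..L})"
    using d[of L] L e \<open>\<gamma>' L = - e\<close> by (simp add: dot_square_norm)
  obtain e1 where e1: "0 < e1" "\<And>h. 0 < h \<Longrightarrow> 0 + h \<in> {0..L} \<Longrightarrow> h < e1 \<Longrightarrow> \<gamma> 0 \<bullet> e < \<gamma> (0 + h) \<bullet> e"
    using has_real_derivative_pos_inc_right[OF d0] by auto
  obtain e2 where e2: "0 < e2" "\<And>h. 0 < h \<Longrightarrow> L - h \<in> {0..L} \<Longrightarrow> h < e2 \<Longrightarrow> \<gamma> L \<bullet> e < \<gamma> (L - h) \<bullet> e"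
    using has_real_derivative_neg_dec_left[OF dL] by auto
  define \<epsilon> where "\<epsilon> = min e1 e2 / 2"
  have \<epsilon>: "0 < \<epsilon>" "\<epsilon> < e1" "\<epsilon> < e2" using e1 e2 by (auto simp: \<epsilon>_def min_def)
  have K: "compact (\<gamma> ` {\<epsilon>..L - \<epsilon>})"
    by (intro compact_continuous_image continuous_on_subset[OF cont]) (use \<epsilon> in auto)
  have "p \<notin> \<gamma> ` {\<epsilon>..L - \<epsilon>}"
    using inj_onD[OF inj, of 0] \<epsilon> L by (force simp: p_def)
  then obtain \<delta> where \<delta>: "0 < \<delta>" "\<And>y. y \<in> \<gamma> ` {\<epsilon>..L - \<epsilon>} \<Longrightarrow> \<delta> \<le> dist p y"
    using separate_point_closed[OF compact_imp_closed[OF K], of p] by blast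
  \<comment> \<open>Both branches of the curve leave p in the direction e: the curve starts with
    velocity e and arrives with velocity -e. A small half disc opposite to e therefore meets the
    boundary only in p.\<close>
  have side: "x \<notin> frontier D" if x: "x \<noteq> p" "dist p x < \<delta>" "(x - p) \<bullet> e \<le> 0" for x
  proof
    assume "x \<in> frontier D"
    then obtain \<xi> where \<xi>: "\<xi> \<in> {0..L}" "x = \<gamma> \<xi>" using image by blast
    have "\<xi> \<noteq> 0" "\<xi> \<noteq> L" using \<xi> x p by (auto simp: p_def)
    moreover have "\<xi> \<notin> {\<epsilon>..L - \<epsilon>}" using \<delta>(2)[of x] \<xi> x(2) by force
    ultimately have "(0 < \<xi> \<and> \<xi> < e1) \<or> (0 < L - \<xi> \<and> L - \<xi> < e2)" using \<xi>(1) \<epsilon> by auto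
    hence "p \<bullet> e < x \<bullet> e" using e1(2)[of \<xi>] e2(2)[of "L - \<xi>"] \<xi> p(2) by (auto simp: p_def)
    thus False using x(3) by (simp add: inner_diff_left)
  qed
  define q where "q = (1 / norm p) *\<^sub>R p"
  have q: "norm q = 1" "q \<bullet> e = 0" "p = norm p *\<^sub>R q" using p e by (auto simp: q_def)
  define t where "t = min (\<delta> / 2) (norm p / 2)"
  have t: "0 < t" "t < \<delta>" "t < norm p" using \<delta>(1) p by (auto simp: t_def min_def)
  \<comment> \<open>Segments inside this half disc that join the ray on either side of p (s = -1
    before it, s = 1 behind it) to the common point p - t e.\<close>
  have seg: "closed_segment (p + (t * s) *\<^sub>R q) (p - t *\<^sub>R e) \<inter> frontier D = {}" if s: "\<bar>s\<bar> = 1" for s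
  proof (intro equals0I)
    fix x assume "x \<in> closed_segment (p + (t * s) *\<^sub>R q) (p - t *\<^sub>R e) \<inter> frontier D"
    hence "x \<in> closed_segment (p + (t * s) *\<^sub>R q) (p - t *\<^sub>R e)" "x \<in> frontier D" by blast+
    then obtain u where u: "0 \<le> u" "u \<le> 1" "x = (1 - u) *\<^sub>R (p + (t * s) *\<^sub>R q) + u *\<^sub>R (p - t *\<^sub>R e)" "x \<in> frontier D"
      unfolding in_segment by blast
    have xp: "x - p = ((1 - u) * (t * s)) *\<^sub>R q - (u * t) *\<^sub>R e" unfolding u(3) by (simp add: algebra_simps)
    have i1: "(x - p) \<bullet> e = - (u * t)" unfolding xp inner_diff_left inner_scaleR_left q(2) using e(1) by (simp add: dot_square_norm)
    have i2: "(x - p) \<bullet> q = (1 - u) * (t * s)"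
      unfolding xp inner_diff_left inner_scaleR_left using q(1,2) by (simp add: dot_square_norm inner_commute)
    have "norm (x - p) \<le> (1 - u) * t + u * t"
      unfolding xp by (rule order_trans[OF norm_triangle_ineq4]) (use u t s q e in \<open>simp add: abs_mult\<close>)
    hence "norm (x - p) \<le> t" by (simp add: algebra_simps)
    moreover have "(x - p) \<bullet> e \<le> 0" unfolding i1 using u(1) t(1) by simp
    moreover have "x \<noteq> p"
    proof
      assume "x = p"
      hence "u * t = 0" "(1 - u) * (t * s) = 0" using i1 i2 by simp_all
      thus False using t(1) s by auto
    qed
    ultimately show False using side[of x] u(4) t by (simp add: dist_norm norm_minus_commute)
  qed
  have ptq: "p + (t * s) *\<^sub>R q = ((norm p + t * s) / norm p) *\<^sub>R p" for s
    using p by (simp add: q_def add_divide_distrib scaleR_add_left)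
  have on_ray: "s *\<^sub>R p \<notin> frontier D" if "0 \<le> s" "s \<noteq> 1" for s
  proof
    assume "s *\<^sub>R p \<in> frontier D"
    hence "s *\<^sub>R p = p" using ray that(1) unfolding p_def by blast
    hence "(s - 1) *\<^sub>R p = 0" by (simp add: scaleR_left_diff_distrib)
    thus False using p that(2) by simp
  qed
  have inside: "p + (t * - 1) *\<^sub>R q \<in> D"
  proof -
    let ?s = "(norm p - t) / norm p"
    have "?s < 1" "0 \<le> ?s" using t p by auto
    have "closed_segment 0 (?s *\<^sub>R p) \<inter> frontier D = {}"
    proof (intro equals0I)
      fix x assume "x \<in> closed_segment 0 (?s *\<^sub>R p) \<inter> frontier D"
      hence "x \<in> closed_segment 0 (?s *\<^sub>R p)" "x \<in> frontier D" by blast+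
      then obtain u where u': "0 \<le> u" "u \<le> 1" "x = (1 - u) *\<^sub>R 0 + u *\<^sub>R (?s *\<^sub>R p)" "x \<in> frontier D" unfolding in_segment by blast
      hence u: "0 \<le> u" "u \<le> 1" "x = (u * ?s) *\<^sub>R p" "x \<in> frontier D" by simp_all
      have "u * ?s \<le> 1 * ?s" using u \<open>0 \<le> ?s\<close> by (intro mult_right_mono) auto
      hence "u * ?s \<noteq> 1" using \<open>?s < 1\<close> by linarith
      moreover have "0 \<le> u * ?s" using u(1) \<open>0 \<le> ?s\<close> by (rule mult_nonneg_nonneg)
      ultimately show False using on_ray u(3,4) by blast
    qed
    hence "closed_segment 0 (?s *\<^sub>R p) \<subseteq> D" by (rule connected_inside[OF connected_segment(1) _ _ D(3)]) simp
    thus ?thesis unfolding ptq by auto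
  qed
  \<comment> \<open>The ray beyond p is connected, avoids the boundary and is unbounded, so no point
    of it lies in D.\<close>
  have outside: "p + (t * 1) *\<^sub>R q \<notin> D"
  proof
    let ?s = "(norm p + t) / norm p"
    let ?S = "(\<lambda>s. s *\<^sub>R p) ` {1<..}"
    assume "p + (t * 1) *\<^sub>R q \<in> D"
    hence "?s *\<^sub>R p \<in> D" unfolding ptq by simp
    moreover have "1 < ?s" using t p by simp
    moreover have "connected ?S" by (intro connected_continuous_image continuous_intros) auto
    moreover have "?S \<inter> frontier D = {}" using on_ray by force
    ultimately have "?S \<subseteq> D" by (intro connected_inside[of ?S D "?s *\<^sub>R p"]) auto
    hence "bounded ?S" using D(2) bounded_subset by blast
    then obtain B where B: "0 < B" "\<forall>x\<in>?S. norm x \<le> B" unfolding bounded_pos by blast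
    have "(1 + B / norm p) *\<^sub>R p \<in> ?S" using B p by auto
    hence "norm ((1 + B / norm p) *\<^sub>R p) \<le> B" using B by blast
    moreover have "norm ((1 + B / norm p) *\<^sub>R p) = norm p + B"
      using B p by (simp add: abs_of_nonneg distrib_right)
    ultimately show False using p by simp
  qed
  have "p - t *\<^sub>R e \<in> D"
    using connected_inside[OF connected_segment(1) seg[of "- 1"] _ inside] by auto
  from connected_inside[OF connected_segment(1) seg[of 1] _ this] show False using outside by auto
qed

end

lemma periodic_ext_id: "\<xi> \<in> {0..<L} \<Longrightarrow> periodic_ext L f \<xi> = f \<xi>"
  by (simp add: periodic_ext_def)

lemma periodic_ext_cong:
  assumes "[x = y] (rmod L)"
  shows "periodic_ext L f x = periodic_ext L f y"
  using assms by (simp add: periodic_ext_def rcong_def)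

lemma periodic_ext_plus: "periodic_ext L f (x + L) = periodic_ext L f x"
  by (rule periodic_ext_cong) (use rcong_altdef[of "x + L" x L] in \<open>auto intro: exI[of _ "- 1"]\<close>)

lemma periodic_ext_closed: "f 0 = f L \<Longrightarrow> 0 < L \<Longrightarrow> \<xi> \<in> {0..L} \<Longrightarrow> periodic_ext L f \<xi> = f \<xi>"
  by (cases "\<xi> = L") (simp_all add: periodic_ext_def)

text \<open>Two copies of the curve are glued at L, where the tangents agree; two periods suffice
  for a shift by less than L.\<close>

lemma periodic_ext_C1:
  fixes f :: "real \<Rightarrow> complex"
  assumes L: "0 < L" and f: "f 0 = f L" "f' 0 = f' L" and cont: "continuous_on {0..L} f'"
    and deriv: "\<And>\<xi>. \<xi> \<in> {0..L} \<Longrightarrow> (f has_vector_derivative f' \<xi>) (at \<xi> within {0..L})"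
  shows "continuous_on {0..2 * L} (periodic_ext L f')"
    "\<xi> \<in> {0..2 * L} \<Longrightarrow> (periodic_ext L f has_vector_derivative periodic_ext L f' \<xi>) (at \<xi> within {0..2 * L})"
proof -
  have eq: "periodic_ext L g \<xi> = (if \<xi> \<in> {0..L} then g \<xi> else g (\<xi> - L))"
    if "g 0 = g L" "\<xi> \<in> {0..2 * L}" for g :: "real \<Rightarrow> complex" and \<xi>
    using periodic_ext_closed[of g L \<xi>] periodic_ext_closed[of g L "\<xi> - L"] periodic_ext_plus[of L g "\<xi> - L"] that L by auto
  have un: "{0..2 * L} = {0..L} \<union> {L..2 * L}" using L by auto
  have sh: "continuous_on {L..2 * L} (\<lambda>x. f' (x - L))"
    by (rule continuous_on_compose2[OF cont]) (auto intro!: continuous_intros)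
  have "continuous_on ({0..L} \<union> {L..2 * L}) (\<lambda>x. if x \<in> {0..L} then f' x else f' (x - L))"
    by (rule continuous_on_cases[OF _ _ cont sh]) (use f(2) in auto)
  thus "continuous_on {0..2 * L} (periodic_ext L f')"
    unfolding un[symmetric] by (rule continuous_on_eq) (simp add: eq[OF f(2)])
  assume \<xi>: "\<xi> \<in> {0..2 * L}"
  have "((\<lambda>x. if x \<in> {0..L} then f x else f (x - L)) has_vector_derivative
      (if \<xi> \<in> {0..L} then f' \<xi> else f' (\<xi> - L))) (at \<xi> within {0..2 * L})"
  proof (rule has_vector_derivative_If_within_closures[where T = "{L..2 * L}"])
    show "\<xi> \<in> {0..L} \<union> closure {0..L} \<inter> closure {L..2 * L} \<Longrightarrow>
      (f has_vector_derivative f' \<xi>) (at \<xi> within {0..L} \<union> closure {0..L} \<inter> closure {L..2 * L})"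
    proof -
      assume a: "\<xi> \<in> {0..L} \<union> closure {0..L} \<inter> closure {L..2 * L}"
      have s: "{0..L} \<union> closure {0..L} \<inter> closure {L..2 * L} = {0..L}" using L by auto
      show ?thesis using a unfolding s by (rule deriv)
    qed
    show "\<xi> \<in> {L..2 * L} \<union> closure {0..L} \<inter> closure {L..2 * L} \<Longrightarrow>
      ((\<lambda>x. f (x - L)) has_vector_derivative f' (\<xi> - L)) (at \<xi> within {L..2 * L} \<union> closure {0..L} \<inter> closure {L..2 * L})"
    proof -
      assume a: "\<xi> \<in> {L..2 * L} \<union> closure {0..L} \<inter> closure {L..2 * L}"
      have s: "{L..2 * L} \<union> closure {0..L} \<inter> closure {L..2 * L} = {L..2 * L}" using L by auto
      have im: "(\<lambda>x. x - L) ` {L..2 * L} = {0..L}" by simp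
      have "((\<lambda>x. x - L) has_vector_derivative 1) (at \<xi> within {L..2 * L})"
        by (auto intro!: derivative_eq_intros)
      from vector_diff_chain_within[OF this, of f "f' (\<xi> - L)"] deriv[of "\<xi> - L"] a
      show ?thesis unfolding s im o_def by simp
    qed
  qed (use un \<xi> L f in auto)
  thus "(periodic_ext L f has_vector_derivative periodic_ext L f' \<xi>) (at \<xi> within {0..2 * L})"
    unfolding eq[OF f(2) \<xi>]
    by (rule has_vector_derivative_transform[OF \<xi>, rotated]) (simp add: eq[OF f(1)])
qed

text \<open>A new base point turns the old one into an interior parameter, so the tangents must fit
  there; with c = 0 nothing moves and a corner may remain.\<close>

lemma (in arclength_domain) base_point_shift:
  assumes c: "c \<in> {0..<L}" and smooth: "c \<noteq> 0 \<Longrightarrow> \<gamma>' L = \<gamma>' 0"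
  shows "\<exists>g'. arclength_domain D L (\<lambda>\<xi>. periodic_ext L \<gamma> (c + \<xi>)) g'"
proof -
  let ?P = "periodic_ext L \<gamma>"
  have P: "?P \<xi> = \<gamma> \<xi>" if "\<xi> \<in> {0..L}" for \<xi> by (rule periodic_ext_closed[OF closed_curve L that])
  have rm: "\<xi> rmod L \<in> {0..<L}" for \<xi> using L rmod_less rmod_nonneg by auto
  have closed: "?P (c + 0) = ?P (c + L)" using periodic_ext_plus[of L \<gamma> c] by simp
  have inj': "inj_on (\<lambda>\<xi>. ?P (c + \<xi>)) {0..<L}"
  proof (rule inj_onI)
    fix x y assume xy: "x \<in> {0..<L}" "y \<in> {0..<L}" "?P (c + x) = ?P (c + y)"
    have "[c + x = c + y] (rmod L)"
      unfolding rcong_def by (rule inj_onD[OF inj xy(3)[unfolded periodic_ext_def] rm rm])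
    hence "[x = y] (rmod L)" by simp
    thus "x = y" using xy L by (simp add: rcong_def)
  qed
  have image': "(\<lambda>\<xi>. ?P (c + \<xi>)) ` {0..L} = frontier D"
  proof (intro equalityI subsetI)
    fix z assume "z \<in> (\<lambda>\<xi>. ?P (c + \<xi>)) ` {0..L}"
    then obtain \<xi> where "z = \<gamma> ((c + \<xi>) rmod L)" by (auto simp: periodic_ext_def)
    thus "z \<in> frontier D" using rm[of "c + \<xi>"] on_frontier[of "(c + \<xi>) rmod L"] by simp
  next
    fix z assume "z \<in> frontier D"
    then obtain y where y': "y \<in> {0..L}" "z = \<gamma> y" using image by blast
    have y: "z = ?P y" using y' P by simp
    have "[(y - c) rmod L = y - c] (rmod L)" by (simp add: rcong_def)
    hence "[c + (y - c) rmod L = c + (y - c)] (rmod L)" by (simp only: rcong_add_left_cancel)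
    from periodic_ext_cong[OF this, of \<gamma>] have "?P (c + (y - c) rmod L) = z" unfolding y by (simp only: add_diff_cancel_left' diff_add_cancel add.commute[of c])
    moreover have "(y - c) rmod L \<in> {0..L}" using rm[of "y - c"] by simp
    ultimately show "z \<in> (\<lambda>\<xi>. ?P (c + \<xi>)) ` {0..L}" by blast
  qed
  show ?thesis
  proof (cases "c = 0")
    case True
    have "arclength_domain D L (\<lambda>\<xi>. ?P (c + \<xi>)) \<gamma>'"
    proof (unfold_locales; (rule D L closed inj' image' cont' unit)?)
      fix \<xi> assume \<xi>: "\<xi> \<in> {0..L}"
      show "((\<lambda>\<xi>. ?P (c + \<xi>)) has_vector_derivative \<gamma>' \<xi>) (at \<xi> within {0..L})"
        by (rule has_vector_derivative_transform[OF \<xi> _ deriv[OF \<xi>]]) (simp add: True P)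
    qed
    thus ?thesis by blast
  next
    case False
    note C1 = periodic_ext_C1[OF L closed_curve smooth[OF False, symmetric] cont' deriv]
    have "arclength_domain D L (\<lambda>\<xi>. ?P (c + \<xi>)) (\<lambda>\<xi>. periodic_ext L \<gamma>' (c + \<xi>))"
    proof (unfold_locales; (rule D L closed inj' image')?)
      show "continuous_on {0..L} (\<lambda>\<xi>. periodic_ext L \<gamma>' (c + \<xi>))"
        by (rule continuous_on_compose2[OF C1(1)]) (use c in \<open>auto intro!: continuous_intros\<close>)
      fix \<xi> assume \<xi>: "\<xi> \<in> {0..L}"
      have "((\<lambda>\<xi>. c + \<xi>) has_vector_derivative 1) (at \<xi> within {0..L})"
        by (auto intro!: derivative_eq_intros)
      moreover have "(?P has_vector_derivative periodic_ext L \<gamma>' (c + \<xi>)) (at (c + \<xi>) within (\<lambda>\<xi>. c + \<xi>) ` {0..L})"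
        by (rule has_vector_derivative_within_subset[OF C1(2)]) (use c \<xi> in auto)
      ultimately have "((?P \<circ> (\<lambda>\<xi>. c + \<xi>)) has_vector_derivative 1 *\<^sub>R periodic_ext L \<gamma>' (c + \<xi>)) (at \<xi> within {0..L})"
        by (rule vector_diff_chain_within)
      thus "((\<lambda>\<xi>. ?P (c + \<xi>)) has_vector_derivative periodic_ext L \<gamma>' (c + \<xi>)) (at \<xi> within {0..L})"
        by (simp add: o_def)
      show "norm (periodic_ext L \<gamma>' (c + \<xi>)) = 1"
        unfolding periodic_ext_def using rm[of "c + \<xi>"] by (intro unit) simp
    qed
    thus ?thesis by blast
  qed
qed

text \<open>Criticality is two-sided through the periodic extension, so both one-sided tangents at
  the base point are orthogonal to the radius, as \<open>no_cusp\<close> requires.\<close>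

lemma (in arclength_domain) smooth_at_central_configuration:
  assumes "central_configuration D L \<gamma> 0"
  shows "\<gamma>' L = \<gamma>' 0"
proof -
  let ?P = "periodic_ext L \<gamma>"
  have P: "?P \<xi> = \<gamma> \<xi>" if "\<xi> \<in> {0..L}" for \<xi> by (rule periodic_ext_closed[OF closed_curve L that])
  have within: "((\<lambda>x. norm (\<gamma> x)) has_real_derivative 0) (at \<xi> within {0..L})"
    if "\<xi> \<in> {0..L}" "((\<lambda>x. norm (?P x)) has_real_derivative 0) (at \<xi>)" for \<xi>
    by (rule has_field_derivative_transform_within[OF has_field_derivative_at_within[OF that(2)] zero_less_one that(1)]) (simp add: P)
  have d: "((\<lambda>x. norm (?P x)) has_real_derivative 0) (at 0)"
    using assms by (simp add: central_configuration_def)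
  have "((\<lambda>x. norm (?P (x + - L))) has_real_derivative 0) (at L)"
    using d DERIV_shift[of "\<lambda>x. norm (?P x)" 0 L "- L"] by simp
  moreover have "?P (x + - L) = ?P x" for x using periodic_ext_plus[of L \<gamma> "x + - L"] by simp
  ultimately have d': "((\<lambda>x. norm (?P x)) has_real_derivative 0) (at L)" by simp
  show ?thesis
  proof (rule no_cusp)
    show "\<gamma> 0 \<bullet> \<gamma>' 0 = 0" by (rule critical_orthogonal[OF _ within[OF _ d]]) (use L in auto)
    have "\<gamma> L \<bullet> \<gamma>' L = 0" by (rule critical_orthogonal[OF _ within[OF _ d']]) (use L in auto)
    thus "\<gamma> 0 \<bullet> \<gamma>' L = 0" using closed_curve by simp
    show "{s *\<^sub>R \<gamma> 0 | s. 0 \<le> s} \<inter> frontier D = {\<gamma> 0}" using assms by (simp add: central_configuration_def)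
  qed
qed

text \<open>Modulo L, g is the periodic extension translated by x - \<xi>; derivative and extremum
  follow the translation, and the ray depends on the point alone.\<close>

lemma strict_central_configuration_shift:
  assumes conf: "strict_central_configuration D L \<gamma> x" and x: "x \<in> {0..<L}" and \<xi>: "[c + \<xi> = x] (rmod L)"
    and g_def: "g = (\<lambda>\<xi>. periodic_ext L \<gamma> (c + \<xi>))"
  shows "g \<xi> = \<gamma> x" "((\<lambda>y. norm (g y)) has_real_derivative 0) (at \<xi>)"
    "(\<forall>\<^sub>F y in at \<xi>. norm (g y) < norm (g \<xi>)) \<or> (\<forall>\<^sub>F y in at \<xi>. norm (g y) > norm (g \<xi>))"
    "{s *\<^sub>R g \<xi> | s. 0 \<le> s} \<inter> frontier D = {g \<xi>}"
proof -
  have g: "g = (\<lambda>y. periodic_ext L \<gamma> (y + (x - \<xi>)))"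
  proof
    fix y
    have "[(y - \<xi>) + (c + \<xi>) = (y - \<xi>) + x] (rmod L)" using \<xi> by (simp only: rcong_add_left_cancel)
    moreover have "(y - \<xi>) + (c + \<xi>) = c + y" "(y - \<xi>) + x = y + (x - \<xi>)" by simp_all
    ultimately show "g y = periodic_ext L \<gamma> (y + (x - \<xi>))"
      unfolding g_def by (intro periodic_ext_cong) (simp only:)
  qed
  show gx: "g \<xi> = \<gamma> x" unfolding g using periodic_ext_id[OF x] by simp
  show "((\<lambda>y. norm (g y)) has_real_derivative 0) (at \<xi>)" unfolding g
    using conf DERIV_shift[of "\<lambda>y. norm (periodic_ext L \<gamma> y)" 0 \<xi> "x - \<xi>"]
    by (simp add: strict_central_configuration_def central_configuration_def)
  have shift: "\<forall>\<^sub>F y in at \<xi>. Q (y + (x - \<xi>))" if ev: "\<forall>\<^sub>F y in at x. Q y" for Q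
  proof -
    obtain d where d: "0 < d" "\<And>y. y \<noteq> x \<Longrightarrow> dist y x < d \<Longrightarrow> Q y" using ev unfolding eventually_at by auto
    show ?thesis unfolding eventually_at
      by (rule exI[of _ d]) (use d in \<open>auto simp: dist_real_def\<close>)
  qed
  show "(\<forall>\<^sub>F y in at \<xi>. norm (g y) < norm (g \<xi>)) \<or> (\<forall>\<^sub>F y in at \<xi>. norm (g y) > norm (g \<xi>))"
    using conf shift[of "\<lambda>y. norm (periodic_ext L \<gamma> y) < norm (\<gamma> x)"] shift[of "\<lambda>y. norm (\<gamma> x) < norm (periodic_ext L \<gamma> y)"]
    unfolding gx unfolding g strict_central_configuration_def by blast
  show "{s *\<^sub>R g \<xi> | s. 0 \<le> s} \<inter> frontier D = {g \<xi>}"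
    unfolding gx using conf by (simp add: strict_central_configuration_def central_configuration_def)
qed

text \<open>Parameters in [0, L) make distinct configurations distinct points of the curve. The base
  point changes only if it is itself a configuration, because an interval around that parameter
  would not fit into [0, L].\<close>

theorem theorem1p9:
  fixes \<omega> \<mu> E L :: real and D :: "complex set" and \<gamma> :: "real \<Rightarrow> complex"
    and m :: nat and C :: "real set"
  assumes "0 < \<omega>" and "0 < \<mu>" and "0 < E"
    and "refraction_domain \<omega> E D"
    and "C1_arclength_boundary D L \<gamma>"
    and "2 \<le> m" and "C \<subseteq> {0..<L}" and "card C = m"
    and "\<And>\<xi>. \<xi> \<in> C \<Longrightarrow> strict_central_configuration D L \<gamma> \<xi>"
    and "m = 2 \<Longrightarrow> not_antipodal_sets \<gamma> C C"
  shows "\<exists>c\<in>{0..<L}. (0 \<notin> C \<longrightarrow> c = 0) \<and>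
    (let \<gamma>c = (\<lambda>\<xi>. periodic_ext L \<gamma> (c + \<xi>)) in
     \<exists>TE a b h0 \<alpha> \<beta> h1.
       admissible_with \<omega> \<mu> E D L \<gamma>c TE m a b h0 \<alpha> \<beta> h1 \<and>
       (\<exists>h2. \<forall>h>h2. symbolic_dynamics \<omega> \<mu> E D L \<gamma>c m a b \<alpha> \<beta> h))"
proof -
  note par = assms(1-3) and dom = assms(4) and C = assms(7-9)
  obtain \<gamma>' where \<gamma>': "continuous_on {0..L} \<gamma>'"
    "\<And>\<xi>. \<xi> \<in> {0..L} \<Longrightarrow> (\<gamma> has_vector_derivative \<gamma>' \<xi>) (at \<xi> within {0..L})"
    "\<And>\<xi>. \<xi> \<in> {0..L} \<Longrightarrow> norm (\<gamma>' \<xi>) = 1"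
    using assms(5) unfolding C1_arclength_boundary_def by blast
  interpret G: arclength_domain D L \<gamma> \<gamma>'
    by unfold_locales
      (use assms(4,5) \<gamma>' in \<open>simp_all add: C1_arclength_boundary_def refraction_domain_def\<close>)
  have finC: "finite C" using C(2) assms(6) by (metis card.infinite not_numeral_le_zero)
  \<comment> \<open>The base point must avoid the finitely many configurations, and 0 is kept
    whenever possible.\<close>
  have "\<exists>c\<in>{0..<L}. c \<notin> C \<and> (0 \<notin> C \<longrightarrow> c = 0)"
  proof (cases "0 \<in> C")
    case True
    have "infinite {0<..<L}" using G.L by simp
    hence "{0<..<L} - C \<noteq> {}" using finC by (metis Diff_eq_empty_iff finite_subset)
    thus ?thesis using True by auto
  next
    case False
    thus ?thesis using G.L by auto
  qed
  then obtain c where c: "c \<in> {0..<L}" "c \<notin> C" "0 \<notin> C \<longrightarrow> c = 0" by blast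
  have "\<gamma>' L = \<gamma>' 0" if "c \<noteq> 0"
  proof (rule G.smooth_at_central_configuration)
    have "0 \<in> C" using c(3) that by blast
    thus "central_configuration D L \<gamma> 0" using C(3) by (simp add: strict_central_configuration_def)
  qed
  from G.base_point_shift[OF c(1) this] obtain g' where g': "arclength_domain D L (\<lambda>\<xi>. periodic_ext L \<gamma> (c + \<xi>)) g'" by blast
  define g where "g = (\<lambda>\<xi>. periodic_ext L \<gamma> (c + \<xi>))"
  interpret g: arclength_domain D L g g' using g' unfolding g_def .
  obtain x where x: "bij_betw x {1..m} C" using ex_bij_betw_nat_finite_1[OF finC] C(2) by auto
  have xC: "x i \<in> C" if "i \<in> {1..m}" for i using x that by (auto simp: bij_betw_def)
  hence xL: "x i \<in> {0..<L}" if "i \<in> {1..m}" for i using C(1) that by blast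
  \<comment> \<open>Parameters of the configurations seen from the base point c; none is 0 because c
    is not a configuration.\<close>
  define X where "X = (\<lambda>i. (x i - c) rmod L)"
  have Xc: "[c + X i = x i] (rmod L)" for i
  proof -
    have "[X i = x i - c] (rmod L)" by (simp add: rcong_def X_def)
    hence "[c + X i = c + (x i - c)] (rmod L)" by (simp only: rcong_add_left_cancel)
    thus ?thesis by simp
  qed
  have X: "X i \<in> {0<..<L}" if i: "i \<in> {1..m}" for i
  proof -
    have "X i \<noteq> 0"
    proof
      assume "X i = 0"
      hence "c = x i" using Xc[of i] c(1) xL[OF i] by (simp add: rcong_def)
      thus False using c(2) xC[OF i] by simp
    qed
    moreover have "0 \<le> X i" "X i < L" using G.L by (auto simp: X_def rmod_nonneg rmod_less)
    ultimately show ?thesis by simp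
  qed
  note S = strict_central_configuration_shift[OF C(3)[OF xC] xL Xc g_def]
  have "\<exists>\<kappa> a b \<alpha> \<beta> \<eta> \<rho>. billiard_intervals D L g g' \<omega> \<mu> E (2 * E / \<omega>\<^sup>2) \<kappa> m a b \<alpha> \<beta> \<eta> \<rho>"
  proof (rule g.billiard_intervals_exist[OF par _ assms(6) X])
    fix y assume "y \<in> {0..L}"
    hence "g y \<in> closure D" using g.on_frontier by (auto simp: frontier_def)
    hence "norm (g y) < sqrt (2 * E) / \<omega>" using dom by (auto simp: refraction_domain_def)
    hence "(norm (g y))\<^sup>2 < (sqrt (2 * E) / \<omega>)\<^sup>2" by (intro power_strict_mono) auto
    thus "(norm (g y))\<^sup>2 < 2 * E / \<omega>\<^sup>2" using par by (simp add: power_divide)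
  next
    show "inj_on X {1..m}"
    proof (rule inj_onI)
      fix i j assume ij: "i \<in> {1..m}" "j \<in> {1..m}" "X i = X j"
      have "[x i = x j] (rmod L)" using Xc[of i] Xc[of j] ij(3) by (simp add: rcong_def)
      hence "x i = x j" using xL[OF ij(1)] xL[OF ij(2)] by (simp add: rcong_def)
      thus "i = j" by (rule inj_onD[OF bij_betw_imp_inj_on[OF x] _ ij(1,2)])
    qed
  next
    fix i assume i: "i \<in> {1..m}"
    show "g (X i) \<bullet> g' (X i) = 0"
      by (rule g.critical_orthogonal[OF _ has_field_derivative_at_within[OF S(2)[OF i i]]]) (use X[OF i] in auto)
    show "{s *\<^sub>R g (X i) | s. 0 \<le> s} \<inter> frontier D = {g (X i)}" by (rule S(4)[OF i i])
    show "(\<forall>\<^sub>F x in at (X i). norm (g x) < norm (g (X i))) \<or> (\<forall>\<^sub>F x in at (X i). norm (g x) > norm (g (X i)))"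
      by (rule S(3)[OF i i])
  next
    assume m: "m = 2"
    hence i: "1 \<in> {1..m}" "2 \<in> {1..m}" by auto
    have "\<not> antipodal \<gamma> (x 1) (x 2)" using assms(10)[OF m] xC i unfolding not_antipodal_sets_def by blast
    thus "\<not> antipodal g (X 1) (X 2)" unfolding antipodal_def using S(1)[OF i(1) i(1)] S(1)[OF i(2) i(2)] by simp
  qed
  then obtain \<kappa> a b \<alpha> \<beta> \<eta> \<rho> where "billiard_intervals D L g g' \<omega> \<mu> E (2 * E / \<omega>\<^sup>2) \<kappa> m a b \<alpha> \<beta> \<eta> \<rho>" by blast
  then interpret B: billiard_intervals D L g g' \<omega> \<mu> E "2 * E / \<omega>\<^sup>2" \<kappa> m a b \<alpha> \<beta> \<eta> \<rho> .
  obtain h0 where h0: "0 < h0" "\<And>h. h > h0 \<Longrightarrow> B.large h" using B.eventually_large by blast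
  have "admissible_with \<omega> \<mu> E D L g B.TE m a b h0 \<alpha> \<beta> h0" by (rule B.admissible[OF h0])
  moreover have "\<forall>h>h0. symbolic_dynamics \<omega> \<mu> E D L g m a b \<alpha> \<beta> h" using B.symbolic h0(2) by blast
  ultimately have "admissible_with \<omega> \<mu> E D L g B.TE m a b h0 \<alpha> \<beta> h0 \<and>
      (\<exists>h2. \<forall>h>h2. symbolic_dynamics \<omega> \<mu> E D L g m a b \<alpha> \<beta> h)"
    by (rule conjI[OF _ exI])
  hence dynamics: "\<exists>TE a b h0 \<alpha> \<beta> h1. admissible_with \<omega> \<mu> E D L g TE m a b h0 \<alpha> \<beta> h1 \<and>
      (\<exists>h2. \<forall>h>h2. symbolic_dynamics \<omega> \<mu> E D L g m a b \<alpha> \<beta> h)" by (intro exI)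
  show ?thesis unfolding Let_def by (rule bexI[OF _ c(1)], rule conjI[OF c(3) dynamics[unfolded g_def]])
qed

end
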